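(* Let $\Omega\subset\mathbb{C}^n$ be a bounded domain and suppose there exists a surjective proper holomorphic map $\Phi:\mathbb{D}^n\to\Omega$ each of whose components is a rational function (with denominator nonvanishing on $\mathbb{D}^n$). Then there exists $r\in(1,2)$, depending on $\Phi$, such that the Bergman projection $\mathbf{B}_\Omega$ is $L^p(\Omega)$-bounded for every $p\in(r,r')$, where $r'=r/(r-1)>2$ is the conjugate exponent of $r$.
   Context: $\mathbb{D}$ is the open unit disk in $\mathbb{C}$ and $\mathbb{D}^n$ the unit polydisk. For a bounded domain $\Omega\subset\mathbb{C}^n$, $A^2(\Omega)=L^2(\Omega)\cap\mathcal{O}(\Omega)$ is the Bergman space (Lebesgue volume measure), and the Bergman projection $\mathbf{B}_\Omega:L^2(\Omega)\to A^2(\Omega)$ is the orthogonal projection. $\mathbf{B}_\Omega$ is called $L^p(\Omega)$-bounded if there is $C>0$ with $\|\mathbf{B}_\Omega h\|_{L^p(\Omega)}\le C\|h\|_{L^p(\Omega)}$ for all $h\in L^2(\Omega)\cap L^p(\Omega)$. *)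

theory Defs
  imports "HOL-Analysis.Analysis"
begin

definition polydisc :: "(complex ^ 'n) set" where
  "polydisc = {z. \<forall>i. norm (z $ i) < 1}"

text \<open>Holomorphic function of several complex variables: complex (Frechet) differentiable
 at every point, i.e. the real derivative is a complex-linear map h -> sum c_i h_i.\<close>
definition holo_on :: "(complex ^ 'n) set \<Rightarrow> (complex ^ 'n \<Rightarrow> complex) \<Rightarrow> bool" where
  "holo_on U f \<longleftrightarrow> (\<forall>z\<in>U. \<exists>c :: 'n \<Rightarrow> complex.
      (f has_derivative (\<lambda>h. \<Sum>i\<in>UNIV. c i * h $ i)) (at z))"

inductive_set poly_fun :: "(complex ^ 'n \<Rightarrow> complex) set" where
  const: "(\<lambda>z. c) \<in> poly_fun"
| coord: "(\<lambda>z. z $ i) \<in> poly_fun"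
| add: "f \<in> poly_fun \<Longrightarrow> g \<in> poly_fun \<Longrightarrow> (\<lambda>z. f z + g z) \<in> poly_fun"
| mult: "f \<in> poly_fun \<Longrightarrow> g \<in> poly_fun \<Longrightarrow> (\<lambda>z. f z * g z) \<in> poly_fun"

definition lp_nn :: "(complex ^ 'n) set \<Rightarrow> real \<Rightarrow> (complex ^ 'n \<Rightarrow> complex) \<Rightarrow> ennreal" where
  "lp_nn \<Omega> p f = (\<integral>\<^sup>+ x. indicator \<Omega> x * ennreal (cmod (f x) powr p) \<partial>lebesgue)"

definition in_Lp :: "(complex ^ 'n) set \<Rightarrow> real \<Rightarrow> (complex ^ 'n \<Rightarrow> complex) \<Rightarrow> bool" where
  "in_Lp \<Omega> p f \<longleftrightarrow> f \<in> borel_measurable (lebesgue_on \<Omega>) \<and> lp_nn \<Omega> p f < \<infinity>"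

definition bergman_space :: "(complex ^ 'n) set \<Rightarrow> (complex ^ 'n \<Rightarrow> complex) set" where
  "bergman_space \<Omega> = {f. holo_on \<Omega> f \<and> in_Lp \<Omega> 2 f}"

text \<open>g is (a representative of) the Bergman projection of h: the orthogonal projection
 of h \<in> L^2(\<Omega>) onto A^2(\<Omega>), i.e. g \<in> A^2 and h - g is L^2-orthogonal to A^2.\<close>
definition is_bergman_proj ::
  "(complex ^ 'n) set \<Rightarrow> (complex ^ 'n \<Rightarrow> complex) \<Rightarrow> (complex ^ 'n \<Rightarrow> complex) \<Rightarrow> bool" where
  "is_bergman_proj \<Omega> h g \<longleftrightarrow> g \<in> bergman_space \<Omega> \<and>
     (\<forall>u\<in>bergman_space \<Omega>.
        (LINT x:\<Omega>|lebesgue. (h x - g x) * cnj (u x)) = 0)"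

text \<open>L^p-boundedness: ||B h||_p \<le> C ||h||_p for h \<in> L^2 \<inter> L^p, written as
 \<integral>|Bh|^p \<le> C^p \<integral>|h|^p.\<close>
definition bergman_Lp_bounded :: "(complex ^ 'n) set \<Rightarrow> real \<Rightarrow> bool" where
  "bergman_Lp_bounded \<Omega> p \<longleftrightarrow> (\<exists>C>0. \<forall>h g.
     in_Lp \<Omega> 2 h \<and> in_Lp \<Omega> p h \<and> is_bergman_proj \<Omega> h g \<longrightarrow>
       lp_nn \<Omega> p g \<le> ennreal (C powr p) * lp_nn \<Omega> p h)"

end

theory Submission
  imports Defs "HOL-Complex_Analysis.Cauchy_Integral_Formula" "HOL-Computational_Algebra.Fundamental_Theorem_Algebra"
begin

text \<open>
Composing with a Cayley transform, replace the polydisc by a product \<open>X\<close> of upper half planes and \<open>\<Phi>\<close> by a proper rational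
map \<open>X \<rightarrow> \<Omega>\<close> with Jacobian determinant \<open>J = N / D\<close>. By Piola's identity and properness, integrals of \<open>u \<cdot> cnj J \<cdot> \<psi> \<circ> \<Phi>\<close>
with \<open>u\<close> rational annihilate the \<open>cnj \<partial>\<close>-derivatives of test functions \<open>\<psi>\<close> on \<open>\<Omega>\<close>; testing with radial bumps
\<open>(r - |\<xi> - y|\<^sup>2)\<^sub>+\<^sup>2\<close> shows that this functional is integration against a holomorphic function on \<open>\<Omega>\<close>. For \<open>u = J\<close> that
function is real, hence a constant \<open>M\<close>, so that \<open>\<Phi>\<close> pushes \<open>|J|\<^sup>2\<close> times volume to \<open>M\<close> times volume, without any discussion of
branched coverings; Sard's theorem gives \<open>M > 0\<close>. For square-integrable \<open>u\<close> it lies in the Bergman space, so \<open>J \<cdot> f \<circ> \<Phi>\<close> is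
orthogonal to \<open>u\<close> whenever \<open>f\<close> is orthogonal to the Bergman space of \<open>\<Omega>\<close>.

With \<open>u\<close> the Bergman kernel of \<open>X\<close> at \<open>w\<close>, the reproducing formula bounds \<open>|J g \<circ> \<Phi>|(w)\<close>, for the projection \<open>g\<close> of \<open>h\<close>, by the
integral of \<open>|J h \<circ> \<Phi>|\<close> against the modulus of the kernel. It remains to bound this positive operator on \<open>L\<^sup>p\<close> with the weight
\<open>|J|\<^sup>2\<^sup>-\<^sup>p\<close>. Since a small negative power of a polynomial is almost invariant under averaging in each variable, a Schur test with
small powers of \<open>N D\<close> and of the heights \<open>Im z\<^sub>i\<close> does this for \<open>p\<close> near \<open>2\<close>.
\<close>

section \<open>Complex differentiability and rational functions\<close>

text \<open>Bell's transformation rule is usually derived from the covering structure of a proper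
  map: local inverses off the critical set, then continuation across its image. Here the geometric
  input is that rows of cofactors are divergence free, so weak Cauchy-Riemann equations survive the
  push-forward, and a form of Weyl's lemma turns them back into holomorphy. Square integrability of
  the function so obtained is an absorption argument instead of a computation sheet by sheet. Half
  planes suit the estimates better than discs: the kernel is controlled on horizontal lines by
  powers of one real variable. The obstacle is that the zeros of the weight lie at unknown places.
  If a polynomial has degree at most \<open>d\<close> in each variable and
  \<open>2 * a * d \<le> 1\<close>, the product of its root factors to the power \<open>-a\<close>
  is bounded by a sum with one factor |s - root|^(-1/2) per term. Such a singularity is integrable
  on a line, uniformly in the position of the root. This condition on \<open>a\<close> is the origin
  of the restriction on \<open>p\<close>.\<close>

definition pd :: "(complex ^ 'n \<Rightarrow> complex) \<Rightarrow> 'n \<Rightarrow> complex ^ 'n \<Rightarrow> complex" where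
  "pd f k z = frechet_derivative f (at z) (axis k 1)"

text \<open>The coefficients that \<open>holo_on\<close> leaves existential are fixed to be
  \<open>pd f i z\<close>. Since \<open>pd\<close> only evaluates the real Frechet derivative at a
  unit vector, it is meant as a holomorphic partial derivative only where \<open>cdiff\<close>
  holds.\<close>

definition cdiff :: "(complex ^ 'n \<Rightarrow> complex) \<Rightarrow> complex ^ 'n \<Rightarrow> bool" where
  "cdiff f z \<longleftrightarrow> (f has_derivative (\<lambda>h. \<Sum>i\<in>UNIV. pd f i z * h $ i)) (at z)"

lemma sum_axis_mult: "(\<Sum>i\<in>UNIV. c i * (axis k (x::complex)) $ i) = c k * x" for k :: "'n::finite"
  by (simp add: axis_def if_distrib sum.delta cong: if_cong)

lemma has_derivative_pd:
  assumes "(f has_derivative (\<lambda>h. \<Sum>i\<in>UNIV. c i * h $ i)) (at z)"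
  shows "pd f k z = c k"
  unfolding pd_def using frechet_derivative_at[OF assms] by (metis mult.right_neutral sum_axis_mult)

lemma cdiffI:
  assumes "(f has_derivative (\<lambda>h. \<Sum>i\<in>UNIV. c i * h $ i)) (at z)"
  shows "cdiff f z"
  unfolding cdiff_def using has_derivative_pd[OF assms] assms by simp

lemma cdiffD: "cdiff f z \<Longrightarrow> (f has_derivative (\<lambda>h. \<Sum>i\<in>UNIV. pd f i z * h $ i)) (at z)"
  unfolding cdiff_def .

lemma holo_on_iff_cdiff: "holo_on U f \<longleftrightarrow> (\<forall>z\<in>U. cdiff f z)"
  unfolding holo_on_def by (auto intro: cdiffI intro!: exI[of _ "\<lambda>i. pd f i _"] dest: cdiffD)

lemma cdiff_const: "cdiff (\<lambda>z. c) z" and pd_const: "pd (\<lambda>z. c) k z = 0" for z :: "complex ^ 'n"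
proof -
  have "((\<lambda>z::complex^'n. c) has_derivative (\<lambda>h. \<Sum>i\<in>UNIV. 0 * h $ i)) (at z)"
    by simp
  from cdiffI[OF this] has_derivative_pd[OF this] show "cdiff (\<lambda>z. c) z" "pd (\<lambda>z. c) k z = 0"
    by auto
qed

lemma cdiff_coord: "cdiff (\<lambda>z. z $ i) z"
  and pd_coord: "pd (\<lambda>z. z $ i) k z = (if k = i then 1 else 0)" for z :: "complex ^ 'n"
proof -
  have "((\<lambda>z::complex^'n. z $ i) has_derivative (\<lambda>h. \<Sum>k\<in>UNIV. (if k = i then 1 else 0) * h $ k)) (at z)"
    by (auto intro!: derivative_eq_intros bounded_linear_imp_has_derivative bounded_linear_vec_nth
        simp: if_distrib[of "\<lambda>x. x * _"] cong: if_cong)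
  from cdiffI[OF this] has_derivative_pd[OF this]
  show "cdiff (\<lambda>z. z $ i) z" "pd (\<lambda>z. z $ i) k z = (if k = i then 1 else 0)"
    by auto
qed

lemma cdiff_add: "cdiff f z \<Longrightarrow> cdiff g z \<Longrightarrow> cdiff (\<lambda>z. f z + g z) z"
  and pd_add: "cdiff f z \<Longrightarrow> cdiff g z \<Longrightarrow> pd (\<lambda>z. f z + g z) k z = pd f k z + pd g k z"
proof -
  assume f: "cdiff f z" and g: "cdiff g z"
  have "((\<lambda>z. f z + g z) has_derivative (\<lambda>h. \<Sum>i\<in>UNIV. (pd f i z + pd g i z) * h $ i)) (at z)"
    by (rule has_derivative_eq_rhs[OF has_derivative_add[OF cdiffD[OF f] cdiffD[OF g]]])
      (simp add: sum.distrib distrib_right)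
  from cdiffI[OF this] has_derivative_pd[OF this]
  show "cdiff (\<lambda>z. f z + g z) z" "pd (\<lambda>z. f z + g z) k z = pd f k z + pd g k z" by auto
qed

lemma cdiff_mult: "cdiff f z \<Longrightarrow> cdiff g z \<Longrightarrow> cdiff (\<lambda>z. f z * g z) z"
  and pd_mult: "cdiff f z \<Longrightarrow> cdiff g z \<Longrightarrow> pd (\<lambda>z. f z * g z) k z = pd f k z * g z + f z * pd g k z"
proof -
  assume f: "cdiff f z" and g: "cdiff g z"
  have "((\<lambda>z. f z * g z) has_derivative (\<lambda>h. \<Sum>i\<in>UNIV. (pd f i z * g z + f z * pd g i z) * h $ i)) (at z)"
    by (rule has_derivative_eq_rhs[OF has_derivative_mult[OF cdiffD[OF f] cdiffD[OF g]]])
      (simp add: fun_eq_iff sum.distrib algebra_simps sum_distrib_left sum_distrib_right)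
  from cdiffI[OF this] has_derivative_pd[OF this]
  show "cdiff (\<lambda>z. f z * g z) z" "pd (\<lambda>z. f z * g z) k z = pd f k z * g z + f z * pd g k z" by auto
qed

lemma cdiff_compose_field:
  assumes f: "cdiff f z" and g: "(g has_field_derivative g') (at (f z))"
  shows "cdiff (\<lambda>z. g (f z)) z" and "pd (\<lambda>z. g (f z)) k z = g' * pd f k z"
proof -
  have "((\<lambda>z. g (f z)) has_derivative (\<lambda>h. \<Sum>i\<in>UNIV. (g' * pd f i z) * h $ i)) (at z)"
    by (rule has_derivative_eq_rhs[OF has_derivative_compose[OF cdiffD[OF f]
            g[unfolded has_field_derivative_def]]]) (simp add: sum_distrib_left mult_ac)
  from cdiffI[OF this] has_derivative_pd[OF this]
  show "cdiff (\<lambda>z. g (f z)) z" "pd (\<lambda>z. g (f z)) k z = g' * pd f k z" by auto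
qed

lemma cdiff_inverse: "cdiff f z \<Longrightarrow> f z \<noteq> 0 \<Longrightarrow> cdiff (\<lambda>z. inverse (f z)) z"
  using cdiff_compose_field(1)[OF _ DERIV_inverse] by blast

lemma cdiff_divide: "cdiff f z \<Longrightarrow> cdiff g z \<Longrightarrow> g z \<noteq> 0 \<Longrightarrow> cdiff (\<lambda>z. f z / g z) z"
  unfolding divide_inverse by (intro cdiff_mult cdiff_inverse)

lemma has_derivative_vec:
  fixes \<Phi> :: "'a::real_normed_vector \<Rightarrow> complex ^ 'm"
  assumes "\<And>i. ((\<lambda>z. \<Phi> z $ i) has_derivative (\<lambda>h. D h i)) F"
  shows "(\<Phi> has_derivative (\<lambda>h. \<chi> i. D h i)) F"
proof -
  have ax: "bounded_linear (axis i :: complex \<Rightarrow> complex ^ 'm)" for i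
    by (intro linear_conv_bounded_linear[THEN iffD1] linearI) (auto simp: axis_def vec_eq_iff)
  have "((\<lambda>z. \<Sum>i\<in>UNIV. axis i (\<Phi> z $ i)) has_derivative (\<lambda>h. \<Sum>i\<in>UNIV. axis i (D h i))) F"
    by (intro has_derivative_sum bounded_linear.has_derivative[OF ax] assms)
  moreover have "(\<Sum>i\<in>UNIV. axis i (v i)) = (\<chi> i. v i)" for v :: "'m \<Rightarrow> complex"
    by (simp add: vec_eq_iff axis_def if_distrib cong: if_cong)
  ultimately show ?thesis by simp
qed

lemma cdiff_compose:
  fixes \<Phi> :: "complex ^ 'n \<Rightarrow> complex ^ 'm"
  assumes \<Phi>: "\<And>i. cdiff (\<lambda>z. \<Phi> z $ i) z" and g: "cdiff g (\<Phi> z)"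
  shows "cdiff (\<lambda>z. g (\<Phi> z)) z"
proof -
  have 1: "(\<Phi> has_derivative (\<lambda>h. \<chi> i. \<Sum>k\<in>UNIV. pd (\<lambda>z. \<Phi> z $ i) k z * h $ k)) (at z)"
    by (rule has_derivative_vec) (rule cdiffD[OF \<Phi>])
  have "((\<lambda>z. g (\<Phi> z)) has_derivative
     (\<lambda>h. \<Sum>k\<in>UNIV. (\<Sum>i\<in>UNIV. pd g i (\<Phi> z) * pd (\<lambda>z. \<Phi> z $ i) k z) * h $ k)) (at z)"
    apply (rule has_derivative_eq_rhs[OF has_derivative_compose[OF 1 cdiffD[OF g]]])
    apply (auto simp: sum_distrib_left sum_distrib_right mult_ac)
    by (subst sum.swap) simp
  then show ?thesis by (rule cdiffI)
qed

lemma cdiff_cong: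
  assumes "open U" "z \<in> U" "\<And>x. x \<in> U \<Longrightarrow> f x = g x" "cdiff f z"
  shows "cdiff g z" and "pd g k z = pd f k z"
proof -
  have "(g has_derivative (\<lambda>h. \<Sum>i\<in>UNIV. pd f i z * h $ i)) (at z)"
    by (rule has_derivative_transform_within_open[OF cdiffD[OF assms(4)] assms(1,2)]) (use assms(3) in auto)
  from cdiffI[OF this] has_derivative_pd[OF this] show "cdiff g z" and "pd g k z = pd f k z" by auto
qed

section \<open>Polynomials and rational functions, with their second derivatives\<close>

lemma poly_fun_cdiff: "f \<in> poly_fun \<Longrightarrow> cdiff f z"
  by (induction f rule: poly_fun.induct) (auto intro: cdiff_const cdiff_coord cdiff_add cdiff_mult)

lemma poly_fun_pd:
  fixes f :: "complex ^ 'n \<Rightarrow> complex"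
  assumes "f \<in> poly_fun" shows "pd f k \<in> poly_fun"
  using assms
proof (induction f rule: poly_fun.induct)
  case (const c)
  have "pd (\<lambda>z::complex^'n. c) k = (\<lambda>z. 0)" by (intro ext pd_const)
  then show ?case by (simp add: poly_fun.const)
next
  case (coord i)
  have "pd (\<lambda>z::complex^'n. z $ i) k = (\<lambda>z. if k = i then 1 else 0)" by (intro ext pd_coord)
  then show ?case by (simp add: poly_fun.const)
next
  case (add f g)
  have "pd (\<lambda>z. f z + g z) k = (\<lambda>z. pd f k z + pd g k z)"
    by (intro ext pd_add poly_fun_cdiff add.hyps)
  then show ?case using add by (simp add: poly_fun.add)
next
  case (mult f g)
  have "pd (\<lambda>z. f z * g z) k = (\<lambda>z. pd f k z * g z + f z * pd g k z)"
    by (intro ext pd_mult poly_fun_cdiff mult.hyps)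
  then show ?case using mult by (simp add: poly_fun.add poly_fun.mult)
qed

text \<open>Induction on how the polynomial is built reduces the symmetry of second derivatives to
  the product rule. Piola's identity rests on this symmetry.\<close>

lemma poly_fun_pd_commute:
  fixes f :: "complex ^ 'n \<Rightarrow> complex"
  assumes "f \<in> poly_fun" shows "pd (pd f k) l z = pd (pd f l) k z"
  using assms
proof (induction f arbitrary: k l z rule: poly_fun.induct)
  case (const c)
  have "pd (\<lambda>z::complex^'n. c) k = (\<lambda>z. 0)" for k by (intro ext pd_const)
  then show ?case by (simp add: pd_const)
next
  case (coord i)
  have "pd (\<lambda>z::complex^'n. z $ i) k = (\<lambda>z. if k = i then 1 else 0)" for k by (intro ext pd_coord)
  then show ?case by (simp add: pd_const)
next
  case (add f g)
  have "pd (\<lambda>z. f z + g z) k = (\<lambda>z. pd f k z + pd g k z)" for k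
    by (intro ext pd_add poly_fun_cdiff add.hyps)
  then show ?case using add by (simp add: pd_add poly_fun_cdiff poly_fun_pd)
next
  case (mult f g)
  have *: "pd (\<lambda>z. f z * g z) k = (\<lambda>z. pd f k z * g z + f z * pd g k z)" for k
    by (intro ext pd_mult poly_fun_cdiff mult.hyps)
  note c = poly_fun_cdiff[OF mult.hyps(1)] poly_fun_cdiff[OF mult.hyps(2)]
    poly_fun_cdiff[OF poly_fun_pd[OF mult.hyps(1)]] poly_fun_cdiff[OF poly_fun_pd[OF mult.hyps(2)]]
  show ?case unfolding *
    by (simp add: pd_add pd_mult cdiff_mult c mult.IH(1)[of k l] mult.IH(2)[of k l])
qed

text \<open>Only the values on \<open>X\<close> count, but numerator and denominator are polynomials
  on the whole space. Both are recovered at the end, where the Jacobian is split as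
  \<open>N / D\<close> and each becomes a weight.\<close>

definition rat_on :: "(complex ^ 'n) set \<Rightarrow> (complex ^ 'n \<Rightarrow> complex) set" where
  "rat_on X = {f. \<exists>P\<in>poly_fun. \<exists>Q\<in>poly_fun. \<forall>z\<in>X. Q z \<noteq> 0 \<and> f z = P z / Q z}"

lemma rat_onI:
  assumes "P \<in> poly_fun" "Q \<in> poly_fun" "\<And>z. z \<in> X \<Longrightarrow> Q z \<noteq> 0" "\<And>z. z \<in> X \<Longrightarrow> f z = P z / Q z"
  shows "f \<in> rat_on X"
  unfolding rat_on_def using assms by blast

lemma rat_onE:
  assumes "f \<in> rat_on X"
  obtains P Q where "P \<in> poly_fun" "Q \<in> poly_fun" "\<And>z. z \<in> X \<Longrightarrow> Q z \<noteq> 0" "\<And>z. z \<in> X \<Longrightarrow> f z = P z / Q z"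
  using assms unfolding rat_on_def by blast

lemma rat_on_poly: "f \<in> poly_fun \<Longrightarrow> f \<in> rat_on X"
  by (rule rat_onI[of f "\<lambda>z. 1"]) (auto intro: poly_fun.const)

lemma rat_on_const: "(\<lambda>z. c) \<in> rat_on X" and rat_on_coord: "(\<lambda>z. z $ i) \<in> rat_on X"
  by (auto intro: rat_on_poly poly_fun.const poly_fun.coord)

lemma rat_on_cong: "f \<in> rat_on X \<Longrightarrow> (\<And>z. z \<in> X \<Longrightarrow> g z = f z) \<Longrightarrow> g \<in> rat_on X"
  unfolding rat_on_def by force

lemma rat_on_add: "f \<in> rat_on X \<Longrightarrow> g \<in> rat_on X \<Longrightarrow> (\<lambda>z. f z + g z) \<in> rat_on X"
proof -
  assume "f \<in> rat_on X" "g \<in> rat_on X"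
  then obtain P Q P' Q' where *: "P \<in> poly_fun" "Q \<in> poly_fun" "\<And>z. z \<in> X \<Longrightarrow> Q z \<noteq> 0" "\<And>z. z \<in> X \<Longrightarrow> f z = P z / Q z"
    "P' \<in> poly_fun" "Q' \<in> poly_fun" "\<And>z. z \<in> X \<Longrightarrow> Q' z \<noteq> 0" "\<And>z. z \<in> X \<Longrightarrow> g z = P' z / Q' z"
    unfolding rat_on_def by blast
  show ?thesis
    by (rule rat_onI[of "\<lambda>z. P z * Q' z + P' z * Q z" "\<lambda>z. Q z * Q' z"])
      (auto intro!: poly_fun.intros * simp: *(3,7) *(4,8) add_frac_eq)
qed

lemma rat_on_mult: "f \<in> rat_on X \<Longrightarrow> g \<in> rat_on X \<Longrightarrow> (\<lambda>z. f z * g z) \<in> rat_on X"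
proof -
  assume "f \<in> rat_on X" "g \<in> rat_on X"
  then obtain P Q P' Q' where *: "P \<in> poly_fun" "Q \<in> poly_fun" "\<And>z. z \<in> X \<Longrightarrow> Q z \<noteq> 0" "\<And>z. z \<in> X \<Longrightarrow> f z = P z / Q z"
    "P' \<in> poly_fun" "Q' \<in> poly_fun" "\<And>z. z \<in> X \<Longrightarrow> Q' z \<noteq> 0" "\<And>z. z \<in> X \<Longrightarrow> g z = P' z / Q' z"
    unfolding rat_on_def by blast
  show ?thesis
    by (rule rat_onI[of "\<lambda>z. P z * P' z" "\<lambda>z. Q z * Q' z"])
      (auto intro!: poly_fun.intros * simp: *(3,7) *(4,8))
qed

lemma rat_on_uminus: "f \<in> rat_on X \<Longrightarrow> (\<lambda>z. - f z) \<in> rat_on X"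
  using rat_on_mult[OF rat_on_const[of "-1"]] by simp

lemma rat_on_diff: "f \<in> rat_on X \<Longrightarrow> g \<in> rat_on X \<Longrightarrow> (\<lambda>z. f z - g z) \<in> rat_on X"
  using rat_on_add[OF _ rat_on_uminus] by simp

lemma rat_on_inverse:
  assumes "f \<in> rat_on X" "\<And>z. z \<in> X \<Longrightarrow> f z \<noteq> 0" shows "(\<lambda>z. inverse (f z)) \<in> rat_on X"
proof -
  from assms(1) obtain P Q where *: "P \<in> poly_fun" "Q \<in> poly_fun" "\<And>z. z \<in> X \<Longrightarrow> Q z \<noteq> 0" "\<And>z. z \<in> X \<Longrightarrow> f z = P z / Q z"
    unfolding rat_on_def by blast
  show ?thesis
    by (rule rat_onI[of Q P]) (use * assms(2) in \<open>auto simp: *(4)\<close>)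
qed

lemma rat_on_divide:
  assumes "f \<in> rat_on X" "g \<in> rat_on X" "\<And>z. z \<in> X \<Longrightarrow> g z \<noteq> 0" shows "(\<lambda>z. f z / g z) \<in> rat_on X"
  unfolding divide_inverse by (intro rat_on_mult rat_on_inverse assms)

lemma rat_on_sum: "finite S \<Longrightarrow> (\<And>i. i \<in> S \<Longrightarrow> f i \<in> rat_on X) \<Longrightarrow> (\<lambda>z. \<Sum>i\<in>S. f i z) \<in> rat_on X"
  by (induction S rule: finite_induct) (auto intro: rat_on_const rat_on_add)

lemma rat_on_prod: "finite S \<Longrightarrow> (\<And>i. i \<in> S \<Longrightarrow> f i \<in> rat_on X) \<Longrightarrow> (\<lambda>z. \<Prod>i\<in>S. f i z) \<in> rat_on X"
  by (induction S rule: finite_induct) (auto intro: rat_on_const rat_on_mult)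

lemma rat_on_det:
  fixes A :: "complex ^ 'm \<Rightarrow> complex ^ 'n ^ 'n"
  assumes "\<And>i j. (\<lambda>z. A z $ i $ j) \<in> rat_on X" shows "(\<lambda>z. det (A z)) \<in> rat_on X"
  unfolding det_def by (intro rat_on_sum rat_on_mult rat_on_prod rat_on_const assms) auto

lemma rat_on_cdiff:
  assumes "f \<in> rat_on X" "open X" "z \<in> X" shows "cdiff f z"
proof -
  from assms(1) obtain P Q where *: "P \<in> poly_fun" "Q \<in> poly_fun" "\<And>z. z \<in> X \<Longrightarrow> Q z \<noteq> 0" "\<And>z. z \<in> X \<Longrightarrow> f z = P z / Q z"
    unfolding rat_on_def by blast
  show ?thesis
    by (rule cdiff_cong(1)[where f="\<lambda>z. P z / Q z", OF assms(2,3) _ cdiff_divide[OF poly_fun_cdiff poly_fun_cdiff]]) (use * assms in auto)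
qed

lemma cdiff_continuous: "cdiff f z \<Longrightarrow> isCont f z"
  using cdiffD has_derivative_continuous by blast

lemma rat_on_continuous: "f \<in> rat_on X \<Longrightarrow> open X \<Longrightarrow> continuous_on X f"
  by (meson rat_on_cdiff cdiff_continuous continuous_at_imp_continuous_on)

text \<open>Differentiating P = Q f, which holds near \<open>z\<close> because \<open>X\<close> is
  open, replaces the quotient rule, and the result can be differentiated once more.\<close>

lemma rat_on_pd_aux:
  assumes f: "f \<in> rat_on X" and X: "open X"
  and *: "P \<in> poly_fun" "Q \<in> poly_fun" "\<And>z. z \<in> X \<Longrightarrow> Q z \<noteq> 0" "\<And>z. z \<in> X \<Longrightarrow> f z = P z / Q z"
  and z: "z \<in> X"
  shows "pd P k z = pd Q k z * f z + Q z * pd f k z"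
proof -
  have "pd P k z = pd (\<lambda>z. Q z * f z) k z"
    by (rule cdiff_cong(2)[OF X z])
      (use *(3,4) in \<open>auto intro!: cdiff_mult poly_fun_cdiff[OF *(2)] rat_on_cdiff[OF f X z]\<close>)
  then show ?thesis using pd_mult[OF poly_fun_cdiff[OF *(2)] rat_on_cdiff[OF f X z]] by simp
qed

lemma rat_on_pd:
  assumes f: "f \<in> rat_on X" and X: "open X" shows "pd f k \<in> rat_on X"
proof -
  from f obtain P Q where *: "P \<in> poly_fun" "Q \<in> poly_fun" "\<And>z. z \<in> X \<Longrightarrow> Q z \<noteq> 0" "\<And>z. z \<in> X \<Longrightarrow> f z = P z / Q z"
    unfolding rat_on_def by blast
  have "(\<lambda>z. (pd P k z - pd Q k z * f z) / Q z) \<in> rat_on X"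
    by (intro rat_on_divide rat_on_diff rat_on_mult f rat_on_poly[OF *(2)] rat_on_poly poly_fun_pd *)
  then show ?thesis
    by (rule rat_on_cong) (use rat_on_pd_aux[OF f X *] *(3) in auto)
qed

text \<open>Differentiate P = Q f twice: every term except Q times the second derivative of f is
  already symmetric in \<open>k\<close> and \<open>l\<close>, and Q has no zero on
  \<open>X\<close>.\<close>

lemma rat_on_pd_commute:
  assumes f: "f \<in> rat_on X" and X: "open X" and z: "z \<in> X"
  shows "pd (pd f k) l z = pd (pd f l) k z"
proof -
  from f obtain P Q where *: "P \<in> poly_fun" "Q \<in> poly_fun" "\<And>z. z \<in> X \<Longrightarrow> Q z \<noteq> 0" "\<And>z. z \<in> X \<Longrightarrow> f z = P z / Q z"
    unfolding rat_on_def by blast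
  note d = poly_fun_cdiff[OF *(2)] poly_fun_cdiff[OF poly_fun_pd[OF *(2)]]
     rat_on_cdiff[OF f X z] rat_on_cdiff[OF rat_on_pd[OF f X] X z]
  have "pd (pd P k) l z = pd (pd Q k) l z * f z + pd Q k z * pd f l z + pd Q l z * pd f k z + Q z * pd (pd f k) l z" for k l
  proof -
    have "pd (pd P k) l z = pd (\<lambda>z. pd Q k z * f z + Q z * pd f k z) l z"
      by (rule cdiff_cong(2)[OF X z])
       (auto intro!: cdiff_mult cdiff_add d rat_on_pd_aux[OF f X *, symmetric])
    also have "\<dots> = pd (pd Q k) l z * f z + pd Q k z * pd f l z + pd Q l z * pd f k z + Q z * pd (pd f k) l z"
      using d by (simp add: pd_add pd_mult cdiff_mult)
    finally show ?thesis .
  qed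
  from this[of k l] this[of l k] poly_fun_pd_commute[OF *(1)] poly_fun_pd_commute[OF *(2)]
  have "Q z * pd (pd f k) l z = Q z * pd (pd f l) k z" by (simp add: algebra_simps)
  then show ?thesis using *(3)[OF z] by simp
qed

lemma rat_on_compose:
  fixes \<Phi> :: "complex ^ 'n \<Rightarrow> complex ^ 'm"
  assumes \<Phi>: "\<And>i. (\<lambda>z. \<Phi> z $ i) \<in> rat_on X" and im: "\<Phi> ` X \<subseteq> Y" and g: "g \<in> rat_on Y"
  shows "(\<lambda>z. g (\<Phi> z)) \<in> rat_on X"
proof -
  have p: "(\<lambda>z. P (\<Phi> z)) \<in> rat_on X" if "P \<in> poly_fun" for P
    using that by (induction P rule: poly_fun.induct) (auto intro: rat_on_const \<Phi> rat_on_add rat_on_mult)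
  from g obtain P Q where *: "P \<in> poly_fun" "Q \<in> poly_fun" "\<And>z. z \<in> Y \<Longrightarrow> Q z \<noteq> 0" "\<And>z. z \<in> Y \<Longrightarrow> g z = P z / Q z"
    unfolding rat_on_def by blast
  have "(\<lambda>z. P (\<Phi> z) / Q (\<Phi> z)) \<in> rat_on X"
    by (rule rat_on_divide) (use p * im in auto)
  then show ?thesis by (rule rat_on_cong) (use * im in auto)
qed

section \<open>Integration by parts and Piola's identity\<close>

text \<open>\<open>p\<close> and \<open>q\<close> are the Wirtinger derivatives of \<open>f\<close>,
  with respect to the variables and to their conjugates, recorded as the two kinds of coefficients
  of one real Frechet derivative.\<close>

definition wd :: "(complex ^ 'n \<Rightarrow> complex) \<Rightarrow> ('n \<Rightarrow> complex) \<Rightarrow> ('n \<Rightarrow> complex) \<Rightarrow> complex ^ 'n \<Rightarrow> bool" where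
  "wd f p q x \<longleftrightarrow> (f has_derivative (\<lambda>h. \<Sum>j\<in>UNIV. p j * h $ j + q j * cnj (h $ j))) (at x)"

lemma wd_cdiff: "cdiff f x \<Longrightarrow> wd f (\<lambda>j. pd f j x) (\<lambda>j. 0) x"
  unfolding wd_def by (drule cdiffD) simp

lemma wd_cnj:
  assumes "wd f p q x" shows "wd (\<lambda>x. cnj (f x)) (\<lambda>j. cnj (q j)) (\<lambda>j. cnj (p j)) x"
  unfolding wd_def
  by (rule has_derivative_eq_rhs[OF bounded_linear.has_derivative[OF bounded_linear_cnj assms[unfolded wd_def]]])
    (simp add: add.commute)

lemma wd_mult:
  assumes "wd f p q x" "wd g p' q' x"
  shows "wd (\<lambda>x. f x * g x) (\<lambda>j. p j * g x + f x * p' j) (\<lambda>j. q j * g x + f x * q' j) x"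
  unfolding wd_def
  by (rule has_derivative_eq_rhs[OF has_derivative_mult[OF assms[unfolded wd_def]]])
    (simp add: fun_eq_iff sum.distrib algebra_simps sum_distrib_left sum_distrib_right)

text \<open>A holomorphic inner map does not mix the two kinds of derivatives: conjugate derivatives
  of \<open>g\<close> pull back to conjugate derivatives only.\<close>

lemma wd_compose:
  fixes \<Phi> :: "complex ^ 'n \<Rightarrow> complex ^ 'm"
  assumes \<Phi>: "\<And>i. cdiff (\<lambda>z. \<Phi> z $ i) x" and g: "wd g p q (\<Phi> x)"
  shows "wd (\<lambda>z. g (\<Phi> z)) (\<lambda>k. \<Sum>i\<in>UNIV. p i * pd (\<lambda>z. \<Phi> z $ i) k x)
     (\<lambda>k. \<Sum>i\<in>UNIV. q i * cnj (pd (\<lambda>z. \<Phi> z $ i) k x)) x"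
proof -
  have 1: "(\<Phi> has_derivative (\<lambda>h. \<chi> i. \<Sum>k\<in>UNIV. pd (\<lambda>z. \<Phi> z $ i) k x * h $ k)) (at x)"
    by (rule has_derivative_vec) (rule cdiffD[OF \<Phi>])
  have "(\<Sum>i\<in>UNIV. p i * (\<Sum>k\<in>UNIV. pd (\<lambda>z. \<Phi> z $ i) k x * h $ k) +
           q i * cnj (\<Sum>k\<in>UNIV. pd (\<lambda>z. \<Phi> z $ i) k x * h $ k)) =
     (\<Sum>k\<in>UNIV. (\<Sum>i\<in>UNIV. p i * pd (\<lambda>z. \<Phi> z $ i) k x) * h $ k +
           (\<Sum>i\<in>UNIV. q i * cnj (pd (\<lambda>z. \<Phi> z $ i) k x)) * cnj (h $ k))" for h
    apply (simp add: sum.distrib sum_distrib_left sum_distrib_right mult.assoc)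
    apply (subst (1 2) sum.swap) by simp
  then show ?thesis unfolding wd_def
    by (intro has_derivative_eq_rhs[OF has_derivative_compose[OF 1 g[unfolded wd_def]]]) (simp add: fun_eq_iff)
qed

lemma wd_cong:
  assumes "open U" "x \<in> U" "\<And>y. y \<in> U \<Longrightarrow> f y = g y" "wd f p q x"
  shows "wd g p q x"
  unfolding wd_def
  by (rule has_derivative_transform_within_open[OF assms(4)[unfolded wd_def] assms(1,2)]) (use assms(3) in auto)

lemma wd_zero: "wd (\<lambda>x. 0) (\<lambda>j. 0) (\<lambda>j. 0) x"
  unfolding wd_def by simp

text \<open>By translation invariance every difference quotient of \<open>V\<close> has integral 0,
  and dominated convergence carries this to the derivative. The uniform bound on \<open>V'\<close>
  makes \<open>V\<close> Lipschitz, which supplies the domination.\<close>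

lemma integral_direction_derivative_zero:
  fixes V :: "'a::euclidean_space \<Rightarrow> complex"
  assumes K: "compact K" and off: "\<And>x. x \<notin> K \<Longrightarrow> V x = 0"
    and der: "\<And>x. (V has_derivative V' x) (at x)"
    and B: "\<And>x h. norm (V' x h) \<le> B * norm h"
  shows "integrable lborel (\<lambda>x. V' x e)" and "(\<integral>x. V' x e \<partial>lborel) = 0"
proof -
  have contV: "continuous_on UNIV V"
    using der has_derivative_continuous continuous_at_imp_continuous_on by blast
  have "integrable lborel (\<lambda>x. indicator K x *\<^sub>R V x)"
    by (rule borel_integrable_compact[OF K continuous_on_subset[OF contV]]) auto
  also have "(\<lambda>x. indicator K x *\<^sub>R V x) = V"
    using off by (auto simp: indicator_def)
  finally have intV: "integrable lborel V" .
  have shift: "integrable lborel (\<lambda>x. V (x + a))" "(\<integral>x. V (x + a) \<partial>lborel) = (\<integral>x. V x \<partial>lborel)" for a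
  proof -
    have eq: "distr lborel borel ((+) a) = (lborel :: 'a measure)" by (rule lborel_distr_plus)
    have "integrable (distr lborel borel ((+) a)) V" using intV by (simp add: eq)
    then show "integrable lborel (\<lambda>x. V (x + a))"
      by (subst (asm) integrable_distr_eq) (use contV borel_measurable_continuous_onI in \<open>auto simp: add.commute\<close>)
    have "(\<integral>x. V x \<partial>distr lborel borel ((+) a)) = (\<integral>x. V (a + x) \<partial>lborel)"
      by (rule integral_distr) (use contV borel_measurable_continuous_onI in auto)
    then show "(\<integral>x. V (x + a) \<partial>lborel) = (\<integral>x. V x \<partial>lborel)" by (simp add: eq add.commute)
  qed
  have lip: "norm (V y - V x) \<le> B * norm (y - x)" for x y
  proof (rule differentiable_bound[where S=UNIV and f'=V'])
    show "onorm (V' z) \<le> B" for z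
      by (rule onorm_le) (rule B)
  qed (use der in auto)
  define t where "t n = inverse (real (Suc n))" for n
  have t: "t n > 0" "t n \<le> 1" "t n \<noteq> 0" for n by (auto simp: t_def field_simps)
  have tlim: "t \<longlonglongrightarrow> 0" unfolding t_def by (rule LIMSEQ_inverse_real_of_nat)
  define f where "f n x = (V (x + t n *\<^sub>R e) - V x) /\<^sub>R t n" for n x
  have f0: "(\<integral>x. f n x \<partial>lborel) = 0" for n
    unfolding f_def integral_scaleR_right Bochner_Integration.integral_diff[OF shift(1) intV] shift(2) by simp
  obtain R where "\<And>x. x \<in> K \<Longrightarrow> norm x \<le> R"
    using compact_imp_bounded[OF K] unfolding bounded_iff by blast
  then have R: "K \<subseteq> cball 0 R" by auto
  \<comment> \<open>Since \<open>t n \<le> 1\<close>, the translates of \<open>K\<close> that occur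
    stay within distance \<open>norm e\<close> of \<open>K\<close>, so a single ball carries all
    difference quotients; \<open>B * norm e\<close> is their Lipschitz bound.\<close>
  define w where "w x = indicator (cball 0 (R + norm e)) x * (B * norm e)" for x :: 'a
  have intw: "integrable lborel w"
    unfolding w_def using borel_integrable_compact[of "cball (0::'a) (R + norm e)" "\<lambda>x. B * norm e"] by simp
  have lim: "(\<lambda>n. f n x) \<longlonglongrightarrow> V' x e" for x
  proof -
    have "((\<lambda>s. x + s *\<^sub>R e) has_derivative (\<lambda>s. s *\<^sub>R e)) (at 0)"
      by (auto intro!: derivative_eq_intros)
    from has_derivative_compose[OF this, of V "V' x"] der[of x]
    have d: "((\<lambda>s. V (x + s *\<^sub>R e)) has_derivative (\<lambda>s. V' x (s *\<^sub>R e))) (at 0)" by simp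
    have lin: "linear (V' x)" using der[of x] has_derivative_linear by blast
    show ?thesis
    proof (rule metric_LIMSEQ_I)
      fix r :: real assume r: "r > 0"
      have "\<forall>\<epsilon>>0. \<exists>\<delta>>0. \<forall>s. norm (s - 0) < \<delta> \<longrightarrow>
          norm (V (x + s *\<^sub>R e) - V (x + 0 *\<^sub>R e) - V' x ((s - 0) *\<^sub>R e)) \<le> \<epsilon> * norm (s - 0)"
        using d unfolding has_derivative_at_alt by simp
      from this[rule_format, of "r/2"] r obtain \<delta> where \<delta>: "\<delta> > 0" "\<And>s. norm s < \<delta> \<Longrightarrow>
          norm (V (x + s *\<^sub>R e) - V x - V' x (s *\<^sub>R e)) \<le> r/2 * norm s"
        by auto
      obtain N where N: "\<And>n. n \<ge> N \<Longrightarrow> t n < \<delta>"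
        using order_tendstoD(2)[OF tlim \<delta>(1)] unfolding eventually_sequentially by blast
      have "dist (f n x) (V' x e) < r" if "n \<ge> N" for n
      proof -
        have "f n x - V' x e = (V (x + t n *\<^sub>R e) - V x - V' x (t n *\<^sub>R e)) /\<^sub>R t n"
          using t(3)[of n] by (simp add: f_def linear_scale[OF lin] scaleR_diff_right)
        then have "norm (f n x - V' x e) = norm (V (x + t n *\<^sub>R e) - V x - V' x (t n *\<^sub>R e)) / t n"
          using t(1)[of n] by (simp add: divide_inverse mult.commute)
        also have "\<dots> \<le> (r/2 * t n) / t n"
          using \<delta>(2)[of "t n"] N[OF that] t(1)[of n] by (intro divide_right_mono) auto
        also have "\<dots> < r" using t(1)[of n] r by simp
        finally show ?thesis by (simp add: dist_norm)
      qed
      then show "\<exists>N. \<forall>n\<ge>N. dist (f n x) (V' x e) < r" by blast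
    qed
  qed
  have fm: "f n \<in> borel_measurable lborel" for n
    unfolding f_def by (intro borel_measurable_integrable integrable_scaleR_right Bochner_Integration.integrable_diff shift(1) intV)
  have V'm: "(\<lambda>x. V' x e) \<in> borel_measurable lborel"
    by (rule borel_measurable_LIMSEQ_metric[OF fm lim])
  have bnd: "norm (f n x) \<le> w x" for n x
  proof (cases "x \<in> cball 0 (R + norm e)")
    case True
    have "norm (f n x) = norm (V (x + t n *\<^sub>R e) - V x) / t n"
      using t(1)[of n] by (simp add: f_def divide_inverse mult.commute)
    also have "\<dots> \<le> (B * norm (t n *\<^sub>R e)) / t n"
      using lip[of "x + t n *\<^sub>R e" x] t[of n] by (intro divide_right_mono) auto
    also have "\<dots> = B * norm e" using t[of n] by simp
    finally show ?thesis using True by (simp add: w_def)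
  next
    case False
    then have nx: "norm x > R + norm e" by simp
    have "norm (t n *\<^sub>R e) \<le> norm e" using t[of n] by (simp add: mult_left_le_one_le)
    then have "norm (x + t n *\<^sub>R e) > R" using nx norm_diff_ineq[of x "t n *\<^sub>R e"] by linarith
    then have "x + t n *\<^sub>R e \<notin> K" using R by (meson mem_cball_0 not_le subsetD)
    moreover have "x \<notin> K"
    proof
      assume "x \<in> K"
      then have "norm x \<le> R" using R by auto
      then show False using nx norm_ge_zero[of e] by linarith
    qed
    ultimately show ?thesis using off False by (simp add: f_def w_def)
  qed
  show "integrable lborel (\<lambda>x. V' x e)"
    by (rule integrable_dominated_convergence[where s=f, OF V'm fm intw]) (use lim bnd in auto)
  have "(\<lambda>n. \<integral>x. f n x \<partial>lborel) \<longlonglongrightarrow> (\<integral>x. V' x e \<partial>lborel)"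
    by (rule integral_dominated_convergence[where s=f, OF V'm fm intw]) (use lim bnd in auto)
  then show "(\<integral>x. V' x e \<partial>lborel) = 0" unfolding f0 by (simp add: LIMSEQ_const_iff)
qed

text \<open>The conjugate derivative in coordinate \<open>k\<close> is a combination of the
  derivatives in the two real directions \<open>axis k 1\<close> and \<open>axis k \<i>\<close>, and
  each of these integrates to 0.\<close>

lemma integral_dbar_zero:
  fixes V :: "complex ^ 'n \<Rightarrow> complex"
  assumes K: "compact K" and off: "\<And>x. x \<notin> K \<Longrightarrow> V x = 0"
    and der: "\<And>x. wd V (\<lambda>j. p j x) (\<lambda>j. q j x) x"
    and cont: "\<And>j. continuous_on K (p j)" "\<And>j. continuous_on K (q j)"
    and off': "\<And>x j. x \<notin> K \<Longrightarrow> p j x = 0" "\<And>x j. x \<notin> K \<Longrightarrow> q j x = 0"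
  shows "integrable lborel (q k)" and "(\<integral>x. q k x \<partial>lborel) = 0"
proof -
  define V' where "V' x h = (\<Sum>j\<in>UNIV. p j x * h $ j + q j x * cnj (h $ j))" for x h
  have "\<exists>B\<ge>0. \<forall>x. norm (p j x) \<le> B \<and> norm (q j x) \<le> B" for j
  proof -
    obtain a where a: "\<And>x. x \<in> K \<Longrightarrow> norm (p j x) \<le> a"
      using compact_imp_bounded[OF compact_continuous_image[OF cont(1) K]] unfolding bounded_iff by blast
    obtain b where b: "\<And>x. x \<in> K \<Longrightarrow> norm (q j x) \<le> b"
      using compact_imp_bounded[OF compact_continuous_image[OF cont(2) K]] unfolding bounded_iff by blast
    show ?thesis
      by (rule exI[of _ "max 0 (max a b)"]) (use a b off' in \<open>force simp: le_max_iff_disj\<close>)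
  qed
  then obtain B where B: "\<And>j. B j \<ge> 0" "\<And>j x. norm (p j x) \<le> B j" "\<And>j x. norm (q j x) \<le> B j"
    by metis
  have bnd: "norm (V' x h) \<le> (\<Sum>j\<in>UNIV. 2 * B j) * norm h" for x h
  proof -
    have "norm (V' x h) \<le> (\<Sum>j\<in>UNIV. (2 * B j) * norm h)"
      unfolding V'_def
    proof (rule sum_norm_le)
      fix j :: 'n
      have "norm (p j x * h $ j + q j x * cnj (h $ j)) \<le> norm (p j x) * norm (h $ j) + norm (q j x) * norm (h $ j)"
        by (rule order_trans[OF norm_triangle_ineq]) (simp add: norm_mult)
      also have "\<dots> \<le> B j * norm h + B j * norm h"
        using B Finite_Cartesian_Product.norm_nth_le[of h j] by (intro add_mono mult_mono) auto
      finally show "norm (p j x * h $ j + q j x * cnj (h $ j)) \<le> 2 * B j * norm h" by simp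
    qed
    then show ?thesis by (simp add: sum_distrib_right)
  qed
  have der': "(V has_derivative V' x) (at x)" for x
    using der[of x] unfolding wd_def V'_def[abs_def] .
  note I = integral_direction_derivative_zero[OF K off der' bnd]
  have e: "V' x (axis k a) = p k x * a + q k x * cnj a" for x a
    unfolding V'_def using sum_axis_mult[of "\<lambda>j. p j x" k a] sum_axis_mult[of "\<lambda>j. q j x" k "cnj a"]
    by (simp add: sum.distrib axis_def if_distrib[of cnj] cong: if_cong)
  have q: "q k x = (1/2) * (V' x (axis k 1) + \<i> * V' x (axis k \<i>))" for x
    unfolding e by (simp add: algebra_simps)
  have q': "q k = (\<lambda>x. (1/2) * (V' x (axis k 1) + \<i> * V' x (axis k \<i>)))"
    using q by (rule ext)
  show "integrable lborel (q k)"
    unfolding q' by (intro integrable_mult_right Bochner_Integration.integrable_add I(1))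
  show "(\<integral>x. q k x \<partial>lborel) = 0"
    unfolding q' by (simp add: I)
qed

section \<open>Determinants: derivatives, cofactors, Piola's identity\<close>

lemma pd_prod:
  assumes "finite S" "\<And>i. i \<in> S \<Longrightarrow> cdiff (f i) z"
  shows "cdiff (\<lambda>z. \<Prod>i\<in>S. f i z) z \<and> pd (\<lambda>z. \<Prod>i\<in>S. f i z) k z = (\<Sum>i\<in>S. pd (f i) k z * (\<Prod>j\<in>S - {i}. f j z))"
  using assms
proof (induction S rule: finite_induct)
  case empty
  then show ?case by (simp add: cdiff_const pd_const)
next
  case (insert a S)
  have "(\<Sum>i\<in>S. pd (f i) k z * (\<Prod>j\<in>insert a S - {i}. f j z)) = f a z * (\<Sum>i\<in>S. pd (f i) k z * (\<Prod>j\<in>S - {i}. f j z))"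
    unfolding sum_distrib_left
  proof (rule sum.cong[OF refl])
    fix i assume i: "i \<in> S"
    then have "insert a S - {i} = insert a (S - {i})" using insert by auto
    then show "pd (f i) k z * (\<Prod>j\<in>insert a S - {i}. f j z) = f a z * (pd (f i) k z * (\<Prod>j\<in>S - {i}. f j z))"
      using insert by simp
  qed
  moreover have "insert a S - {a} = S" using insert by auto
  ultimately show ?case using insert by (simp add: cdiff_mult pd_mult)
qed

lemma pd_sum:
  assumes "finite S" "\<And>i. i \<in> S \<Longrightarrow> cdiff (f i) z"
  shows "cdiff (\<lambda>z. \<Sum>i\<in>S. f i z) z \<and> pd (\<lambda>z. \<Sum>i\<in>S. f i z) k z = (\<Sum>i\<in>S. pd (f i) k z)"
  using assms by (induction S rule: finite_induct) (simp_all add: cdiff_const pd_const cdiff_add pd_add)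

lemma pd_det:
  fixes A :: "complex ^ 'm \<Rightarrow> complex ^ 'n ^ 'n"
  assumes A: "\<And>i j. cdiff (\<lambda>z. A z $ i $ j) z"
  shows "pd (\<lambda>z. det (A z)) k z = (\<Sum>i\<in>UNIV. det (\<chi> r. if r = i then (\<chi> l. pd (\<lambda>z. A z $ i $ l) k z) else A z $ r))"
proof -
  let ?P = "{p. p permutes (UNIV :: 'n set)}"
  have fin: "finite ?P" by simp
  have d: "det (\<chi> r. if r = i then (\<chi> l. pd (\<lambda>z. A z $ i $ l) k z) else A z $ r) =
     (\<Sum>p\<in>?P. of_int (sign p) * (pd (\<lambda>z. A z $ i $ p i) k z * (\<Prod>j\<in>UNIV - {i}. A z $ j $ p j)))" for i
    unfolding det_def
  proof (rule sum.cong[OF refl])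
    fix p
    have "(\<Prod>r\<in>UNIV. (\<chi> r. if r = i then (\<chi> l. pd (\<lambda>z. A z $ i $ l) k z) else A z $ r) $ r $ p r) =
      pd (\<lambda>z. A z $ i $ p i) k z * (\<Prod>j\<in>UNIV - {i}. A z $ j $ p j)"
      by (subst prod.remove[of UNIV i]) (auto intro!: prod.cong)
    then show "of_int (sign p) * (\<Prod>r\<in>UNIV. (\<chi> r. if r = i then (\<chi> l. pd (\<lambda>z. A z $ i $ l) k z) else A z $ r) $ r $ p r) =
      of_int (sign p) * (pd (\<lambda>z. A z $ i $ p i) k z * (\<Prod>j\<in>UNIV - {i}. A z $ j $ p j))" by simp
  qed
  have pr: "cdiff (\<lambda>z. \<Prod>i\<in>UNIV. A z $ i $ p i) z \<and> pd (\<lambda>z. \<Prod>i\<in>UNIV. A z $ i $ p i) k z =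
     (\<Sum>i\<in>UNIV. pd (\<lambda>z. A z $ i $ p i) k z * (\<Prod>j\<in>UNIV - {i}. A z $ j $ p j))" for p
    by (rule pd_prod) (use A in auto)
  have "pd (\<lambda>z. det (A z)) k z = (\<Sum>p\<in>?P. pd (\<lambda>z. of_int (sign p) * (\<Prod>i\<in>UNIV. A z $ i $ p i)) k z)"
    unfolding det_def by (rule conjunct2[OF pd_sum[OF fin]]) (use pr in \<open>auto intro!: cdiff_mult cdiff_const\<close>)
  also have "\<dots> = (\<Sum>p\<in>?P. of_int (sign p) * (\<Sum>i\<in>UNIV. pd (\<lambda>z. A z $ i $ p i) k z * (\<Prod>j\<in>UNIV - {i}. A z $ j $ p j)))"
    by (rule sum.cong[OF refl]) (use pr in \<open>simp add: pd_mult cdiff_const pd_const\<close>)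
  also have "\<dots> = (\<Sum>i\<in>UNIV. \<Sum>p\<in>?P. of_int (sign p) * (pd (\<lambda>z. A z $ i $ p i) k z * (\<Prod>j\<in>UNIV - {i}. A z $ j $ p j)))"
    unfolding sum_distrib_left by (rule sum.swap)
  finally show ?thesis unfolding d .
qed

lemma det_row_expand:
  fixes c :: "'n::finite \<Rightarrow> complex ^ 'n"
  shows "det (\<chi> r. if r = i then v else c r) = (\<Sum>l\<in>UNIV. v $ l * det (\<chi> r. if r = i then axis l 1 else c r))"
proof -
  have "det (\<chi> r. if r = i then v else c r) = det (\<chi> r. if r = i then (\<Sum>l\<in>UNIV. v $ l *s axis l 1) else c r)"
    by (simp only: basis_expansion)
  also have "\<dots> = (\<Sum>l\<in>UNIV. det (\<chi> r. if r = i then v $ l *s axis l 1 else c r))"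
    using det_linear_row_sum[of UNIV i "\<lambda>_ l. v $ l *s axis l 1" c] by simp
  also have "\<dots> = (\<Sum>l\<in>UNIV. v $ l * det (\<chi> r. if r = i then axis l 1 else c r))"
    by (simp add: det_row_mul[of i _ "\<lambda>_. axis _ 1" c])
  finally show ?thesis .
qed

lemma det_two_rows_swap:
  fixes c :: "'n::finite \<Rightarrow> complex ^ 'n"
  assumes "i \<noteq> j"
  shows "det (\<chi> r. if r = i then u else if r = j then v else c r) = - det (\<chi> r. if r = i then v else if r = j then u else c r)"
proof -
  let ?A = "(\<chi> r. if r = i then v else if r = j then u else c r) :: complex ^ 'n ^ 'n"
  have "(\<chi> r. ?A $ Transposition.transpose i j r) = (\<chi> r. if r = i then u else if r = j then v else c r)"
    using assms by (auto simp: vec_eq_iff Transposition.transpose_def)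
  then show ?thesis
    using det_permute_rows[of "Transposition.transpose i j" ?A] assms
    by (simp add: permutes_swap_id sign_swap_id)
qed

definition jac :: "(complex ^ 'n \<Rightarrow> complex ^ 'n) \<Rightarrow> complex ^ 'n \<Rightarrow> complex" where
  "jac \<Phi> z = det (\<chi> i k. pd (\<lambda>z. \<Phi> z $ i) k z)"

text \<open>The cofactor of the Jacobian matrix at position (\<open>j\<close>, \<open>k\<close>),
  kept as a full determinant with row \<open>j\<close> replaced by a unit vector. This avoids minors
  and their signs, and the determinant can still be differentiated row by row.\<close>

definition jac_cof :: "(complex ^ 'n \<Rightarrow> complex ^ 'n) \<Rightarrow> 'n \<Rightarrow> 'n \<Rightarrow> complex ^ 'n \<Rightarrow> complex" where
  "jac_cof \<Phi> j k z = det (\<chi> r. if r = j then axis k 1 else (\<chi> l. pd (\<lambda>z. \<Phi> z $ r) l z))"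

text \<open>Summed against row \<open>i\<close>, the cofactors of row \<open>j\<close> reassemble
  the determinant whose row \<open>j\<close> is overwritten by row \<open>i\<close>; for distinct
  indices it has two equal rows.\<close>

lemma jac_cof_expand:
  "(\<Sum>k\<in>UNIV. jac_cof \<Phi> j k z * pd (\<lambda>z. \<Phi> z $ i) k z) = (if i = j then jac \<Phi> z else 0)"
proof -
  let ?c = "\<lambda>r. (\<chi> l. pd (\<lambda>z. \<Phi> z $ r) l z)"
  have "(\<Sum>k\<in>UNIV. jac_cof \<Phi> j k z * pd (\<lambda>z. \<Phi> z $ i) k z) = det (\<chi> r. if r = j then ?c i else ?c r)"
    unfolding det_row_expand[of j "?c i"] jac_cof_def by (simp add: mult.commute)
  also have "\<dots> = (if i = j then jac \<Phi> z else 0)"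
  proof (cases "i = j")
    case True
    then have "(\<chi> r. if r = j then ?c i else ?c r) = (\<chi> r. ?c r)" by (simp add: vec_eq_iff)
    then show ?thesis using True by (simp add: jac_def)
  next
    case False
    have "det (\<chi> r. if r = j then ?c i else ?c r) = 0"
      by (rule det_identical_rows[OF False]) (use False in \<open>auto simp: row_def\<close>)
    then show ?thesis using False by simp
  qed
  finally show ?thesis .
qed

lemma jac_rat_on:
  assumes "\<And>i. (\<lambda>z. \<Phi> z $ i) \<in> rat_on X" "open X"
  shows "jac \<Phi> \<in> rat_on X"
  unfolding jac_def[abs_def] by (intro rat_on_det) (simp add: rat_on_pd assms)

lemma jac_cof_rat_on:
  assumes "\<And>i. (\<lambda>z. \<Phi> z $ i) \<in> rat_on X" "open X"
  shows "jac_cof \<Phi> j k \<in> rat_on X"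
proof -
  have "(\<lambda>z. (\<chi> r. if r = j then axis k 1 else (\<chi> l. pd (\<lambda>z. \<Phi> z $ r) l z)) $ i $ l) \<in> rat_on X" for i l
    by (cases "i = j") (auto intro: rat_on_const rat_on_pd assms)
  then show ?thesis unfolding jac_cof_def[abs_def] by (intro rat_on_det) simp
qed

text \<open>Piola's identity.\<close>
lemma jac_cof_divergence:
  fixes \<Phi> :: "complex ^ 'n \<Rightarrow> complex ^ 'n"
  assumes rat: "\<And>i. (\<lambda>z. \<Phi> z $ i) \<in> rat_on X" and X: "open X" and z: "z \<in> X"
  shows "(\<Sum>k\<in>UNIV. pd (jac_cof \<Phi> j k) k z) = 0"
proof -
  let ?c = "\<lambda>r. (\<chi> l. pd (\<lambda>z. \<Phi> z $ r) l z) :: complex ^ 'n"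
  \<comment> \<open>Row \<open>j\<close> is constant and drops out, so the derivative of the
    cofactor along \<open>k\<close> is a sum of terms \<open>b i k l * m i k l\<close>. Being a
    second derivative, \<open>b\<close> is symmetric in \<open>k\<close> and \<open>l\<close>, while
    exchanging \<open>k\<close> and \<open>l\<close> swaps two rows in \<open>m\<close>. The double
    sum therefore equals its own negative.\<close>
  define b where "b i k l = pd (pd (\<lambda>z. \<Phi> z $ i) l) k z" for i k l
  have bs: "b i k l = b i l k" for i k l unfolding b_def by (rule rat_on_pd_commute[OF rat X z])
  define m where "m i k l = det (\<chi> r. if r = i then axis l 1 else if r = j then axis k 1 else ?c r)" for i k l
  have ms: "m i k l = - m i l k" if "i \<noteq> j" for i k l
    unfolding m_def by (rule det_two_rows_swap[OF that])
  have cd: "cdiff (\<lambda>z. (\<chi> r. if r = j then axis k 1 else (\<chi> l. pd (\<lambda>z. \<Phi> z $ r) l z)) $ i $ l) z" for k i l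
    by (cases "i = j") (auto intro: cdiff_const rat_on_cdiff[OF rat_on_pd[OF rat X] X z])
  have "pd (jac_cof \<Phi> j k) k z = (\<Sum>i\<in>UNIV. if i = j then 0 else (\<Sum>l\<in>UNIV. b i k l * m i k l))" for k
    unfolding jac_cof_def[abs_def] pd_det[OF cd]
  proof (rule sum.cong[OF refl])
    fix i :: 'n
    let ?D = "det (\<chi> r. if r = i then \<chi> l. pd (\<lambda>z. (\<chi> r. if r = j then axis k 1 else ?c r) $ i $ l) k z
              else (\<chi> r. if r = j then axis k 1 else (\<chi> l. pd (\<lambda>z. \<Phi> z $ r) l z)) $ r)"
    let ?D = "det (\<chi> r. if r = i then \<chi> l. pd (\<lambda>z. (\<chi> r. if r = j then axis k 1 else (\<chi> l. pd (\<lambda>z. \<Phi> z $ r) l z)) $ i $ l) k z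
              else (\<chi> r. if r = j then axis k 1 else (\<chi> l. pd (\<lambda>z. \<Phi> z $ r) l z)) $ r)"
    show "?D = (if i = j then 0 else (\<Sum>l\<in>UNIV. b i k l * m i k l))"
    proof (cases "i = j")
      case True
      have "(\<chi> l. pd (\<lambda>z. (\<chi> r. if r = j then axis k 1 else (\<chi> l. pd (\<lambda>z. \<Phi> z $ r) l z)) $ i $ l) k z) = (0 :: complex^'n)"
        using True by (simp add: vec_eq_iff pd_const)
      then show ?thesis unfolding \<open>(\<chi> l. pd (\<lambda>z. (\<chi> r. if r = j then axis k 1 else (\<chi> l. pd (\<lambda>z. \<Phi> z $ r) l z)) $ i $ l) k z) = 0\<close>
        using True by (auto intro!: det_zero_row(1)[of i] simp: row_def vec_eq_iff)
    next
      case False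
      have "(\<chi> l. pd (\<lambda>z. (\<chi> r. if r = j then axis k 1 else (\<chi> l. pd (\<lambda>z. \<Phi> z $ r) l z)) $ i $ l) k z) = (\<chi> l. b i k l)"
        using False by (simp add: vec_eq_iff b_def)
      then have "?D = det (\<chi> r. if r = i then (\<chi> l. b i k l) else if r = j then axis k 1 else ?c r)"
        by (auto intro!: arg_cong[where f=det] simp: vec_eq_iff)
      also have "\<dots> = (\<Sum>l\<in>UNIV. b i k l * m i k l)"
        unfolding det_row_expand[of i "\<chi> l. b i k l"] m_def by simp
      finally show ?thesis using False by simp
    qed
  qed
  then have "(\<Sum>k\<in>UNIV. pd (jac_cof \<Phi> j k) k z) = (\<Sum>i\<in>UNIV. \<Sum>k\<in>UNIV. if i = j then 0 else (\<Sum>l\<in>UNIV. b i k l * m i k l))"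
    by (simp only:) (rule sum.swap)
  also have "\<dots> = 0"
  proof (rule sum.neutral, rule ballI)
    fix i :: 'n
    show "(\<Sum>k\<in>UNIV. if i = j then 0 else (\<Sum>l\<in>UNIV. b i k l * m i k l)) = 0"
    proof (cases "i = j")
      case False
      define S where "S = (\<Sum>k\<in>UNIV. \<Sum>l\<in>UNIV. b i k l * m i k l)"
      have "S = (\<Sum>k\<in>UNIV. \<Sum>l\<in>UNIV. - (b i l k * m i l k))"
        unfolding S_def by (intro sum.cong refl) (subst bs, subst ms[OF False], simp)
      also have "\<dots> = - (\<Sum>k\<in>UNIV. \<Sum>l\<in>UNIV. b i l k * m i l k)" by (simp add: sum_negf)
      also have "(\<Sum>k\<in>UNIV. \<Sum>l\<in>UNIV. b i l k * m i l k) = S" unfolding S_def by (rule sum.swap)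
      finally have "S = 0" by simp
      then show ?thesis using False by (simp add: S_def)
    qed simp
  qed
  finally show ?thesis .
qed

text \<open>Besides the map of the theorem, the identity, the Cayley transforms and the rotations
  are instances. The push-forward results proved here thus also act as the change of variables for
  these maps.\<close>

locale proper_rational =
  fixes X \<Omega> :: "(complex ^ 'n) set" and \<Phi> :: "complex ^ 'n \<Rightarrow> complex ^ 'n"
  assumes open_X: "open X" and open_Omega: "open \<Omega>" and maps: "\<Phi> ` X \<subseteq> \<Omega>"
    and rat: "\<And>i. (\<lambda>z. \<Phi> z $ i) \<in> rat_on X"
    and proper: "\<And>K. K \<subseteq> \<Omega> \<Longrightarrow> compact K \<Longrightarrow> compact (X \<inter> \<Phi> -` K)"
begin

lemma cont_Phi: "continuous_on X \<Phi>"
proof -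
  have "continuous_on X (\<lambda>z. \<chi> i. \<Phi> z $ i)"
    by (intro continuous_intros rat_on_continuous rat open_X)
  then show ?thesis by simp
qed

text \<open>The integrand is the sum over \<open>k\<close> of the conjugate derivatives of \<open>u
  \<cdot> cnj (jac_cof \<Phi> j k) \<cdot> \<eta> \<circ> \<Phi>\<close>. As \<open>u\<close> is
  holomorphic and the cofactor rows are divergence free, only \<eta> \<circ> \<Phi> is effectively
  differentiated, and the cofactor expansion contracts the chain rule to
  \<open>cnj (jac \<Phi>)\<close> times \<open>\<eta>2 j\<close>. Properness of \<Phi> gives compact
  support inside \<open>X\<close>, so every summand integrates to 0.\<close>

lemma pull_back_dbar:
  assumes u: "u \<in> rat_on X" and K: "K \<subseteq> \<Omega>" "compact K"
    and der: "\<And>\<xi>. wd \<eta> (\<lambda>j. \<eta>1 j \<xi>) (\<lambda>j. \<eta>2 j \<xi>) \<xi>"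
    and cont: "\<And>j. continuous_on UNIV (\<eta>1 j)" "\<And>j. continuous_on UNIV (\<eta>2 j)"
    and off: "\<And>\<xi>. \<xi> \<notin> K \<Longrightarrow> \<eta> \<xi> = 0" "\<And>\<xi> j. \<xi> \<notin> K \<Longrightarrow> \<eta>1 j \<xi> = 0" "\<And>\<xi> j. \<xi> \<notin> K \<Longrightarrow> \<eta>2 j \<xi> = 0"
  shows "(\<integral>x. indicator X x *\<^sub>R (u x * cnj (jac \<Phi> x) * \<eta>2 j (\<Phi> x)) \<partial>lborel) = 0"
proof -
  define K' where "K' = X \<inter> \<Phi> -` K"
  have K': "compact K'" "K' \<subseteq> X" unfolding K'_def using proper[OF K] by auto
  have A: "jac_cof \<Phi> j k \<in> rat_on X" for k by (rule jac_cof_rat_on[OF rat open_X])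
  have con\<eta>: "continuous_on UNIV \<eta>"
    using der unfolding wd_def by (meson has_derivative_continuous continuous_at_imp_continuous_on)
  have cP: "continuous_on X (\<lambda>x. g (\<Phi> x))" if "continuous_on UNIV g" for g :: "complex ^ 'n \<Rightarrow> complex"
    by (rule continuous_on_compose2[OF that cont_Phi]) auto
  define V where "V k x = (if x \<in> X then u x * cnj (jac_cof \<Phi> j k x) * \<eta> (\<Phi> x) else 0)" for k x
  define p where "p k l x = (if x \<in> X then (pd u l x * cnj (jac_cof \<Phi> j k x) + u x * cnj 0) * \<eta> (\<Phi> x) +
      u x * cnj (jac_cof \<Phi> j k x) * (\<Sum>m\<in>UNIV. \<eta>1 m (\<Phi> x) * pd (\<lambda>z. \<Phi> z $ m) l x) else 0)" for k l x
  define q where "q k l x = (if x \<in> X then (0 * cnj (jac_cof \<Phi> j k x) + u x * cnj (pd (jac_cof \<Phi> j k) l x)) * \<eta> (\<Phi> x) +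
      u x * cnj (jac_cof \<Phi> j k x) * (\<Sum>m\<in>UNIV. \<eta>2 m (\<Phi> x) * cnj (pd (\<lambda>z. \<Phi> z $ m) l x)) else 0)" for k l x
  have offK: "V k x = 0" "p k l x = 0" "q k l x = 0" if "x \<notin> K'" for k l x
    using that off by (auto simp: V_def p_def q_def K'_def)
  have wdV: "wd (V k) (\<lambda>l. p k l x) (\<lambda>l. q k l x) x" for k x
  proof (cases "x \<in> X")
    case True
    have cd: "cdiff f x" if "f \<in> rat_on X" for f using rat_on_cdiff[OF that open_X True] .
    have "wd (\<lambda>x. u x * cnj (jac_cof \<Phi> j k x) * \<eta> (\<Phi> x)) (\<lambda>l. p k l x) (\<lambda>l. q k l x) x"
      using wd_mult[OF wd_mult[OF wd_cdiff[OF cd[OF u]] wd_cnj[OF wd_cdiff[OF cd[OF A[of k]]]]] wd_compose[OF cd[OF rat] der]]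
      unfolding p_def q_def using True by simp
    then show ?thesis
      by (rule wd_cong[OF open_X True, rotated]) (simp add: V_def)
  next
    case False
    have "open (- K')" "x \<in> - K'" using K' False by (auto simp: compact_imp_closed open_Compl)
    then have "wd (V k) (\<lambda>l. 0) (\<lambda>l. 0) x"
      by (rule wd_cong[OF _ _ _ wd_zero]) (use offK in auto)
    then show ?thesis using offK \<open>x \<in> - K'\<close> by simp
  qed
  have cpq: "continuous_on K' (p k l)" "continuous_on K' (q k l)" for k l
  proof -
    note c = rat_on_continuous[OF _ open_X] rat_on_pd[OF _ open_X] u A rat cP cont con\<eta>
    have "continuous_on X (\<lambda>x. (pd u l x * cnj (jac_cof \<Phi> j k x) + u x * cnj 0) * \<eta> (\<Phi> x) +
      u x * cnj (jac_cof \<Phi> j k x) * (\<Sum>m\<in>UNIV. \<eta>1 m (\<Phi> x) * pd (\<lambda>z. \<Phi> z $ m) l x))"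
      by (intro continuous_intros c)
    then show "continuous_on K' (p k l)"
      using K' by (elim continuous_on_subset[THEN continuous_on_eq]) (auto simp: p_def)
    have "continuous_on X (\<lambda>x. (0 * cnj (jac_cof \<Phi> j k x) + u x * cnj (pd (jac_cof \<Phi> j k) l x)) * \<eta> (\<Phi> x) +
      u x * cnj (jac_cof \<Phi> j k x) * (\<Sum>m\<in>UNIV. \<eta>2 m (\<Phi> x) * cnj (pd (\<lambda>z. \<Phi> z $ m) l x)))"
      by (intro continuous_intros c)
    then show "continuous_on K' (q k l)"
      using K' by (elim continuous_on_subset[THEN continuous_on_eq]) (auto simp: q_def)
  qed
  note I = integral_dbar_zero[OF K'(1) offK(1) wdV cpq offK(2,3)]
  have sumq: "(\<Sum>k\<in>UNIV. q k k x) = indicator X x *\<^sub>R (u x * cnj (jac \<Phi> x) * \<eta>2 j (\<Phi> x))" for x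
  proof (cases "x \<in> X")
    case True
    have "(\<Sum>k\<in>UNIV. q k k x) = u x * \<eta> (\<Phi> x) * cnj (\<Sum>k\<in>UNIV. pd (jac_cof \<Phi> j k) k x) +
       (\<Sum>k\<in>UNIV. u x * (\<Sum>m\<in>UNIV. \<eta>2 m (\<Phi> x) * cnj (jac_cof \<Phi> j k x * pd (\<lambda>z. \<Phi> z $ m) k x)))"
      using True by (simp add: q_def sum.distrib sum_distrib_left mult_ac)
    also have "(\<Sum>k\<in>UNIV. u x * (\<Sum>m\<in>UNIV. \<eta>2 m (\<Phi> x) * cnj (jac_cof \<Phi> j k x * pd (\<lambda>z. \<Phi> z $ m) k x))) =
       u x * (\<Sum>m\<in>UNIV. \<eta>2 m (\<Phi> x) * cnj (\<Sum>k\<in>UNIV. jac_cof \<Phi> j k x * pd (\<lambda>z. \<Phi> z $ m) k x))"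
      unfolding sum_distrib_left[symmetric] cnj_sum by (subst sum.swap) (simp add: sum_distrib_left)
    also have "\<dots> = u x * cnj (jac \<Phi> x) * \<eta>2 j (\<Phi> x)"
      unfolding jac_cof_expand by (simp add: if_distrib[of cnj] if_distrib[of "\<lambda>y. _ * y"] cong: if_cong)
    finally show ?thesis using True jac_cof_divergence[OF rat open_X True] by simp
  qed (simp add: q_def)
  have "(\<integral>x. indicator X x *\<^sub>R (u x * cnj (jac \<Phi> x) * \<eta>2 j (\<Phi> x)) \<partial>lborel) = (\<integral>x. (\<Sum>k\<in>UNIV. q k k x) \<partial>lborel)"
    by (simp only: sumq)
  also have "\<dots> = (\<Sum>k\<in>UNIV. \<integral>x. q k k x \<partial>lborel)"
    by (rule Bochner_Integration.integral_sum) (rule I(1))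
  also have "\<dots> = 0" using I(2) by simp
  finally show ?thesis .
qed

end

section \<open>The representing holomorphic function\<close>

text \<open>The functionals below are differentiated in their parameters through a quadratic
  remainder bound, never under the integral sign.\<close>

lemma has_derivative_quadratic:
  assumes D: "bounded_linear D" and \<delta>: "\<delta> > 0"
    and q: "\<And>y. y \<in> S \<Longrightarrow> dist y x < \<delta> \<Longrightarrow> norm (f y - f x - D (y - x)) \<le> C * (norm (y - x))\<^sup>2"
  shows "(f has_derivative D) (at x within S)"
proof (rule has_derivativeI_sandwich[OF \<delta> D, where H="\<lambda>y. C * norm (y - x)"])
  fix y assume y: "y \<in> S" "y \<noteq> x" "dist y x < \<delta>"
  then have "norm (f y - f x - D (y - x)) / norm (y - x) \<le> (C * (norm (y - x))\<^sup>2) / norm (y - x)"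
    using q[of y] by (intro divide_right_mono) auto
  then show "norm (f y - f x - D (y - x)) / norm (y - x) \<le> C * norm (y - x)"
    using y by (simp add: power2_eq_square)
next
  have "((\<lambda>y. C * norm (y - x)) \<longlongrightarrow> C * norm (x - x)) (at x within S)"
    by (intro tendsto_intros)
  then show "((\<lambda>y. C * norm (y - x)) \<longlongrightarrow> 0) (at x within S)" by simp
qed

text \<open>The derivative \<open>2 * max 0 a\<close> is Lipschitz with constant 2, so the Taylor
  remainder is at most \<open>b\<^sup>2\<close> even across the kink at 0. The uniformity in
  \<open>a\<close> is what makes bumps of this shape convenient.\<close>

lemma pos_part_sq_remainder:
  fixes a b :: real
  shows "\<bar>(max 0 (a + b))\<^sup>2 - (max 0 a)\<^sup>2 - 2 * max 0 a * b\<bar> \<le> b\<^sup>2"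
proof (cases "a \<ge> 0")
  case a: True
  show ?thesis
  proof (cases "a + b \<ge> 0")
    case True then show ?thesis using a by (simp add: power2_eq_square algebra_simps max_def)
  next
    case False
    have "(- a\<^sup>2 - 2 * a * b) \<le> b\<^sup>2" using zero_le_power2[of "a + b"] by (simp add: power2_sum)
    moreover have "a\<^sup>2 + 2 * a * b \<le> b\<^sup>2"
    proof -
      have "a\<^sup>2 + 2 * a * b \<le> 0"
        using mult_nonneg_nonpos[of a "a + 2 * b"] a False by (simp add: power2_eq_square algebra_simps)
      then show ?thesis using zero_le_power2[of b] by linarith
    qed
    ultimately show ?thesis using a False by (auto simp: max_def abs_le_iff)
  qed
next
  case a: False
  show ?thesis
  proof (cases "a + b \<ge> 0")
    case True
    then have "(a + b)\<^sup>2 \<le> b\<^sup>2" using a by (intro power_mono) auto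
    then show ?thesis using a True by (simp add: max_def)
  next
    case False then show ?thesis using a by (simp add: max_def)
  qed
qed

lemma has_derivative_pos_part_sq:
  "((\<lambda>a. (max 0 a)\<^sup>2) has_derivative (\<lambda>h. 2 * max 0 a * h)) (at (a::real))"
proof (rule has_derivative_quadratic[of _ 1 _ _ _ 1])
  fix y assume "dist y a < 1"
  show "norm ((max 0 y)\<^sup>2 - (max 0 a)\<^sup>2 - 2 * max 0 a * (y - a)) \<le> 1 * (norm (y - a))\<^sup>2"
    using pos_part_sq_remainder[of a "y - a"] by simp
qed (auto intro: bounded_linear_mult_right)

lemma has_derivative_inverse_power:
  fixes s :: real
  assumes "s \<noteq> 0"
  shows "((\<lambda>s. inverse s ^ n) has_derivative (\<lambda>h. - (real n * inverse s ^ (n + 1)) * h)) (at s within S)"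
proof (cases n)
  case (Suc m)
  have "((\<lambda>s. inverse s ^ Suc m) has_field_derivative
      of_nat (Suc m) * (- (inverse s ^ Suc (Suc 0)) * inverse s ^ (Suc m - Suc 0))) (at s within S)"
    by (rule DERIV_power[OF DERIV_inverse[OF assms]])
  then show ?thesis unfolding has_field_derivative_def Suc
    by (rule has_derivative_eq_rhs) (simp add: fun_eq_iff mult_ac)
qed simp

text \<open>\<open>r\<close> is the square of the radius of the support. \<open>2 * tent\<close> is
  the derivative of \<open>bump\<close> in \<open>r\<close>; multiplied by \<open>\<xi> - y\<close>
  or its conjugate it gives, up to sign, the Wirtinger derivatives of \<open>bump\<close>, which is
  just smooth enough for a test function.\<close>

definition tent :: "real \<Rightarrow> complex ^ 'n \<Rightarrow> complex ^ 'n \<Rightarrow> complex" where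
  "tent r y \<xi> = of_real (max 0 (r - (norm (\<xi> - y))\<^sup>2))"

definition bump :: "real \<Rightarrow> complex ^ 'n \<Rightarrow> complex ^ 'n \<Rightarrow> complex" where
  "bump r y \<xi> = of_real ((max 0 (r - (norm (\<xi> - y))\<^sup>2))\<^sup>2)"

lemma tent_bump_zero:
  assumes "\<xi> \<notin> cball y (sqrt r)" "r \<ge> 0" shows "tent r y \<xi> = 0" "bump r y \<xi> = 0"
proof -
  have "sqrt r < norm (\<xi> - y)" using assms by (simp add: dist_norm norm_minus_commute)
  then have "(sqrt r)\<^sup>2 < (norm (\<xi> - y))\<^sup>2" by (intro power_strict_mono) (use assms in auto)
  then have "r < (norm (\<xi> - y))\<^sup>2" using assms by simp
  then show "tent r y \<xi> = 0" "bump r y \<xi> = 0" by (auto simp: tent_def bump_def max_def)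
qed

lemma tent_bump_cont [continuous_intros]:
  "continuous_on S (tent r y)" "continuous_on S (bump r y)"
  unfolding tent_def[abs_def] bump_def[abs_def] by (intro continuous_intros)+

lemma norm_vec_sq: "(norm v)\<^sup>2 = (\<Sum>j\<in>UNIV. (norm (v $ j))\<^sup>2)" for v :: "complex ^ 'n"
  unfolding norm_vec_def L2_set_def by (simp add: sum_nonneg)

lemma inner_vec_complex:
  "complex_of_real (2 * (v \<bullet> h)) = (\<Sum>j\<in>UNIV. cnj (v $ j) * h $ j + v $ j * cnj (h $ j))"
  for v h :: "complex ^ 'n"
  unfolding inner_vec_def sum_distrib_left of_real_sum
  by (rule sum.cong) (auto simp: inner_complex_def complex_eq_iff algebra_simps)

lemma wd_bump:
  "wd (bump r y) (\<lambda>j. - 2 * tent r y \<xi> * cnj (\<xi> $ j - y $ j)) (\<lambda>j. - 2 * tent r y \<xi> * (\<xi> $ j - y $ j)) \<xi>"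
proof -
  have 1: "((\<lambda>\<xi>. r - (norm (\<xi> - y))\<^sup>2) has_derivative (\<lambda>h. - (2 * ((\<xi> - y) \<bullet> h)))) (at \<xi>)"
    unfolding power2_norm_eq_inner by (auto intro!: derivative_eq_intros simp: inner_commute)
  have "((\<lambda>\<xi>. of_real ((max 0 (r - (norm (\<xi> - y))\<^sup>2))\<^sup>2)) has_derivative
     (\<lambda>h. complex_of_real (2 * max 0 (r - (norm (\<xi> - y))\<^sup>2) * (- (2 * ((\<xi> - y) \<bullet> h)))))) (at \<xi>)"
    by (rule bounded_linear.has_derivative[OF bounded_linear_of_real has_derivative_compose[OF 1 has_derivative_pos_part_sq]])
  moreover have "complex_of_real (2 * max 0 (r - (norm (\<xi> - y))\<^sup>2) * (- (2 * ((\<xi> - y) \<bullet> h)))) =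
     (\<Sum>j\<in>UNIV. - 2 * tent r y \<xi> * cnj (\<xi> $ j - y $ j) * h $ j + - 2 * tent r y \<xi> * (\<xi> $ j - y $ j) * cnj (h $ j))" for h
  proof -
    have "complex_of_real (2 * max 0 (r - (norm (\<xi> - y))\<^sup>2) * (- (2 * ((\<xi> - y) \<bullet> h)))) =
      - 2 * tent r y \<xi> * complex_of_real (2 * ((\<xi> - y) \<bullet> h))" by (simp add: tent_def)
    also have "\<dots> = (\<Sum>j\<in>UNIV. - 2 * tent r y \<xi> * cnj (\<xi> $ j - y $ j) * h $ j + - 2 * tent r y \<xi> * (\<xi> $ j - y $ j) * cnj (h $ j))"
      unfolding inner_vec_complex sum_distrib_left by (rule sum.cong) (auto simp: algebra_simps)
    finally show ?thesis .
  qed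
  ultimately show ?thesis unfolding wd_def bump_def[abs_def] by (simp only:)
qed

lemma wd_cnj_coord: "wd (\<lambda>\<xi>. cnj (\<xi> $ j - y $ j)) (\<lambda>l. 0) (\<lambda>l. if l = j then 1 else 0) \<xi>"
proof -
  have "cdiff (\<lambda>\<xi>. \<xi> $ j + (- y $ j)) \<xi>" by (intro cdiff_add cdiff_coord cdiff_const)
  moreover have "pd (\<lambda>\<xi>. \<xi> $ j + (- y $ j)) l \<xi> = (if l = j then 1 else 0)" for l
    by (subst pd_add[OF cdiff_coord cdiff_const]) (simp add: pd_coord pd_const)
  ultimately show ?thesis
    using wd_cnj[OF wd_cdiff, of "\<lambda>\<xi>. \<xi> $ j + (- y $ j)" \<xi>] by (simp add: if_distrib[of cnj] cong: if_cong)
qed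

section \<open>Weak Cauchy-Riemann equations and Weyl's lemma\<close>

context proper_rational
begin

definition L :: "(complex ^ 'n \<Rightarrow> complex) \<Rightarrow> (complex ^ 'n \<Rightarrow> complex) \<Rightarrow> complex" where
  "L w \<psi> = (\<integral>x. indicator X x *\<^sub>R (w x * \<psi> (\<Phi> x)) \<partial>lborel)"

definition adm :: "(complex ^ 'n) set \<Rightarrow> (complex ^ 'n \<Rightarrow> complex) \<Rightarrow> bool" where
  "adm K \<psi> \<longleftrightarrow> continuous_on UNIV \<psi> \<and> (\<forall>\<xi>. \<xi> \<notin> K \<longrightarrow> \<psi> \<xi> = 0)"

lemma adm_eq: "adm K \<psi> \<Longrightarrow> indicator X x *\<^sub>R (w x * \<psi> (\<Phi> x)) = indicator (X \<inter> \<Phi> -` K) x *\<^sub>R (w x * \<psi> (\<Phi> x))"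
  for w :: "_ \<Rightarrow> complex"
  by (auto simp: adm_def indicator_def)

lemma L_integrable:
  assumes w: "continuous_on X w" and K: "K \<subseteq> \<Omega>" "compact K" and \<psi>: "adm K \<psi>"
  shows "integrable lborel (\<lambda>x. indicator X x *\<^sub>R (w x * \<psi> (\<Phi> x)))"
proof -
  have "continuous_on X (\<lambda>x. w x * \<psi> (\<Phi> x))"
    by (intro continuous_intros w continuous_on_compose2[OF _ cont_Phi, of UNIV \<psi>])
      (use \<psi> in \<open>auto simp: adm_def\<close>)
  then show ?thesis
    unfolding adm_eq[OF \<psi>] by (intro borel_integrable_compact proper K) (auto elim: continuous_on_subset)
qed

lemma L_cmult: "L w (\<lambda>\<xi>. c * f \<xi>) = c * L w f"
proof -
  have "(\<lambda>x. indicator X x *\<^sub>R (w x * (c * f (\<Phi> x)))) = (\<lambda>x. c * (indicator X x *\<^sub>R (w x * f (\<Phi> x))))"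
    by (auto simp: indicator_def)
  then show ?thesis unfolding L_def by (simp only: integral_mult_right_zero)
qed

lemma L_diff:
  assumes "continuous_on X w" "K \<subseteq> \<Omega>" "compact K" "adm K f" "adm K g"
  shows "L w (\<lambda>\<xi>. f \<xi> - g \<xi>) = L w f - L w g"
  unfolding L_def Bochner_Integration.integral_diff[OF L_integrable[OF assms(1-4)] L_integrable[OF assms(1-3,5)], symmetric]
  by (intro Bochner_Integration.integral_cong) (auto simp: indicator_def algebra_simps)

lemma L_sum:
  assumes "continuous_on X w" "K \<subseteq> \<Omega>" "compact K" "\<And>i. i \<in> I \<Longrightarrow> adm K (f i)"
  shows "L w (\<lambda>\<xi>. \<Sum>i\<in>I. f i \<xi>) = (\<Sum>i\<in>I. L w (f i))"
proof -
  have "(\<Sum>i\<in>I. L w (f i)) = (\<integral>x. (\<Sum>i\<in>I. indicator X x *\<^sub>R (w x * f i (\<Phi> x))) \<partial>lborel)"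
    unfolding L_def
    by (rule Bochner_Integration.integral_sum[symmetric]) (rule L_integrable[OF assms(1-3) assms(4)])
  also have "\<dots> = L w (\<lambda>\<xi>. \<Sum>i\<in>I. f i \<xi>)"
    unfolding L_def by (simp only: scaleR_sum_right[symmetric] sum_distrib_left[symmetric])
  finally show ?thesis by simp
qed

text \<open>\<open>X\<close> may be unbounded and \<open>w\<close> may blow up at its boundary, but
  a test function supported in \<open>K\<close> only sees the compact preimage of \<open>K\<close>;
  \<open>C\<close> is the integral of |w| over that preimage.\<close>

lemma L_bound:
  assumes w: "continuous_on X w" and K: "K \<subseteq> \<Omega>" "compact K"
  obtains C where "C \<ge> 0" "\<And>\<psi> B. adm K \<psi> \<Longrightarrow> (\<And>\<xi>. norm (\<psi> \<xi>) \<le> B) \<Longrightarrow> norm (L w \<psi>) \<le> C * B"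
proof
  let ?K = "X \<inter> \<Phi> -` K"
  define C where "C = (\<integral>x. indicator ?K x *\<^sub>R norm (w x) \<partial>lborel)"
  have i: "integrable lborel (\<lambda>x. indicator ?K x *\<^sub>R norm (w x))"
    by (intro borel_integrable_compact proper K continuous_on_norm continuous_on_subset[OF w]) auto
  show "C \<ge> 0" unfolding C_def by (intro Bochner_Integration.integral_nonneg) (auto simp: indicator_def)
  fix \<psi> B assume \<psi>: "adm K \<psi>" and B: "\<And>\<xi>. norm (\<psi> \<xi>) \<le> B"
  have "norm (L w \<psi>) \<le> (\<integral>x. norm (indicator X x *\<^sub>R (w x * \<psi> (\<Phi> x))) \<partial>lborel)"
    unfolding L_def by (rule integral_norm_bound)
  also have "\<dots> \<le> (\<integral>x. (indicator ?K x *\<^sub>R norm (w x)) * B \<partial>lborel)"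
  proof (rule integral_mono)
    show "integrable lborel (\<lambda>x. norm (indicator X x *\<^sub>R (w x * \<psi> (\<Phi> x))))"
      by (rule integrable_norm[OF L_integrable[OF w K \<psi>]])
    show "integrable lborel (\<lambda>x. (indicator ?K x *\<^sub>R norm (w x)) * B)"
      using i by simp
    show "norm (indicator X x *\<^sub>R (w x * \<psi> (\<Phi> x))) \<le> (indicator ?K x *\<^sub>R norm (w x)) * B" for x
      unfolding adm_eq[OF \<psi>] using B[of "\<Phi> x"] by (auto simp: indicator_def norm_mult mult_left_mono)
  qed
  also have "\<dots> = C * B" unfolding C_def using i by simp
  finally show "norm (L w \<psi>) \<le> C * B" .
qed

text \<open>Weak Cauchy-Riemann equations on \<Omega> for the push-forward of \<open>w\<close> under
  \<Phi>. A test function comes with its two families of Wirtinger derivatives, all of them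
  continuous and supported in one compact set.\<close>

definition dbar_closed :: "(complex ^ 'n \<Rightarrow> complex) \<Rightarrow> bool" where
  "dbar_closed w \<longleftrightarrow> continuous_on X w \<and> (\<forall>K \<eta> \<eta>1 \<eta>2 j. K \<subseteq> \<Omega> \<longrightarrow> compact K \<longrightarrow>
     (\<forall>\<xi>. wd \<eta> (\<lambda>j. \<eta>1 j \<xi>) (\<lambda>j. \<eta>2 j \<xi>) \<xi>) \<longrightarrow> adm K \<eta> \<longrightarrow> (\<forall>j. adm K (\<eta>1 j) \<and> adm K (\<eta>2 j)) \<longrightarrow>
     L w (\<eta>2 j) = 0)"

lemma dbar_closed_jac:
  assumes "u \<in> rat_on X" shows "dbar_closed (\<lambda>x. u x * cnj (jac \<Phi> x))"
  unfolding dbar_closed_def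
proof (intro conjI allI impI)
  show "continuous_on X (\<lambda>x. u x * cnj (jac \<Phi> x))"
    by (intro continuous_intros rat_on_continuous assms jac_rat_on rat open_X)
  fix K \<eta> \<eta>1 \<eta>2 j
  assume *: "K \<subseteq> \<Omega>" "compact K" "\<forall>\<xi>. wd \<eta> (\<lambda>j. \<eta>1 j \<xi>) (\<lambda>j. \<eta>2 j \<xi>) \<xi>" "adm K \<eta>"
     "\<forall>j. adm K (\<eta>1 j) \<and> adm K (\<eta>2 j)"
  show "L (\<lambda>x. u x * cnj (jac \<Phi> x)) (\<eta>2 j) = 0"
    unfolding L_def
  proof (rule pull_back_dbar[OF assms *(1,2)])
    show "wd \<eta> (\<lambda>j. \<eta>1 j \<xi>) (\<lambda>j. \<eta>2 j \<xi>) \<xi>" for \<xi> using *(3) by blast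
  qed (use *(4,5) in \<open>auto simp: adm_def\<close>)
qed

lemma adm_bump: "r \<ge> 0 \<Longrightarrow> cball y (sqrt r) \<subseteq> K \<Longrightarrow> adm K (bump r y)"
  and adm_tent: "r \<ge> 0 \<Longrightarrow> cball y (sqrt r) \<subseteq> K \<Longrightarrow> adm K (tent r y)"
  using tent_bump_zero[of _ y r] tent_bump_cont by (auto simp: adm_def subset_iff)

lemma adm_mult: "adm K f \<Longrightarrow> continuous_on UNIV g \<Longrightarrow> adm K (\<lambda>\<xi>. f \<xi> * g \<xi>)"
  by (auto simp: adm_def intro: continuous_on_mult)

lemma adm_cmult: "adm K f \<Longrightarrow> adm K (\<lambda>\<xi>. c * f \<xi>)"
  by (auto simp: adm_def intro: continuous_intros)

lemma adm_diff: "adm K f \<Longrightarrow> adm K g \<Longrightarrow> adm K (\<lambda>\<xi>. f \<xi> - g \<xi>)"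
  by (auto simp: adm_def intro: continuous_on_diff)

lemma adm_sum: "(\<And>i. i \<in> I \<Longrightarrow> adm K (f i)) \<Longrightarrow> adm K (\<lambda>\<xi>. \<Sum>i\<in>I. f i \<xi>)"
  by (auto simp: adm_def intro: continuous_on_sum)

text \<open>Test with the bump itself. It depends on \<open>\<xi> - y\<close> only, so its conjugate
  derivative in \<open>\<xi>\<close> is minus the one in \<open>y\<close>: this is the
  Cauchy-Riemann equation for the functional as a function of the centre.\<close>

lemma dbar_closed_first:
  assumes w: "dbar_closed w" and r: "r \<ge> 0" "cball y (sqrt r) \<subseteq> \<Omega>"
  shows "L w (\<lambda>\<xi>. tent r y \<xi> * (\<xi> $ j - y $ j)) = 0"
proof -
  let ?K = "cball y (sqrt r)"
  have t: "adm ?K (\<lambda>\<xi>. - 2 * tent r y \<xi> * cnj (\<xi> $ j - y $ j))" "adm ?K (\<lambda>\<xi>. - 2 * tent r y \<xi> * (\<xi> $ j - y $ j))" for j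
    by (intro adm_mult adm_cmult adm_tent r order_refl continuous_intros)+
  have "L w (\<lambda>\<xi>. - 2 * tent r y \<xi> * (\<xi> $ j - y $ j)) = 0"
    using w[unfolded dbar_closed_def, THEN conjunct2, rule_format, OF r(2) compact_cball wd_bump adm_bump[OF r(1) order_refl] conjI[OF t]] .
  then have "L w (\<lambda>\<xi>. - 2 * (tent r y \<xi> * (\<xi> $ j - y $ j))) = 0" by (simp add: mult.assoc)
  then show ?thesis unfolding L_cmult by simp
qed

text \<open>Test with \<open>cnj (\<xi> $ j - y $ j)\<close> times the bump and sum over
  \<open>j\<close>. Because |\<xi> - y|^2 times the tent is \<open>r\<close> times the tent minus
  the bump, what remains is an Euler equation in \<open>r\<close>, with \<open>2 * tent\<close> as
  the \<open>r\<close>-derivative of the bump.\<close>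

lemma dbar_closed_second:
  assumes w: "dbar_closed w" and r: "r \<ge> 0" "cball y (sqrt r) \<subseteq> \<Omega>"
  shows "of_nat (CARD('n) + 2) * L w (bump r y) = of_real r * L w (\<lambda>\<xi>. 2 * tent r y \<xi>)"
proof -
  let ?K = "cball y (sqrt r)"
  have cw: "continuous_on X w" using w by (simp add: dbar_closed_def)
  define g1 where "g1 j l \<xi> = 0 * bump r y \<xi> + cnj (\<xi> $ j - y $ j) * (- 2 * tent r y \<xi> * cnj (\<xi> $ l - y $ l))" for j l \<xi>
  define g2 where "g2 j l \<xi> = (if l = j then 1 else 0) * bump r y \<xi> + cnj (\<xi> $ j - y $ j) * (- 2 * tent r y \<xi> * (\<xi> $ l - y $ l))" for j l \<xi>
  have wdg: "wd (\<lambda>\<xi>. cnj (\<xi> $ j - y $ j) * bump r y \<xi>) (\<lambda>l. g1 j l \<xi>) (\<lambda>l. g2 j l \<xi>) \<xi>" for j \<xi>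
    unfolding g1_def g2_def by (rule wd_mult[OF wd_cnj_coord wd_bump])
  have a: "adm ?K (g1 j l)" "adm ?K (g2 j l)" "adm ?K (\<lambda>\<xi>. cnj (\<xi> $ j - y $ j) * bump r y \<xi>)" for j l
    using tent_bump_zero[of _ y r] r unfolding adm_def g1_def[abs_def] g2_def[abs_def]
    by (auto intro!: continuous_intros)
  have z: "L w (g2 j j) = 0" for j
    using w[unfolded dbar_closed_def, THEN conjunct2, rule_format, OF r(2) compact_cball wdg a(3) conjI[OF a(1,2)]] .
  have "0 = (\<Sum>j\<in>UNIV. L w (g2 j j))" using z by simp
  also have "\<dots> = L w (\<lambda>\<xi>. \<Sum>j\<in>UNIV. g2 j j \<xi>)"
    by (rule L_sum[OF cw r(2) compact_cball a(2), symmetric])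
  also have "(\<lambda>\<xi>. \<Sum>j\<in>UNIV. g2 j j \<xi>) = (\<lambda>\<xi>. of_nat (CARD('n) + 2) * bump r y \<xi> - of_real r * (2 * tent r y \<xi>))"
  proof
    fix \<xi>
    have A: "(\<Sum>j\<in>UNIV. cnj (\<xi> $ j - y $ j) * (- 2 * tent r y \<xi> * (\<xi> $ j - y $ j))) = - 2 * tent r y \<xi> * of_real ((norm (\<xi> - y))\<^sup>2)"
      unfolding norm_vec_sq of_real_sum sum_distrib_left
      by (rule sum.cong) (simp_all only: complex_norm_square vector_minus_component mult_ac)
    have B: "tent r y \<xi> * of_real ((norm (\<xi> - y))\<^sup>2) = of_real r * tent r y \<xi> - bump r y \<xi>"
      unfolding tent_def bump_def of_real_mult[symmetric] of_real_diff[symmetric] of_real_eq_iff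
      by (auto simp: max_def power2_eq_square algebra_simps)
    have "(\<Sum>j\<in>UNIV. g2 j j \<xi>) = (\<Sum>j\<in>(UNIV :: 'n set). bump r y \<xi>) + - 2 * tent r y \<xi> * of_real ((norm (\<xi> - y))\<^sup>2)"
      unfolding A[symmetric] g2_def sum.distrib by simp
    also have "\<dots> = of_nat CARD('n) * bump r y \<xi> - 2 * (tent r y \<xi> * of_real ((norm (\<xi> - y))\<^sup>2))" by simp
    also have "\<dots> = of_nat (CARD('n) + 2) * bump r y \<xi> - of_real r * (2 * tent r y \<xi>)"
      unfolding B by (simp add: algebra_simps)
    finally show "(\<Sum>j\<in>UNIV. g2 j j \<xi>) = of_nat (CARD('n) + 2) * bump r y \<xi> - of_real r * (2 * tent r y \<xi>)" .
  qed
  also have "L w \<dots> = L w (\<lambda>\<xi>. of_nat (CARD('n) + 2) * bump r y \<xi>) - L w (\<lambda>\<xi>. of_real r * (2 * tent r y \<xi>))"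
    by (rule L_diff[OF cw r(2) compact_cball]) (intro adm_cmult adm_bump adm_tent r order_refl)+
  finally show ?thesis unfolding L_cmult by simp
qed

text \<open>The Euler equation (n + 2) v = r v' makes v / r^(n + 2) constant; this takes the place
  of the mean value property. The exponent is that of the mass of a bump: height of order r^2 over a
  ball of radius sqrt r in real dimension 2 n.\<close>

lemma bump_radial:
  assumes w: "dbar_closed w" and r0: "r0 > 0" "cball y (sqrt r0) \<subseteq> \<Omega>" and r: "0 < r" "r \<le> r0"
  shows "L w (bump r y) / of_real (r ^ (CARD('n) + 2)) = L w (bump r0 y) / of_real (r0 ^ (CARD('n) + 2))"
proof -
  let ?K = "cball y (sqrt r0)" and ?N = "CARD('n) + 2"
  have cw: "continuous_on X w" using w by (simp add: dbar_closed_def)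
  obtain C where C: "C \<ge> 0" "\<And>\<psi> B. adm ?K \<psi> \<Longrightarrow> (\<And>\<xi>. norm (\<psi> \<xi>) \<le> B) \<Longrightarrow> norm (L w \<psi>) \<le> C * B"
    using L_bound[OF cw r0(2) compact_cball] by blast
  have ad: "adm ?K (bump s y)" "adm ?K (\<lambda>\<xi>. 2 * tent s y \<xi>)" if "0 < s" "s \<le> r0" for s
    using that by (auto intro!: adm_bump adm_cmult adm_tent subset_cball simp del: cball_subset_cball_iff)
  define v where "v s = L w (bump s y)" for s
  define v' where "v' s = L w (\<lambda>\<xi>. 2 * tent s y \<xi>)" for s
  \<comment> \<open>The pointwise remainder is at most \<open>(t - s)\<^sup>2\<close>, and the
    functional multiplies it by at most \<open>C\<close>.\<close>
  have dv: "(v has_derivative (\<lambda>h. of_real h * v' s)) (at s within {0<..r0})" if s: "0 < s" "s \<le> r0" for s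
  proof (rule has_derivative_quadratic[of _ 1 _ _ _ C])
    show "bounded_linear (\<lambda>h. complex_of_real h * v' s)"
      by (rule bounded_linear_mult_const[OF bounded_linear_of_real])
    fix t assume t: "t \<in> {0<..r0}"
    let ?\<psi> = "\<lambda>\<xi>. bump t y \<xi> - bump s y \<xi> - of_real (t - s) * (2 * tent s y \<xi>)"
    have eq: "v t - v s - of_real (t - s) * v' s = L w ?\<psi>"
      unfolding v_def v'_def using t s
      by (simp add: L_diff[OF cw r0(2) compact_cball] ad adm_diff adm_cmult L_cmult)
    have "norm (?\<psi> \<xi>) \<le> (t - s)\<^sup>2" for \<xi>
    proof -
      have "?\<psi> \<xi> = of_real ((max 0 (s - (norm (\<xi> - y))\<^sup>2 + (t - s)))\<^sup>2 - (max 0 (s - (norm (\<xi> - y))\<^sup>2))\<^sup>2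
          - 2 * max 0 (s - (norm (\<xi> - y))\<^sup>2) * (t - s))"
        by (simp add: bump_def tent_def)
      then show ?thesis using pos_part_sq_remainder[of "s - (norm (\<xi> - y))\<^sup>2" "t - s"] by (simp only: norm_of_real)
    qed
    moreover have "adm ?K ?\<psi>" using t s by (intro adm_diff adm_cmult ad) auto
    ultimately show "norm (v t - v s - of_real (t - s) * v' s) \<le> C * (norm (t - s))\<^sup>2"
      unfolding eq using C(2)[of ?\<psi> "(t - s)\<^sup>2"] by simp
  qed auto
  have ode: "of_nat ?N * v s = of_real s * v' s" if "0 < s" "s \<le> r0" for s
    unfolding v_def v'_def
    by (rule dbar_closed_second[OF w _ subset_trans[OF subset_cball r0(2)]]) (use that in auto)
  have "\<exists>c. \<forall>s\<in>{0<..r0}. of_real (inverse s ^ ?N) * v s = c"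
  proof (rule has_derivative_zero_constant)
    fix s assume s: "s \<in> {0<..r0}"
    have d1: "((\<lambda>s. inverse s ^ ?N) has_derivative (\<lambda>h. - (real ?N * inverse s ^ (?N + 1)) * h)) (at s within {0<..r0})"
      by (rule has_derivative_inverse_power) (use s in auto)
    have "((\<lambda>s. of_real (inverse s ^ ?N) * v s) has_derivative
       (\<lambda>h. of_real (inverse s ^ ?N) * (of_real h * v' s) + of_real (- (real ?N * inverse s ^ (?N + 1)) * h) * v s)) (at s within {0<..r0})"
      by (rule has_derivative_mult[OF bounded_linear.has_derivative[OF bounded_linear_of_real d1] dv]) (use s in auto)
    moreover have "of_real (inverse s ^ ?N) * (of_real h * v' s) + of_real (- (real ?N * inverse s ^ (?N + 1)) * h) * v s = 0" for h
    proof -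
      have "of_real (- (real ?N * inverse s ^ (?N + 1)) * h) * v s = - of_real (h * inverse s ^ (?N + 1)) * (of_nat ?N * v s)"
        by (simp add: algebra_simps)
      also have "\<dots> = - of_real (h * inverse s ^ (?N + 1)) * (of_real s * v' s)" using ode s by simp
      also have "\<dots> = - of_real (h * (inverse s ^ ?N)) * v' s" using s by (simp add: field_simps)
      finally show ?thesis by (simp add: algebra_simps)
    qed
    ultimately show "((\<lambda>s. of_real (inverse s ^ ?N) * v s) has_derivative (\<lambda>h. 0)) (at s within {0<..r0})"
      by (simp only:)
  qed auto
  then have "of_real (inverse r ^ ?N) * v r = of_real (inverse r0 ^ ?N) * v r0" using r r0 by auto
  then show ?thesis unfolding v_def by (simp add: divide_inverse power_inverse mult.commute)
qed

text \<open>Weyl's lemma for the Cauchy-Riemann system. As the normalised value on a bump does not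
  depend on the radius, one radius can be kept near a given point while the centre moves.
  Differentiation in the centre falls on the bump, and \<open>dbar_closed_first\<close> removes the
  conjugate part.\<close>

theorem dbar_closed_representation:
  assumes w: "dbar_closed w"
  obtains F where "holo_on \<Omega> F"
    "\<And>y r. r > 0 \<Longrightarrow> cball y (sqrt r) \<subseteq> \<Omega> \<Longrightarrow> L w (bump r y) = of_real (r ^ (CARD('n) + 2)) * F y"
proof -
  let ?N = "CARD('n) + 2"
  have cw: "continuous_on X w" using w by (simp add: dbar_closed_def)
  define \<rho> where "\<rho> y = (SOME r. r > 0 \<and> cball y (sqrt r) \<subseteq> \<Omega>)" for y
  define F where "F y = L w (bump (\<rho> y) y) / of_real (\<rho> y ^ ?N)" for y
  have Feq: "L w (bump r y) / of_real (r ^ ?N) = F y" if r: "r > 0" "cball y (sqrt r) \<subseteq> \<Omega>" for y r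
  proof -
    have "\<rho> y > 0 \<and> cball y (sqrt (\<rho> y)) \<subseteq> \<Omega>" unfolding \<rho>_def by (rule someI[of _ r]) (use r in simp)
    then show ?thesis unfolding F_def
      using bump_radial[OF w, of r y "\<rho> y"] bump_radial[OF w, of "\<rho> y" y r] r by (cases "r \<le> \<rho> y") auto
  qed
  have "cdiff F y0" if y0: "y0 \<in> \<Omega>" for y0
  proof -
    obtain e where e: "e > 0" "cball y0 e \<subseteq> \<Omega>" using open_Omega y0 open_contains_cball by blast
    \<comment> \<open>Half of \<open>e\<close>, so that bumps of radius \<open>R\<close> with
      centres within \<open>R\<close> of \<open>y0\<close> all live in
      \<open>cball y0 (2 * R)\<close>.\<close>
    define R where "R = e / 2"
    have R: "R > 0" "cball y0 (2 * R) \<subseteq> \<Omega>" using e by (auto simp: R_def)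
    define r where "r = R\<^sup>2"
    have r: "r > 0" "sqrt r = R" using R by (auto simp: r_def)
    let ?K = "cball y0 (2 * R)"
    have sub: "cball y R \<subseteq> ?K" if "dist y y0 \<le> R" for y
    proof
      fix x assume "x \<in> cball y R"
      then show "x \<in> ?K" using that dist_triangle[of y0 x y] by (simp add: dist_commute)
    qed
    obtain C where C: "C \<ge> 0" "\<And>\<psi> B. adm ?K \<psi> \<Longrightarrow> (\<And>\<xi>. norm (\<psi> \<xi>) \<le> B) \<Longrightarrow> norm (L w \<psi>) \<le> C * B"
      using L_bound[OF cw R(2) compact_cball] by blast
    define c where "c j = L w (\<lambda>\<xi>. 2 * (tent r y0 \<xi> * cnj (\<xi> $ j - y0 $ j)))" for j
    have Fr: "F y = L w (bump r y) / of_real (r ^ ?N)" if "dist y y0 < R" for y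
      by (rule Feq[symmetric]) (use that r sub[of y] R in auto)
    have ab: "adm ?K (bump r y)" if "dist y y0 \<le> R" for y
      by (rule adm_bump) (use that r sub[of y] in auto)
    have at: "adm ?K (\<lambda>\<xi>. 2 * (tent r y0 \<xi> * cnj (\<xi> $ j - y0 $ j)))"
      "adm ?K (\<lambda>\<xi>. 2 * (tent r y0 \<xi> * (\<xi> $ j - y0 $ j)))" for j
      by (intro adm_cmult adm_mult adm_tent continuous_intros; use r sub[of y0] R in auto)+
    have "((\<lambda>y. L w (bump r y)) has_derivative (\<lambda>h. \<Sum>j\<in>UNIV. c j * h $ j)) (at y0)"
    \<comment> \<open>27 = 25 + 2. On \<open>cball y0 (2 * R)\<close> the increment \<open>b\<close>
      of the argument of the positive part satisfies
      \<open>\<bar>b\<bar> \<le> 5 * R * norm h\<close>, and \<open>R\<^sup>2 = r\<close>; the part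
      of \<open>b\<close> that is quadratic in \<open>h\<close>, multiplied by
      \<open>2 * max 0 a\<close>, contributes the 2.\<close>
    proof (rule has_derivative_quadratic[of _ R _ _ _ "C * (27 * r)"])
      show "bounded_linear (\<lambda>h. \<Sum>j\<in>UNIV. c j * h $ j)"
        by (intro bounded_linear_sum bounded_linear_const_mult bounded_linear_vec_nth)
      fix y assume "dist y y0 < R"
      define h where "h = y - y0"
      have h: "norm h < R" "y = y0 + h" using \<open>dist y y0 < R\<close> by (auto simp: h_def dist_norm)
      define \<psi> where "\<psi> \<xi> = (bump r y \<xi> - bump r y0 \<xi>
         - (\<Sum>j\<in>UNIV. h $ j * (2 * (tent r y0 \<xi> * cnj (\<xi> $ j - y0 $ j)))))
         - (\<Sum>j\<in>UNIV. cnj (h $ j) * (2 * (tent r y0 \<xi> * (\<xi> $ j - y0 $ j))))" for \<xi>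
      have s1: "adm ?K (\<lambda>\<xi>. \<Sum>j\<in>UNIV. h $ j * (2 * (tent r y0 \<xi> * cnj (\<xi> $ j - y0 $ j))))"
        and s2: "adm ?K (\<lambda>\<xi>. \<Sum>j\<in>UNIV. cnj (h $ j) * (2 * (tent r y0 \<xi> * (\<xi> $ j - y0 $ j))))"
        by (intro adm_sum adm_cmult[OF at(1)] adm_cmult[OF at(2)])+
      have b1: "adm ?K (bump r y)" "adm ?K (bump r y0)" using ab[of y] ab[of y0] h R by (auto simp: dist_norm)
      have adm\<psi>: "adm ?K \<psi>" unfolding \<psi>_def[abs_def] by (intro adm_diff s1 s2 b1)
      have "L w \<psi> = L w (bump r y) - L w (bump r y0) - (\<Sum>j\<in>UNIV. h $ j * c j)
          - (\<Sum>j\<in>UNIV. cnj (h $ j) * L w (\<lambda>\<xi>. 2 * (tent r y0 \<xi> * (\<xi> $ j - y0 $ j))))"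
        unfolding \<psi>_def[abs_def] c_def
        by (simp only: L_diff[OF cw R(2) compact_cball] adm_diff s1 s2 b1 L_sum[OF cw R(2) compact_cball] adm_cmult[OF at(1)]
           adm_cmult[OF at(2)] L_cmult)
      also have "\<dots> = L w (bump r y) - L w (bump r y0) - (\<Sum>j\<in>UNIV. c j * h $ j)"
        unfolding L_cmult[of w 2]
        using dbar_closed_first[OF w, of r y0] r sub[of y0] R by (simp add: mult.commute)
      finally have L\<psi>: "L w \<psi> = L w (bump r y) - L w (bump r y0) - (\<Sum>j\<in>UNIV. c j * h $ j)" .
      have "norm (\<psi> \<xi>) \<le> 27 * r * (norm h)\<^sup>2" for \<xi>
      proof (cases "\<xi> \<in> ?K")
        case False
        then show ?thesis using adm\<psi> r by (simp add: adm_def)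
      next
        case True
        define a where "a = r - (norm (\<xi> - y0))\<^sup>2"
        define b where "b = 2 * ((\<xi> - y0) \<bullet> h) - (norm h)\<^sup>2"
        have ab: "r - (norm (\<xi> - y))\<^sup>2 = a + b"
        proof -
          have "(norm (u - h))\<^sup>2 = (norm u)\<^sup>2 - 2 * (u \<bullet> h) + (norm h)\<^sup>2" for u :: "complex ^ 'n"
            unfolding power2_norm_eq_inner by (simp add: inner_diff_left inner_diff_right inner_commute)
          from this[of "\<xi> - y0"] show ?thesis unfolding a_def b_def h(2) by (simp add: diff_diff_eq)
        qed
        have "(\<Sum>j\<in>UNIV. h $ j * (2 * (tent r y0 \<xi> * cnj (\<xi> $ j - y0 $ j))))
           + (\<Sum>j\<in>UNIV. cnj (h $ j) * (2 * (tent r y0 \<xi> * (\<xi> $ j - y0 $ j)))) =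
           2 * tent r y0 \<xi> * complex_of_real (2 * ((\<xi> - y0) \<bullet> h))"
          unfolding inner_vec_complex sum_distrib_left sum.distrib[symmetric]
          by (rule sum.cong) (auto simp: algebra_simps)
        then have "\<psi> \<xi> = bump r y \<xi> - bump r y0 \<xi> - 2 * tent r y0 \<xi> * complex_of_real (2 * ((\<xi> - y0) \<bullet> h))"
          unfolding \<psi>_def by (simp add: algebra_simps)
        also have "\<dots> = of_real ((max 0 (a + b))\<^sup>2 - (max 0 a)\<^sup>2 - 2 * max 0 a * b - 2 * max 0 a * (norm h)\<^sup>2)"
          unfolding bump_def tent_def ab a_def[symmetric] b_def by (simp add: algebra_simps)
        finally have "norm (\<psi> \<xi>) = \<bar>((max 0 (a + b))\<^sup>2 - (max 0 a)\<^sup>2 - 2 * max 0 a * b) - 2 * max 0 a * (norm h)\<^sup>2\<bar>"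
          by (simp only: norm_of_real)
        also have "\<dots> \<le> b\<^sup>2 + 2 * r * (norm h)\<^sup>2"
        proof -
          have "0 \<le> max 0 a" "max 0 a \<le> r" using r by (auto simp: a_def)
          then have "0 \<le> 2 * max 0 a * (norm h)\<^sup>2" "2 * max 0 a * (norm h)\<^sup>2 \<le> 2 * r * (norm h)\<^sup>2"
            by (auto intro!: mult_right_mono mult_nonneg_nonneg)
          then show ?thesis using pos_part_sq_remainder[of a b] by linarith
        qed
        also have "b\<^sup>2 \<le> (5 * R * norm h)\<^sup>2"
        proof -
          have "\<bar>(\<xi> - y0) \<bullet> h\<bar> \<le> norm (\<xi> - y0) * norm h" by (rule Cauchy_Schwarz_ineq2)
          also have "\<dots> \<le> (2 * R) * norm h"
            using True by (intro mult_right_mono) (auto simp: dist_norm norm_minus_commute)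
          finally have 1: "\<bar>(\<xi> - y0) \<bullet> h\<bar> \<le> 2 * R * norm h" .
          have 2: "(norm h)\<^sup>2 \<le> R * norm h" using h by (auto simp: power2_eq_square intro: mult_right_mono)
          have "\<bar>b\<bar> \<le> 5 * R * norm h" unfolding b_def using 1 2 zero_le_power2[of "norm h"] by linarith
          then show ?thesis by (metis abs_ge_zero power2_abs power_mono)
        qed
        also have "(5 * R * norm h)\<^sup>2 + 2 * r * (norm h)\<^sup>2 = 27 * r * (norm h)\<^sup>2"
          by (simp add: r_def power_mult_distrib)
        finally show ?thesis by simp
      qed
      from C(2)[OF adm\<psi> this]
      show "norm (L w (bump r y) - L w (bump r y0) - (\<Sum>j\<in>UNIV. c j * (y - y0) $ j)) \<le> C * (27 * r) * (norm (y - y0))\<^sup>2"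
        unfolding L\<psi> h_def by (simp add: mult_ac)
    qed (use R in auto)
    then have "((\<lambda>y. L w (bump r y) / of_real (r ^ ?N)) has_derivative (\<lambda>h. \<Sum>j\<in>UNIV. (c j / of_real (r ^ ?N)) * h $ j)) (at y0)"
      using r(1) by (auto intro!: derivative_eq_intros simp: sum_divide_distrib)
    then have "cdiff (\<lambda>y. L w (bump r y) / of_real (r ^ ?N)) y0" by (rule cdiffI)
    then show "cdiff F y0"
      by (rule cdiff_cong(1)[OF open_ball[of y0 R], rotated -1]) (use R Fr in \<open>auto simp: dist_commute\<close>)
  qed
  then have "holo_on \<Omega> F" by (simp add: holo_on_iff_cdiff)
  moreover have "L w (bump r y) = of_real (r ^ ?N) * F y" if "r > 0" "cball y (sqrt r) \<subseteq> \<Omega>" for y r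
    using Feq[OF that] that by (simp add: field_simps)
  ultimately show ?thesis using that by blast
qed

end

text \<open>The derivative is complex linear, yet its imaginary part vanishes in all directions;
  \<open>axis i 1\<close> and \<open>axis i \<i>\<close> then kill both parts of each
  coefficient.\<close>

lemma holo_real_constant:
  assumes F: "holo_on \<Omega> F" and \<Omega>: "open \<Omega>" "connected \<Omega>" and re: "\<And>z. z \<in> \<Omega> \<Longrightarrow> Im (F z) = 0"
    and z: "z \<in> \<Omega>" "z' \<in> \<Omega>"
  shows "F z = F z'"
proof (rule has_derivative_zero_unique_connected[OF \<Omega> _ z])
  fix x assume x: "x \<in> \<Omega>"
  have cd: "(F has_derivative (\<lambda>h. \<Sum>i\<in>UNIV. pd F i x * h $ i)) (at x)"
    using F x by (simp add: holo_on_iff_cdiff cdiffD)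
  have "((\<lambda>x. Im (F x)) has_derivative (\<lambda>h. Im (\<Sum>i\<in>UNIV. pd F i x * h $ i))) (at x)"
    by (rule bounded_linear.has_derivative[OF bounded_linear_Im cd])
  moreover have "((\<lambda>x. Im (F x)) has_derivative (\<lambda>h. 0)) (at x)"
    by (rule has_derivative_transform_within_open[OF has_derivative_const[of 0] \<Omega>(1) x]) (use re in auto)
  ultimately have 0: "Im (\<Sum>i\<in>UNIV. pd F i x * h $ i) = 0" for h
    using has_derivative_unique by metis
  have "pd F i x = 0" for i
    using 0[of "axis i 1"] 0[of "axis i \<i>"] unfolding sum_axis_mult by (simp add: complex_eq_iff)
  then show "(F has_derivative (\<lambda>h. 0)) (at x)" using cd by simp
qed

section \<open>Mass of a bump, and passage to arbitrary test functions\<close>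

lemma jac_id: "jac (\<lambda>z. z) z = 1" for z :: "complex ^ 'n"
proof -
  have "(\<chi> i k. pd (\<lambda>z. z $ i) k z) = (mat 1 :: complex ^ 'n ^ 'n)"
    by (auto simp: vec_eq_iff mat_def pd_coord)
  then show ?thesis unfolding jac_def by (simp only: det_I)
qed

lemma lborel_integral_shift:
  fixes f :: "'a::euclidean_space \<Rightarrow> 'b::{banach, second_countable_topology}"
  assumes "f \<in> borel_measurable borel"
  shows "(\<integral>x. f (a + x) \<partial>lborel) = (\<integral>x. f x \<partial>lborel)"
proof -
  have "(\<integral>x. f x \<partial>distr lborel borel ((+) a)) = (\<integral>x. f (a + x) \<partial>lborel)"
    by (rule integral_distr) (use assms in auto)
  then show ?thesis by (simp add: lborel_distr_plus)
qed

lemma bump_sym: "bump r y \<xi> = bump r \<xi> y"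
  by (simp add: bump_def norm_minus_commute)

lemma bump_nonneg: "bump r y \<xi> = of_real (norm (bump r y \<xi>))"
  unfolding bump_def norm_of_real by simp

lemma bump_measurable [measurable]: "bump r y \<in> borel_measurable borel"
  by (rule borel_measurable_continuous_onI) (rule tent_bump_cont)

lemma bump_integrable: "r \<ge> 0 \<Longrightarrow> integrable lborel (bump r y)"
proof -
  assume r: "r \<ge> 0"
  have "integrable lborel (\<lambda>\<xi>. indicator (cball y (sqrt r)) \<xi> *\<^sub>R bump r y \<xi>)"
    by (rule borel_integrable_compact) (auto intro: tent_bump_cont)
  also have "(\<lambda>\<xi>. indicator (cball y (sqrt r)) \<xi> *\<^sub>R bump r y \<xi>) = bump r y"
    using tent_bump_zero(2)[OF _ r] by (fastforce simp: indicator_def)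
  finally show ?thesis .
qed

text \<open>The identity map with \<open>w = 1\<close> is an instance of the theory above, which
  yields the power of \<open>r\<close> without polar coordinates. Of \<open>c\<close> only the
  positivity is kept.\<close>

lemma integral_bump:
  obtains c where "c > 0"
    "\<And>r (y :: complex ^ 'n). r > 0 \<Longrightarrow> (\<integral>\<xi>. bump r y \<xi> \<partial>lborel) = of_real (c * r ^ (CARD('n) + 2))"
proof -
  interpret I: proper_rational UNIV UNIV "\<lambda>z :: complex ^ 'n. z"
    by standard (auto intro: rat_on_coord)
  have "I.dbar_closed (\<lambda>x. (\<lambda>_. 1) x * cnj (jac (\<lambda>z. z) x))"
    by (rule I.dbar_closed_jac) (rule rat_on_const)
  then have "I.dbar_closed (\<lambda>x. 1)" by (simp add: jac_id)
  then obtain F where F: "\<And>y r. r > 0 \<Longrightarrow> cball y (sqrt r) \<subseteq> UNIV \<Longrightarrow> I.L (\<lambda>x. 1) (bump r y) = of_real (r ^ (CARD('n) + 2)) * F y"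
    by (rule I.dbar_closed_representation) (rule that, blast)
  have F': "(\<integral>\<xi>. bump r (0::complex^'n) \<xi> \<partial>lborel) = of_real (r ^ (CARD('n) + 2)) * F 0" if "r > 0" for r
    using F[OF that, of 0] by (simp add: I.L_def)
  define c where "c = (\<integral>\<xi>. norm (bump 1 (0::complex^'n) \<xi>) \<partial>lborel)"
  have "(\<integral>\<xi>. bump 1 (0::complex^'n) \<xi> \<partial>lborel) = of_real c"
    unfolding c_def integral_complex_of_real[symmetric] by (simp add: bump_nonneg[symmetric])
  then have F0: "F 0 = of_real c" using F'[of 1] by simp
  \<comment> \<open>On the ball of radius 1/2 the bump is at least (1 - 1/4)^2 = 9/16.\<close>
  have "0 < (9/16) * measure lborel (ball (0::complex^'n) (1/2))" using content_ball_pos[of "1/2" "0::complex^'n"] by simp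
  also have "\<dots> = (\<integral>\<xi>. (9/16) * indicator (ball (0::complex^'n) (1/2)) \<xi> \<partial>lborel)" by simp
  also have "\<dots> \<le> c" unfolding c_def
  proof (rule integral_mono)
    show "integrable lborel (\<lambda>\<xi>::complex^'n. (9/16) * indicator (ball 0 (1/2)) \<xi> :: real)"
      by (intro integrable_mult_right integrable_real_indicator) (use emeasure_bounded_finite[OF bounded_ball] in auto)
    show "integrable lborel (\<lambda>\<xi>::complex^'n. norm (bump 1 0 \<xi>))" by (intro integrable_norm bump_integrable) simp
    fix \<xi> :: "complex^'n"
    show "9 / 16 * indicator (ball 0 (1/2)) \<xi> \<le> norm (bump 1 0 \<xi>)"
    proof (cases "\<xi> \<in> ball 0 (1/2)")
      case True
      then have "(norm \<xi>)\<^sup>2 \<le> (1/2)\<^sup>2" by (intro power_mono) auto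
      then have n4: "(norm \<xi>)\<^sup>2 \<le> 1/4" by (simp add: power_divide)
      then have "3/4 \<le> max 0 (1 - (norm \<xi>)\<^sup>2)" by simp
      then have "(3/4)\<^sup>2 \<le> (max 0 (1 - (norm \<xi>)\<^sup>2))\<^sup>2" by (rule power_mono) simp
      then have "9/16 \<le> \<bar>(max 0 (1 - (norm \<xi>)\<^sup>2))\<^sup>2\<bar>" by (simp only: power_divide abs_power2) simp
      then show ?thesis using True unfolding bump_def norm_of_real diff_zero indicator_simps(1)[OF True] by simp
    qed simp
  qed
  finally have c: "c > 0" .
  show ?thesis
  proof (rule that[OF c])
    fix r :: real and y :: "complex ^ 'n" assume r: "r > 0"
    have "(\<integral>\<xi>. bump r y \<xi> \<partial>lborel) = (\<integral>\<xi>. bump r y (y + \<xi>) \<partial>lborel)"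
      by (rule lborel_integral_shift[symmetric]) simp
    also have "\<dots> = (\<integral>\<xi>. bump r (0 :: complex ^ 'n) \<xi> \<partial>lborel)" by (simp add: bump_def)
    finally show "(\<integral>\<xi>. bump r y \<xi> \<partial>lborel) = of_real (c * r ^ (CARD('n) + 2))"
      using F'[OF r] F0 by (simp add: mult.commute)
  qed
qed

lemma compact_nbhd:
  fixes K :: "'a::euclidean_space set"
  assumes "compact K" "open \<Omega>" "K \<subseteq> \<Omega>"
  obtains e K1 where "e > 0" "compact K1" "K1 \<subseteq> \<Omega>" "\<And>x y. x \<in> K \<Longrightarrow> dist x y \<le> e \<Longrightarrow> y \<in> K1"
proof (cases "K = {}")
  case True then show ?thesis using that[of 1 "{}"] by auto
next
  case False
  obtain e where e: "e > 0" "{x. infdist x K \<le> e} \<subseteq> \<Omega>"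
    using compact_in_open_separated[OF False assms] by blast
  show ?thesis
  proof (rule that[OF e(1) _ e(2)])
    show "compact {x. infdist x K \<le> e}" by (rule compact_infdist_le[OF False assms(1) e(1)])
    fix x y assume "x \<in> K" "dist x y \<le> e"
    then show "y \<in> {x. infdist x K \<le> e}" using infdist_le[of x K y] by (simp add: dist_commute)
  qed
qed

context proper_rational
begin

text \<open>Mollification. By Fubini, \<open>L\<close> of the convolution of \<open>\<psi>\<close>
  with a bump is the integral of \<open>\<psi>\<close> against the known values of \<open>L\<close>
  on bumps, and the convolution divided by the mass of the bump is uniformly close to
  \<open>\<psi>\<close> for small radii.\<close>

lemma L_eq_integral:
  assumes w: "continuous_on X w" and F: "continuous_on \<Omega> F"
    and rep: "\<And>y r. r > 0 \<Longrightarrow> cball y (sqrt r) \<subseteq> \<Omega> \<Longrightarrow> L w (bump r y) = of_real (r ^ (CARD('n) + 2)) * F y"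
    and c: "c > 0" "\<And>r (y :: complex ^ 'n). r > 0 \<Longrightarrow> (\<integral>\<xi>. bump r y \<xi> \<partial>lborel) = of_real (c * r ^ (CARD('n) + 2))"
    and K: "K \<subseteq> \<Omega>" "compact K" and \<psi>: "adm K \<psi>"
  shows "of_real c * L w \<psi> = (\<integral>y. indicator \<Omega> y *\<^sub>R (F y * \<psi> y) \<partial>lborel)"
proof -
  let ?N = "CARD('n) + 2"
  obtain e K1 where e: "e > 0" "compact K1" "K1 \<subseteq> \<Omega>" "\<And>x y. x \<in> K \<Longrightarrow> dist x y \<le> e \<Longrightarrow> y \<in> K1"
    using compact_nbhd[OF K(2) open_Omega K(1)] by metis
  have KK1: "K \<subseteq> K1" using e(1,4) by (metis dist_self less_imp_le subsetI)
  define K' where "K' = X \<inter> \<Phi> -` K1"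
  have K': "compact K'" "K' \<subseteq> X" unfolding K'_def using proper[OF e(3,2)] by auto
  \<comment> \<open>Bumps of radius at most \<open>e\<close> centred in \<open>K\<close> vanish
    outside \<open>K1\<close>, so \<open>w\<close> may be cut off to the compact preimage of
    \<open>K1\<close>. This makes \<open>W\<close> integrable on the whole space, as Fubini
    requires.\<close>
  define W where "W x = indicator K' x *\<^sub>R w x" for x
  define \<Phi>' where "\<Phi>' x = indicator X x *\<^sub>R \<Phi> x" for x
  have iW: "integrable lborel W"
    unfolding W_def by (intro borel_integrable_compact K' continuous_on_subset[OF w])
  have Wm [measurable]: "W \<in> borel_measurable borel" using borel_measurable_integrable[OF iW] by simp
  have \<Phi>'m [measurable]: "\<Phi>' \<in> borel_measurable borel"
    unfolding \<Phi>'_def by (intro borel_measurable_continuous_on_indicator cont_Phi borel_open open_X)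
  have \<psi>c: "continuous_on UNIV \<psi>" and \<psi>0: "\<And>\<xi>. \<xi> \<notin> K \<Longrightarrow> \<psi> \<xi> = 0" using \<psi> by (auto simp: adm_def)
  have \<psi>m [measurable]: "\<psi> \<in> borel_measurable borel" using \<psi>c by (rule borel_measurable_continuous_onI)
  have i\<psi>: "integrable lborel \<psi>"
  proof -
    have "integrable lborel (\<lambda>x. indicator K x *\<^sub>R \<psi> x)"
      by (intro borel_integrable_compact K continuous_on_subset[OF \<psi>c]) auto
    also have "(\<lambda>x. indicator K x *\<^sub>R \<psi> x) = \<psi>" using \<psi>0 by (auto simp: indicator_def)
    finally show ?thesis .
  qed
  have WX: "indicator X x *\<^sub>R (w x * g (\<Phi> x)) = W x * g (\<Phi>' x)" if "\<And>\<xi>. \<xi> \<notin> K1 \<Longrightarrow> g \<xi> = 0" for g x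
    using that by (auto simp: W_def \<Phi>'_def K'_def indicator_def)
  have Lg: "L w g = (\<integral>x. W x * g (\<Phi>' x) \<partial>lborel)" if "\<And>\<xi>. \<xi> \<notin> K1 \<Longrightarrow> g \<xi> = 0" for g
    unfolding L_def by (intro Bochner_Integration.integral_cong refl WX that)
  define I where "I = (\<integral>y. indicator \<Omega> y *\<^sub>R (F y * \<psi> y) \<partial>lborel)"
  \<comment> \<open>\<open>\<omega>\<close> bounds the oscillation of \<open>\<psi>\<close> over the
    radius of the bump; the other factor of the error does not depend on that radius.\<close>
  have key: "norm (I - of_real c * L w \<psi>) \<le> \<omega> * (c * (\<integral>x. norm (W x) \<partial>lborel))" if \<omega>: "\<omega> > 0" for \<omega>
  proof -
    have "uniformly_continuous_on K1 \<psi>"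
      by (intro compact_uniformly_continuous continuous_on_subset[OF \<psi>c] e) auto
    then obtain d where d: "d > 0" "\<And>x y. x \<in> K1 \<Longrightarrow> y \<in> K1 \<Longrightarrow> dist y x < d \<Longrightarrow> dist (\<psi> y) (\<psi> x) < \<omega>"
      unfolding uniformly_continuous_on_def using \<omega> by metis
    define s where "s = min e (d / 2)"
    define r where "r = s\<^sup>2"
    have s: "s > 0" "s \<le> e" "s < d" using e(1) d(1) by (auto simp: s_def)
    have r: "r > 0" "sqrt r = s" using s by (auto simp: r_def)
    have osc: "norm (\<psi> y - \<psi> \<xi>) \<le> \<omega>" if "dist \<xi> y \<le> s" for \<xi> y
    proof (cases "\<xi> \<in> K \<or> y \<in> K")
      case True
      then have "\<xi> \<in> K1" "y \<in> K1"
        using e(4)[of \<xi> y] e(4)[of y \<xi>] that s KK1 by (auto simp: dist_commute)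
      then show ?thesis using d(2)[of \<xi> y] that s by (simp add: dist_norm norm_minus_commute less_imp_le)
    qed (use \<psi>0 \<omega> in auto)
    have b0: "bump r y \<xi> = 0" if "dist y \<xi> > s" for y \<xi> :: "complex ^ 'n"
      using tent_bump_zero(2)[of \<xi> y r] that r by auto
    define A where "A \<xi> = (\<integral>y. \<psi> y * bump r y \<xi> \<partial>lborel)" for \<xi>
    have A0: "A \<xi> = 0" if "\<xi> \<notin> K1" for \<xi>
    proof -
      have "\<psi> y * bump r y \<xi> = 0" for y
        using that e(4)[of y \<xi>] \<psi>0[of y] b0[of y \<xi>] s by (cases "dist y \<xi> > s") auto
      then show ?thesis unfolding A_def by (simp only: Bochner_Integration.integral_zero)
    qed
    have bumpm [measurable]: "(\<lambda>z. bump r (f z) (g z)) \<in> borel_measurable M"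
      if [measurable]: "f \<in> borel_measurable M" "g \<in> borel_measurable M" for f g :: "_ \<Rightarrow> complex ^ 'n" and M
      unfolding bump_def by measurable
    have bump_le: "norm (bump r y \<xi>) \<le> r\<^sup>2" for y \<xi> :: "complex ^ 'n"
    proof -
      have "(max 0 (r - (norm (\<xi> - y))\<^sup>2))\<^sup>2 \<le> r\<^sup>2" using r by (intro power_mono) auto
      then show ?thesis unfolding bump_def norm_of_real by simp
    qed
    have i\<psi>b: "integrable lborel (\<lambda>y. \<psi> y * bump r y \<xi>)" for \<xi>
    proof (rule Bochner_Integration.integrable_bound[of _ "\<lambda>y. \<psi> y * of_real (r\<^sup>2)"])
      show "integrable lborel (\<lambda>y. \<psi> y * of_real (r\<^sup>2))" using i\<psi> by simp
      show "AE y in lborel. norm (\<psi> y * bump r y \<xi>) \<le> norm (\<psi> y * of_real (r\<^sup>2))"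
        unfolding norm_mult using bump_le r by (intro AE_I2 mult_left_mono) (auto simp: norm_power)
    qed measurable
    have Am: "A \<in> borel_measurable borel" unfolding A_def by measurable
    have Adiff: "norm (A \<xi> - of_real (c * r ^ ?N) * \<psi> \<xi>) \<le> \<omega> * (c * r ^ ?N)" for \<xi>
    proof -
      have ib: "integrable lborel (\<lambda>y. bump r y \<xi>)" "(\<integral>y. bump r y \<xi> \<partial>lborel) = of_real (c * r ^ ?N)"
        unfolding bump_sym[of r _ \<xi>] using bump_integrable[of r \<xi>] c(2)[OF r(1)] r by auto
      have nb: "(\<integral>y. norm (bump r y \<xi>) \<partial>lborel) = c * r ^ ?N"
      proof -
        have "complex_of_real (\<integral>y. norm (bump r y \<xi>) \<partial>lborel) = (\<integral>y. bump r y \<xi> \<partial>lborel)"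
          unfolding integral_complex_of_real[symmetric] by (simp only: bump_nonneg[symmetric])
        then show ?thesis unfolding ib(2) of_real_eq_iff .
      qed
      have "A \<xi> - of_real (c * r ^ ?N) * \<psi> \<xi> = (\<integral>y. \<psi> y * bump r y \<xi> \<partial>lborel) - (\<integral>y. bump r y \<xi> * \<psi> \<xi> \<partial>lborel)"
        unfolding A_def ib(2)[symmetric] by (simp only: integral_mult_left_zero)
      also have "\<dots> = (\<integral>y. \<psi> y * bump r y \<xi> - bump r y \<xi> * \<psi> \<xi> \<partial>lborel)"
        by (rule Bochner_Integration.integral_diff[symmetric]) (use i\<psi>b ib in auto)
      also have "norm \<dots> \<le> (\<integral>y. norm (\<psi> y * bump r y \<xi> - bump r y \<xi> * \<psi> \<xi>) \<partial>lborel)"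
        by (rule integral_norm_bound)
      also have "\<dots> \<le> (\<integral>y. \<omega> * norm (bump r y \<xi>) \<partial>lborel)"
      proof (rule integral_mono)
        show "integrable lborel (\<lambda>y. norm (\<psi> y * bump r y \<xi> - bump r y \<xi> * \<psi> \<xi>))"
          by (intro integrable_norm Bochner_Integration.integrable_diff i\<psi>b integrable_mult_left ib)
        show "integrable lborel (\<lambda>y. \<omega> * norm (bump r y \<xi>))"
          by (intro integrable_mult_right integrable_norm ib)
        fix y
        have "norm (\<psi> y * bump r y \<xi> - bump r y \<xi> * \<psi> \<xi>) = norm (\<psi> y - \<psi> \<xi>) * norm (bump r y \<xi>)"
          unfolding norm_mult[symmetric] by (simp add: algebra_simps)
        also have "\<dots> \<le> \<omega> * norm (bump r y \<xi>)"
          using b0[of y \<xi>] osc[of \<xi> y] by (cases "dist y \<xi> > s") (auto simp: dist_commute intro: mult_right_mono)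
        finally show "norm (\<psi> y * bump r y \<xi> - bump r y \<xi> * \<psi> \<xi>) \<le> \<omega> * norm (bump r y \<xi>)" .
      qed
      also have "\<dots> = \<omega> * (c * r ^ ?N)" using nb by simp
      finally show ?thesis .
    qed
    have "of_real (r ^ ?N) * I = (\<integral>y. \<psi> y * L w (bump r y) \<partial>lborel)"
    proof -
      have "of_real (r ^ ?N) * (indicator \<Omega> y *\<^sub>R (F y * \<psi> y)) = \<psi> y * L w (bump r y)" for y
      proof (cases "y \<in> K")
        case True
        have "cball y (sqrt r) \<subseteq> \<Omega>" using e(3,4) True s r by auto
        then show ?thesis using rep[OF r(1)] True K by (auto simp: mult_ac)
      qed (use \<psi>0 in auto)
      then show ?thesis unfolding I_def integral_mult_right_zero[symmetric] by (simp only:)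
    qed
    also have "\<dots> = (\<integral>y. (\<integral>x. \<psi> y * (W x * bump r y (\<Phi>' x)) \<partial>lborel) \<partial>lborel)"
    proof (rule Bochner_Integration.integral_cong[OF refl])
      fix y
      show "\<psi> y * L w (bump r y) = (\<integral>x. \<psi> y * (W x * bump r y (\<Phi>' x)) \<partial>lborel)"
      proof (cases "y \<in> K")
        case True
        have "bump r y \<xi> = 0" if "\<xi> \<notin> K1" for \<xi>
          using that e(4)[OF True, of \<xi>] b0[of y \<xi>] s by force
        from Lg[OF this] show ?thesis by simp
      qed (use \<psi>0 in auto)
    qed
    also have "\<dots> = (\<integral>x. (\<integral>y. \<psi> y * (W x * bump r y (\<Phi>' x)) \<partial>lborel) \<partial>lborel)"
    proof (rule lborel_pair.Fubini_integral)
      show "integrable (lborel \<Otimes>\<^sub>M lborel) (\<lambda>(x, y). \<psi> y * (W x * bump r y (\<Phi>' x)))"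
      proof (rule integrableI_bounded)
        show "(\<lambda>(x, y). \<psi> y * (W x * bump r y (\<Phi>' x))) \<in> borel_measurable (lborel \<Otimes>\<^sub>M lborel)"
          by measurable
        have "(\<integral>\<^sup>+z. ennreal (norm (case z of (x, y) \<Rightarrow> \<psi> y * (W x * bump r y (\<Phi>' x)))) \<partial>(lborel \<Otimes>\<^sub>M lborel))
           \<le> (\<integral>\<^sup>+z. ennreal (norm (W (fst z))) * (ennreal (norm (\<psi> (snd z))) * ennreal (r\<^sup>2)) \<partial>(lborel \<Otimes>\<^sub>M lborel))"
        proof (rule nn_integral_mono)
          fix z :: "(complex ^ 'n) \<times> (complex ^ 'n)"
          obtain x y where z: "z = (x, y)" by (cases z)
          have "norm (\<psi> y * (W x * bump r y (\<Phi>' x))) \<le> norm (W x) * (norm (\<psi> y) * r\<^sup>2)"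
            using mult_left_mono[OF bump_le, of "norm (W x) * norm (\<psi> y)" y "\<Phi>' x"] by (simp add: norm_mult mult_ac)
          then show "ennreal (norm (case z of (x, y) \<Rightarrow> \<psi> y * (W x * bump r y (\<Phi>' x))))
             \<le> ennreal (norm (W (fst z))) * (ennreal (norm (\<psi> (snd z))) * ennreal (r\<^sup>2))"
            unfolding z by (simp add: ennreal_mult[symmetric] ennreal_leI)
        qed
        also have "\<dots> = (\<integral>\<^sup>+x. (\<integral>\<^sup>+y. ennreal (norm (W x)) * (ennreal (norm (\<psi> y)) * ennreal (r\<^sup>2)) \<partial>lborel) \<partial>lborel)"
          by (subst lborel.nn_integral_fst[symmetric]) auto
        also have "\<dots> = (\<integral>\<^sup>+x. ennreal (norm (W x)) \<partial>lborel) * ((\<integral>\<^sup>+y. ennreal (norm (\<psi> y)) \<partial>lborel) * ennreal (r\<^sup>2))"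
          by (simp add: nn_integral_cmult nn_integral_multc)
        also have "\<dots> < \<infinity>"
          using iW i\<psi> unfolding integrable_iff_bounded by (auto intro!: ennreal_mult_less_top[THEN iffD2] simp: ennreal_mult_less_top)
        finally show "(\<integral>\<^sup>+z. ennreal (norm (case z of (x, y) \<Rightarrow> \<psi> y * (W x * bump r y (\<Phi>' x)))) \<partial>(lborel \<Otimes>\<^sub>M lborel)) < \<infinity>" .
      qed
    qed
    also have "\<dots> = (\<integral>x. W x * A (\<Phi>' x) \<partial>lborel)"
      unfolding A_def integral_mult_right_zero[symmetric] by (intro Bochner_Integration.integral_cong) (auto simp: mult_ac)
    finally have 1: "of_real (r ^ ?N) * I = (\<integral>x. W x * A (\<Phi>' x) \<partial>lborel)" .
    have 2: "of_real (r ^ ?N) * (of_real c * L w \<psi>) = (\<integral>x. W x * (of_real (c * r ^ ?N) * \<psi> (\<Phi>' x)) \<partial>lborel)"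
    proof -
      have "L w \<psi> = (\<integral>x. W x * \<psi> (\<Phi>' x) \<partial>lborel)" by (rule Lg) (use \<psi>0 KK1 in auto)
      then have "of_real (r ^ ?N) * (of_real c * L w \<psi>) = (\<integral>x. of_real (c * r ^ ?N) * (W x * \<psi> (\<Phi>' x)) \<partial>lborel)"
        unfolding integral_mult_right_zero by simp
      also have "\<dots> = (\<integral>x. W x * (of_real (c * r ^ ?N) * \<psi> (\<Phi>' x)) \<partial>lborel)"
        by (simp only: mult_ac)
      finally show ?thesis .
    qed
    have bA: "norm (A \<xi>) \<le> (\<integral>y. norm (\<psi> y) * r\<^sup>2 \<partial>lborel)" for \<xi>
      unfolding A_def
    proof (rule order_trans[OF integral_norm_bound], rule integral_mono)
      show "norm (\<psi> y * bump r y \<xi>) \<le> norm (\<psi> y) * r\<^sup>2" for y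
        unfolding norm_mult by (intro mult_left_mono bump_le) simp
    qed (intro integrable_norm integrable_mult_left i\<psi>b i\<psi>)+
    have iWA: "integrable lborel (\<lambda>x. W x * A (\<Phi>' x))"
    proof (rule Bochner_Integration.integrable_bound)
      show "integrable lborel (\<lambda>x. norm (W x) * (\<integral>y. norm (\<psi> y) * r\<^sup>2 \<partial>lborel))"
        using iW by (intro integrable_mult_left integrable_norm)
      show "AE x in lborel. norm (W x * A (\<Phi>' x)) \<le> norm (norm (W x) * (\<integral>y. norm (\<psi> y) * r\<^sup>2 \<partial>lborel))"
        using bA by (auto simp: norm_mult intro!: mult_left_mono order_trans[OF bA abs_ge_self])
      show "(\<lambda>x. W x * A (\<Phi>' x)) \<in> borel_measurable lborel" using Am by measurable
    qed
    obtain B where B: "\<And>\<xi>. norm (\<psi> \<xi>) \<le> B" 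
    proof -
      obtain b where b: "\<And>\<xi>. \<xi> \<in> K \<Longrightarrow> norm (\<psi> \<xi>) \<le> b"
        using compact_imp_bounded[OF compact_continuous_image[OF continuous_on_subset[OF \<psi>c] K(2)]] unfolding bounded_iff by blast
      show ?thesis by (rule that[of "max 0 b"]) (use b \<psi>0 in \<open>force simp: le_max_iff_disj\<close>)
    qed
    have iW\<psi>: "integrable lborel (\<lambda>x. W x * (of_real (c * r ^ ?N) * \<psi> (\<Phi>' x)))"
    proof (rule Bochner_Integration.integrable_bound)
      show "integrable lborel (\<lambda>x. norm (W x) * (c * r ^ ?N * B))"
        using iW by (intro integrable_mult_left integrable_norm)
      have 1: "norm (of_real (c * r ^ ?N) * \<psi> \<xi>) \<le> c * r ^ ?N * B" for \<xi>
        unfolding norm_mult norm_of_real using c r B by (auto intro!: mult_mono)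
      have 2: "norm (W x * z) \<le> norm (norm (W x) * b)" if "norm z \<le> b" for x z b
        using mult_left_mono[OF order_trans[OF that abs_ge_self], of "norm (W x)"] by (simp add: norm_mult abs_mult)
      show "AE x in lborel. norm (W x * (of_real (c * r ^ ?N) * \<psi> (\<Phi>' x))) \<le> norm (norm (W x) * (c * r ^ ?N * B))"
        by (intro AE_I2 2 1)
    qed measurable
    have "of_real (r ^ ?N) * (I - of_real c * L w \<psi>) = (\<integral>x. W x * A (\<Phi>' x) - W x * (of_real (c * r ^ ?N) * \<psi> (\<Phi>' x)) \<partial>lborel)"
      unfolding right_diff_distrib 1 2 by (rule Bochner_Integration.integral_diff[OF iWA iW\<psi>, symmetric])
    also have "norm \<dots> \<le> (\<integral>x. norm (W x) * (\<omega> * (c * r ^ ?N)) \<partial>lborel)"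
    proof (rule order_trans[OF integral_norm_bound], rule integral_mono)
      show "integrable lborel (\<lambda>x. norm (W x * A (\<Phi>' x) - W x * (of_real (c * r ^ ?N) * \<psi> (\<Phi>' x))))"
        by (intro integrable_norm Bochner_Integration.integrable_diff iWA iW\<psi>)
      show "integrable lborel (\<lambda>x. norm (W x) * (\<omega> * (c * r ^ ?N)))"
        using iW by (intro integrable_mult_left integrable_norm)
      show "norm (W x * A (\<Phi>' x) - W x * (of_real (c * r ^ ?N) * \<psi> (\<Phi>' x))) \<le> norm (W x) * (\<omega> * (c * r ^ ?N))" for x
        unfolding right_diff_distrib[symmetric] norm_mult[of "W x"] by (intro mult_left_mono Adiff) simp
    qed
    also have "\<dots> = r ^ ?N * (\<omega> * (c * (\<integral>x. norm (W x) \<partial>lborel)))" by (simp only: integral_mult_left_zero) (simp add: mult_ac)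
    finally have "r ^ ?N * norm (I - of_real c * L w \<psi>) \<le> r ^ ?N * (\<omega> * (c * (\<integral>x. norm (W x) \<partial>lborel)))"
      using r by (simp add: norm_mult norm_power)
    then show ?thesis using r by (simp add: mult_le_cancel_left_pos)
  qed
  have "norm (I - of_real c * L w \<psi>) \<le> 0 + \<epsilon>" if "\<epsilon> > 0" for \<epsilon>
  proof -
    define M where "M = c * (\<integral>x. norm (W x) \<partial>lborel)"
    have M: "M \<ge> 0" unfolding M_def using c by (intro mult_nonneg_nonneg Bochner_Integration.integral_nonneg) auto
    have "norm (I - of_real c * L w \<psi>) \<le> \<epsilon> / (M + 1) * M"
      unfolding M_def[symmetric] using key[of "\<epsilon> / (M + 1)"] that M by (simp add: M_def)
    also have "\<dots> = \<epsilon> * (M / (M + 1))" by simp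
    also have "\<dots> \<le> \<epsilon> * 1" using M that by (intro mult_left_mono) (auto simp: divide_le_eq)
    also have "\<dots> = \<epsilon>" by simp
    finally show ?thesis by simp
  qed
  then have "norm (I - of_real c * L w \<psi>) \<le> 0" by (rule field_le_epsilon)
  then show ?thesis unfolding I_def by simp
qed

text \<open>The last clause exhibits \<open>F y\<close> as a positive multiple of \<open>L\<close>
  on a single bump, so that reality and sign of \<open>F\<close> can be read off from
  \<open>w\<close>.\<close>

theorem L_representation:
  assumes w: "dbar_closed w"
  obtains F where "holo_on \<Omega> F"
    "\<And>K \<psi>. K \<subseteq> \<Omega> \<Longrightarrow> compact K \<Longrightarrow> adm K \<psi> \<Longrightarrow> L w \<psi> = (\<integral>y. indicator \<Omega> y *\<^sub>R (F y * \<psi> y) \<partial>lborel)"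
    "\<And>y. y \<in> \<Omega> \<Longrightarrow> \<exists>r>0. cball y (sqrt r) \<subseteq> \<Omega> \<and> (\<exists>c>0. F y = of_real c * L w (bump r y))"
proof -
  let ?N = "CARD('n) + 2"
  obtain G where G: "holo_on \<Omega> G"
    "\<And>y r. r > 0 \<Longrightarrow> cball y (sqrt r) \<subseteq> \<Omega> \<Longrightarrow> L w (bump r y) = of_real (r ^ ?N) * G y"
    by (rule dbar_closed_representation[OF w]) (rule that, blast+)
  obtain c where c: "c > 0" "\<And>r (y :: complex ^ 'n). r > 0 \<Longrightarrow> (\<integral>\<xi>. bump r y \<xi> \<partial>lborel) = of_real (c * r ^ ?N)"
    by (rule integral_bump[where 'n='n]) (rule that, blast+)
  have cG: "cdiff G y" if "y \<in> \<Omega>" for y using G(1) that by (simp add: holo_on_iff_cdiff)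
  have contG: "continuous_on \<Omega> G" using cG by (simp add: cdiff_continuous continuous_at_imp_continuous_on)
  have cw: "continuous_on X w" using w by (simp add: dbar_closed_def)
  define F where "F y = of_real (1 / c) * G y" for y
  show ?thesis
  proof (rule that[of F])
    show "holo_on \<Omega> F" unfolding holo_on_iff_cdiff F_def by (intro ballI cdiff_mult cdiff_const cG)
    fix K \<psi> assume K: "K \<subseteq> \<Omega>" "compact K" "adm K \<psi>"
    have "L w \<psi> = of_real (1 / c) * (\<integral>y. indicator \<Omega> y *\<^sub>R (G y * \<psi> y) \<partial>lborel)"
      using L_eq_integral[OF cw contG G(2) c K] c(1) by (simp add: field_simps)
    also have "\<dots> = (\<integral>y. indicator \<Omega> y *\<^sub>R (F y * \<psi> y) \<partial>lborel)"
      unfolding integral_mult_right_zero[symmetric] F_def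
      by (intro Bochner_Integration.integral_cong) (auto simp: indicator_def)
    finally show "L w \<psi> = (\<integral>y. indicator \<Omega> y *\<^sub>R (F y * \<psi> y) \<partial>lborel)" .
  next
    fix y assume "y \<in> \<Omega>"
    then obtain e where e: "e > 0" "cball y e \<subseteq> \<Omega>" using open_Omega open_contains_cball by blast
    have "F y = of_real (1 / c * (1 / (e\<^sup>2) ^ ?N)) * L w (bump (e\<^sup>2) y)"
      using G(2)[of "e\<^sup>2" y] e c by (simp add: F_def field_simps)
    then show "\<exists>r>0. cball y (sqrt r) \<subseteq> \<Omega> \<and> (\<exists>c>0. F y = of_real c * L w (bump r y))"
      using e c by (intro exI[of _ "e\<^sup>2"] conjI exI[of _ "1 / c * (1 / (e\<^sup>2) ^ ?N)"]) auto
  qed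
qed

end

section \<open>Push-forward of the squared Jacobian\<close>

lemma cutoff_functions:
  fixes U :: "'a::euclidean_space set"
  assumes U: "open U" "bounded U"
  obtains \<tau> :: "nat \<Rightarrow> 'a \<Rightarrow> real" where
    "\<And>k. continuous_on UNIV (\<tau> k)" "\<And>k x. 0 \<le> \<tau> k x" "\<And>k x. \<tau> k x \<le> 1"
    "\<And>k. \<exists>K. compact K \<and> K \<subseteq> U \<and> (\<forall>x. x \<notin> K \<longrightarrow> \<tau> k x = 0)"
    "\<And>x. incseq (\<lambda>k. \<tau> k x)" "\<And>x. (\<lambda>k. \<tau> k x) \<longlonglongrightarrow> indicator U x"
proof -
  have ne: "- U \<noteq> {}" using U(2) by (metis Compl_empty_eq double_compl not_bounded_UNIV)
  have cl: "closed (- U)" using U(1) by (rule closed_Compl)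
  define d where "d x = infdist x (- U)" for x
  have d0: "d x = 0" if "x \<notin> U" for x using that by (simp add: d_def)
  have dpos: "d x > 0" if "x \<in> U" for x
    using in_closed_iff_infdist_zero[OF cl ne, of x] infdist_nonneg[of x "- U"] that unfolding d_def by (simp add: less_le)
  have dc: "continuous_on S d" for S unfolding d_def by (intro continuous_intros)
  have dnn: "d x \<ge> 0" for x by (simp add: d_def infdist_nonneg)
  \<comment> \<open>For positive \<open>k\<close> this is 0 where the distance to the complement is
    at most 1/k and 1 where it is at least 2/k. The support stays away from the boundary and is
    compact because \<open>U\<close> is bounded.\<close>
  define \<tau> where "\<tau> k x = min 1 (max 0 (real k * d x - 1))" for k x
  show ?thesis
  proof (rule that[of \<tau>])
    show "continuous_on UNIV (\<tau> k)" for k unfolding \<tau>_def by (intro continuous_intros dc)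
    show "0 \<le> \<tau> k x" "\<tau> k x \<le> 1" for k x by (auto simp: \<tau>_def)
    show "\<exists>K. compact K \<and> K \<subseteq> U \<and> (\<forall>x. x \<notin> K \<longrightarrow> \<tau> k x = 0)" for k
    proof (intro exI[of _ "{x. 1 \<le> real k * d x}"] conjI allI impI)
      show sub: "{x. 1 \<le> real k * d x} \<subseteq> U" using d0 by fastforce
      have "closed {x. 1 \<le> real k * d x}" by (intro closed_Collect_le continuous_intros dc)
      then show "compact {x. 1 \<le> real k * d x}"
        using bounded_subset[OF U(2) sub] by (simp add: compact_eq_bounded_closed)
    qed (auto simp: \<tau>_def)
    show "incseq (\<lambda>k. \<tau> k x)" for x
    proof (rule incseq_SucI)
      fix k
      have "real k * d x \<le> real (Suc k) * d x" using dnn[of x] by (intro mult_right_mono) auto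
      then show "\<tau> k x \<le> \<tau> (Suc k) x" unfolding \<tau>_def by linarith
    qed
    show "(\<lambda>k. \<tau> k x) \<longlonglongrightarrow> indicator U x" for x
    proof (cases "x \<in> U")
      case True
      obtain k0 :: nat where k0: "2 / d x \<le> real k0" using real_arch_simple by blast
      have "\<tau> k x = 1" if "k \<ge> k0" for k
      proof -
        have "2 \<le> real k0 * d x" using k0 dpos[OF True] by (simp add: field_simps)
        also have "\<dots> \<le> real k * d x" using that dnn by (intro mult_right_mono) auto
        finally show ?thesis by (simp add: \<tau>_def)
      qed
      then have "eventually (\<lambda>k. \<tau> k x = indicator U x) sequentially"
        using True by (auto simp: eventually_sequentially)
      then show ?thesis by (rule tendsto_eventually)
    next
      case False then show ?thesis by (simp add: \<tau>_def d0)
    qed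
  qed
qed

text \<open>Allows test functions built from a function holomorphic on \<Omega> only: a cutoff with
  compact support in \<Omega> makes them continuous everywhere.\<close>

lemma continuous_on_extend_zero:
  fixes g :: "'a::t2_space \<Rightarrow> complex"
  assumes K: "compact K" "K \<subseteq> \<Omega>" and \<Omega>: "open \<Omega>" and g: "continuous_on \<Omega> g" and off: "\<And>x. x \<notin> K \<Longrightarrow> g x = 0"
  shows "continuous_on UNIV g"
proof -
  have "continuous_on (- K) g" using off by (intro continuous_on_eq[OF continuous_on_const[of _ 0]]) auto
  then have "continuous_on (\<Omega> \<union> - K) g"
    using K \<Omega> g by (intro continuous_on_open_Un) (auto intro!: open_Compl compact_imp_closed)
  moreover have "\<Omega> \<union> - K = UNIV" using K by auto
  ultimately show ?thesis by simp
qed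

context proper_rational
begin

lemma jac_rat: "jac \<Phi> \<in> rat_on X" by (rule jac_rat_on[OF rat open_X])

lemma jac_cont: "continuous_on X (jac \<Phi>)" by (rule rat_on_continuous[OF jac_rat open_X])

lemma rat_indicator_measurable [measurable]:
  "u \<in> rat_on X \<Longrightarrow> (\<lambda>x. indicator X x *\<^sub>R u x) \<in> borel_measurable borel"
  by (intro borel_measurable_continuous_on_indicator rat_on_continuous open_X borel_open)

text \<open>\<Phi> made total, hence Borel on the whole space. As the default value 0 may well
  belong to \<Omega>, \<open>ext\<close> is used next to a factor that vanishes off
  \<open>X\<close>, such as \<open>jn\<close>.\<close>

definition ext :: "complex ^ 'n \<Rightarrow> complex ^ 'n" where "ext x = indicator X x *\<^sub>R \<Phi> x"

lemma ext_measurable [measurable]: "ext \<in> borel_measurable borel"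
  unfolding ext_def by (intro borel_measurable_continuous_on_indicator cont_Phi borel_open open_X)

lemma ext_eq: "x \<in> X \<Longrightarrow> ext x = \<Phi> x" by (simp add: ext_def)

definition jn :: "complex ^ 'n \<Rightarrow> real" where "jn x = indicator X x * (norm (jac \<Phi> x))\<^sup>2"

lemma jn_measurable [measurable]: "jn \<in> borel_measurable borel"
proof -
  have "(\<lambda>x. (norm (indicator X x *\<^sub>R jac \<Phi> x))\<^sup>2) \<in> borel_measurable borel"
    using jac_rat by measurable
  also have "(\<lambda>x. (norm (indicator X x *\<^sub>R jac \<Phi> x))\<^sup>2) = jn" by (auto simp: jn_def indicator_def)
  finally show ?thesis .
qed

lemma jn_nonneg: "jn x \<ge> 0" by (simp add: jn_def)

lemma L_jac_real:
  "L (\<lambda>x. jac \<Phi> x * cnj (jac \<Phi> x)) (\<lambda>\<xi>. of_real (\<tau> \<xi>)) = of_real (\<integral>x. jn x * \<tau> (ext x) \<partial>lborel)"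
proof -
  have "indicator X x *\<^sub>R (jac \<Phi> x * cnj (jac \<Phi> x) * of_real (\<tau> (\<Phi> x))) = complex_of_real (jn x * \<tau> (ext x))" for x
    unfolding complex_norm_square[symmetric] jn_def by (auto simp: indicator_def ext_eq)
  then show ?thesis unfolding L_def integral_complex_of_real[symmetric] by (simp only:)
qed

text \<open>\<open>M\<close> plays the part of the number of sheets of \<Phi>. Reality and sign of
  the representing function are visible on bumps, where \<open>L\<close> integrates
  \<open>jn\<close> against a nonnegative function; connectedness of \<Omega> then leaves a
  constant.\<close>

lemma jac_push_real:
  assumes con: "connected \<Omega>"
  obtains M where "M \<ge> 0" "\<And>K \<tau>. K \<subseteq> \<Omega> \<Longrightarrow> compact K \<Longrightarrow> continuous_on UNIV \<tau> \<Longrightarrow> (\<And>\<xi>. \<xi> \<notin> K \<Longrightarrow> \<tau> \<xi> = 0) \<Longrightarrow>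
    integrable lborel (\<lambda>x. jn x * \<tau> (ext x)) \<and> (\<integral>x. jn x * \<tau> (ext x) \<partial>lborel) = M * (\<integral>y. \<tau> y \<partial>lborel)"
proof -
  let ?w = "\<lambda>x. jac \<Phi> x * cnj (jac \<Phi> x)"
  have w: "dbar_closed ?w" by (rule dbar_closed_jac[OF jac_rat])
  then have cw: "continuous_on X ?w" by (simp add: dbar_closed_def)
  obtain F where F: "holo_on \<Omega> F"
    "\<And>K \<psi>. K \<subseteq> \<Omega> \<Longrightarrow> compact K \<Longrightarrow> adm K \<psi> \<Longrightarrow> L ?w \<psi> = (\<integral>y. indicator \<Omega> y *\<^sub>R (F y * \<psi> y) \<partial>lborel)"
    "\<And>y. y \<in> \<Omega> \<Longrightarrow> \<exists>r>0. cball y (sqrt r) \<subseteq> \<Omega> \<and> (\<exists>c>0. F y = of_real c * L ?w (bump r y))"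
    by (rule L_representation[OF w]) (rule that, blast+)
  have Fre: "Im (F y) = 0 \<and> Re (F y) \<ge> 0" if y: "y \<in> \<Omega>" for y
  proof -
    obtain r c where "c > 0" "F y = of_real c * L ?w (bump r y)" using F(3)[OF y] by blast
    moreover have "L ?w (bump r y) = of_real (\<integral>x. jn x * norm (bump r y (ext x)) \<partial>lborel)"
      using L_jac_real[of "\<lambda>\<xi>. norm (bump r y \<xi>)"] by (simp only: bump_nonneg[symmetric])
    moreover have "(\<integral>x. jn x * norm (bump r y (ext x)) \<partial>lborel) \<ge> 0"
      by (intro Bochner_Integration.integral_nonneg) (simp add: jn_nonneg)
    ultimately show ?thesis by simp
  qed
  \<comment> \<open>Every point of \<Omega> gives the same value; the default 0 keeps
    \<open>M \<ge> 0\<close> true when \<Omega> is empty.\<close>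
  define M where "M = (if \<Omega> = {} then 0 else Re (F (SOME y. y \<in> \<Omega>)))"
  have FM: "F y = of_real M" if y: "y \<in> \<Omega>" for y
  proof -
    have s: "(SOME y. y \<in> \<Omega>) \<in> \<Omega>" using y by (rule someI)
    have "F y = F (SOME y. y \<in> \<Omega>)" by (rule holo_real_constant[OF F(1) open_Omega con _ y s]) (use Fre in auto)
    then show ?thesis using Fre[OF s] y by (auto simp: M_def complex_eq_iff)
  qed
  have M0: "M \<ge> 0"
    unfolding M_def using Fre[OF someI_ex[of "\<lambda>y. y \<in> \<Omega>"]] by auto
  show ?thesis
  proof (rule that[OF M0])
    fix K and \<tau> :: "complex ^ 'n \<Rightarrow> real"
    assume K: "K \<subseteq> \<Omega>" "compact K" and \<tau>: "continuous_on UNIV \<tau>" "\<And>\<xi>. \<xi> \<notin> K \<Longrightarrow> \<tau> \<xi> = 0"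
    have ad: "adm K (\<lambda>\<xi>. complex_of_real (\<tau> \<xi>))" unfolding adm_def using \<tau> by (auto intro: continuous_on_of_real)
    have "complex_of_real (\<integral>x. jn x * \<tau> (ext x) \<partial>lborel) = (\<integral>y. indicator \<Omega> y *\<^sub>R (F y * complex_of_real (\<tau> y)) \<partial>lborel)"
      using F(2)[OF K ad] unfolding L_jac_real .
    also have "\<dots> = (\<integral>y. complex_of_real (M * \<tau> y) \<partial>lborel)"
    proof (rule Bochner_Integration.integral_cong[OF refl])
      show "indicator \<Omega> y *\<^sub>R (F y * complex_of_real (\<tau> y)) = complex_of_real (M * \<tau> y)" for y
        using FM[of y] \<tau>(2)[of y] K(1) by (cases "y \<in> \<Omega>") auto
    qed
    also have "\<dots> = complex_of_real (M * (\<integral>y. \<tau> y \<partial>lborel))"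
      unfolding integral_complex_of_real by simp
    finally have 1: "(\<integral>x. jn x * \<tau> (ext x) \<partial>lborel) = M * (\<integral>y. \<tau> y \<partial>lborel)" unfolding of_real_eq_iff .
    have "integrable lborel (\<lambda>x. Re (indicator X x *\<^sub>R (?w x * complex_of_real (\<tau> (\<Phi> x)))))"
      by (rule integrable_Re[OF L_integrable[OF cw K ad]])
    also have "(\<lambda>x. Re (indicator X x *\<^sub>R (?w x * complex_of_real (\<tau> (\<Phi> x))))) = (\<lambda>x. jn x * \<tau> (ext x))"
      unfolding complex_norm_square[symmetric] jn_def by (auto simp: indicator_def ext_eq)
    finally show "integrable lborel (\<lambda>x. jn x * \<tau> (ext x)) \<and> (\<integral>x. jn x * \<tau> (ext x) \<partial>lborel) = M * (\<integral>y. \<tau> y \<partial>lborel)"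
      using 1 by blast
  qed
qed

text \<open>The two measures are compared on open sets \<open>G\<close>, where cutoff functions for
  the bounded open set \<open>G \<inter> \<Omega>\<close> increase to its indicator. Boundedness of
  \<Omega> makes both measures finite, so agreement on this intersection-stable generator suffices;
  in particular |J|^2 has finite integral over \<open>X\<close>.\<close>

lemma jac_push:
  assumes con: "connected \<Omega>" and bd: "bounded \<Omega>"
  obtains M where "M \<ge> 0" "\<And>f. f \<in> borel_measurable borel \<Longrightarrow>
    (\<integral>\<^sup>+x. ennreal (jn x) * f (ext x) \<partial>lborel) = ennreal M * (\<integral>\<^sup>+y. indicator \<Omega> y * f y \<partial>lborel)"
proof -
  obtain M where M: "M \<ge> 0" "\<And>K \<tau>. K \<subseteq> \<Omega> \<Longrightarrow> compact K \<Longrightarrow> continuous_on UNIV \<tau> \<Longrightarrow> (\<And>\<xi>. \<xi> \<notin> K \<Longrightarrow> \<tau> \<xi> = 0) \<Longrightarrow>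
    integrable lborel (\<lambda>x. jn x * \<tau> (ext x)) \<and> (\<integral>x. jn x * \<tau> (ext x) \<partial>lborel) = M * (\<integral>y. \<tau> y \<partial>lborel)"
    by (rule jac_push_real[OF con]) (rule that, blast+)
  have \<Omega>m [measurable]: "\<Omega> \<in> sets borel" using open_Omega by simp
  define \<nu>1 where "\<nu>1 = distr (density lborel (\<lambda>x. ennreal (jn x))) borel ext"
  define \<nu>2 where "\<nu>2 = density lborel (\<lambda>y. ennreal M * indicator \<Omega> y)"
  have e1: "emeasure \<nu>1 A = (\<integral>\<^sup>+x. ennreal (jn x) * indicator A (ext x) \<partial>lborel)" if "A \<in> sets borel" for A
  proof -
    have [measurable]: "A \<in> sets borel" by fact
    have "emeasure \<nu>1 A = (\<integral>\<^sup>+x. ennreal (jn x) * indicator (ext -` A \<inter> space (density lborel (\<lambda>x. ennreal (jn x)))) x \<partial>lborel)"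
      unfolding \<nu>1_def by (subst emeasure_distr; (subst emeasure_density)?)
        (use measurable_sets_borel[OF ext_measurable that] in auto)
    also have "\<dots> = (\<integral>\<^sup>+x. ennreal (jn x) * indicator A (ext x) \<partial>lborel)"
      by (intro nn_integral_cong) (auto simp: indicator_def)
    finally show ?thesis .
  qed
  have e2: "emeasure \<nu>2 A = ennreal M * emeasure lborel (\<Omega> \<inter> A)" if "A \<in> sets borel" for A
  proof -
    have [measurable]: "A \<in> sets borel" by fact
    have "emeasure \<nu>2 A = (\<integral>\<^sup>+x. ennreal M * indicator (\<Omega> \<inter> A) x \<partial>lborel)"
      unfolding \<nu>2_def by (subst emeasure_density) (auto intro!: nn_integral_cong simp: indicator_def)
    then show ?thesis by (simp add: nn_integral_cmult)
  qed
  have eq: "emeasure \<nu>1 G = emeasure \<nu>2 G" if G: "open G" for G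
  proof -
    let ?U = "G \<inter> \<Omega>"
    have U: "open ?U" "bounded ?U" using G open_Omega bd by (auto intro: bounded_subset)
    obtain \<tau> :: "nat \<Rightarrow> complex ^ 'n \<Rightarrow> real" where \<tau>: 
      "\<And>k. continuous_on UNIV (\<tau> k)" "\<And>k x. 0 \<le> \<tau> k x" "\<And>k x. \<tau> k x \<le> 1"
      "\<And>k. \<exists>K. compact K \<and> K \<subseteq> ?U \<and> (\<forall>x. x \<notin> K \<longrightarrow> \<tau> k x = 0)"
      "\<And>x. incseq (\<lambda>k. \<tau> k x)" "\<And>x. (\<lambda>k. \<tau> k x) \<longlonglongrightarrow> indicator ?U x"
      by (rule cutoff_functions[OF U]) (rule that, assumption+)
    have \<tau>m [measurable]: "\<tau> k \<in> borel_measurable borel" for k by (rule borel_measurable_continuous_onI[OF \<tau>(1)])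
    have k: "(\<integral>\<^sup>+x. ennreal (jn x * \<tau> k (ext x)) \<partial>lborel) = ennreal M * (\<integral>\<^sup>+y. ennreal (\<tau> k y) \<partial>lborel)" for k
    proof -
      obtain K where K: "compact K" "K \<subseteq> ?U" "\<And>x. x \<notin> K \<Longrightarrow> \<tau> k x = 0" using \<tau>(4)[of k] by blast
      have m: "integrable lborel (\<lambda>x. jn x * \<tau> k (ext x))" "(\<integral>x. jn x * \<tau> k (ext x) \<partial>lborel) = M * (\<integral>y. \<tau> k y \<partial>lborel)"
        using M(2)[OF _ K(1) \<tau>(1) K(3)] K(2) by auto
      have "integrable lborel (\<lambda>x. indicator K x *\<^sub>R \<tau> k x)"
        by (intro borel_integrable_compact K continuous_on_subset[OF \<tau>(1)]) auto
      also have "(\<lambda>x. indicator K x *\<^sub>R \<tau> k x) = \<tau> k" by (rule ext) (use K(3) in \<open>auto simp: indicator_def\<close>)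
      finally have i: "integrable lborel (\<tau> k)" .
      show ?thesis
        using nn_integral_eq_integral[OF m(1)] nn_integral_eq_integral[OF i] m(2) \<tau>(2) jn_nonneg M(1)
        by (simp add: ennreal_mult Bochner_Integration.integral_nonneg)
    qed
    have "(\<lambda>k. \<integral>\<^sup>+x. ennreal (jn x * \<tau> k (ext x)) \<partial>lborel) \<longlonglongrightarrow> (\<integral>\<^sup>+x. ennreal (jn x * indicator ?U (ext x)) \<partial>lborel)"
    proof (rule nn_integral_LIMSEQ)
      show "incseq (\<lambda>k x. ennreal (jn x * \<tau> k (ext x)))"
        using \<tau>(5) by (intro incseq_SucI le_funI ennreal_leI mult_left_mono) (auto simp: incseq_Suc_iff jn_nonneg)
      show "(\<lambda>k. ennreal (jn x * \<tau> k (ext x))) \<longlonglongrightarrow> ennreal (jn x * indicator ?U (ext x))" for x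
        by (intro tendsto_ennrealI tendsto_mult_left \<tau>(6))
    qed measurable
    moreover have "(\<lambda>k. \<integral>\<^sup>+x. ennreal (jn x * \<tau> k (ext x)) \<partial>lborel) \<longlonglongrightarrow> ennreal M * (\<integral>\<^sup>+y. ennreal (indicator ?U y) \<partial>lborel)"
      unfolding k
    proof (intro ennreal_tendsto_cmult nn_integral_LIMSEQ)
      show "incseq (\<lambda>k x. ennreal (\<tau> k x))"
        using \<tau>(5) by (intro incseq_SucI le_funI ennreal_leI) (auto simp: incseq_Suc_iff)
      show "(\<lambda>k. ennreal (\<tau> k x)) \<longlonglongrightarrow> ennreal (indicator ?U x)" for x
        by (intro tendsto_ennrealI \<tau>(6))
    qed auto
    ultimately have "(\<integral>\<^sup>+x. ennreal (jn x * indicator ?U (ext x)) \<partial>lborel) = ennreal M * (\<integral>\<^sup>+y. ennreal (indicator ?U y) \<partial>lborel)"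
      by (rule LIMSEQ_unique)
    also have "(\<integral>\<^sup>+x. ennreal (jn x * indicator ?U (ext x)) \<partial>lborel) = (\<integral>\<^sup>+x. ennreal (jn x) * indicator G (ext x) \<partial>lborel)"
      using maps by (intro nn_integral_cong) (auto simp: indicator_def jn_def ext_def)
    also have "(\<integral>\<^sup>+y. ennreal (indicator ?U y) \<partial>lborel) = emeasure lborel (\<Omega> \<inter> G)"
      using U(1) by (simp add: ennreal_indicator Int_commute)
    finally show ?thesis using e1[of G] e2[of G] G by simp
  qed
  have "\<nu>1 = \<nu>2"
  proof (rule measure_eqI_generator_eq[where E="{S. open S}" and \<Omega>=UNIV and A="\<lambda>_. UNIV"])
    show "Int_stable {S :: (complex ^ 'n) set. open S}" by (auto simp: Int_stable_def)
    show "emeasure \<nu>1 X = emeasure \<nu>2 X" if "X \<in> {S. open S}" for X using eq that by simp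
    show "sets \<nu>1 = sigma_sets UNIV {S. open S}" "sets \<nu>2 = sigma_sets UNIV {S. open S}"
      by (auto simp: \<nu>1_def \<nu>2_def borel_def)
    show "emeasure \<nu>1 UNIV \<noteq> \<infinity>" for i :: nat
      using eq[OF open_UNIV] e2[of UNIV] emeasure_bounded_finite[OF bd] by (simp add: ennreal_mult_eq_top_iff)
  qed auto
  show ?thesis
  proof (rule that[OF M(1)])
    fix f :: "complex ^ 'n \<Rightarrow> ennreal" assume [measurable]: "f \<in> borel_measurable borel"
    have "(\<integral>\<^sup>+x. ennreal (jn x) * f (ext x) \<partial>lborel) = (\<integral>\<^sup>+y. f y \<partial>\<nu>1)"
      unfolding \<nu>1_def by (subst nn_integral_distr) (auto simp: nn_integral_density)
    also have "\<dots> = (\<integral>\<^sup>+y. (ennreal M * indicator \<Omega> y) * f y \<partial>lborel)"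
      unfolding \<open>\<nu>1 = \<nu>2\<close> \<nu>2_def by (subst nn_integral_density) auto
    also have "\<dots> = ennreal M * (\<integral>\<^sup>+y. indicator \<Omega> y * f y \<partial>lborel)"
      unfolding mult.assoc by (rule nn_integral_cmult) measurable
    finally show "(\<integral>\<^sup>+x. ennreal (jn x) * f (ext x) \<partial>lborel) = ennreal M * (\<integral>\<^sup>+y. indicator \<Omega> y * f y \<partial>lborel)" .
  qed
qed

end

text \<open>The analogue for complex densities, which do not define measures in the ordinary sense:
  a Dynkin argument leads from open to Borel sets, then simple functions and dominated convergence
  reach \<open>f\<close>.\<close>

lemma complex_push_forward_eq:
  fixes w F :: "'a::euclidean_space \<Rightarrow> complex" and \<phi> :: "'a \<Rightarrow> 'a"
  assumes w: "integrable lborel w" and F: "integrable lborel F" and \<phi>: "\<phi> \<in> borel_measurable borel"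
    and op: "\<And>G. open G \<Longrightarrow> (\<integral>x. w x * indicator G (\<phi> x) \<partial>lborel) = (\<integral>y. F y * indicator G y \<partial>lborel)"
    and f: "f \<in> borel_measurable borel"
    and wf: "integrable lborel (\<lambda>x. w x * f (\<phi> x))" and Ff: "integrable lborel (\<lambda>y. F y * f y)"
  shows "(\<integral>x. w x * f (\<phi> x) \<partial>lborel) = (\<integral>y. F y * f y \<partial>lborel)"
proof -
  note \<phi>[measurable]
  have wm [measurable]: "w \<in> borel_measurable borel" "F \<in> borel_measurable borel"
    using borel_measurable_integrable[OF w] borel_measurable_integrable[OF F] by auto
  have iw: "integrable lborel (\<lambda>x. w x * indicator A (\<phi> x))" if [measurable]: "A \<in> sets borel" for A
    by (rule Bochner_Integration.integrable_bound[OF w]) (auto simp: norm_mult indicator_def)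
  have iF: "integrable lborel (\<lambda>x. F x * indicator A x)" if [measurable]: "A \<in> sets borel" for A
    by (rule Bochner_Integration.integrable_bound[OF F]) (auto simp: norm_mult indicator_def)
  have ind: "(\<integral>x. w x * indicator A (\<phi> x) \<partial>lborel) = (\<integral>y. F y * indicator A y \<partial>lborel)" if "A \<in> sets borel" for A
  proof -
    have A: "A \<in> sigma_sets UNIV {S. open S}" using that by (simp add: borel_def)
    have i: "Int_stable {S :: 'a set. open S}" by (auto simp: Int_stable_def)
    have p: "{S :: 'a set. open S} \<subseteq> Pow UNIV" by simp
    from A show ?thesis
    proof (induct rule: sigma_sets_induct_disjoint[OF i p, consumes 1, case_names basic empty compl union])
      case (basic A) then show ?case using op by simp
    next
      case empty then show ?case by simp
    next
      case (compl A)
      then have A: "A \<in> sets borel" by (simp add: borel_def)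
      have "(\<integral>x. w x * indicator (UNIV - A) (\<phi> x) \<partial>lborel) = (\<integral>x. w x * indicator UNIV (\<phi> x) - w x * indicator A (\<phi> x) \<partial>lborel)"
        by (intro Bochner_Integration.integral_cong) (auto simp: indicator_def)
      also have "\<dots> = (\<integral>x. w x * indicator UNIV (\<phi> x) \<partial>lborel) - (\<integral>x. w x * indicator A (\<phi> x) \<partial>lborel)"
        by (intro Bochner_Integration.integral_diff iw A) simp
      also have "\<dots> = (\<integral>x. F x * indicator UNIV x \<partial>lborel) - (\<integral>x. F x * indicator A x \<partial>lborel)"
        using op[OF open_UNIV] compl(2) by simp
      also have "\<dots> = (\<integral>x. F x * indicator UNIV x - F x * indicator A x \<partial>lborel)"
        by (intro Bochner_Integration.integral_diff[symmetric] iF A) simp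
      also have "\<dots> = (\<integral>x. F x * indicator (UNIV - A) x \<partial>lborel)"
        by (intro Bochner_Integration.integral_cong) (auto simp: indicator_def)
      finally show ?case .
    next
      case (union A)
      then have A [measurable]: "A i \<in> sets borel" for i by (auto simp: borel_def)
      define B where "B n = (\<Union>i<n. A i)" for n
      have B [measurable]: "B n \<in> sets borel" for n by (simp add: B_def)
      have indB: "indicator (B n) x = (\<Sum>i<n. indicator (A i) x :: complex)" for n x
        unfolding B_def using indicator_UN_disjoint[of "{..<n}" A x] union(1)
        by (simp add: disjoint_family_on_def)
      have indU: "(\<lambda>n. indicator (B n) x :: complex) \<longlonglongrightarrow> indicator (\<Union>i. A i) x" for x
        unfolding B_def by (rule LIMSEQ_indicator_UN)
      have "(\<lambda>n. \<integral>x. w x * indicator (B n) (\<phi> x) \<partial>lborel) \<longlonglongrightarrow> (\<integral>x. w x * indicator (\<Union>i. A i) (\<phi> x) \<partial>lborel)"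
      proof (rule integral_dominated_convergence[where w="\<lambda>x. norm (w x)"])
        show "AE x in lborel. (\<lambda>n. w x * indicator (B n) (\<phi> x)) \<longlonglongrightarrow> w x * indicator (\<Union>i. A i) (\<phi> x)"
          by (intro AE_I2 tendsto_mult_left indU)
      qed (use w in \<open>auto simp: norm_mult indicator_def\<close>)
      moreover have "(\<lambda>n. \<integral>x. F x * indicator (B n) x \<partial>lborel) \<longlonglongrightarrow> (\<integral>x. F x * indicator (\<Union>i. A i) x \<partial>lborel)"
      proof (rule integral_dominated_convergence[where w="\<lambda>x. norm (F x)"])
        show "AE x in lborel. (\<lambda>n. F x * indicator (B n) x) \<longlonglongrightarrow> F x * indicator (\<Union>i. A i) x"
          by (intro AE_I2 tendsto_mult_left indU)
      qed (use F in \<open>auto simp: norm_mult indicator_def\<close>)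
      moreover have "(\<integral>x. w x * indicator (B n) (\<phi> x) \<partial>lborel) = (\<integral>x. F x * indicator (B n) x \<partial>lborel)" for n
        unfolding indB sum_distrib_left
        by (subst (1 2) Bochner_Integration.integral_sum) (auto simp: iw iF union(3))
      ultimately show ?case using LIMSEQ_unique by force
    qed
  qed
  have simp_eq: "(\<integral>x. w x * s (\<phi> x) \<partial>lborel) = (\<integral>y. F y * s y \<partial>lborel)" if s: "simple_function borel s" for s :: "'a \<Rightarrow> complex"
  proof -
    have fin: "finite (range s)" using s by (auto simp: simple_function_def)
    have ms: "s -` {v} \<in> sets borel" for v
      using measurable_sets_borel[OF borel_measurable_simple_function[OF s], of "{v}"] by simp
    have rep: "s x = (\<Sum>v\<in>range s. v * indicator (s -` {v}) x)" for x
    proof -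
      have "(\<Sum>v\<in>range s. v * indicator (s -` {v}) x) = (\<Sum>v\<in>range s. if v = s x then v else 0)"
        by (intro sum.cong) (auto simp: indicator_def)
      then show ?thesis using fin by simp
    qed
    have "(\<integral>x. w x * s (\<phi> x) \<partial>lborel) = (\<integral>x. (\<Sum>v\<in>range s. v * (w x * indicator (s -` {v}) (\<phi> x))) \<partial>lborel)"
      by (subst rep) (simp add: sum_distrib_left mult_ac)
    also have "\<dots> = (\<Sum>v\<in>range s. v * (\<integral>x. w x * indicator (s -` {v}) (\<phi> x) \<partial>lborel))"
      by (subst Bochner_Integration.integral_sum) (auto intro!: iw ms)
    also have "\<dots> = (\<Sum>v\<in>range s. v * (\<integral>x. F x * indicator (s -` {v}) x \<partial>lborel))"
      by (simp only: ind[OF ms])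
    also have "\<dots> = (\<integral>x. (\<Sum>v\<in>range s. v * (F x * indicator (s -` {v}) x)) \<partial>lborel)"
      by (subst Bochner_Integration.integral_sum) (auto intro!: iF ms)
    also have "\<dots> = (\<integral>y. F y * s y \<partial>lborel)"
      by (intro Bochner_Integration.integral_cong refl, subst rep) (simp add: sum_distrib_left mult_ac)
    finally show ?thesis .
  qed
  obtain s where s: "\<And>i. simple_function borel (s i)" "\<And>x. (\<lambda>i. s i x) \<longlonglongrightarrow> f x" "\<And>i x. norm (s i x) \<le> 2 * norm (f x)"
    using borel_measurable_implies_sequence_metric[OF f, of 0] by auto
  have sm [measurable]: "s i \<in> borel_measurable borel" for i
    using s(1) by (rule borel_measurable_simple_function)
  note f[measurable]
  have "(\<lambda>i. \<integral>x. w x * s i (\<phi> x) \<partial>lborel) \<longlonglongrightarrow> (\<integral>x. w x * f (\<phi> x) \<partial>lborel)"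
  proof (rule integral_dominated_convergence[where w="\<lambda>x. 2 * norm (w x * f (\<phi> x))"])
    show "AE x in lborel. (\<lambda>i. w x * s i (\<phi> x)) \<longlonglongrightarrow> w x * f (\<phi> x)" by (intro AE_I2 tendsto_mult_left s)
    show "AE x in lborel. norm (w x * s i (\<phi> x)) \<le> 2 * norm (w x * f (\<phi> x))" for i
    proof (rule AE_I2)
      fix x show "norm (w x * s i (\<phi> x)) \<le> 2 * norm (w x * f (\<phi> x))"
        using mult_left_mono[OF s(3)[of i "\<phi> x"], of "norm (w x)"] by (simp add: norm_mult mult_ac)
    qed
    show "integrable lborel (\<lambda>x. 2 * norm (w x * f (\<phi> x)))" using wf by (intro integrable_mult_right integrable_norm)
  qed measurable
  moreover have "(\<lambda>i. \<integral>x. F x * s i x \<partial>lborel) \<longlonglongrightarrow> (\<integral>x. F x * f x \<partial>lborel)"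
  proof (rule integral_dominated_convergence[where w="\<lambda>x. 2 * norm (F x * f x)"])
    show "AE x in lborel. (\<lambda>i. F x * s i x) \<longlonglongrightarrow> F x * f x" by (intro AE_I2 tendsto_mult_left s)
    show "AE x in lborel. norm (F x * s i x) \<le> 2 * norm (F x * f x)" for i
    proof (rule AE_I2)
      fix x show "norm (F x * s i x) \<le> 2 * norm (F x * f x)"
        using mult_left_mono[OF s(3)[of i x], of "norm (F x)"] by (simp add: norm_mult mult_ac)
    qed
    show "integrable lborel (\<lambda>x. 2 * norm (F x * f x))" using Ff by (intro integrable_mult_right integrable_norm)
  qed measurable
  ultimately show ?thesis unfolding simp_eq[OF s(1)] by (rule LIMSEQ_unique)
qed

section \<open>Pull-back and orthogonality\<close>

lemma borel_measurable_cnj' [measurable]: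
  "f \<in> borel_measurable M \<Longrightarrow> (\<lambda>x. cnj (f x)) \<in> borel_measurable M"
  by (rule borel_measurable_continuous_on[OF continuous_on_cnj[OF continuous_on_id]])

text \<open>The definitions integrate over the completed measure, the arguments below over
  \<open>lborel\<close>; a function that is Borel on \<Omega> does not see the difference.\<close>

lemma lp_nn_lborel:
  assumes "(\<lambda>x. indicator \<Omega> x *\<^sub>R f x) \<in> borel_measurable borel"
  shows "lp_nn \<Omega> p f = (\<integral>\<^sup>+x. indicator \<Omega> x * ennreal (cmod (f x) powr p) \<partial>lborel)"
proof (cases "\<Omega> \<in> sets borel")
  case [measurable]: True
  note assms[measurable]
  have "lp_nn \<Omega> p f = (\<integral>\<^sup>+x. indicator \<Omega> x * ennreal (cmod (indicator \<Omega> x *\<^sub>R f x) powr p) \<partial>lebesgue)"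
    unfolding lp_nn_def by (intro nn_integral_cong) (auto simp: indicator_def)
  also have "\<dots> = (\<integral>\<^sup>+x. indicator \<Omega> x * ennreal (cmod (indicator \<Omega> x *\<^sub>R f x) powr p) \<partial>lborel)"
    by (rule nn_integral_completion) measurable
  also have "\<dots> = (\<integral>\<^sup>+x. indicator \<Omega> x * ennreal (cmod (f x) powr p) \<partial>lborel)"
    by (intro nn_integral_cong) (auto simp: indicator_def)
  finally show ?thesis .
next
  case False
  have "indicator \<Omega> x * ennreal (cmod (f x) powr p) = ennreal (cmod (indicator \<Omega> x *\<^sub>R f x) powr p)" for x
    by (auto simp: indicator_def)
  then show ?thesis unfolding lp_nn_def
    by (simp only:) (rule nn_integral_completion, use assms in measurable)
qed

lemma powr_two_sq: "cmod z powr 2 = (cmod z)\<^sup>2"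
  using powr_numeral[of "cmod z" "num.Bit0 num.One"] by (cases "z = 0") auto

lemma holo_on_continuous: "holo_on U f \<Longrightarrow> continuous_on U f"
  by (auto simp: holo_on_iff_cdiff intro!: continuous_at_imp_continuous_on cdiff_continuous)

lemma holo_indicator_measurable:
  "holo_on U f \<Longrightarrow> open U \<Longrightarrow> (\<lambda>x. indicator U x *\<^sub>R f x) \<in> borel_measurable borel"
  by (intro borel_measurable_continuous_on_indicator holo_on_continuous borel_open)

lemma bergman_space_iff:
  assumes "open U"
  shows "f \<in> bergman_space U \<longleftrightarrow> holo_on U f \<and> (\<integral>\<^sup>+x. indicator U x * ennreal ((cmod (f x))\<^sup>2) \<partial>lborel) < \<infinity>"
proof -
  have "f \<in> borel_measurable (lebesgue_on U)" if "holo_on U f"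
    using continuous_imp_measurable_on_sets_lebesgue[OF holo_on_continuous[OF that]] assms by (simp add: borel_open)
  moreover have "lp_nn U 2 f = (\<integral>\<^sup>+x. indicator U x * ennreal ((cmod (f x))\<^sup>2) \<partial>lborel)" if "holo_on U f"
    using lp_nn_lborel[OF holo_indicator_measurable[OF that assms], of 2] by (simp add: powr_two_sq)
  ultimately show ?thesis unfolding bergman_space_def in_Lp_def by auto
qed

lemma ennreal_sum_prod:
  "p \<ge> 0 \<Longrightarrow> q \<ge> 0 \<Longrightarrow> r \<ge> 0 \<Longrightarrow> s \<ge> 0 \<Longrightarrow> t \<ge> 0 \<Longrightarrow>
    ennreal (p * q + r * (s * t)) = ennreal p * ennreal q + ennreal r * (ennreal s * ennreal t)"
  by (simp add: ennreal_plus ennreal_mult)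

lemma weighted_am_gm:
  fixes a b M :: real
  assumes "M > 0" shows "a * b \<le> M / 2 * a\<^sup>2 + 1 / (2 * M) * b\<^sup>2"
proof -
  have "0 \<le> (M * a - b)\<^sup>2" by simp
  then have "2 * M * (a * b) \<le> M\<^sup>2 * a\<^sup>2 + b\<^sup>2" by (simp add: power2_eq_square algebra_simps)
  then show ?thesis using assms by (simp add: field_simps power2_eq_square)
qed

lemma integrable_from_sq:
  fixes f g :: "'a::euclidean_space \<Rightarrow> complex"
  assumes [measurable]: "f \<in> borel_measurable borel" "g \<in> borel_measurable borel"
    and "(\<integral>\<^sup>+x. ennreal ((norm (f x))\<^sup>2) \<partial>lborel) < \<infinity>" "(\<integral>\<^sup>+x. ennreal ((norm (g x))\<^sup>2) \<partial>lborel) < \<infinity>"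
  shows "integrable lborel (\<lambda>x. f x * g x)"
proof (rule Bochner_Integration.integrable_bound[of _ "\<lambda>x. (norm (f x))\<^sup>2 + (norm (g x))\<^sup>2"])
  have "integrable lborel (\<lambda>x. (norm (f x))\<^sup>2)" "integrable lborel (\<lambda>x. (norm (g x))\<^sup>2)"
    using assms(3,4) by (auto intro!: integrableI_bounded)
  then show "integrable lborel (\<lambda>x. (norm (f x))\<^sup>2 + (norm (g x))\<^sup>2)" by (rule Bochner_Integration.integrable_add)
  have "norm (f x * g x) \<le> norm ((norm (f x))\<^sup>2 + (norm (g x))\<^sup>2)" for x
  proof -
    have "norm (f x) * norm (g x) \<le> (norm (f x))\<^sup>2 + (norm (g x))\<^sup>2"
      using weighted_am_gm[of 1 "norm (f x)" "norm (g x)"] zero_le_power2[of "norm (f x)"] zero_le_power2[of "norm (g x)"]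
      by linarith
    then show ?thesis by (simp add: norm_mult)
  qed
  then show "AE x in lborel. norm (f x * g x) \<le> norm ((norm (f x))\<^sup>2 + (norm (g x))\<^sup>2)" by simp
qed measurable

context proper_rational
begin

lemma L_ext: "L w \<psi> = (\<integral>x. (indicator X x *\<^sub>R w x) * \<psi> (ext x) \<partial>lborel)"
  unfolding L_def by (intro Bochner_Integration.integral_cong) (auto simp: indicator_def ext_eq)

text \<open>\<open>F\<close> is the image of \<open>u\<close> under the adjoint of the pull-back f
  \<mapsto> J \<cdot> f \<circ> \<Phi>. Its square integrability is an absorption argument: test
  with a cutoff times \<open>cnj F\<close>, split the product by the weighted arithmetic-geometric
  inequality, and push the part without \<open>u\<close> forward to \<Omega>, where it is at most
  half of the left side.\<close>

lemma adjoint_in_bergman_space: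
  assumes bd: "bounded \<Omega>"
    and M: "M > 0" "\<And>f. f \<in> borel_measurable borel \<Longrightarrow>
      (\<integral>\<^sup>+x. ennreal (jn x) * f (ext x) \<partial>lborel) = ennreal M * (\<integral>\<^sup>+y. indicator \<Omega> y * f y \<partial>lborel)"
    and u: "u \<in> rat_on X" "(\<integral>\<^sup>+x. indicator X x * ennreal ((norm (u x))\<^sup>2) \<partial>lborel) < \<infinity>"
  obtains F where "F \<in> bergman_space \<Omega>"
    "\<And>f. f \<in> borel_measurable borel \<Longrightarrow> (\<integral>\<^sup>+y. indicator \<Omega> y * ennreal ((norm (f y))\<^sup>2) \<partial>lborel) < \<infinity> \<Longrightarrow>
      (\<integral>x. indicator X x *\<^sub>R (u x * cnj (jac \<Phi> x) * f (\<Phi> x)) \<partial>lborel) = (\<integral>y. indicator \<Omega> y *\<^sub>R (F y * f y) \<partial>lborel)"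
proof -
  have \<Omega>m [measurable]: "\<Omega> \<in> sets borel" using open_Omega by simp
  define w where "w x = u x * cnj (jac \<Phi> x)" for x
  have w: "dbar_closed w" unfolding w_def by (rule dbar_closed_jac[OF u(1)])
  then have cw: "continuous_on X w" by (simp add: dbar_closed_def)
  obtain F where F: "holo_on \<Omega> F"
    "\<And>K \<psi>. K \<subseteq> \<Omega> \<Longrightarrow> compact K \<Longrightarrow> adm K \<psi> \<Longrightarrow> L w \<psi> = (\<integral>y. indicator \<Omega> y *\<^sub>R (F y * \<psi> y) \<partial>lborel)"
    by (rule L_representation[OF w]) (rule that, assumption+)
  have cF: "continuous_on \<Omega> F" by (rule holo_on_continuous[OF F(1)])
  define W where "W x = indicator X x *\<^sub>R w x" for x
  define F' where "F' y = indicator \<Omega> y *\<^sub>R F y" for y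
  have F'm [measurable]: "F' \<in> borel_measurable borel" unfolding F'_def by (rule holo_indicator_measurable[OF F(1) open_Omega])
  have Wm [measurable]: "W \<in> borel_measurable borel"
    unfolding W_def by (intro borel_measurable_continuous_on_indicator cw borel_open open_X)
  define un where "un x = indicator X x * (norm (u x))\<^sup>2" for x
  define U' where "U' x = indicator X x *\<^sub>R u x" for x
  define J' where "J' x = indicator X x *\<^sub>R cnj (jac \<Phi> x)" for x
  have U'm [measurable]: "U' \<in> borel_measurable borel" unfolding U'_def by (rule rat_indicator_measurable[OF u(1)])
  have J'm [measurable]: "J' \<in> borel_measurable borel"
    unfolding J'_def by (intro borel_measurable_continuous_on_indicator continuous_on_cnj jac_cont borel_open open_X)
  have WUJ: "W x = U' x * J' x" for x by (simp add: W_def U'_def J'_def w_def indicator_def)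
  have jnJ: "(norm (J' x))\<^sup>2 = jn x" for x by (simp add: J'_def jn_def indicator_def)
  have unU: "(norm (U' x))\<^sup>2 = un x" for x by (simp add: U'_def un_def indicator_def)
  obtain a where a: "(\<integral>\<^sup>+x. ennreal ((norm (U' x))\<^sup>2) \<partial>lborel) = ennreal a" "a \<ge> 0"
  proof -
    have "(\<integral>\<^sup>+x. ennreal ((norm (U' x))\<^sup>2) \<partial>lborel) = (\<integral>\<^sup>+x. indicator X x * ennreal ((norm (u x))\<^sup>2) \<partial>lborel)"
      by (intro nn_integral_cong) (auto simp: U'_def indicator_def)
    then have "(\<integral>\<^sup>+x. ennreal ((norm (U' x))\<^sup>2) \<partial>lborel) < \<infinity>" using u(2) by simp
    then show ?thesis by (intro that[of "enn2real (\<integral>\<^sup>+x. ennreal ((norm (U' x))\<^sup>2) \<partial>lborel)"]) auto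
  qed
  have LW: "L w \<psi> = (\<integral>x. W x * \<psi> (ext x) \<partial>lborel)" for \<psi> unfolding W_def by (rule L_ext)
  have WF: "(\<integral>x. W x * \<psi> (ext x) \<partial>lborel) = (\<integral>y. F' y * \<psi> y \<partial>lborel)"
    if "K \<subseteq> \<Omega>" "compact K" "adm K \<psi>" for K \<psi>
    using F(2)[OF that] unfolding LW F'_def by (simp add: scaleR_conv_of_real mult.assoc)
  obtain \<tau> :: "nat \<Rightarrow> complex ^ 'n \<Rightarrow> real" where \<tau>: 
    "\<And>k. continuous_on UNIV (\<tau> k)" "\<And>k x. 0 \<le> \<tau> k x" "\<And>k x. \<tau> k x \<le> 1"
    "\<And>k. \<exists>K. compact K \<and> K \<subseteq> \<Omega> \<and> (\<forall>x. x \<notin> K \<longrightarrow> \<tau> k x = 0)"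
    "\<And>x. incseq (\<lambda>k. \<tau> k x)" "\<And>x. (\<lambda>k. \<tau> k x) \<longlonglongrightarrow> indicator \<Omega> x"
    by (rule cutoff_functions[OF open_Omega bd]) (rule that, assumption+)
  have \<tau>m [measurable]: "\<tau> k \<in> borel_measurable borel" for k by (rule borel_measurable_continuous_onI[OF \<tau>(1)])
  have bound: "(\<integral>\<^sup>+y. ennreal (\<tau> k y * (norm (F' y))\<^sup>2) \<partial>lborel) \<le> ennreal (M * a)" for k
  proof -
    obtain K where K: "compact K" "K \<subseteq> \<Omega>" "\<And>x. x \<notin> K \<Longrightarrow> \<tau> k x = 0" using \<tau>(4)[of k] by blast
    \<comment> \<open>The cutoff makes \<open>\<psi>\<close> an admissible test function and the
      quantity \<open>I\<close> finite, without which it could not be absorbed.\<close>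
    define \<psi> where "\<psi> y = of_real (\<tau> k y) * cnj (F' y)" for y
    have "continuous_on UNIV \<psi>"
    proof (rule continuous_on_extend_zero[OF K(1,2) open_Omega])
      have "continuous_on \<Omega> (\<lambda>y. of_real (\<tau> k y) * cnj (F y))"
        by (intro continuous_intros cF continuous_on_subset[OF \<tau>(1)]) auto
      then show "continuous_on \<Omega> \<psi>" by (rule continuous_on_eq) (simp add: \<psi>_def F'_def)
    qed (simp add: \<psi>_def K(3))
    then have ad: "adm K \<psi>" by (simp add: adm_def \<psi>_def K(3))
    have \<psi>m [measurable]: "\<psi> \<in> borel_measurable borel" unfolding \<psi>_def by measurable
    define I where "I = (\<integral>y. \<tau> k y * (norm (F' y))\<^sup>2 \<partial>lborel)"
    have eqI: "F' y * \<psi> y = of_real (\<tau> k y * (norm (F' y))\<^sup>2)" for y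
      unfolding \<psi>_def of_real_mult complex_norm_square by (simp add: mult_ac)
    have int: "integrable lborel (\<lambda>y. \<tau> k y * (norm (F' y))\<^sup>2)"
    proof -
      have "continuous_on K (\<lambda>y. \<tau> k y * (norm (F y))\<^sup>2)"
        by (intro continuous_intros continuous_on_subset[OF cF K(2)] continuous_on_subset[OF \<tau>(1)]) auto
      then have "integrable lborel (\<lambda>y. indicator K y *\<^sub>R (\<tau> k y * (norm (F y))\<^sup>2))" by (rule borel_integrable_compact[OF K(1)])
      also have "(\<lambda>y. indicator K y *\<^sub>R (\<tau> k y * (norm (F y))\<^sup>2)) = (\<lambda>y. \<tau> k y * (norm (F' y))\<^sup>2)"
        by (rule ext) (use K(2,3) in \<open>auto simp: F'_def indicator_def\<close>)
      finally show ?thesis .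
    qed
    have I0: "I \<ge> 0" unfolding I_def by (intro Bochner_Integration.integral_nonneg) (simp add: \<tau>)
    have nnI: "(\<integral>\<^sup>+y. ennreal (\<tau> k y * (norm (F' y))\<^sup>2) \<partial>lborel) = ennreal I"
      unfolding I_def by (rule nn_integral_eq_integral[OF int]) (simp add: \<tau>)
    have W\<psi>: "W x * \<psi> (ext x) = indicator X x *\<^sub>R (w x * \<psi> (\<Phi> x))" for x
      by (auto simp: W_def ext_def indicator_def)
    have "(\<integral>x. W x * \<psi> (ext x) \<partial>lborel) = of_real I"
      unfolding WF[OF K(2,1) ad] eqI I_def by (rule integral_complex_of_real)
    then have "ennreal I = ennreal (norm (\<integral>x. W x * \<psi> (ext x) \<partial>lborel))" using I0 by simp
    also have "\<dots> \<le> (\<integral>\<^sup>+x. ennreal (norm (W x * \<psi> (ext x))) \<partial>lborel)"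
      by (rule integral_norm_bound_ennreal) (unfold W\<psi>, rule L_integrable[OF cw K(2,1) ad])
    also have "\<dots> \<le> (\<integral>\<^sup>+x. ennreal (M / 2) * ennreal ((norm (U' x))\<^sup>2) + ennreal (1 / (2 * M)) * (ennreal (jn x) * ennreal ((norm (\<psi> (ext x)))\<^sup>2)) \<partial>lborel)"
    proof (rule nn_integral_mono)
      fix x
      have "norm (W x * \<psi> (ext x)) = norm (U' x) * (norm (J' x) * norm (\<psi> (ext x)))" by (simp add: WUJ norm_mult)
      also have "\<dots> \<le> M / 2 * (norm (U' x))\<^sup>2 + 1 / (2 * M) * (jn x * (norm (\<psi> (ext x)))\<^sup>2)"
        using weighted_am_gm[OF M(1), of "norm (U' x)" "norm (J' x) * norm (\<psi> (ext x))"] by (simp add: power_mult_distrib jnJ)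
      finally have "ennreal (norm (W x * \<psi> (ext x))) \<le> ennreal (M / 2 * (norm (U' x))\<^sup>2 + 1 / (2 * M) * (jn x * (norm (\<psi> (ext x)))\<^sup>2))"
        by (rule ennreal_leI)
      also have "\<dots> = ennreal (M / 2) * ennreal ((norm (U' x))\<^sup>2) + ennreal (1 / (2 * M)) * (ennreal (jn x) * ennreal ((norm (\<psi> (ext x)))\<^sup>2))"
        by (rule ennreal_sum_prod) (use M(1) jn_nonneg in auto)
      finally show "ennreal (norm (W x * \<psi> (ext x))) \<le> ennreal (M / 2) * ennreal ((norm (U' x))\<^sup>2) + ennreal (1 / (2 * M)) * (ennreal (jn x) * ennreal ((norm (\<psi> (ext x)))\<^sup>2))" .
    qed
    also have "\<dots> = ennreal (M / 2) * ennreal a + ennreal (1 / (2 * M)) * (\<integral>\<^sup>+x. ennreal (jn x) * ennreal ((norm (\<psi> (ext x)))\<^sup>2) \<partial>lborel)"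
      by (subst nn_integral_add) (auto simp: nn_integral_cmult a)
    finally have s1: "ennreal I \<le> ennreal (M / 2) * ennreal a + ennreal (1 / (2 * M)) * (\<integral>\<^sup>+x. ennreal (jn x) * ennreal ((norm (\<psi> (ext x)))\<^sup>2) \<partial>lborel)" .
    have s2: "(\<integral>\<^sup>+x. ennreal (jn x) * ennreal ((norm (\<psi> (ext x)))\<^sup>2) \<partial>lborel) = ennreal M * (\<integral>\<^sup>+y. indicator \<Omega> y * ennreal ((norm (\<psi> y))\<^sup>2) \<partial>lborel)"
      by (rule M(2)) measurable
    have "(\<integral>\<^sup>+y. indicator \<Omega> y * ennreal ((norm (\<psi> y))\<^sup>2) \<partial>lborel) \<le> (\<integral>\<^sup>+y. ennreal (\<tau> k y * (norm (F' y))\<^sup>2) \<partial>lborel)"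
    proof (rule nn_integral_mono)
      fix y
      have "(\<tau> k y)\<^sup>2 \<le> \<tau> k y" using \<tau>(2,3)[of k y] by (simp add: power2_eq_square mult_left_le)
      then have "(norm (\<psi> y))\<^sup>2 \<le> \<tau> k y * (norm (F' y))\<^sup>2"
        by (simp add: \<psi>_def norm_mult power_mult_distrib mult_right_mono)
      then show "indicator \<Omega> y * ennreal ((norm (\<psi> y))\<^sup>2) \<le> ennreal (\<tau> k y * (norm (F' y))\<^sup>2)"
        by (auto simp: indicator_def intro: ennreal_leI)
    qed
    also have "\<dots> = ennreal I" by (rule nnI)
    finally have "(\<integral>\<^sup>+y. indicator \<Omega> y * ennreal ((norm (\<psi> y))\<^sup>2) \<partial>lborel) \<le> ennreal I" .
    then have "ennreal (M / 2) * ennreal a + ennreal (1 / (2 * M)) * (\<integral>\<^sup>+x. ennreal (jn x) * ennreal ((norm (\<psi> (ext x)))\<^sup>2) \<partial>lborel)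
       \<le> ennreal (M / 2) * ennreal a + ennreal (1 / (2 * M)) * (ennreal M * ennreal I)"
      unfolding s2 by (intro add_left_mono mult_left_mono) auto
    with s1 have "ennreal I \<le> ennreal (M / 2) * ennreal a + ennreal (1 / (2 * M)) * (ennreal M * ennreal I)"
      by (rule order_trans)
    also have "\<dots> = ennreal (M / 2 * a + 1 / (2 * M) * (M * I))"
      by (rule ennreal_sum_prod[symmetric]) (use M(1) a(2) I0 in auto)
    finally have "I \<le> M / 2 * a + 1 / (2 * M) * (M * I)"
      by (subst (asm) ennreal_le_iff) (use M(1) a(2) I0 in auto)
    \<comment> \<open>The weights \<open>M / 2\<close> and \<open>1 / (2 * M)\<close> of the
      arithmetic-geometric inequality are chosen so that the push-forward constant cancels and
      exactly half of \<open>I\<close> comes back.\<close>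
    also have "1 / (2 * M) * (M * I) = I / 2" using M(1) by simp
    finally have "I \<le> M * a" by simp
    then show ?thesis unfolding nnI by (rule ennreal_leI)
  qed
  have F'L2: "(\<integral>\<^sup>+y. ennreal ((norm (F' y))\<^sup>2) \<partial>lborel) \<le> ennreal (M * a)"
  proof -
    have "(\<lambda>k. \<integral>\<^sup>+y. ennreal (\<tau> k y * (norm (F' y))\<^sup>2) \<partial>lborel) \<longlonglongrightarrow> (\<integral>\<^sup>+y. ennreal (indicator \<Omega> y * (norm (F' y))\<^sup>2) \<partial>lborel)"
    proof (rule nn_integral_LIMSEQ)
      show "incseq (\<lambda>k y. ennreal (\<tau> k y * (norm (F' y))\<^sup>2))"
        using \<tau>(5) by (intro incseq_SucI le_funI ennreal_leI mult_right_mono) (auto simp: incseq_Suc_iff)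
      show "(\<lambda>k. ennreal (\<tau> k y * (norm (F' y))\<^sup>2)) \<longlonglongrightarrow> ennreal (indicator \<Omega> y * (norm (F' y))\<^sup>2)" for y
        by (intro tendsto_ennrealI tendsto_mult_right \<tau>(6))
    qed measurable
    then have "(\<integral>\<^sup>+y. ennreal (indicator \<Omega> y * (norm (F' y))\<^sup>2) \<partial>lborel) \<le> ennreal (M * a)"
      by (rule LIMSEQ_le_const2) (use bound in auto)
    also have "(\<integral>\<^sup>+y. ennreal (indicator \<Omega> y * (norm (F' y))\<^sup>2) \<partial>lborel) = (\<integral>\<^sup>+y. ennreal ((norm (F' y))\<^sup>2) \<partial>lborel)"
      by (intro nn_integral_cong) (auto simp: F'_def indicator_def)
    finally show ?thesis .
  qed
  then have F'fin: "(\<integral>\<^sup>+y. ennreal ((norm (F' y))\<^sup>2) \<partial>lborel) < \<infinity>" by (auto intro: le_less_trans)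
  have Jfin: "(\<integral>\<^sup>+x. ennreal ((norm (J' x))\<^sup>2) \<partial>lborel) < \<infinity>"
  proof -
    have "(\<integral>\<^sup>+x. ennreal (jn x) * 1 \<partial>lborel) = ennreal M * (\<integral>\<^sup>+y. indicator \<Omega> y * 1 \<partial>lborel)"
      by (rule M(2)[of "\<lambda>_. 1"]) simp
    then show ?thesis unfolding jnJ using emeasure_bounded_finite[OF bd]
      by (simp add: ennreal_mult_less_top)
  qed
  have iW: "integrable lborel W"
    unfolding WUJ[abs_def] by (rule integrable_from_sq) (use a Jfin in auto)
  have iF: "integrable lborel F'"
  proof -
    have "integrable lborel (\<lambda>y. F' y * indicator \<Omega> y)"
    proof (rule integrable_from_sq[OF _ _ F'fin])
      have "(\<integral>\<^sup>+y. ennreal ((norm (indicator \<Omega> y :: complex))\<^sup>2) \<partial>lborel) = (\<integral>\<^sup>+y. indicator \<Omega> y \<partial>lborel)"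
        by (intro nn_integral_cong) (auto simp: indicator_def)
      then show "(\<integral>\<^sup>+y. ennreal ((norm (indicator \<Omega> y :: complex))\<^sup>2) \<partial>lborel) < \<infinity>"
        using emeasure_bounded_finite[OF bd] by simp
    qed measurable
    also have "(\<lambda>y. F' y * indicator \<Omega> y) = F'" by (auto simp: F'_def indicator_def)
    finally show ?thesis .
  qed
  have op: "(\<integral>x. W x * indicator G (ext x) \<partial>lborel) = (\<integral>y. F' y * indicator G y \<partial>lborel)" if G: "open G" for G
  proof -
    let ?U = "G \<inter> \<Omega>"
    have U: "open ?U" "bounded ?U" using G open_Omega bd by (auto intro: bounded_subset)
    obtain \<sigma> :: "nat \<Rightarrow> complex ^ 'n \<Rightarrow> real" where \<sigma>: 
      "\<And>k. continuous_on UNIV (\<sigma> k)" "\<And>k x. 0 \<le> \<sigma> k x" "\<And>k x. \<sigma> k x \<le> 1"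
      "\<And>k. \<exists>K. compact K \<and> K \<subseteq> ?U \<and> (\<forall>x. x \<notin> K \<longrightarrow> \<sigma> k x = 0)"
      "\<And>x. incseq (\<lambda>k. \<sigma> k x)" "\<And>x. (\<lambda>k. \<sigma> k x) \<longlonglongrightarrow> indicator ?U x"
      by (rule cutoff_functions[OF U]) (rule that, assumption+)
    have \<sigma>m [measurable]: "\<sigma> k \<in> borel_measurable borel" for k by (rule borel_measurable_continuous_onI[OF \<sigma>(1)])
    have [measurable]: "?U \<in> sets borel" using U(1) by simp
    have \<sigma>lim: "(\<lambda>k. complex_of_real (\<sigma> k x)) \<longlonglongrightarrow> of_real (indicator ?U x)" for x
      by (intro tendsto_of_real \<sigma>(6))
    have "(\<lambda>k. \<integral>x. W x * of_real (\<sigma> k (ext x)) \<partial>lborel) \<longlonglongrightarrow> (\<integral>x. W x * of_real (indicator ?U (ext x)) \<partial>lborel)"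
    proof (rule integral_dominated_convergence[where w="\<lambda>x. norm (W x)"])
      show "AE x in lborel. (\<lambda>k. W x * of_real (\<sigma> k (ext x))) \<longlonglongrightarrow> W x * of_real (indicator ?U (ext x))"
        by (intro AE_I2 tendsto_mult_left \<sigma>lim)
      show "AE x in lborel. norm (W x * of_real (\<sigma> k (ext x))) \<le> norm (W x)" for k
        using \<sigma>(2,3) by (intro AE_I2) (simp add: norm_mult mult_left_le)
      show "integrable lborel (\<lambda>x. norm (W x))" by (rule integrable_norm[OF iW])
    qed measurable
    moreover have "(\<lambda>k. \<integral>x. F' x * of_real (\<sigma> k x) \<partial>lborel) \<longlonglongrightarrow> (\<integral>x. F' x * of_real (indicator ?U x) \<partial>lborel)"
    proof (rule integral_dominated_convergence[where w="\<lambda>x. norm (F' x)"])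
      show "AE x in lborel. (\<lambda>k. F' x * of_real (\<sigma> k x)) \<longlonglongrightarrow> F' x * of_real (indicator ?U x)"
        by (intro AE_I2 tendsto_mult_left \<sigma>lim)
      show "AE x in lborel. norm (F' x * of_real (\<sigma> k x)) \<le> norm (F' x)" for k
        using \<sigma>(2,3) by (intro AE_I2) (simp add: norm_mult mult_left_le)
      show "integrable lborel (\<lambda>x. norm (F' x))" by (rule integrable_norm[OF iF])
    qed measurable
    moreover have "(\<integral>x. W x * of_real (\<sigma> k (ext x)) \<partial>lborel) = (\<integral>x. F' x * of_real (\<sigma> k x) \<partial>lborel)" for k
    proof -
      obtain K where K: "compact K" "K \<subseteq> ?U" "\<And>x. x \<notin> K \<Longrightarrow> \<sigma> k x = 0" using \<sigma>(4)[of k] by blast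
      show ?thesis
        by (rule WF[of K "\<lambda>x. of_real (\<sigma> k x)"]) (use K \<sigma>(1) in \<open>auto simp: adm_def intro: continuous_on_of_real\<close>)
    qed
    ultimately have "(\<integral>x. W x * of_real (indicator ?U (ext x)) \<partial>lborel) = (\<integral>x. F' x * of_real (indicator ?U x) \<partial>lborel)"
      using LIMSEQ_unique by (simp only:)
    moreover have "W x * of_real (indicator ?U (ext x)) = W x * indicator G (ext x)" for x
      using maps by (auto simp: W_def ext_def indicator_def)
    moreover have "F' x * of_real (indicator ?U x) = F' x * indicator G x" for x
      by (auto simp: F'_def indicator_def)
    ultimately show ?thesis by simp
  qed
  show ?thesis
  proof (rule that[of F])
    have "(\<integral>\<^sup>+y. indicator \<Omega> y * ennreal ((cmod (F y))\<^sup>2) \<partial>lborel) = (\<integral>\<^sup>+y. ennreal ((norm (F' y))\<^sup>2) \<partial>lborel)"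
      by (intro nn_integral_cong) (auto simp: F'_def indicator_def)
    then show "F \<in> bergman_space \<Omega>" using F(1) F'fin by (simp add: bergman_space_iff[OF open_Omega])
    fix f :: "complex ^ 'n \<Rightarrow> complex"
    assume fm [measurable]: "f \<in> borel_measurable borel" and ff: "(\<integral>\<^sup>+y. indicator \<Omega> y * ennreal ((norm (f y))\<^sup>2) \<partial>lborel) < \<infinity>"
    have "(\<integral>\<^sup>+x. ennreal ((norm (J' x * f (ext x)))\<^sup>2) \<partial>lborel) = (\<integral>\<^sup>+x. ennreal (jn x) * ennreal ((norm (f (ext x)))\<^sup>2) \<partial>lborel)"
      by (intro nn_integral_cong) (simp add: norm_mult power_mult_distrib jnJ ennreal_mult jn_nonneg)
    also have "\<dots> = ennreal M * (\<integral>\<^sup>+y. indicator \<Omega> y * ennreal ((norm (f y))\<^sup>2) \<partial>lborel)" by (rule M(2)) measurable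
    also have "\<dots> < \<infinity>" using ff by (simp add: ennreal_mult_less_top)
    finally have "integrable lborel (\<lambda>x. U' x * (J' x * f (ext x)))"
      by (intro integrable_from_sq) (use a in auto)
    then have 1: "integrable lborel (\<lambda>x. W x * f (ext x))" by (simp add: WUJ mult.assoc)
    have "integrable lborel (\<lambda>y. F' y * (indicator \<Omega> y *\<^sub>R f y))"
    proof (rule integrable_from_sq[OF _ _ F'fin])
      have "(\<integral>\<^sup>+y. ennreal ((norm (indicator \<Omega> y *\<^sub>R f y))\<^sup>2) \<partial>lborel) = (\<integral>\<^sup>+y. indicator \<Omega> y * ennreal ((norm (f y))\<^sup>2) \<partial>lborel)"
        by (intro nn_integral_cong) (auto simp: indicator_def)
      then show "(\<integral>\<^sup>+y. ennreal ((norm (indicator \<Omega> y *\<^sub>R f y))\<^sup>2) \<partial>lborel) < \<infinity>" using ff by simp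
    qed measurable
    also have "(\<lambda>y. F' y * (indicator \<Omega> y *\<^sub>R f y)) = (\<lambda>y. F' y * f y)" by (auto simp: F'_def indicator_def)
    finally have 2: "integrable lborel (\<lambda>y. F' y * f y)" .
    have "(\<integral>x. W x * f (ext x) \<partial>lborel) = (\<integral>y. F' y * f y \<partial>lborel)"
      by (rule complex_push_forward_eq[OF iW iF ext_measurable op fm 1 2])
    moreover have "indicator X x *\<^sub>R (u x * cnj (jac \<Phi> x) * f (\<Phi> x)) = W x * f (ext x)" for x
      by (auto simp: W_def w_def ext_def indicator_def)
    moreover have "indicator \<Omega> y *\<^sub>R (F y * f y) = F' y * f y" for y
      by (auto simp: F'_def indicator_def)
    ultimately show "(\<integral>x. indicator X x *\<^sub>R (u x * cnj (jac \<Phi> x) * f (\<Phi> x)) \<partial>lborel) = (\<integral>y. indicator \<Omega> y *\<^sub>R (F y * f y) \<partial>lborel)"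
      by simp
  qed
qed

text \<open>One half of Bell's transformation rule for the Bergman projection.\<close>
lemma pull_back_orthogonal:
  assumes bd: "bounded \<Omega>"
    and M: "M > 0" "\<And>f. f \<in> borel_measurable borel \<Longrightarrow>
      (\<integral>\<^sup>+x. ennreal (jn x) * f (ext x) \<partial>lborel) = ennreal M * (\<integral>\<^sup>+y. indicator \<Omega> y * f y \<partial>lborel)"
    and u: "u \<in> rat_on X" "(\<integral>\<^sup>+x. indicator X x * ennreal ((norm (u x))\<^sup>2) \<partial>lborel) < \<infinity>"
    and f: "f \<in> borel_measurable borel" "(\<integral>\<^sup>+y. indicator \<Omega> y * ennreal ((norm (f y))\<^sup>2) \<partial>lborel) < \<infinity>"
    and orth: "\<And>g. g \<in> bergman_space \<Omega> \<Longrightarrow> (\<integral>y. indicator \<Omega> y *\<^sub>R (f y * cnj (g y)) \<partial>lborel) = 0"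
  shows "(\<integral>x. indicator X x *\<^sub>R (jac \<Phi> x * f (\<Phi> x) * cnj (u x)) \<partial>lborel) = 0"
proof -
  obtain F where F: "F \<in> bergman_space \<Omega>"
    "\<And>f. f \<in> borel_measurable borel \<Longrightarrow> (\<integral>\<^sup>+y. indicator \<Omega> y * ennreal ((norm (f y))\<^sup>2) \<partial>lborel) < \<infinity> \<Longrightarrow>
      (\<integral>x. indicator X x *\<^sub>R (u x * cnj (jac \<Phi> x) * f (\<Phi> x)) \<partial>lborel) = (\<integral>y. indicator \<Omega> y *\<^sub>R (F y * f y) \<partial>lborel)"
    by (rule adjoint_in_bergman_space[OF bd M u]) (assumption, rule that, assumption+)
  have "(\<integral>x. indicator X x *\<^sub>R (jac \<Phi> x * f (\<Phi> x) * cnj (u x)) \<partial>lborel)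
     = (\<integral>x. cnj (indicator X x *\<^sub>R (u x * cnj (jac \<Phi> x) * cnj (f (\<Phi> x)))) \<partial>lborel)"
    by (simp add: mult_ac)
  also have "\<dots> = cnj (\<integral>x. indicator X x *\<^sub>R (u x * cnj (jac \<Phi> x) * cnj (f (\<Phi> x))) \<partial>lborel)"
    by (rule Bochner_Integration.integral_cnj)
  also have "(\<integral>x. indicator X x *\<^sub>R (u x * cnj (jac \<Phi> x) * cnj (f (\<Phi> x))) \<partial>lborel) = (\<integral>y. indicator \<Omega> y *\<^sub>R (F y * cnj (f y)) \<partial>lborel)"
    by (rule F(2)) (use f in auto)
  also have "cnj \<dots> = (\<integral>y. cnj (indicator \<Omega> y *\<^sub>R (F y * cnj (f y))) \<partial>lborel)" by (rule Bochner_Integration.integral_cnj[symmetric])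
  also have "\<dots> = (\<integral>y. indicator \<Omega> y *\<^sub>R (f y * cnj (F y)) \<partial>lborel)" by (simp add: mult_ac)
  also have "\<dots> = 0" by (rule orth[OF F(1)])
  finally show ?thesis .
qed

end

section \<open>Positivity of the multiplicity\<close>

lemma rank_less_if_not_surj:
  fixes f :: "real ^ 'm \<Rightarrow> real ^ 'm"
  assumes "linear f" "\<not> surj f" shows "rank (matrix f) < CARD('m)"
proof -
  have "(\<lambda>x. matrix f *v x) = f" by (rule matrix_vector_mul(2)[OF assms(1)])
  then have "rank (matrix f) \<noteq> CARD('m)" using assms(2) full_rank_surjective[of "matrix f"] by metis
  then show ?thesis using rank_bound[of "matrix f"] by simp
qed

text \<open>The library's Sard theorem needs a well-ordered index type; \<open>'n bit0\<close> supplies one of cardinality \<open>2 n\<close>.\<close>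
lemma sard_complex:
  fixes \<Phi> :: "complex ^ 'n \<Rightarrow> complex ^ 'n"
  assumes der: "\<And>x. x \<in> X \<Longrightarrow> (\<Phi> has_derivative D x) (at x)" and ns: "\<And>x. x \<in> X \<Longrightarrow> \<not> surj (D x)"
  shows "negligible (\<Phi> ` X)"
proof -
  have dim: "DIM(complex ^ 'n) = DIM(real ^ 'n bit0)" by (simp add: mult.commute)
  obtain T :: "complex ^ 'n \<Rightarrow> real ^ 'n bit0" and T' where T: "linear T" "linear T'"
    "\<And>x. T' (T x) = x" "\<And>y. T (T' y) = y"
    by (rule isomorphisms_UNIV_UNIV[OF dim]) blast
  have bT: "bounded_linear T" "bounded_linear T'" using T by (auto simp: linear_conv_bounded_linear)
  define f where "f y = T (\<Phi> (T' y))" for y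
  have "negligible (f ` (T ` X))"
  proof (rule baby_Sard[where f'="\<lambda>y h. T (D (T' y) (T' h))"])
    fix y assume "y \<in> T ` X"
    then have x: "T' y \<in> X" using T by auto
    have "((\<lambda>y. \<Phi> (T' y)) has_derivative (\<lambda>h. D (T' y) (T' h))) (at y)"
      by (rule has_derivative_compose[OF bounded_linear_imp_has_derivative[OF bT(2)] der[OF x]])
    then have "(f has_derivative (\<lambda>h. T (D (T' y) (T' h)))) (at y)"
      unfolding f_def by (rule bounded_linear.has_derivative[OF bT(1)])
    then show "(f has_derivative (\<lambda>h. T (D (T' y) (T' h)))) (at y within T ` X)"
      by (rule has_derivative_at_withinI)
    show "rank (matrix (\<lambda>h. T (D (T' y) (T' h)))) < CARD('n bit0)"
    proof (rule rank_less_if_not_surj)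
      show "linear (\<lambda>h. T (D (T' y) (T' h)))"
        using \<open>(f has_derivative (\<lambda>h. T (D (T' y) (T' h)))) (at y)\<close> by (rule has_derivative_linear)
      show "\<not> surj (\<lambda>h. T (D (T' y) (T' h)))"
      proof
        assume s: "surj (\<lambda>h. T (D (T' y) (T' h)))"
        have "surj (D (T' y))"
          unfolding surj_def
        proof
          fix z
          obtain h where "T z = T (D (T' y) (T' h))" using s unfolding surj_def by blast
          then have "z = D (T' y) (T' h)" by (metis T(3))
          then show "\<exists>x. z = D (T' y) x" by blast
        qed
        then show False using ns[OF x] by blast
      qed
    qed
  qed simp
  moreover have "\<Phi> ` X = T' ` (f ` (T ` X))" by (auto simp: f_def T image_image)
  moreover have "negligible (T' ` S)" if "negligible S" for S
    by (rule negligible_differentiable_image_negligible[OF _ that])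
      (use dim bT(2) in \<open>auto intro: bounded_linear_imp_differentiable_on\<close>)
  ultimately show ?thesis by simp
qed

lemma not_surj_if_det_zero:
  fixes A :: "complex ^ 'n ^ 'n"
  assumes "det A = 0" shows "\<not> surj (\<lambda>h. A *v h)"
proof
  assume "surj (\<lambda>h. A *v h)"
  then obtain B where "A ** B = mat 1" using matrix_right_invertible_surjective[of A] by blast
  then have "det A * det B = 1" by (metis det_I det_mul)
  then show False using assms by simp
qed

context proper_rational
begin

text \<open>If \<open>M\<close> were 0, the Jacobian would vanish almost everywhere, hence
  everywhere by continuity. Every point of \<open>X\<close> would be critical and the image
  negligible by Sard, yet the image is the nonempty open set \<Omega>.\<close>

lemma jac_push_positive:
  assumes im: "\<Phi> ` X = \<Omega>" and ne: "\<Omega> \<noteq> {}"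
    and M: "M \<ge> 0" "\<And>f. f \<in> borel_measurable borel \<Longrightarrow>
      (\<integral>\<^sup>+x. ennreal (jn x) * f (ext x) \<partial>lborel) = ennreal M * (\<integral>\<^sup>+y. indicator \<Omega> y * f y \<partial>lborel)"
  shows "M > 0"
proof (rule ccontr)
  assume "\<not> M > 0"
  then have "M = 0" using M(1) by simp
  then have "(\<integral>\<^sup>+x. ennreal (jn x) \<partial>lborel) = 0" using M(2)[of "\<lambda>_. 1"] by simp
  then have "AE x in lborel. ennreal (jn x) = 0" by (subst (asm) nn_integral_0_iff_AE) auto
  then have ae: "AE x in lborel. jn x = 0"
    by eventually_elim (metis antisym ennreal_eq_0_iff jn_nonneg)
  have J0: "jac \<Phi> x = 0" if x: "x \<in> X" for x
  proof (rule ccontr)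
    assume n: "jac \<Phi> x \<noteq> 0"
    let ?S = "X \<inter> jac \<Phi> -` (- {0})"
    have op: "open ?S" by (rule continuous_open_preimage[OF jac_cont open_X]) auto
    have "{x \<in> space lborel. jn x \<noteq> 0} \<in> sets lborel" by measurable
    then have nullB: "{x. jn x \<noteq> 0} \<in> null_sets lborel"
      using ae AE_iff_null[of lborel "\<lambda>x. jn x = 0"] by simp
    have sub: "?S \<subseteq> {x. jn x \<noteq> 0}" by (auto simp: jn_def)
    have meas: "?S \<in> sets lborel" using op by simp
    have "?S \<in> null_sets lborel" by (rule null_sets_subset[OF nullB meas sub])
    then have "negligible ?S"
      unfolding negligible_iff_null_sets by (rule null_sets_completionI)
    then show False using open_not_negligible[OF op] x n by auto
  qed
  have "negligible (\<Phi> ` X)"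
  proof (rule sard_complex[where D="\<lambda>x h. (\<chi> i k. pd (\<lambda>z. \<Phi> z $ i) k x) *v h"])
    fix x assume x: "x \<in> X"
    have "(\<Phi> has_derivative (\<lambda>h. \<chi> i. \<Sum>k\<in>UNIV. pd (\<lambda>z. \<Phi> z $ i) k x * h $ k)) (at x)"
      by (rule has_derivative_vec) (rule cdiffD[OF rat_on_cdiff[OF rat open_X x]])
    then show "(\<Phi> has_derivative (\<lambda>h. (\<chi> i k. pd (\<lambda>z. \<Phi> z $ i) k x) *v h)) (at x)"
      by (simp add: matrix_vector_mult_def)
    show "\<not> surj (\<lambda>h. (\<chi> i k. pd (\<lambda>z. \<Phi> z $ i) k x) *v h)"
      by (rule not_surj_if_det_zero) (use J0[OF x] in \<open>simp add: jac_def\<close>)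
  qed
  then show False using open_not_negligible[OF open_Omega ne] im by simp
qed

end

section \<open>Half planes and the Cayley transform\<close>

lemma Basis_vec_complex: "(Basis :: (complex ^ 'n) set) = (\<lambda>(i, b). axis i b) ` (UNIV \<times> Basis)"
  unfolding Basis_vec_def by auto

lemma prod_Basis_vec:
  fixes f :: "complex ^ 'n \<Rightarrow> 'b::comm_monoid_mult"
  shows "(\<Prod>b\<in>Basis. f b) = (\<Prod>i\<in>UNIV. \<Prod>b\<in>Basis. f (axis i b))"
proof -
  have inj: "inj_on (\<lambda>(i, b). axis i b :: complex ^ 'n) (UNIV \<times> Basis)"
    by (auto simp: inj_on_def axis_eq_axis)
  have "(\<Prod>b\<in>Basis. f b) = (\<Prod>p\<in>UNIV \<times> Basis. f ((\<lambda>(i, b). axis i b) p))"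
    unfolding Basis_vec_complex by (rule prod.reindex[OF inj, unfolded o_def])
  also have "\<dots> = (\<Prod>i\<in>UNIV. \<Prod>b\<in>Basis. f (axis i b))"
    by (simp add: prod.cartesian_product case_prod_beta)
  finally show ?thesis .
qed

lemma vec_lambda_measurable:
  "(\<lambda>f. \<chi> i. (f i :: complex)) \<in> measurable (Pi\<^sub>M (UNIV :: 'n::finite set) (\<lambda>_. lborel)) borel"
proof (rule borel_measurable_euclidean_space[THEN iffD2], rule ballI)
  fix b :: "complex ^ 'n" assume "b \<in> Basis"
  then obtain i c where b: "b = axis i c" unfolding Basis_vec_complex by auto
  have "(\<lambda>f. f i \<bullet> c) \<in> borel_measurable (Pi\<^sub>M (UNIV :: 'n set) (\<lambda>_. lborel :: complex measure))"
    by measurable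
  then show "(\<lambda>f. (\<chi> i. f i) \<bullet> b) \<in> borel_measurable (Pi\<^sub>M UNIV (\<lambda>_. lborel))"
    by (simp add: b inner_axis)
qed

text \<open>Both measures agree on boxes. This opens the way to integrating one complex coordinate
  at a time.\<close>

lemma lborel_vec_eq:
  "(lborel :: (complex ^ 'n) measure) = distr (Pi\<^sub>M (UNIV :: 'n set) (\<lambda>_. lborel)) borel (\<lambda>f. \<chi> i. f i)"
proof (rule lborel_eqI)
  interpret product_sigma_finite "\<lambda>_ :: 'n. lborel :: complex measure" by standard
  fix l u :: "complex ^ 'n" assume le: "\<And>b. b \<in> Basis \<Longrightarrow> l \<bullet> b \<le> u \<bullet> b"
  have le': "l $ i \<bullet> b \<le> u $ i \<bullet> b" if "b \<in> Basis" for i b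
    using le[of "axis i b"] that by (auto simp: Basis_vec_complex inner_axis)
  have pre: "(\<lambda>f. \<chi> i. f i) -` box l u \<inter> space (Pi\<^sub>M UNIV (\<lambda>_. lborel)) = Pi\<^sub>E UNIV (\<lambda>i. box (l $ i) (u $ i))"
    by (auto simp: Pi_iff mem_box space_PiM PiE_def Basis_vec_complex inner_axis)
  have "emeasure (distr (Pi\<^sub>M (UNIV :: 'n set) (\<lambda>_. lborel)) borel (\<lambda>f. \<chi> i. f i)) (box l u)
     = emeasure (Pi\<^sub>M UNIV (\<lambda>_. lborel)) (Pi\<^sub>E UNIV (\<lambda>i. box (l $ i) (u $ i)))"
    by (subst emeasure_distr[OF vec_lambda_measurable]) (auto simp: pre)
  also have "\<dots> = (\<Prod>i\<in>UNIV. emeasure lborel (box (l $ i) (u $ i)))"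
    by (rule emeasure_PiM) auto
  also have "\<dots> = (\<Prod>i\<in>UNIV. ennreal (\<Prod>b\<in>Basis. (u $ i - l $ i) \<bullet> b))"
    by (intro prod.cong refl emeasure_lborel_box) (rule le')
  also have "\<dots> = ennreal (\<Prod>i\<in>UNIV. \<Prod>b\<in>Basis. (u $ i - l $ i) \<bullet> b)"
    by (rule prod_ennreal) (auto intro!: prod_nonneg simp: inner_diff_left le')
  also have "(\<Prod>i\<in>UNIV. \<Prod>b\<in>Basis. (u $ i - l $ i) \<bullet> b) = (\<Prod>b\<in>Basis. (u - l) \<bullet> b)"
    unfolding prod_Basis_vec by (simp add: inner_axis)
  finally show "emeasure (distr (Pi\<^sub>M (UNIV :: 'n set) (\<lambda>_. lborel)) borel (\<lambda>f. \<chi> i. f i)) (box l u) = (\<Prod>b\<in>Basis. (u - l) \<bullet> b)" .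
qed simp

lemma nn_integral_vec:
  fixes f :: "complex ^ 'n \<Rightarrow> ennreal"
  assumes "f \<in> borel_measurable borel"
  shows "(\<integral>\<^sup>+z. f z \<partial>lborel) = (\<integral>\<^sup>+x. f (\<chi> i. x i) \<partial>Pi\<^sub>M UNIV (\<lambda>_. lborel))"
  by (subst lborel_vec_eq) (rule nn_integral_distr[OF vec_lambda_measurable], use assms in auto)

lemma lborel_complex_eq:
  "(lborel :: complex measure) = distr (lborel \<Otimes>\<^sub>M lborel) borel (\<lambda>(x, y). Complex x y)"
proof (rule lborel_eqI)
  have m: "(\<lambda>(x, y). Complex x y) \<in> measurable (lborel \<Otimes>\<^sub>M lborel) borel"
    by (rule borel_measurable_complex_iff[THEN iffD2]) (auto simp: case_prod_beta)
  fix l u :: complex assume le: "\<And>b. b \<in> Basis \<Longrightarrow> l \<bullet> b \<le> u \<bullet> b"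
  have le': "Re l \<le> Re u" "Im l \<le> Im u" using le[of 1] le[of \<i>] by (auto simp: Basis_complex_def)
  have pre: "(\<lambda>(x, y). Complex x y) -` box l u \<inter> space (lborel \<Otimes>\<^sub>M lborel) = {Re l<..<Re u} \<times> {Im l<..<Im u}"
    by (auto simp: mem_box Basis_complex_def space_pair_measure)
  have "emeasure (distr (lborel \<Otimes>\<^sub>M lborel) borel (\<lambda>(x, y). Complex x y)) (box l u) = emeasure (lborel \<Otimes>\<^sub>M lborel) ({Re l<..<Re u} \<times> {Im l<..<Im u})"
    by (subst emeasure_distr[OF m]) (auto simp: pre)
  also have "\<dots> = ennreal (Re u - Re l) * ennreal (Im u - Im l)"
    using le' by (subst lborel.emeasure_pair_measure_Times) auto
  also have "\<dots> = (\<Prod>b\<in>Basis. (u - l) \<bullet> b)"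
    using le' by (simp add: Basis_complex_def ennreal_mult[symmetric])
  finally show "emeasure (distr (lborel \<Otimes>\<^sub>M lborel) borel (\<lambda>(x, y). Complex x y)) (box l u) = (\<Prod>b\<in>Basis. (u - l) \<bullet> b)" .
qed simp

lemma nn_integral_complex:
  fixes f :: "complex \<Rightarrow> ennreal"
  assumes [measurable]: "f \<in> borel_measurable borel"
  shows "(\<integral>\<^sup>+z. f z \<partial>lborel) = (\<integral>\<^sup>+y. \<integral>\<^sup>+x. f (Complex x y) \<partial>lborel \<partial>lborel)"
proof -
  have m [measurable]: "(\<lambda>(x, y). Complex x y) \<in> measurable (lborel \<Otimes>\<^sub>M lborel) borel"
    by (rule borel_measurable_complex_iff[THEN iffD2]) (auto simp: case_prod_beta)
  have m2: "(\<lambda>p. f (Complex (fst p) (snd p))) \<in> borel_measurable (lborel \<Otimes>\<^sub>M lborel)"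
    using measurable_compose[OF m assms] by (simp add: case_prod_beta)
  have "(\<integral>\<^sup>+z. f z \<partial>lborel) = (\<integral>\<^sup>+p. f (Complex (fst p) (snd p)) \<partial>(lborel \<Otimes>\<^sub>M lborel))"
    by (subst lborel_complex_eq, subst nn_integral_distr[OF m]) (auto simp: case_prod_beta)
  also have "\<dots> = (\<integral>\<^sup>+y. \<integral>\<^sup>+x. f (Complex x y) \<partial>lborel \<partial>lborel)"
    by (subst lborel_pair.nn_integral_snd[symmetric, where f="\<lambda>p. f (Complex (fst p) (snd p))"]) (use m2 in auto)
  finally show ?thesis .
qed

definition UH :: "(complex ^ 'n) set" where "UH = {z. \<forall>i. 0 < Im (z $ i)}"

lemma open_UH: "open (UH :: (complex ^ 'n) set)"
proof -
  have eq: "UH = (\<Inter>i. {z :: complex ^ 'n. 0 < Im (z $ i)})" by (auto simp: UH_def)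
  show ?thesis unfolding eq by (intro open_INT ballI open_Collect_less continuous_intros) auto
qed

lemma open_polydisc: "open (polydisc :: (complex ^ 'n) set)"
proof -
  have eq: "polydisc = (\<Inter>i. {z :: complex ^ 'n. norm (z $ i) < 1})" by (auto simp: polydisc_def)
  show ?thesis unfolding eq by (intro open_INT ballI open_Collect_less continuous_intros) auto
qed

lemma bounded_polydisc: "bounded (polydisc :: (complex ^ 'n) set)"
  unfolding bounded_iff
proof (intro exI ballI)
  fix z :: "complex ^ 'n" assume "z \<in> polydisc"
  then have "(\<Sum>i\<in>UNIV. norm (z $ i)) \<le> (\<Sum>i\<in>(UNIV :: 'n set). 1)"
    by (intro sum_mono) (auto simp: polydisc_def less_imp_le)
  moreover have "norm z \<le> (\<Sum>i\<in>UNIV. norm (z $ i))" unfolding norm_vec_def by (rule L2_set_le_sum) simp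
  ultimately show "norm z \<le> real CARD('n)" by simp
qed

lemma convex_polydisc: "convex (polydisc :: (complex ^ 'n) set)"
proof -
  have eq: "polydisc = (\<Inter>i. (\<lambda>z :: complex ^ 'n. z $ i) -` ball 0 1)" by (auto simp: polydisc_def)
  show ?thesis unfolding eq
    by (intro convex_INT convex_linear_vimage convex_ball bounded_linear.linear[OF bounded_linear_vec_nth])
qed

lemma zero_polydisc: "0 \<in> polydisc" by (simp add: polydisc_def)

text \<open>Points of the upper half plane are closer to \<open>w\<close> than to
  \<open>cnj w\<close>, in the form of an identity. It sends half planes into discs, and later it
  bounds \<open>cmod (z - w)\<close> by \<open>cmod (z - cnj w)\<close>.\<close>

lemma cmod_diff_cnj: "(cmod (z - cnj w))\<^sup>2 = (cmod (z - w))\<^sup>2 + 4 * Im z * Im w"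
  by (simp add: cmod_power2) (simp add: power2_eq_square algebra_simps)

lemma cnj_dist_pos: "Im z > 0 \<Longrightarrow> Im w > 0 \<Longrightarrow> z - cnj w \<noteq> 0"
  by (auto simp: complex_eq_iff)

text \<open>The centre \<open>w\<close>, which goes to 0, is a parameter. A fixed centre transfers
  the problem to half planes; a variable one moves the point of evaluation in the reproducing
  formula to 0, where the mean value property is available.\<close>

definition cay :: "complex ^ 'n \<Rightarrow> complex ^ 'n \<Rightarrow> complex ^ 'n" where
  "cay w z = (\<chi> i. (z $ i - w $ i) / (z $ i - cnj (w $ i)))"

definition cayinv :: "complex ^ 'n \<Rightarrow> complex ^ 'n \<Rightarrow> complex ^ 'n" where
  "cayinv w t = (\<chi> i. (w $ i - cnj (w $ i) * t $ i) / (1 - t $ i))"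

lemma cay_in_polydisc:
  assumes w: "w \<in> UH" and z: "z \<in> UH" shows "cay w z \<in> polydisc"
  unfolding polydisc_def cay_def
proof (intro CollectI allI)
  fix i
  have p: "Im (z $ i) > 0" "Im (w $ i) > 0" using w z by (auto simp: UH_def)
  have "(cmod (z $ i - w $ i))\<^sup>2 < (cmod (z $ i - cnj (w $ i)))\<^sup>2" using p by (simp add: cmod_diff_cnj)
  then have "cmod (z $ i - w $ i) < cmod (z $ i - cnj (w $ i))" by (simp add: power2_less_imp_less)
  then show "cmod ((\<chi> i. (z $ i - w $ i) / (z $ i - cnj (w $ i))) $ i) < 1"
    using cnj_dist_pos[OF p] by (simp add: norm_divide divide_less_eq)
qed

lemma cay_cayinv:
  assumes w: "w \<in> UH" and t: "t \<in> polydisc"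
  shows "cayinv w t \<in> UH" "cay w (cayinv w t) = t"
proof -
  have *: "Im (cayinv w t $ i) > 0 \<and> cay w (cayinv w t) $ i = t $ i" for i
  proof -
    have wi: "Im (w $ i) > 0" using w by (simp add: UH_def)
    have ti: "cmod (t $ i) < 1" using t by (simp add: polydisc_def)
    then have t1: "1 - t $ i \<noteq> 0" by auto
    define z where "z = (w $ i - cnj (w $ i) * t $ i) / (1 - t $ i)"
    have 1: "z - w $ i = t $ i * ((w $ i - cnj (w $ i)) / (1 - t $ i))"
      using t1 by (simp add: z_def field_simps)
    have 2: "z - cnj (w $ i) = (w $ i - cnj (w $ i)) / (1 - t $ i)"
      using t1 by (simp add: z_def field_simps)
    have n0: "w $ i - cnj (w $ i) \<noteq> 0" using wi by (auto simp: complex_eq_iff)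
    then have 3: "(z - w $ i) / (z - cnj (w $ i)) = t $ i" unfolding 1 2 using t1 by simp
    have "cmod (z - w $ i) < cmod (z - cnj (w $ i))"
      unfolding 1 2 norm_mult[of "t $ i"]
      using mult_strict_right_mono[OF ti, of "cmod ((w $ i - cnj (w $ i)) / (1 - t $ i))"] n0 t1 by simp
    then have "(cmod (z - w $ i))\<^sup>2 < (cmod (z - cnj (w $ i)))\<^sup>2" by (intro power_strict_mono) auto
    then have "Im z > 0" using wi by (simp add: cmod_diff_cnj zero_less_mult_iff)
    then show ?thesis using 3 by (simp add: cayinv_def cay_def z_def[symmetric])
  qed
  show "cayinv w t \<in> UH" using * by (simp add: UH_def)
  show "cay w (cayinv w t) = t" using * by (simp add: vec_eq_iff)
qed

lemma cayinv_cay: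
  assumes w: "w \<in> UH" and z: "z \<in> UH" shows "cayinv w (cay w z) = z"
proof -
  have "cayinv w (cay w z) $ i = z $ i" for i
  proof -
    have p: "Im (z $ i) > 0" "Im (w $ i) > 0" using w z by (auto simp: UH_def)
    have n: "z $ i - cnj (w $ i) \<noteq> 0" by (rule cnj_dist_pos[OF p])
    have n0: "w $ i - cnj (w $ i) \<noteq> 0" using p by (auto simp: complex_eq_iff)
    have 1: "1 - (z $ i - w $ i) / (z $ i - cnj (w $ i)) = (w $ i - cnj (w $ i)) / (z $ i - cnj (w $ i))"
      using n by (simp add: field_simps)
    have 2: "w $ i - cnj (w $ i) * ((z $ i - w $ i) / (z $ i - cnj (w $ i))) = z $ i * (w $ i - cnj (w $ i)) / (z $ i - cnj (w $ i))"
      using n by (simp add: field_simps)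
    show ?thesis unfolding cayinv_def cay_def vec_lambda_beta 1 2 using n n0 by simp
  qed
  then show ?thesis by (simp add: vec_eq_iff)
qed

lemma cay_image: "w \<in> UH \<Longrightarrow> cay w ` UH = polydisc"
  using cay_in_polydisc cay_cayinv by (metis (no_types, lifting) image_eqI image_subsetI subsetI subset_antisym)

lemma cay_rat: "w \<in> UH \<Longrightarrow> (\<lambda>z. cay w z $ i) \<in> rat_on UH"
  unfolding cay_def vec_lambda_beta
  by (intro rat_on_divide rat_on_diff rat_on_coord rat_on_const cnj_dist_pos) (auto simp: UH_def)

lemma cayinv_rat: "(\<lambda>z. cayinv w z $ i) \<in> rat_on polydisc"
  unfolding cayinv_def vec_lambda_beta
  by (intro rat_on_divide rat_on_diff rat_on_mult rat_on_coord rat_on_const)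
    (auto simp: polydisc_def, metis less_irrefl norm_one)

lemma rat_on_vec_continuous:
  fixes f :: "complex ^ 'n \<Rightarrow> complex ^ 'm"
  assumes "\<And>i. (\<lambda>z. f z $ i) \<in> rat_on U" "open U"
  shows "continuous_on U f"
proof -
  have "continuous_on U (\<lambda>z. \<chi> i. f z $ i)" by (intro continuous_intros rat_on_continuous assms)
  then show ?thesis by simp
qed

lemma cay_proper_rational:
  fixes w :: "complex ^ 'n"
  assumes w: "w \<in> UH" shows "proper_rational UH polydisc (cay w)"
proof
  fix K :: "(complex ^ 'n) set" assume K: "K \<subseteq> polydisc" "compact K"
  have "UH \<inter> cay w -` K = cayinv w ` K"
    using K(1) cay_cayinv[OF w] cayinv_cay[OF w] by (auto simp: image_iff) (metis cayinv_cay[OF w])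
  moreover have "compact (cayinv w ` K)"
    by (intro compact_continuous_image continuous_on_subset[OF rat_on_vec_continuous[OF cayinv_rat open_polydisc]] K)
  ultimately show "compact (UH \<inter> cay w -` K)" by simp
qed (use cay_rat[OF w] cay_in_polydisc[OF w] in \<open>auto simp: open_UH open_polydisc\<close>)

lemma jac_diagonal:
  assumes "\<And>i k. pd (\<lambda>z. \<Phi> z $ i) k z = (if k = i then d i else 0)"
  shows "jac \<Phi> z = (\<Prod>i\<in>UNIV. d i)"
  unfolding jac_def by (subst det_diagonal) (auto simp: assms)

lemma jac_cay:
  assumes w: "w \<in> UH" and z: "z \<in> UH"
  shows "jac (cay w) z = (\<Prod>i\<in>UNIV. (w $ i - cnj (w $ i)) / (z $ i - cnj (w $ i))\<^sup>2)"
proof (rule jac_diagonal)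
  fix i k
  have p: "Im (z $ i) > 0" "Im (w $ i) > 0" using w z by (auto simp: UH_def)
  have n: "z $ i - cnj (w $ i) \<noteq> 0" by (rule cnj_dist_pos[OF p])
  have "((\<lambda>s. (s - w $ i) / (s - cnj (w $ i))) has_field_derivative (w $ i - cnj (w $ i)) / (z $ i - cnj (w $ i))\<^sup>2) (at (z $ i))"
    using n by (auto intro!: derivative_eq_intros simp: power2_eq_square)
  from cdiff_compose_field(2)[OF cdiff_coord this, of k]
  show "pd (\<lambda>z. cay w z $ i) k z = (if k = i then (w $ i - cnj (w $ i)) / (z $ i - cnj (w $ i))\<^sup>2 else 0)"
    unfolding cay_def vec_lambda_beta pd_coord by (simp split: if_splits)
qed

lemma proper_rational_compose_cay:
  fixes \<Phi> :: "complex ^ 'n \<Rightarrow> complex ^ 'n"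
  assumes w: "w \<in> UH" and \<Phi>: "proper_rational polydisc \<Omega> \<Phi>"
  shows "proper_rational UH \<Omega> (\<lambda>z. \<Phi> (cay w z))"
proof -
  interpret P: proper_rational polydisc \<Omega> \<Phi> by fact
  interpret C: proper_rational UH polydisc "cay w" by (rule cay_proper_rational[OF w])
  show ?thesis
  proof
    show "(\<lambda>z. \<Phi> (cay w z)) ` UH \<subseteq> \<Omega>" using P.maps C.maps by auto
    show "(\<lambda>z. \<Phi> (cay w z) $ i) \<in> rat_on UH" for i
      by (rule rat_on_compose[OF C.rat C.maps P.rat])
    fix K assume "K \<subseteq> \<Omega>" "compact K"
    then have "compact (UH \<inter> cay w -` (polydisc \<inter> \<Phi> -` K))" by (intro C.proper P.proper) auto
    also have "UH \<inter> cay w -` (polydisc \<inter> \<Phi> -` K) = UH \<inter> (\<lambda>z. \<Phi> (cay w z)) -` K"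
      using C.maps by auto
    finally show "compact (UH \<inter> (\<lambda>z. \<Phi> (cay w z)) -` K)" .
  qed (auto simp: open_UH P.open_Omega)
qed

section \<open>The reproducing formula\<close>

context proper_rational
begin

lemma jac_push_integral:
  fixes f :: "complex ^ 'n \<Rightarrow> complex"
  assumes M: "M \<ge> 0" "\<And>f. f \<in> borel_measurable borel \<Longrightarrow>
      (\<integral>\<^sup>+x. ennreal (jn x) * f (ext x) \<partial>lborel) = ennreal M * (\<integral>\<^sup>+y. indicator \<Omega> y * f y \<partial>lborel)"
    and f [measurable]: "f \<in> borel_measurable borel"
  shows "(\<integral>x. jn x *\<^sub>R f (ext x) \<partial>lborel) = M *\<^sub>R (\<integral>y. indicator \<Omega> y *\<^sub>R f y \<partial>lborel)"
proof -
  have \<Omega>m [measurable]: "\<Omega> \<in> sets borel" using open_Omega by simp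
  define \<mu> where "\<mu> = density lborel (\<lambda>x. ennreal (jn x))"
  have eq: "distr \<mu> borel ext = density lborel (\<lambda>y. ennreal (M * indicator \<Omega> y))"
  proof (rule measure_eqI)
    fix A assume "A \<in> sets (distr \<mu> borel ext)"
    then have A [measurable]: "A \<in> sets borel" by simp
    have pre: "ext -` A \<in> sets borel" using measurable_sets_borel[OF ext_measurable A] .
    have "emeasure (distr \<mu> borel ext) A = emeasure \<mu> (ext -` A)"
      by (subst emeasure_distr) (auto simp: \<mu>_def)
    also have "\<dots> = (\<integral>\<^sup>+x. ennreal (jn x) * indicator (ext -` A) x \<partial>lborel)"
      unfolding \<mu>_def by (rule emeasure_density) (use pre in auto)
    also have "\<dots> = (\<integral>\<^sup>+x. ennreal (jn x) * indicator A (ext x) \<partial>lborel)"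
      by (intro nn_integral_cong) (auto simp: indicator_def)
    also have "\<dots> = ennreal M * (\<integral>\<^sup>+y. indicator \<Omega> y * indicator A y \<partial>lborel)" by (rule M(2)) measurable
    also have "\<dots> = (\<integral>\<^sup>+y. ennreal (M * indicator \<Omega> y) * indicator A y \<partial>lborel)"
      by (subst nn_integral_cmult[symmetric]) (auto intro!: nn_integral_cong simp: indicator_def)
    also have "\<dots> = emeasure (density lborel (\<lambda>y. ennreal (M * indicator \<Omega> y))) A"
      by (rule emeasure_density[symmetric]) auto
    finally show "emeasure (distr \<mu> borel ext) A = emeasure (density lborel (\<lambda>y. ennreal (M * indicator \<Omega> y))) A" .
  qed (simp add: \<mu>_def)
  have "(\<integral>x. jn x *\<^sub>R f (ext x) \<partial>lborel) = (\<integral>x. f (ext x) \<partial>\<mu>)"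
    unfolding \<mu>_def by (rule integral_density[symmetric]) (auto simp: jn_nonneg)
  also have "\<dots> = (\<integral>y. f y \<partial>distr \<mu> borel ext)"
    by (rule integral_distr[symmetric]) (auto simp: \<mu>_def)
  also have "\<dots> = (\<integral>y. (M * indicator \<Omega> y) *\<^sub>R f y \<partial>lborel)"
    unfolding eq by (rule integral_density) (auto simp: M(1))
  also have "\<dots> = M *\<^sub>R (\<integral>y. indicator \<Omega> y *\<^sub>R f y \<partial>lborel)"
    unfolding scaleR_scaleR[symmetric] by (rule integral_scaleR_right)
  finally show ?thesis .
qed

end

section \<open>Mean values over the polydisc\<close>

definition rot :: "complex \<Rightarrow> complex ^ 'n \<Rightarrow> complex ^ 'n" where "rot c z = (\<chi> i. c * z $ i)"

lemma rot_polydisc: "norm c = 1 \<Longrightarrow> rot c z \<in> polydisc \<longleftrightarrow> z \<in> polydisc"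
  by (simp add: rot_def polydisc_def norm_mult)

lemma rot_rot: "rot a (rot b z) = rot (a * b) z" "rot 1 z = z"
  by (simp_all add: rot_def vec_eq_iff mult.assoc)

lemma rot_rat: "(\<lambda>z. rot c z $ i) \<in> rat_on U"
  unfolding rot_def vec_lambda_beta by (intro rat_on_mult rat_on_const rat_on_coord)

lemma rot_proper_rational:
  assumes c: "norm c = 1" shows "proper_rational polydisc polydisc (rot c :: complex ^ 'n \<Rightarrow> _)"
proof
  fix K :: "(complex ^ 'n) set" assume K: "K \<subseteq> polydisc" "compact K"
  have "c \<noteq> 0" using c by auto
  then have cc: "c * inverse c = 1" "inverse c * c = 1" "norm (inverse c) = 1" using c by (auto simp: norm_inverse)
  have "polydisc \<inter> rot c -` K = rot (inverse c) ` K"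
  proof
    show "polydisc \<inter> rot c -` K \<subseteq> rot (inverse c) ` K"
    proof
      fix z assume "z \<in> polydisc \<inter> rot c -` K"
      then have "z = rot (inverse c) (rot c z)" "rot c z \<in> K" using cc by (auto simp: rot_rot)
      then show "z \<in> rot (inverse c) ` K" by blast
    qed
    show "rot (inverse c) ` K \<subseteq> polydisc \<inter> rot c -` K"
      using K(1) rot_polydisc[OF cc(3)] cc by (auto simp: rot_rot)
  qed
  moreover have "compact (rot (inverse c) ` K)"
    by (intro compact_continuous_image continuous_on_subset[OF rat_on_vec_continuous[OF rot_rat open_UNIV]] K) auto
  ultimately show "compact (polydisc \<inter> rot c -` K)" by simp
qed (use rot_polydisc[OF c] rot_rat in \<open>auto simp: open_polydisc\<close>)

text \<open>An instance of the push-forward theorem: for a rotation \<open>jn\<close> is the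
  indicator of the polydisc, and comparing total masses, which are finite and positive, gives
  \<open>M = 1\<close>.\<close>

lemma rot_push:
  fixes f :: "complex ^ 'n \<Rightarrow> ennreal" and g :: "complex ^ 'n \<Rightarrow> complex"
  assumes c: "norm c = 1"
  shows "f \<in> borel_measurable borel \<Longrightarrow> (\<integral>\<^sup>+z. indicator polydisc z * f (rot c z) \<partial>lborel) = (\<integral>\<^sup>+z. indicator polydisc z * f z \<partial>lborel)"
    and "g \<in> borel_measurable borel \<Longrightarrow> (\<integral>z. indicator polydisc z *\<^sub>R g (rot c z) \<partial>lborel) = (\<integral>z. indicator polydisc z *\<^sub>R g z \<partial>lborel)"
proof -
  interpret R: proper_rational polydisc polydisc "rot c :: complex ^ 'n \<Rightarrow> _" by (rule rot_proper_rational[OF c])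
  obtain M where M: "M \<ge> 0" "\<And>f. f \<in> borel_measurable borel \<Longrightarrow>
      (\<integral>\<^sup>+x. ennreal (R.jn x) * f (R.ext x) \<partial>lborel) = ennreal M * (\<integral>\<^sup>+y. indicator polydisc y * f y \<partial>lborel)"
    by (rule R.jac_push[OF convex_connected[OF convex_polydisc] bounded_polydisc]) (rule that, assumption+)
  have "jac (rot c) z = (\<Prod>i\<in>(UNIV :: 'n set). c)" for z :: "complex ^ 'n"
  proof (rule jac_diagonal)
    fix i k :: 'n
    show "pd (\<lambda>z. rot c z $ i) k z = (if k = i then c else 0)"
      unfolding rot_def vec_lambda_beta by (simp add: pd_mult cdiff_const cdiff_coord pd_const pd_coord)
  qed
  then have jn: "R.jn z = indicator polydisc z" for z unfolding R.jn_def using c by (simp add: norm_power)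
  have fin: "emeasure lborel (polydisc :: (complex ^ 'n) set) < \<infinity>" by (rule emeasure_bounded_finite[OF bounded_polydisc])
  have pos: "emeasure lborel (polydisc :: (complex ^ 'n) set) \<noteq> 0"
  proof
    assume "emeasure lborel (polydisc :: (complex ^ 'n) set) = 0"
    then have "(polydisc :: (complex ^ 'n) set) \<in> null_sets lborel"
      by (intro null_setsI) (simp_all add: borel_open[OF open_polydisc])
    then have "negligible (polydisc :: (complex ^ 'n) set)"
      unfolding negligible_iff_null_sets by (rule null_sets_completionI)
    then show False using open_not_negligible[OF open_polydisc] zero_polydisc by blast
  qed
  have [measurable]: "(polydisc :: (complex ^ 'n) set) \<in> sets borel" by (rule borel_open[OF open_polydisc])
  have "emeasure lborel (polydisc :: (complex ^ 'n) set) = ennreal M * emeasure lborel (polydisc :: (complex ^ 'n) set)"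
    using M(2)[of "\<lambda>_. 1"] by (simp add: jn ennreal_indicator)
  moreover obtain v where v: "emeasure lborel (polydisc :: (complex ^ 'n) set) = ennreal v" "v > 0"
    using fin pos by (cases "emeasure lborel (polydisc :: (complex ^ 'n) set)" rule: ennreal_cases) (auto simp: less_le)
  ultimately have "v = M * v" using M(1) by (simp add: ennreal_mult[symmetric])
  then have M1: "M = 1" using v by simp
  show "(\<integral>\<^sup>+z. indicator polydisc z * f (rot c z) \<partial>lborel) = (\<integral>\<^sup>+z. indicator polydisc z * f z \<partial>lborel)"
    if "f \<in> borel_measurable borel"
  proof -
    have "(\<integral>\<^sup>+z. indicator polydisc z * f (rot c z) \<partial>lborel) = (\<integral>\<^sup>+x. ennreal (R.jn x) * f (R.ext x) \<partial>lborel)"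
      by (intro nn_integral_cong) (auto simp: jn R.ext_def indicator_def)
    then show ?thesis using M(2)[OF that] M1 by simp
  qed
  show "(\<integral>z. indicator polydisc z *\<^sub>R g (rot c z) \<partial>lborel) = (\<integral>z. indicator polydisc z *\<^sub>R g z \<partial>lborel)"
    if "g \<in> borel_measurable borel"
  proof -
    have "(\<integral>z. indicator polydisc z *\<^sub>R g (rot c z) \<partial>lborel) = (\<integral>x. R.jn x *\<^sub>R g (R.ext x) \<partial>lborel)"
      by (intro Bochner_Integration.integral_cong) (auto simp: jn R.ext_def indicator_def)
    then show ?thesis using R.jac_push_integral[OF M that] M1 by simp
  qed
qed

definition cis2pi :: "real \<Rightarrow> complex" where "cis2pi t = exp (2 * of_real pi * \<i> * of_real t)"

lemma norm_cis2pi: "norm (cis2pi t) = 1"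
  unfolding cis2pi_def by (simp add: norm_exp_eq_Re)

lemma continuous_cis2pi: "continuous_on S cis2pi"
  unfolding cis2pi_def by (intro continuous_intros)

lemma circle_mean_value:
  assumes f: "f holomorphic_on cball 0 1"
  shows "(\<integral>t. indicator {0..1} t *\<^sub>R f (cis2pi t) \<partial>lborel) = f 0"
proof -
  have c: "continuous_on {0..1} (\<lambda>t. f (cis2pi t))"
    by (intro continuous_on_compose2[OF holomorphic_on_imp_continuous_on[OF f] continuous_cis2pi]) (auto simp: norm_cis2pi)
  have "((\<lambda>u. f u / (u - 0)) has_contour_integral (2 * of_real pi * \<i> * f 0)) (circlepath 0 1)"
    by (rule Cauchy_integral_circlepath_simple) (use f in auto)
  then have "((\<lambda>t. f (circlepath 0 1 t) / (circlepath 0 1 t - 0) * vector_derivative (circlepath 0 1) (at t within {0..1}))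
     has_integral 2 * of_real pi * \<i> * f 0) {0..1}"
    unfolding has_contour_integral_def .
  then have "((\<lambda>t. 2 * of_real pi * \<i> * f (cis2pi t)) has_integral 2 * of_real pi * \<i> * f 0) {0..1}"
    by (rule has_integral_eq[rotated]) (simp add: vector_derivative_circlepath01, simp add: circlepath cis2pi_def)
  then have "((\<lambda>t. (1 / (2 * of_real pi * \<i>)) * (2 * of_real pi * \<i> * f (cis2pi t))) has_integral
      (1 / (2 * of_real pi * \<i>)) * (2 * of_real pi * \<i> * f 0)) {0..1}"
    by (rule has_integral_mult_right)
  then have "((\<lambda>t. f (cis2pi t)) has_integral f 0) {0..1}" by simp
  moreover have "set_integrable lborel {0..1} (\<lambda>t. f (cis2pi t))"
    unfolding set_integrable_def by (rule borel_integrable_compact[OF _ c]) simp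
  ultimately show ?thesis
    using set_borel_integral_eq_integral(2)[of "{0..1}" "\<lambda>t. f (cis2pi t)"]
    by (simp add: set_lebesgue_integral_def integral_unique)
qed

text \<open>The function l \<mapsto> G (l z) is holomorphic on the closed unit disc because all its
  arguments stay in the open polydisc, so the one-variable Cauchy formula applies.\<close>

lemma polydisc_slice_mean:
  assumes G: "holo_on polydisc G" and z: "z \<in> polydisc"
  shows "(\<integral>t. indicator {0..1} t *\<^sub>R G (rot (cis2pi t) z) \<partial>lborel) = G 0"
proof -
  have "(\<lambda>l. G (rot l z)) holomorphic_on cball 0 1"
  proof (rule holomorphic_onI)
    fix l :: complex assume l: "l \<in> cball 0 1"
    have "rot l z \<in> polydisc"
      unfolding polydisc_def rot_def
    proof (intro CollectI allI)
      fix i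
      have "norm (l * z $ i) \<le> 1 * norm (z $ i)" unfolding norm_mult using l by (intro mult_right_mono) auto
      also have "\<dots> < 1" using z by (simp add: polydisc_def)
      finally show "norm ((\<chi> i. l * z $ i) $ i) < 1" by simp
    qed
    then have "cdiff G (rot l z)" using G by (simp add: holo_on_iff_cdiff)
    then have d: "(G has_derivative (\<lambda>h. \<Sum>i\<in>UNIV. pd G i (rot l z) * h $ i)) (at (rot l z))" by (rule cdiffD)
    have "((\<lambda>l. rot l z) has_derivative (\<lambda>h. \<chi> i. h * z $ i)) (at l)"
      by (rule has_derivative_vec) (auto simp: rot_def intro!: derivative_eq_intros)
    from has_derivative_compose[OF this d]
    have "((\<lambda>l. G (rot l z)) has_derivative (\<lambda>h. (\<Sum>i\<in>UNIV. pd G i (rot l z) * z $ i) * h)) (at l)"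
      by (rule has_derivative_eq_rhs) (simp add: fun_eq_iff sum_distrib_left sum_distrib_right mult_ac)
    then have "((\<lambda>l. G (rot l z)) has_field_derivative (\<Sum>i\<in>UNIV. pd G i (rot l z) * z $ i)) (at l)"
      by (simp add: has_field_derivative_def)
    then show "(\<lambda>l. G (rot l z)) field_differentiable at l within cball 0 1"
      using field_differentiable_at_within field_differentiable_def by blast
  qed
  from circle_mean_value[OF this] show ?thesis by (simp add: rot_def zero_vec_def)
qed

text \<open>Average over the circle of simultaneous rotations: the integral is invariant under each
  of them, and after exchanging the integrals the inner one equals \<open>G 0\<close> for every
  \<open>z\<close> in the polydisc. A single circle is enough, with no iteration over the
  coordinates.\<close>

lemma polydisc_mean_value:
  fixes G :: "complex ^ 'n \<Rightarrow> complex"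
  assumes G: "holo_on polydisc G" and int: "integrable lborel (\<lambda>z. indicator polydisc z *\<^sub>R G z)"
  shows "(\<integral>z. indicator polydisc z *\<^sub>R G z \<partial>lborel) = measure lborel (polydisc :: (complex ^ 'n) set) *\<^sub>R G 0"
proof -
  define G' where "G' z = indicator polydisc z *\<^sub>R G z" for z
  have iG': "integrable lborel G'" unfolding G'_def[abs_def] by (rule int)
  have G'm [measurable]: "G' \<in> borel_measurable borel" using borel_measurable_integrable[OF iG'] by simp
  have [measurable]: "(polydisc :: (complex ^ 'n) set) \<in> sets borel" by (rule borel_open[OF open_polydisc])
  have rotm: "(\<lambda>p. rot (cis2pi (fst p)) (snd p :: complex ^ 'n)) \<in> borel_measurable (borel \<Otimes>\<^sub>M borel)"
    unfolding borel_prod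
  proof (rule borel_measurable_continuous_onI)
    show "continuous_on UNIV (\<lambda>p. rot (cis2pi (fst p)) (snd p :: complex ^ 'n))"
      unfolding rot_def
      by (intro continuous_intros continuous_on_compose2[OF continuous_cis2pi[of UNIV]]) auto
  qed
  have ptm [measurable]: "(\<lambda>p. G' (rot (cis2pi (fst p)) (snd p))) \<in> borel_measurable (borel \<Otimes>\<^sub>M borel)"
    by (rule measurable_compose[OF rotm G'm])
  have G'rot: "G' (rot (cis2pi t) z) = indicator polydisc z *\<^sub>R G' (rot (cis2pi t) z)" for t z
    using rot_polydisc[OF norm_cis2pi, of t z] by (simp add: G'_def indicator_def)
  have indG': "indicator polydisc z *\<^sub>R G' z = G' z" for z by (simp add: G'_def indicator_def)
  have I: "(\<integral>z. G' (rot (cis2pi t) z) \<partial>lborel) = (\<integral>z. G' z \<partial>lborel)" for t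
    using rot_push(2)[OF norm_cis2pi G'm, of t] by (simp only: G'rot[symmetric] indG')
  have N: "(\<integral>\<^sup>+z. ennreal (norm (G' (rot (cis2pi t) z))) \<partial>lborel) = (\<integral>\<^sup>+z. ennreal (norm (G' z)) \<partial>lborel)" for t
  proof -
    have "(\<integral>\<^sup>+z. ennreal (norm (G' (rot (cis2pi t) z))) \<partial>lborel) = (\<integral>\<^sup>+z. indicator polydisc z * ennreal (norm (G' (rot (cis2pi t) z))) \<partial>lborel)"
      by (intro nn_integral_cong) (subst G'rot, simp add: indicator_def)
    also have "\<dots> = (\<integral>\<^sup>+z. indicator polydisc z * ennreal (norm (G' z)) \<partial>lborel)"
      by (rule rot_push(1)[OF norm_cis2pi]) measurable
    also have "\<dots> = (\<integral>\<^sup>+z. ennreal (norm (G' z)) \<partial>lborel)"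
      by (intro nn_integral_cong) (simp add: G'_def indicator_def)
    finally show ?thesis .
  qed
  have "(\<integral>z. G' z \<partial>lborel) = (\<integral>t. indicator {0..1::real} t *\<^sub>R (\<integral>z. G' z \<partial>lborel) \<partial>lborel)" by simp
  also have "\<dots> = (\<integral>t. (\<integral>z. indicator {0..1} t *\<^sub>R G' (rot (cis2pi t) z) \<partial>lborel) \<partial>lborel)"
    by (simp only: integral_scaleR_right I)
  also have "\<dots> = (\<integral>z. (\<integral>t. indicator {0..1} t *\<^sub>R G' (rot (cis2pi t) z) \<partial>lborel) \<partial>lborel)"
  proof (rule lborel_pair.Fubini_integral[symmetric])
    show "integrable (lborel \<Otimes>\<^sub>M lborel) (\<lambda>(t, z). indicator {0..1} t *\<^sub>R G' (rot (cis2pi t) z))"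
    proof (rule integrableI_bounded)
      show m: "(\<lambda>(t, z). indicator {0..1} t *\<^sub>R G' (rot (cis2pi t) z)) \<in> borel_measurable (lborel \<Otimes>\<^sub>M lborel)"
        using ptm by (simp add: case_prod_beta)
      have "(\<integral>\<^sup>+p. ennreal (norm (case p of (t, z) \<Rightarrow> indicator {0..1} t *\<^sub>R G' (rot (cis2pi t) z))) \<partial>(lborel \<Otimes>\<^sub>M lborel))
         = (\<integral>\<^sup>+t. (\<integral>\<^sup>+z. ennreal (norm (indicator {0..1} t *\<^sub>R G' (rot (cis2pi t) z))) \<partial>lborel) \<partial>lborel)"
        by (subst lborel.nn_integral_fst[symmetric]) (use m in auto)
      also have "\<dots> = (\<integral>\<^sup>+t. indicator {0..1::real} t * (\<integral>\<^sup>+z. ennreal (norm (G' z)) \<partial>lborel) \<partial>lborel)"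
        by (intro nn_integral_cong) (auto simp: indicator_def N)
      also have "\<dots> = (\<integral>\<^sup>+z. ennreal (norm (G' z)) \<partial>lborel)"
        by (subst nn_integral_multc) auto
      also have "\<dots> < \<infinity>" using iG' unfolding integrable_iff_bounded by simp
      finally show "(\<integral>\<^sup>+p. ennreal (norm (case p of (t, z) \<Rightarrow> indicator {0..1} t *\<^sub>R G' (rot (cis2pi t) z))) \<partial>(lborel \<Otimes>\<^sub>M lborel)) < \<infinity>" .
    qed
  qed
  also have "\<dots> = (\<integral>z. indicator (polydisc :: (complex ^ 'n) set) z *\<^sub>R G 0 \<partial>lborel)"
  proof (rule Bochner_Integration.integral_cong[OF refl])
    fix z :: "complex ^ 'n"
    show "(\<integral>t. indicator {0..1} t *\<^sub>R G' (rot (cis2pi t) z) \<partial>lborel) = indicator polydisc z *\<^sub>R G 0"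
    proof (cases "z \<in> polydisc")
      case True
      then have "G' (rot (cis2pi t) z) = G (rot (cis2pi t) z)" for t
        by (simp add: G'_def rot_polydisc[OF norm_cis2pi])
      then show ?thesis using polydisc_slice_mean[OF G True] True by simp
    next
      case False
      then have "G' (rot (cis2pi t) z) = 0" for t by (simp add: G'_def rot_polydisc[OF norm_cis2pi])
      then show ?thesis using False by simp
    qed
  qed
  also have "\<dots> = measure lborel (polydisc :: (complex ^ 'n) set) *\<^sub>R G 0"
  proof -
    have "emeasure lborel (polydisc :: (complex ^ 'n) set) < \<infinity>" by (rule emeasure_bounded_finite[OF bounded_polydisc])
    then have "integrable lborel (indicator polydisc :: complex ^ 'n \<Rightarrow> real)"
      by (intro integrable_real_indicator) auto
    then show ?thesis by (subst integral_scaleR_left) auto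
  qed
  finally show ?thesis by (simp add: G'_def)
qed

text \<open>The Bergman kernel of the product of half planes without its normalising factor, one
  \<open>- 1 / pi\<close> per coordinate.\<close>

definition berg :: "complex ^ 'n \<Rightarrow> complex ^ 'n \<Rightarrow> complex" where
  "berg w z = (\<Prod>i\<in>UNIV. 1 / (z $ i - cnj (w $ i))\<^sup>2)"

lemma berg_rat:
  assumes "w \<in> UH" shows "berg w \<in> rat_on UH"
proof -
  have "z $ i - cnj (w $ i) \<noteq> 0" if "z \<in> UH" for z i
    using assms that by (intro cnj_dist_pos) (auto simp: UH_def)
  then show ?thesis unfolding berg_def[abs_def] power2_eq_square
    by (intro rat_on_prod rat_on_divide rat_on_mult rat_on_diff rat_on_coord rat_on_const) auto
qed

text \<open>Since the kernel at \<open>w\<close> is the Jacobian of the Cayley transform centred at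
  \<open>w\<close>, up to a factor free of \<open>z\<close>, reproduction at \<open>w\<close> is the
  mean value property at 0.\<close>

lemma jac_cay_berg:
  assumes "w \<in> UH" "z \<in> UH"
  shows "jac (cay w) z = (\<Prod>i\<in>UNIV. w $ i - cnj (w $ i)) * berg w z"
  unfolding jac_cay[OF assms] berg_def prod.distrib[symmetric] by simp

lemma emeasure_vec_box:
  fixes A :: "'n::finite \<Rightarrow> complex set"
  assumes "\<And>i. A i \<in> sets borel"
  shows "{z :: complex ^ 'n. \<forall>i. z $ i \<in> A i} \<in> sets borel"
    and "emeasure lborel {z :: complex ^ 'n. \<forall>i. z $ i \<in> A i} = (\<Prod>i\<in>UNIV. emeasure lborel (A i))"
proof -
  interpret product_sigma_finite "\<lambda>_ :: 'n. lborel :: complex measure" by standard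
  have "{z :: complex ^ 'n. \<forall>i. z $ i \<in> A i} = (\<Inter>i. (\<lambda>z. z $ i) -` A i)" by auto
  moreover have "(\<lambda>z :: complex ^ 'n. z $ i) \<in> borel_measurable borel" for i
    by (intro borel_measurable_continuous_onI continuous_intros)
  then have "(\<lambda>z :: complex ^ 'n. z $ i) -` A i \<in> sets borel" for i
    using measurable_sets_borel assms by blast
  ultimately show m: "{z :: complex ^ 'n. \<forall>i. z $ i \<in> A i} \<in> sets borel" by (simp add: sets.countable_INT')
  have "emeasure lborel {z :: complex ^ 'n. \<forall>i. z $ i \<in> A i} = (\<integral>\<^sup>+z. indicator {z :: complex ^ 'n. \<forall>i. z $ i \<in> A i} z \<partial>lborel)"
    using m by simp
  also have "\<dots> = (\<integral>\<^sup>+x. indicator {z :: complex ^ 'n. \<forall>i. z $ i \<in> A i} (\<chi> i. x i) \<partial>Pi\<^sub>M UNIV (\<lambda>_. lborel))"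
    by (rule nn_integral_vec) (use m in auto)
  also have "\<dots> = (\<integral>\<^sup>+x. (\<Prod>i\<in>UNIV. indicator (A i) (x i)) \<partial>Pi\<^sub>M UNIV (\<lambda>_. lborel))"
    by (intro nn_integral_cong) (auto simp: indicator_def prod_zero_iff split: if_splits)
  also have "\<dots> = (\<Prod>i\<in>UNIV. emeasure lborel (A i))"
    using assms by (subst product_nn_integral_prod) auto
  finally show "emeasure lborel {z :: complex ^ 'n. \<forall>i. z $ i \<in> A i} = (\<Prod>i\<in>UNIV. emeasure lborel (A i))" .
qed

text \<open>The lower bound comes from the box \<open>\<bar>Re z\<^sub>i - Re w\<^sub>i\<bar> < Im w\<^sub>i\<close>, \<open>0 < Im z\<^sub>i < Im w\<^sub>i\<close>; it is uniform in \<open>w\<close>.\<close>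
lemma cay_jac_mass_lower:
  fixes w :: "complex ^ 'n"
  assumes w: "w \<in> UH"
  shows "ennreal ((8/25) ^ CARD('n)) \<le> (\<integral>\<^sup>+z. indicator UH z * ennreal ((norm (jac (cay w) z))\<^sup>2) \<partial>lborel)"
proof -
  define v where "v i = Im (w $ i)" for i
  have v: "v i > 0" for i using w by (simp add: v_def UH_def)
  define A where "A i = box (Complex (Re (w $ i) - v i) 0) (Complex (Re (w $ i) + v i) (v i))" for i
  define B where "B = {z :: complex ^ 'n. \<forall>i. z $ i \<in> A i}"
  have Am: "A i \<in> sets borel" for i by (simp add: A_def)
  have eA: "emeasure lborel (A i) = ennreal (2 * (v i)\<^sup>2)" for i
    unfolding A_def using v[of i]
    by (subst emeasure_lborel_box) (auto simp: Basis_complex_def power2_eq_square)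
  have lower: "ennreal (\<Prod>i\<in>UNIV. 4 / (25 * (v i)\<^sup>2)) * indicator B z \<le> indicator UH z * ennreal ((norm (jac (cay w) z))\<^sup>2)" for z
  proof (cases "z \<in> B")
    case True
    have zi: "\<bar>Re (z $ i) - Re (w $ i)\<bar> < v i" "0 < Im (z $ i)" "Im (z $ i) < v i" for i
      using True by (auto simp: B_def A_def mem_box Basis_complex_def abs_less_iff algebra_simps)
    then have zU: "z \<in> UH" by (simp add: UH_def)
    \<comment> \<open>On the box \<open>(cmod (z $ i - cnj (w $ i)))\<^sup>2\<close> is at most v^2
      + (2 v)^2 = 5 v^2, and \<open>w $ i - cnj (w $ i)\<close> has modulus 2 v. This gives 4 v^2 /
      (5 v^2)^2 per coordinate; times the area 2 v^2 of the box it is 8/25, free of v.\<close>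
    have "(\<Prod>i\<in>UNIV. 4 / (25 * (v i)\<^sup>2)) \<le> (\<Prod>i\<in>UNIV. (norm ((w $ i - cnj (w $ i)) / (z $ i - cnj (w $ i))\<^sup>2))\<^sup>2)"
    proof (rule prod_mono)
      fix i :: 'n
      have d: "(cmod (z $ i - cnj (w $ i)))\<^sup>2 \<le> 5 * (v i)\<^sup>2"
      proof -
        have "(Re (z $ i) - Re (w $ i))\<^sup>2 \<le> (v i)\<^sup>2"
          using zi(1)[of i] v[of i] by (intro power2_le_iff_abs_le[THEN iffD2]) auto
        moreover have "(Im (z $ i) + Im (w $ i))\<^sup>2 \<le> (2 * v i)\<^sup>2"
          using zi(2,3)[of i] v[of i] by (intro power_mono) (auto simp: v_def)
        ultimately show ?thesis by (simp add: cmod_power2 power_mult_distrib)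
      qed
      have n: "cmod (z $ i - cnj (w $ i)) > 0"
        using cnj_dist_pos[of "z $ i" "w $ i"] zi(2)[of i] v[of i] by (simp add: v_def)
      have "norm (w $ i - cnj (w $ i)) = 2 * v i"
        using v[of i] by (simp add: complex_diff_cnj norm_mult v_def)
      then have "(norm ((w $ i - cnj (w $ i)) / (z $ i - cnj (w $ i))\<^sup>2))\<^sup>2 = 4 * (v i)\<^sup>2 / ((cmod (z $ i - cnj (w $ i)))\<^sup>2)\<^sup>2"
        by (simp add: norm_divide norm_power power_divide power_mult_distrib)
      moreover have "4 / (25 * (v i)\<^sup>2) = 4 * (v i)\<^sup>2 / (5 * (v i)\<^sup>2)\<^sup>2"
        using v[of i] by (simp add: power2_eq_square)
      moreover have "4 * (v i)\<^sup>2 / (5 * (v i)\<^sup>2)\<^sup>2 \<le> 4 * (v i)\<^sup>2 / ((cmod (z $ i - cnj (w $ i)))\<^sup>2)\<^sup>2"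
        using d n v[of i] by (intro divide_left_mono power_mono mult_pos_pos zero_less_power) auto
      ultimately show "0 \<le> 4 / (25 * (v i)\<^sup>2) \<and> 4 / (25 * (v i)\<^sup>2) \<le> (norm ((w $ i - cnj (w $ i)) / (z $ i - cnj (w $ i))\<^sup>2))\<^sup>2"
        by simp
    qed
    also have "\<dots> = (norm (jac (cay w) z))\<^sup>2"
      unfolding jac_cay[OF w zU] by (simp add: prod_norm[symmetric] prod_power_distrib)
    finally show ?thesis using True zU by (simp add: ennreal_leI)
  qed simp
  have "ennreal ((8/25) ^ CARD('n)) = ennreal (\<Prod>i\<in>(UNIV :: 'n set). 4 / (25 * (v i)\<^sup>2) * (2 * (v i)\<^sup>2))"
    using v by (simp add: less_imp_neq[OF v, symmetric])
  also have "\<dots> = ennreal (\<Prod>i\<in>UNIV. 4 / (25 * (v i)\<^sup>2)) * ennreal (\<Prod>i\<in>UNIV. 2 * (v i)\<^sup>2)"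
    unfolding prod.distrib[of "\<lambda>i. 4 / (25 * (v i)\<^sup>2)" "\<lambda>i. 2 * (v i)\<^sup>2"]
    by (rule ennreal_mult) (intro prod_nonneg ballI, simp)+
  also have "ennreal (\<Prod>i\<in>UNIV. 2 * (v i)\<^sup>2) = emeasure lborel B"
    unfolding B_def emeasure_vec_box(2)[OF Am] eA by (rule prod_ennreal[symmetric]) auto
  also have "ennreal (\<Prod>i\<in>UNIV. 4 / (25 * (v i)\<^sup>2)) * emeasure lborel B = (\<integral>\<^sup>+z. ennreal (\<Prod>i\<in>UNIV. 4 / (25 * (v i)\<^sup>2)) * indicator B z \<partial>lborel)"
    using emeasure_vec_box(1)[OF Am] by (subst nn_integral_cmult_indicator) (auto simp: B_def)
  also have "\<dots> \<le> (\<integral>\<^sup>+z. indicator UH z * ennreal ((norm (jac (cay w) z))\<^sup>2) \<partial>lborel)"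
    by (intro nn_integral_mono lower)
  finally show ?thesis .
qed

text \<open>Bergman's reproducing formula for the product of half planes, with only a lower bound on its normalising constant.\<close>
lemma reproducing_half_space:
  fixes g :: "complex ^ 'n \<Rightarrow> complex"
  assumes w: "w \<in> UH" and g: "holo_on UH g" "(\<integral>\<^sup>+z. indicator UH z * ennreal ((norm (g z))\<^sup>2) \<partial>lborel) < \<infinity>"
  shows "(8/25) ^ CARD('n) * norm (g w) \<le> norm (\<integral>z. indicator UH z *\<^sub>R (g z * cnj (berg w z)) \<partial>lborel)"
    and "(\<integral>\<^sup>+z. indicator UH z * ennreal ((norm (berg w z))\<^sup>2) \<partial>lborel) < \<infinity>"
proof -
  interpret C: proper_rational UH polydisc "cay w" by (rule cay_proper_rational[OF w])
  obtain M where M: "M \<ge> 0" "\<And>f. f \<in> borel_measurable borel \<Longrightarrow>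
      (\<integral>\<^sup>+x. ennreal (C.jn x) * f (C.ext x) \<partial>lborel) = ennreal M * (\<integral>\<^sup>+y. indicator polydisc y * f y \<partial>lborel)"
    by (rule C.jac_push[OF convex_connected[OF convex_polydisc] bounded_polydisc]) (rule that, assumption+)
  have Dm [measurable]: "(polydisc :: (complex ^ 'n) set) \<in> sets borel" "(UH :: (complex ^ 'n) set) \<in> sets borel"
    by (auto intro: borel_open open_polydisc open_UH)
  define vol where "vol = measure lborel (polydisc :: (complex ^ 'n) set)"
  have vol: "emeasure lborel (polydisc :: (complex ^ 'n) set) = ennreal vol"
  proof -
    have "emeasure lborel (polydisc :: (complex ^ 'n) set) < \<infinity>" by (rule emeasure_bounded_finite[OF bounded_polydisc])
    then show ?thesis unfolding vol_def by (intro emeasure_eq_ennreal_measure) auto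
  qed
  have "(\<integral>\<^sup>+z. indicator UH z * ennreal ((norm (jac (cay w) z))\<^sup>2) \<partial>lborel) = (\<integral>\<^sup>+x. ennreal (C.jn x) \<partial>lborel)"
    by (intro nn_integral_cong) (auto simp: C.jn_def indicator_def)
  also have "\<dots> = ennreal (M * vol)" using M(2)[of "\<lambda>_. 1"] M(1) by (simp add: vol ennreal_mult vol_def)
  finally have mass: "(\<integral>\<^sup>+z. indicator UH z * ennreal ((norm (jac (cay w) z))\<^sup>2) \<partial>lborel) = ennreal (M * vol)" .
  have Mvol: "(8/25) ^ CARD('n) \<le> M * vol"
    using cay_jac_mass_lower[OF w] unfolding mass by (subst (asm) ennreal_le_iff) (auto simp: M(1) vol_def)
  have Mpos: "M > 0"
  proof (rule ccontr)
    assume "\<not> M > 0"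
    then have "(8/25 :: real) ^ CARD('n) \<le> 0" using Mvol M(1) by simp
    then show False using zero_less_power[of "8/25 :: real" "CARD('n)"] by linarith
  qed
  define \<kappa> where "\<kappa> = (\<Prod>i\<in>UNIV. w $ i - cnj (w $ i))"
  have wne: "w $ i - cnj (w $ i) \<noteq> 0" for i using w cnj_dist_pos[of "w $ i" "w $ i"] by (simp add: UH_def)
  have \<kappa>: "\<kappa> \<noteq> 0" unfolding \<kappa>_def using wne by simp
  have Jb: "jac (cay w) z = \<kappa> * berg w z" if "z \<in> UH" for z unfolding \<kappa>_def by (rule jac_cay_berg[OF w that])
  have bne: "berg w z \<noteq> 0" if "z \<in> UH" for z
  proof -
    have "z $ i - cnj (w $ i) \<noteq> 0" for i using w that by (intro cnj_dist_pos) (auto simp: UH_def)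
    then show ?thesis by (simp add: berg_def)
  qed
  show "(\<integral>\<^sup>+z. indicator UH z * ennreal ((norm (berg w z))\<^sup>2) \<partial>lborel) < \<infinity>"
  proof -
    have "(\<integral>\<^sup>+z. indicator UH z * ennreal ((norm (berg w z))\<^sup>2) \<partial>lborel) =
        (\<integral>\<^sup>+z. ennreal (1 / (norm \<kappa>)\<^sup>2) * ennreal (C.jn z) \<partial>lborel)"
      by (intro nn_integral_cong) (use \<kappa> in \<open>auto simp: indicator_def C.jn_def Jb norm_mult power_mult_distrib ennreal_mult[symmetric]\<close>)
    also have "\<dots> = ennreal (1 / (norm \<kappa>)\<^sup>2) * (\<integral>\<^sup>+z. ennreal (C.jn z) \<partial>lborel)"
      by (rule nn_integral_cmult) measurable
    also have "(\<integral>\<^sup>+z. ennreal (C.jn z) \<partial>lborel) = (\<integral>\<^sup>+z. indicator UH z * ennreal ((norm (jac (cay w) z))\<^sup>2) \<partial>lborel)"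
      by (intro nn_integral_cong) (auto simp: C.jn_def indicator_def)
    finally show ?thesis unfolding mass by (simp add: ennreal_mult_less_top)
  qed
  \<comment> \<open>Dividing by the Jacobian transports \<open>g\<close> to the polydisc. Then
    \<open>jn\<close> times \<open>G \<circ> cay w\<close> is \<open>g\<close> times the conjugate
    Jacobian, so the pairing of \<open>g\<close> with the kernel is a multiple of the integral of
    \<open>G\<close>, hence of \<open>G 0\<close>, hence of \<open>g w\<close>.\<close>
  define H where "H z = g z / jac (cay w) z" for z
  define G where "G t = H (cayinv w t)" for t
  have Gholo: "holo_on polydisc G"
    unfolding holo_on_iff_cdiff G_def
  proof
    fix t :: "complex ^ 'n" assume t: "t \<in> polydisc"
    have c: "cayinv w t \<in> UH" by (rule cay_cayinv(1)[OF w t])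
    have "cdiff H (cayinv w t)" unfolding H_def
      using g(1) c Jb[OF c] bne[OF c] \<kappa> by (intro cdiff_divide rat_on_cdiff[OF C.jac_rat open_UH c]) (auto simp: holo_on_iff_cdiff)
    then show "cdiff (\<lambda>t. H (cayinv w t)) t"
      by (rule cdiff_compose[rotated]) (rule rat_on_cdiff[OF cayinv_rat open_polydisc t])
  qed
  have GC: "G (cay w z) = g z / jac (cay w) z" if "z \<in> UH" for z
    by (simp add: G_def H_def cayinv_cay[OF w that])
  define G' where "G' t = indicator polydisc t *\<^sub>R G t" for t
  have G'm [measurable]: "G' \<in> borel_measurable borel" unfolding G'_def by (rule holo_indicator_measurable[OF Gholo open_polydisc])
  define g' where "g' z = indicator UH z *\<^sub>R g z" for z
  define J' where "J' z = indicator UH z *\<^sub>R cnj (jac (cay w) z)" for z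
  have g'm [measurable]: "g' \<in> borel_measurable borel" unfolding g'_def by (rule holo_indicator_measurable[OF g(1) open_UH])
  have J'm [measurable]: "J' \<in> borel_measurable borel"
    unfolding J'_def by (intro borel_measurable_continuous_on_indicator continuous_on_cnj C.jac_cont borel_open open_UH)
  have prodeq: "C.jn z *\<^sub>R G' (C.ext z) = g' z * J' z" for z
  proof (cases "z \<in> UH")
    case True
    have n: "jac (cay w) z \<noteq> 0" using Jb[OF True] bne[OF True] \<kappa> by simp
    have "C.jn z *\<^sub>R G' (C.ext z) = of_real ((norm (jac (cay w) z))\<^sup>2) * (g z / jac (cay w) z)"
      using True cay_in_polydisc[OF w True] by (simp add: C.jn_def C.ext_def G'_def GC scaleR_conv_of_real)
    also have "\<dots> = g z * cnj (jac (cay w) z)"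
      unfolding complex_norm_square using n by simp
    finally show ?thesis using True by (simp add: g'_def J'_def)
  qed (simp add: C.jn_def g'_def)
  have g'fin: "(\<integral>\<^sup>+z. ennreal ((norm (g' z))\<^sup>2) \<partial>lborel) < \<infinity>"
  proof -
    have "(\<integral>\<^sup>+z. ennreal ((norm (g' z))\<^sup>2) \<partial>lborel) = (\<integral>\<^sup>+z. indicator UH z * ennreal ((norm (g z))\<^sup>2) \<partial>lborel)"
      by (intro nn_integral_cong) (auto simp: g'_def indicator_def)
    then show ?thesis using g(2) by simp
  qed
  have J'fin: "(\<integral>\<^sup>+z. ennreal ((norm (J' z))\<^sup>2) \<partial>lborel) < \<infinity>"
  proof -
    have "(\<integral>\<^sup>+z. ennreal ((norm (J' z))\<^sup>2) \<partial>lborel) = (\<integral>\<^sup>+z. indicator UH z * ennreal ((norm (jac (cay w) z))\<^sup>2) \<partial>lborel)"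
      by (intro nn_integral_cong) (auto simp: J'_def indicator_def)
    then show ?thesis unfolding mass by simp
  qed
  have "integrable lborel (\<lambda>z. g' z * J' z)" by (rule integrable_from_sq[OF g'm J'm g'fin J'fin])
  then have fin1: "(\<integral>\<^sup>+z. ennreal (norm (g' z * J' z)) \<partial>lborel) < \<infinity>" unfolding integrable_iff_bounded by simp
  have "(\<integral>\<^sup>+z. ennreal (norm (g' z * J' z)) \<partial>lborel) = (\<integral>\<^sup>+z. ennreal (C.jn z) * ennreal (norm (G' (C.ext z))) \<partial>lborel)"
    by (intro nn_integral_cong) (simp add: prodeq[symmetric] C.jn_nonneg ennreal_mult)
  also have "\<dots> = ennreal M * (\<integral>\<^sup>+t. indicator polydisc t * ennreal (norm (G' t)) \<partial>lborel)" by (rule M(2)) measurable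
  also have "(\<integral>\<^sup>+t. indicator polydisc t * ennreal (norm (G' t)) \<partial>lborel) = (\<integral>\<^sup>+t. ennreal (norm (G' t)) \<partial>lborel)"
    by (intro nn_integral_cong) (auto simp: G'_def indicator_def)
  finally have "(\<integral>\<^sup>+t. ennreal (norm (G' t)) \<partial>lborel) < \<infinity>"
    using fin1 Mpos by (auto simp: ennreal_mult_less_top)
  then have iG': "integrable lborel G'" by (intro integrableI_bounded) auto
  have "(\<integral>z. g' z * J' z \<partial>lborel) = M *\<^sub>R (\<integral>t. indicator polydisc t *\<^sub>R G' t \<partial>lborel)"
    unfolding prodeq[symmetric] by (rule C.jac_push_integral[OF M G'm])
  also have "(\<integral>t. indicator polydisc t *\<^sub>R G' t \<partial>lborel) = vol *\<^sub>R G 0"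
  proof -
    have "indicator polydisc t *\<^sub>R G' t = G' t" for t by (simp add: G'_def indicator_def)
    then show ?thesis
      using polydisc_mean_value[OF Gholo] iG' unfolding G'_def[symmetric] vol_def[symmetric] by simp
  qed
  also have "G 0 = g w / (\<kappa> * berg w w)"
  proof -
    have "cayinv w 0 = w" by (simp add: cayinv_def)
    then show ?thesis using Jb[OF w] by (simp add: G_def H_def)
  qed
  also have "\<kappa> * berg w w = 1 / \<kappa>"
    unfolding \<kappa>_def berg_def using wne by (simp add: prod.distrib[symmetric] power2_eq_square) (simp add: prod_dividef)
  finally have "(\<integral>z. g' z * J' z \<partial>lborel) = of_real (M * vol) * (g w * \<kappa>)" by (simp add: scaleR_conv_of_real)
  moreover have "(\<integral>z. g' z * J' z \<partial>lborel) = cnj \<kappa> * (\<integral>z. indicator UH z *\<^sub>R (g z * cnj (berg w z)) \<partial>lborel)"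
    unfolding integral_mult_right_zero[symmetric]
    by (intro Bochner_Integration.integral_cong) (auto simp: g'_def J'_def indicator_def Jb)
  ultimately have "norm (cnj \<kappa> * (\<integral>z. indicator UH z *\<^sub>R (g z * cnj (berg w z)) \<partial>lborel)) = norm (of_real (M * vol) * (g w * \<kappa>))"
    by simp
  then have "norm \<kappa> * norm (\<integral>z. indicator UH z *\<^sub>R (g z * cnj (berg w z)) \<partial>lborel) = norm \<kappa> * (M * vol * norm (g w))"
    using M(1) by (simp add: norm_mult vol_def mult_ac)
  then have "norm (\<integral>z. indicator UH z *\<^sub>R (g z * cnj (berg w z)) \<partial>lborel) = M * vol * norm (g w)"
    using \<kappa> by simp
  then show "(8/25) ^ CARD('n) * norm (g w) \<le> norm (\<integral>z. indicator UH z *\<^sub>R (g z * cnj (berg w z)) \<partial>lborel)"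
    using Mvol by (simp add: mult_right_mono)
qed

section \<open>Half-plane estimates\<close>

lemma ennreal_sum_prod2:
  "p \<ge> 0 \<Longrightarrow> q \<ge> 0 \<Longrightarrow> r \<ge> 0 \<Longrightarrow> s \<ge> 0 \<Longrightarrow> ennreal (p * q + r * s) = ennreal p * ennreal q + ennreal r * ennreal s"
  by (simp add: ennreal_plus ennreal_mult)

section \<open>Integrals over horizontal lines and over heights\<close>

lemma nn_integral_powr_from_0:
  fixes s c :: real
  assumes "s > -1" "c \<ge> 0"
  shows "(\<integral>\<^sup>+x. ennreal (indicator {0..c} x * x powr s) \<partial>lborel) = ennreal (c powr (s + 1) / (s + 1))"
proof (rule nn_integral_has_integral_lborel)
  have "((\<lambda>x. x powr s) has_integral (c powr (s + 1) / (s + 1))) {0..c}"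
    by (rule has_integral_powr_from_0[OF assms])
  then have "((\<lambda>x. if x \<in> {0..c} then x powr s else 0) has_integral (c powr (s + 1) / (s + 1))) UNIV"
    by (simp only: has_integral_restrict_UNIV)
  moreover have "(\<lambda>x. if x \<in> {0..c} then x powr s else 0) = (\<lambda>x. indicator {0..c} x * x powr s)"
    by (auto simp: indicator_def)
  ultimately show "((\<lambda>x. indicator {0..c} x * x powr s) has_integral (c powr (s + 1) / (s + 1))) UNIV" by simp
qed auto

lemma nn_integral_powr_to_inf:
  fixes s c :: real
  assumes "s < -1" "c > 0"
  shows "(\<integral>\<^sup>+x. ennreal (indicator {c..} x * x powr s) \<partial>lborel) = ennreal (- (c powr (s + 1)) / (s + 1))"
proof (rule nn_integral_has_integral_lborel)
  have "((\<lambda>x. x powr s) has_integral (- (c powr (s + 1)) / (s + 1))) {c..}"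
    by (rule has_integral_powr_to_inf[OF assms])
  then have "((\<lambda>x. if x \<in> {c..} then x powr s else 0) has_integral (- (c powr (s + 1)) / (s + 1))) UNIV"
    by (simp only: has_integral_restrict_UNIV)
  moreover have "(\<lambda>x. if x \<in> {c..} then x powr s else 0) = (\<lambda>x. indicator {c..} x * x powr s)"
    by (auto simp: indicator_def)
  ultimately show "((\<lambda>x. indicator {c..} x * x powr s) has_integral (- (c powr (s + 1)) / (s + 1))) UNIV" by simp
qed auto

lemma nn_integral_abs_shift:
  fixes f :: "real \<Rightarrow> ennreal" and a :: real
  assumes [measurable]: "f \<in> borel_measurable borel"
  shows "(\<integral>\<^sup>+x. f \<bar>x - a\<bar> \<partial>lborel) \<le> 2 * (\<integral>\<^sup>+x. indicator {0..} x * f x \<partial>lborel)"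
proof -
  let ?I = "\<integral>\<^sup>+x. indicator {0..} x * f x \<partial>lborel"
  have "(\<integral>\<^sup>+x. f \<bar>x - a\<bar> \<partial>lborel) = (\<integral>\<^sup>+x. f \<bar>x\<bar> \<partial>lborel)"
    using nn_integral_real_affine[of "\<lambda>x. f \<bar>x - a\<bar>" 1 a] by simp
  also have "\<dots> \<le> (\<integral>\<^sup>+x. indicator {0..} x * f x + indicator {0..} (- x) * f (- x) \<partial>lborel)"
    by (intro nn_integral_mono) (auto simp: indicator_def abs_if)
  also have "\<dots> = ?I + (\<integral>\<^sup>+x. indicator {0..} (- x) * f (- x) \<partial>lborel)"
    by (rule nn_integral_add) auto
  also have "(\<integral>\<^sup>+x. indicator {0..} (- x) * f (- x) \<partial>lborel) = ?I"
    using nn_integral_real_affine[of "\<lambda>x. indicator {0..} x * f x" "-1" 0] by simp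
  finally show ?thesis by (simp add: mult_2)
qed

lemma x_integral_1:
  fixes T u :: real
  assumes T: "T > 0"
  shows "(\<integral>\<^sup>+x. ennreal (max T \<bar>x - u\<bar> powr (-3/2)) \<partial>lborel) \<le> ennreal (6 * T powr (-1/2))"
proof -
  have "(\<integral>\<^sup>+x. ennreal (max T \<bar>x - u\<bar> powr (-3/2)) \<partial>lborel) \<le> 2 * (\<integral>\<^sup>+x. indicator {0..} x * ennreal (max T x powr (-3/2)) \<partial>lborel)"
    by (rule nn_integral_abs_shift[of "\<lambda>x. ennreal (max T x powr (-3/2))"]) auto
  also have "(\<integral>\<^sup>+x. indicator {0..} x * ennreal (max T x powr (-3/2)) \<partial>lborel)
     \<le> (\<integral>\<^sup>+x. ennreal (T powr (-3/2)) * indicator {0..T} x + ennreal (indicator {T..} x * x powr (-3/2)) \<partial>lborel)"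
    by (intro nn_integral_mono) (auto simp: indicator_def max_def)
  also have "\<dots> = ennreal (T powr (-3/2)) * ennreal T + ennreal (- (T powr (-3/2 + 1)) / (-3/2 + 1))"
    using T by (subst nn_integral_add) (auto simp: nn_integral_cmult_indicator nn_integral_powr_to_inf)
  also have "\<dots> = ennreal (3 * T powr (-1/2))"
  proof -
    have "T powr (-3/2) * T = T powr (-1/2)"
      using T powr_add[of T "-3/2" 1] by simp
    then show ?thesis using T by (simp add: ennreal_mult[symmetric] ennreal_plus[symmetric] del: ennreal_plus)
  qed
  finally have "(\<integral>\<^sup>+x. ennreal (max T \<bar>x - u\<bar> powr (-3/2)) \<partial>lborel) \<le> 2 * ennreal (3 * T powr (-1/2))"
    by (simp add: mult_left_mono)
  also have "2 * ennreal (3 * T powr (-1/2)) = ennreal (6 * T powr (-1/2))"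
    using ennreal_mult[of 2 "3 * T powr (-1/2)"] by simp
  finally show ?thesis .
qed

lemma x_integral_2:
  fixes T a :: real
  assumes T: "T > 0"
  shows "(\<integral>\<^sup>+x. ennreal (indicator {..T} \<bar>x - a\<bar> * \<bar>x - a\<bar> powr (-1/2)) \<partial>lborel) \<le> ennreal (4 * T powr (1/2))"
proof -
  have "(\<integral>\<^sup>+x. ennreal (indicator {..T} \<bar>x - a\<bar> * \<bar>x - a\<bar> powr (-1/2)) \<partial>lborel)
     \<le> 2 * (\<integral>\<^sup>+x. indicator {0..} x * ennreal (indicator {..T} x * x powr (-1/2)) \<partial>lborel)"
    by (rule nn_integral_abs_shift[of "\<lambda>x. ennreal (indicator {..T} x * x powr (-1/2))"]) auto
  also have "(\<integral>\<^sup>+x. indicator {0..} x * ennreal (indicator {..T} x * x powr (-1/2)) \<partial>lborel)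
      = (\<integral>\<^sup>+x. ennreal (indicator {0..T} x * x powr (-1/2)) \<partial>lborel)"
    by (intro nn_integral_cong) (auto simp: indicator_def)
  also have "\<dots> = ennreal (T powr (-1/2 + 1) / (-1/2 + 1))" by (rule nn_integral_powr_from_0) (use T in auto)
  finally have "(\<integral>\<^sup>+x. ennreal (indicator {..T} \<bar>x - a\<bar> * \<bar>x - a\<bar> powr (-1/2)) \<partial>lborel) \<le> 2 * ennreal (2 * T powr (1/2))"
    by (simp add: mult.commute)
  also have "2 * ennreal (2 * T powr (1/2)) = ennreal (4 * T powr (1/2))"
    using ennreal_mult[of 2 "2 * T powr (1/2)"] by simp
  finally show ?thesis .
qed

text \<open>Split at distance \<open>T\<close> from \<open>a\<close>. Near \<open>a\<close> the
  first factor is at most \<open>T powr (-3/2)\<close> and the remaining singularity is integrable;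
  elsewhere the second factor is at most \<open>T powr (-1/2)\<close>. The bound 10 = 4 + 6 does not
  depend on \<open>a\<close>, and the plain kernel gets the same bound so that both can be treated
  alike.\<close>

lemma x_integral_3:
  fixes T u a :: real
  assumes T: "T > 0"
  shows "(\<integral>\<^sup>+x. ennreal (max T \<bar>x - u\<bar> powr (-3/2) * \<bar>x - a\<bar> powr (-1/2)) \<partial>lborel) \<le> ennreal (10 / T)"
    and "(\<integral>\<^sup>+x. ennreal (max T \<bar>x - u\<bar> powr (-2)) \<partial>lborel) \<le> ennreal (10 / T)"
proof -
  have T1: "T powr (-1) = 1 / T" using T by (simp add: powr_minus_divide)
  have pw: "T powr (-3/2) * T powr (1/2) = 1 / T" "T powr (-1/2) * T powr (-1/2) = 1 / T"
    unfolding T1[symmetric] using powr_add[of T "-3/2" "1/2"] powr_add[of T "-1/2" "-1/2"] by simp_all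
  have "(\<integral>\<^sup>+x. ennreal (max T \<bar>x - u\<bar> powr (-3/2) * \<bar>x - a\<bar> powr (-1/2)) \<partial>lborel)
     \<le> (\<integral>\<^sup>+x. ennreal (T powr (-3/2)) * ennreal (indicator {..T} \<bar>x - a\<bar> * \<bar>x - a\<bar> powr (-1/2)) +
          ennreal (T powr (-1/2)) * ennreal (max T \<bar>x - u\<bar> powr (-3/2)) \<partial>lborel)"
  proof (rule nn_integral_mono)
    fix x
    let ?m = "max T \<bar>x - u\<bar> powr (-3/2)"
    have m: "?m \<le> T powr (-3/2)" using T by (intro powr_mono2') auto
    have "?m * \<bar>x - a\<bar> powr (-1/2) \<le> T powr (-3/2) * (indicator {..T} \<bar>x - a\<bar> * \<bar>x - a\<bar> powr (-1/2)) + T powr (-1/2) * ?m"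
    proof (cases "\<bar>x - a\<bar> \<le> T")
      case True
      then show ?thesis using m mult_right_mono[OF m, of "\<bar>x - a\<bar> powr (-1/2)"] by (simp add: add_increasing2)
    next
      case False
      then have "\<bar>x - a\<bar> powr (-1/2) \<le> T powr (-1/2)" using T by (intro powr_mono2') auto
      then show ?thesis using False mult_left_mono[of "\<bar>x - a\<bar> powr (-1/2)" "T powr (-1/2)" ?m] by (simp add: mult.commute)
    qed
    then have "ennreal (?m * \<bar>x - a\<bar> powr (-1/2)) \<le> ennreal (T powr (-3/2) * (indicator {..T} \<bar>x - a\<bar> * \<bar>x - a\<bar> powr (-1/2)) + T powr (-1/2) * ?m)"
      by (rule ennreal_leI)
    also have "\<dots> = ennreal (T powr (-3/2)) * ennreal (indicator {..T} \<bar>x - a\<bar> * \<bar>x - a\<bar> powr (-1/2)) + ennreal (T powr (-1/2)) * ennreal ?m"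
      by (subst ennreal_plus) (auto simp: ennreal_mult)
    finally show "ennreal (?m * \<bar>x - a\<bar> powr (-1/2)) \<le> ennreal (T powr (-3/2)) * ennreal (indicator {..T} \<bar>x - a\<bar> * \<bar>x - a\<bar> powr (-1/2)) + ennreal (T powr (-1/2)) * ennreal ?m" .
  qed
  also have "\<dots> = ennreal (T powr (-3/2)) * (\<integral>\<^sup>+x. ennreal (indicator {..T} \<bar>x - a\<bar> * \<bar>x - a\<bar> powr (-1/2)) \<partial>lborel) +
      ennreal (T powr (-1/2)) * (\<integral>\<^sup>+x. ennreal (max T \<bar>x - u\<bar> powr (-3/2)) \<partial>lborel)"
    by (subst nn_integral_add) (auto simp: nn_integral_cmult)
  also have "\<dots> \<le> ennreal (T powr (-3/2)) * ennreal (4 * T powr (1/2)) + ennreal (T powr (-1/2)) * ennreal (6 * T powr (-1/2))"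
    by (intro add_mono mult_left_mono x_integral_1 x_integral_2 T) auto
  also have "\<dots> = ennreal (4 * (T powr (-3/2) * T powr (1/2)) + 6 * (T powr (-1/2) * T powr (-1/2)))"
    by (simp add: ennreal_mult[symmetric] ennreal_plus[symmetric] mult_ac del: ennreal_plus)
  also have "\<dots> = ennreal (10 / T)" unfolding pw by simp
  finally show "(\<integral>\<^sup>+x. ennreal (max T \<bar>x - u\<bar> powr (-3/2) * \<bar>x - a\<bar> powr (-1/2)) \<partial>lborel) \<le> ennreal (10 / T)" .
  have "(\<integral>\<^sup>+x. ennreal (max T \<bar>x - u\<bar> powr (-2)) \<partial>lborel) \<le> (\<integral>\<^sup>+x. ennreal (T powr (-1/2)) * ennreal (max T \<bar>x - u\<bar> powr (-3/2)) \<partial>lborel)"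
  proof (rule nn_integral_mono)
    fix x
    have "max T \<bar>x - u\<bar> powr (-2) = max T \<bar>x - u\<bar> powr (-1/2) * max T \<bar>x - u\<bar> powr (-3/2)"
      using T by (simp add: powr_add[symmetric])
    also have "\<dots> \<le> T powr (-1/2) * max T \<bar>x - u\<bar> powr (-3/2)"
      using T by (intro mult_right_mono powr_mono2') auto
    finally show "ennreal (max T \<bar>x - u\<bar> powr (-2)) \<le> ennreal (T powr (-1/2)) * ennreal (max T \<bar>x - u\<bar> powr (-3/2))"
      by (simp add: ennreal_mult[symmetric] ennreal_leI)
  qed
  also have "\<dots> = ennreal (T powr (-1/2)) * (\<integral>\<^sup>+x. ennreal (max T \<bar>x - u\<bar> powr (-3/2)) \<partial>lborel)"
    by (rule nn_integral_cmult) auto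
  also have "\<dots> \<le> ennreal (T powr (-1/2)) * ennreal (6 * T powr (-1/2))"
    by (intro mult_left_mono x_integral_1 T) auto
  also have "\<dots> = ennreal (6 * (T powr (-1/2) * T powr (-1/2)))"
    by (simp add: ennreal_mult[symmetric] mult_ac)
  also have "\<dots> \<le> ennreal (10 / T)" unfolding pw using T by (intro ennreal_leI) (simp add: divide_right_mono)
  finally show "(\<integral>\<^sup>+x. ennreal (max T \<bar>x - u\<bar> powr (-2)) \<partial>lborel) \<le> ennreal (10 / T)" .
qed

text \<open>Split at \<open>y = v\<close>. Integrability at 0 uses \<open>b < 1\<close> and produces
  \<open>1 / (1 - b)\<close>; integrability at infinity uses \<open>b > 0\<close> and produces
  \<open>1 / b\<close>.\<close>

lemma y_integral:
  fixes b v :: real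
  assumes b: "0 < b" "b < 1" and v: "v > 0"
  shows "(\<integral>\<^sup>+y. ennreal (indicator {0<..} y * (y powr (-b) * (10 / (y + v)))) \<partial>lborel) \<le> ennreal (10 * (1 / (1 - b) + 1 / b) * v powr (-b))"
proof -
  have "(\<integral>\<^sup>+y. ennreal (indicator {0<..} y * (y powr (-b) * (10 / (y + v)))) \<partial>lborel)
     \<le> (\<integral>\<^sup>+y. ennreal (10 / v) * ennreal (indicator {0..v} y * y powr (-b)) + ennreal 10 * ennreal (indicator {v..} y * y powr (-b-1)) \<partial>lborel)"
  proof (rule nn_integral_mono)
    fix y
    have "indicator {0<..} y * (y powr (-b) * (10 / (y + v))) \<le> 10 / v * (indicator {0..v} y * y powr (-b)) + 10 * (indicator {v..} y * y powr (-b-1))"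
    proof (cases "y > 0")
      case True
      show ?thesis
      proof (cases "y \<le> v")
        case True
        have "y powr (-b) * (10 / (y + v)) \<le> y powr (-b) * (10 / v)"
          using v \<open>y > 0\<close> by (intro mult_left_mono divide_left_mono) auto
        then show ?thesis using True \<open>y > 0\<close> by (auto simp: indicator_def mult_ac intro: add_increasing2)
      next
        case False
        have "y powr (-b) * (10 / (y + v)) \<le> y powr (-b) * (10 / y)"
          using v \<open>y > 0\<close> by (intro mult_left_mono divide_left_mono) auto
        also have "\<dots> = 10 * y powr (-b-1)"
          using \<open>y > 0\<close> powr_add[of y "-b" "-1"] by (simp add: powr_minus_divide)
        finally show ?thesis using False \<open>y > 0\<close> by simp
      qed
    qed (auto simp: indicator_def v)
    then have "ennreal (indicator {0<..} y * (y powr (-b) * (10 / (y + v)))) \<le> ennreal (10 / v * (indicator {0..v} y * y powr (-b)) + 10 * (indicator {v..} y * y powr (-b-1)))"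
      by (rule ennreal_leI)
    also have "\<dots> = ennreal (10 / v) * ennreal (indicator {0..v} y * y powr (-b)) + ennreal 10 * ennreal (indicator {v..} y * y powr (-b-1))"
      by (rule ennreal_sum_prod2) (use v in auto)
    finally show "ennreal (indicator {0<..} y * (y powr (-b) * (10 / (y + v)))) \<le> \<dots>" .
  qed
  also have "\<dots> = ennreal (10 / v) * (\<integral>\<^sup>+y. ennreal (indicator {0..v} y * y powr (-b)) \<partial>lborel)
      + ennreal 10 * (\<integral>\<^sup>+y. ennreal (indicator {v..} y * y powr (-b-1)) \<partial>lborel)"
    by (subst nn_integral_add) (auto simp: nn_integral_cmult)
  also have "\<dots> = ennreal (10 / v) * ennreal (v powr (-b+1) / (-b+1)) + ennreal 10 * ennreal (- (v powr (-b-1+1)) / (-b-1+1))"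
    using b v by (subst nn_integral_powr_from_0, simp, simp, subst nn_integral_powr_to_inf) auto
  also have "\<dots> = ennreal (10 / v * (v powr (-b+1) / (-b+1)) + 10 * (- (v powr (-b-1+1)) / (-b-1+1)))"
    by (rule ennreal_sum_prod2[symmetric]) (use b v in auto)
  also have "10 / v * (v powr (-b+1) / (-b+1)) + 10 * (- (v powr (-b-1+1)) / (-b-1+1)) = 10 * (1 / (1 - b) + 1 / b) * v powr (-b)"
  proof -
    have "v powr (-b+1) = v powr (-b) * v" using v powr_add[of v "-b" 1] by simp
    then show ?thesis using b v by (simp add: field_simps)
  qed
  finally show ?thesis .
qed

lemma cmod_half_plane_ge:
  assumes "Im z > 0" "Im w > 0"
  shows "max (Im z + Im w) \<bar>Re z - Re w\<bar> \<le> cmod (z - cnj w)" "cmod (z - w) \<le> cmod (z - cnj w)"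
proof -
  show "max (Im z + Im w) \<bar>Re z - Re w\<bar> \<le> cmod (z - cnj w)"
    using abs_Re_le_cmod[of "z - cnj w"] abs_Im_le_cmod[of "z - cnj w"] by auto
  have "(cmod (z - w))\<^sup>2 \<le> (cmod (z - cnj w))\<^sup>2" using assms by (simp add: cmod_diff_cnj)
  then show "cmod (z - w) \<le> cmod (z - cnj w)" by (rule power2_le_imp_le) simp
qed

text \<open>A Forelli-Rudin estimate. Only the bound of order \<open>1 / (y + v)\<close> for each
  horizontal line enters, so the kernel with and without an additional singularity share one
  proof.\<close>

lemma half_plane_integral:
  fixes f :: "complex \<Rightarrow> real"
  assumes b: "0 < b" "b < 1" and v: "v > 0" and fm [measurable]: "f \<in> borel_measurable borel"
    and x: "\<And>y. y > 0 \<Longrightarrow> (\<integral>\<^sup>+x. ennreal (f (Complex x y)) \<partial>lborel) \<le> ennreal (10 / (y + v))"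
  shows "(\<integral>\<^sup>+z. ennreal (indicator {0<..} (Im z) * (Im z powr (-b) * f z)) \<partial>lborel) \<le> ennreal (10 * (1 / (1 - b) + 1 / b) * v powr (-b))"
proof -
  have Cm [measurable]: "(\<lambda>x. Complex x y) \<in> borel_measurable borel" for y
    by (rule borel_measurable_complex_iff[THEN iffD2]) auto
  have "(\<integral>\<^sup>+z. ennreal (indicator {0<..} (Im z) * (Im z powr (-b) * f z)) \<partial>lborel)
     = (\<integral>\<^sup>+y. \<integral>\<^sup>+x. ennreal (indicator {0<..} y * (y powr (-b) * f (Complex x y))) \<partial>lborel \<partial>lborel)"
    by (subst nn_integral_complex) auto
  also have "\<dots> \<le> (\<integral>\<^sup>+y. ennreal (indicator {0<..} y * (y powr (-b) * (10 / (y + v)))) \<partial>lborel)"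
  proof (rule nn_integral_mono)
    fix y :: real
    show "(\<integral>\<^sup>+x. ennreal (indicator {0<..} y * (y powr (-b) * f (Complex x y))) \<partial>lborel) \<le> ennreal (indicator {0<..} y * (y powr (-b) * (10 / (y + v))))"
    proof (cases "y > 0")
      case True
      have "(\<integral>\<^sup>+x. ennreal (indicator {0<..} y * (y powr (-b) * f (Complex x y))) \<partial>lborel) = ennreal (y powr (-b)) * (\<integral>\<^sup>+x. ennreal (f (Complex x y)) \<partial>lborel)"
        using True by (subst nn_integral_cmult[symmetric]) (auto simp: ennreal_mult' intro: measurable_compose[OF Cm fm])
      also have "\<dots> \<le> ennreal (y powr (-b)) * ennreal (10 / (y + v))" by (intro mult_left_mono x True) simp
      finally show ?thesis using True v by (simp add: ennreal_mult[symmetric])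
    qed simp
  qed
  also have "\<dots> \<le> ennreal (10 * (1 / (1 - b) + 1 / b) * v powr (-b))" by (rule y_integral[OF b v])
  finally show ?thesis .
qed

lemma half_plane_integral_2:
  assumes b: "0 < b" "b < 1" and w: "Im w > 0"
  shows "(\<integral>\<^sup>+z. ennreal (indicator {0<..} (Im z) * (Im z powr (-b) * cmod (z - cnj w) powr (-2))) \<partial>lborel)
    \<le> ennreal (10 * (1 / (1 - b) + 1 / b) * Im w powr (-b))"
proof (rule half_plane_integral[OF b w])
  fix y :: real assume y: "y > 0"
  have "(\<integral>\<^sup>+x. ennreal (cmod (Complex x y - cnj w) powr (-2)) \<partial>lborel) \<le> (\<integral>\<^sup>+x. ennreal (max (y + Im w) \<bar>x - Re w\<bar> powr (-2)) \<partial>lborel)"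
    using cmod_half_plane_ge(1)[of "Complex _ y" w] y w by (intro nn_integral_mono ennreal_leI powr_mono2') auto
  also have "\<dots> \<le> ennreal (10 / (y + Im w))" by (rule x_integral_3(2)) (use y w in auto)
  finally show "(\<integral>\<^sup>+x. ennreal (cmod (Complex x y - cnj w) powr (-2)) \<partial>lborel) \<le> ennreal (10 / (y + Im w))" .
qed measurable

text \<open>Half a power of the kernel is traded for a singularity at \<open>a\<close>, which will
  be a root of a polynomial. As \<open>cmod (z - a)\<close> is at least the horizontal distance, the
  bound is uniform over all positions of \<open>a\<close>.\<close>

lemma half_plane_integral_3:
  assumes b: "0 < b" "b < 1" and w: "Im w > 0"
  shows "(\<integral>\<^sup>+z. ennreal (indicator {0<..} (Im z) * (Im z powr (-b) * (cmod (z - cnj w) powr (-3/2) * cmod (z - a) powr (-1/2)))) \<partial>lborel)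
    \<le> ennreal (10 * (1 / (1 - b) + 1 / b) * Im w powr (-b))"
proof (rule half_plane_integral[OF b w])
  fix y :: real assume y: "y > 0"
  have "(\<integral>\<^sup>+x. ennreal (cmod (Complex x y - cnj w) powr (-3/2) * cmod (Complex x y - a) powr (-1/2)) \<partial>lborel)
     \<le> (\<integral>\<^sup>+x. ennreal (max (y + Im w) \<bar>x - Re w\<bar> powr (-3/2) * \<bar>x - Re a\<bar> powr (-1/2)) \<partial>lborel)"
  \<comment> \<open>At \<open>x = Re a\<close> the right side is 0, because
    \<open>0 powr (-1/2) = 0\<close>, and the comparison may fail; that point is discarded as a null
    set.\<close>
  proof (rule nn_integral_mono_AE)
    have "AE x in lborel. x \<noteq> Re a" by (rule AE_lborel_singleton)
    then show "AE x in lborel. ennreal (cmod (Complex x y - cnj w) powr (-3/2) * cmod (Complex x y - a) powr (-1/2))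
        \<le> ennreal (max (y + Im w) \<bar>x - Re w\<bar> powr (-3/2) * \<bar>x - Re a\<bar> powr (-1/2))"
    proof eventually_elim
      fix x assume x: "x \<noteq> Re a"
      have "cmod (Complex x y - cnj w) powr (-3/2) \<le> max (y + Im w) \<bar>x - Re w\<bar> powr (-3/2)"
        using cmod_half_plane_ge(1)[of "Complex x y" w] y w by (intro powr_mono2') auto
      moreover have "cmod (Complex x y - a) powr (-1/2) \<le> \<bar>x - Re a\<bar> powr (-1/2)"
        using abs_Re_le_cmod[of "Complex x y - a"] x by (intro powr_mono2') auto
      ultimately show "ennreal (cmod (Complex x y - cnj w) powr (-3/2) * cmod (Complex x y - a) powr (-1/2))
        \<le> ennreal (max (y + Im w) \<bar>x - Re w\<bar> powr (-3/2) * \<bar>x - Re a\<bar> powr (-1/2))"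
        by (intro ennreal_leI mult_mono) auto
    qed
  qed
  also have "\<dots> \<le> ennreal (10 / (y + Im w))" by (rule x_integral_3(1)) (use y w in auto)
  finally show "(\<integral>\<^sup>+x. ennreal (cmod (Complex x y - cnj w) powr (-3/2) * cmod (Complex x y - a) powr (-1/2)) \<partial>lborel) \<le> ennreal (10 / (y + Im w))" .
qed measurable

lemma complex_poly_factor:
  fixes q :: "complex poly"
  assumes "q \<noteq> 0"
  obtains c rs where "c \<noteq> 0" "length rs = degree q" "\<And>z. poly q z = c * (\<Prod>r\<leftarrow>rs. z - r)"
proof -
  obtain A where A: "size A = degree q" "q = smult (lead_coeff q) (\<Prod>x\<in>#A. [:- x, 1:])"
    using alg_closed_imp_factorization[OF assms] by blast
  obtain rs where rs: "A = mset rs" by (metis ex_mset)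
  have p: "poly (\<Prod>x\<leftarrow>rs. [:- x, 1:]) z = (\<Prod>r\<leftarrow>rs. z - r)" for z
    by (induction rs) (auto simp: algebra_simps)
  have e: "(\<Prod>x\<in>#A. [:- x, 1:]) = (\<Prod>x\<leftarrow>rs. [:- x, 1:])"
    by (simp only: rs mset_map[symmetric] prod_mset_prod_list)
  have "poly q z = lead_coeff q * (\<Prod>r\<leftarrow>rs. z - r)" for z
    by (subst A(2)) (simp only: e poly_smult p)
  then show ?thesis using that[of "lead_coeff q" rs] A(1) rs assms by simp
qed

section \<open>Polynomial weights\<close>

text \<open>|x|^(-a) with value infinity at 0, even for \<open>a = 0\<close>, since
  \<open>0 powr a = 0\<close>. With the value 0 that a real power would take there, the estimate
  below would be false at zeros of the polynomial, and the iterated integration runs through points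
  where it may vanish.\<close>

definition wt :: "real \<Rightarrow> complex \<Rightarrow> ennreal" where
  "wt a x = inverse (ennreal (cmod x powr a))"

lemma wt_zero: "wt a 0 = \<infinity>" by (simp add: wt_def)

lemma wt_nonzero: "x \<noteq> 0 \<Longrightarrow> wt a x = ennreal (cmod x powr (- a))"
  by (simp add: wt_def inverse_ennreal powr_minus)

lemma wt_measurable [measurable]: "f \<in> borel_measurable M \<Longrightarrow> (\<lambda>x. wt a (f x)) \<in> borel_measurable M"
  unfolding wt_def by measurable

text \<open>A single coordinate factor of the modulus of \<open>berg\<close>, with the height weight
  and the cut-off to the half plane built in.\<close>

definition kap :: "real \<Rightarrow> complex \<Rightarrow> complex \<Rightarrow> ennreal" where
  "kap b \<omega> s = ennreal (indicator {0<..} (Im s) * (Im s powr (-b) * cmod (s - cnj \<omega>) powr (-2)))"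

lemma kap_measurable [measurable]: "f \<in> borel_measurable M \<Longrightarrow> (\<lambda>x. kap b \<omega> (f x)) \<in> borel_measurable M"
proof -
  have "kap b \<omega> \<in> borel_measurable borel" unfolding kap_def by measurable
  then show "f \<in> borel_measurable M \<Longrightarrow> (\<lambda>x. kap b \<omega> (f x)) \<in> borel_measurable M"
    by (rule measurable_compose[rotated])
qed

text \<open>Each factor is at most the square of S = 1 plus the sum of the square roots, so the
  product is at most S^(2 m); the condition on \<open>a\<close> brings the exponent down to at most
  1. In this way a product of root singularities becomes a sum with one root per term.\<close>

lemma prod_powr_le:
  fixes \<rho> :: "nat \<Rightarrow> real"
  assumes \<rho>: "\<And>i. i < m \<Longrightarrow> \<rho> i \<ge> 0" and a: "a \<ge> 0" "2 * a * real m \<le> 1"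
  shows "(\<Prod>i<m. \<rho> i) powr a \<le> 1 + (\<Sum>i<m. sqrt (\<rho> i))"
proof -
  define S where "S = 1 + (\<Sum>i<m. sqrt (\<rho> i))"
  have "(\<Sum>i<m. sqrt (\<rho> i)) \<ge> 0" by (rule sum_nonneg) (use \<rho> in auto)
  then have S1: "S \<ge> 1" by (simp add: S_def)
  have le: "\<rho> i \<le> S\<^sup>2" if "i < m" for i
  proof -
    have "sqrt (\<rho> i) \<le> (\<Sum>i<m. sqrt (\<rho> i))" by (rule member_le_sum) (use that \<rho> in auto)
    then have "sqrt (\<rho> i) \<le> S" by (simp add: S_def)
    then have "(sqrt (\<rho> i))\<^sup>2 \<le> S\<^sup>2" by (rule power_mono) (use \<rho>[OF that] in simp)
    then show ?thesis using \<rho>[OF that] by simp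
  qed
  have "(\<Prod>i<m. \<rho> i) \<le> (\<Prod>i<m. S\<^sup>2)" by (rule prod_mono) (use \<rho> le in auto)
  also have "\<dots> = S powr (2 * real m)"
    using S1 powr_realpow[of S "2 * m"] by (simp add: power_mult)
  finally have "(\<Prod>i<m. \<rho> i) powr a \<le> (S powr (2 * real m)) powr a"
    by (rule powr_mono2[OF a(1)  _, rotated]) (use \<rho> in \<open>auto intro: prod_nonneg\<close>)
  also have "\<dots> = S powr (2 * a * real m)" by (simp add: powr_powr mult_ac)
  also have "\<dots> \<le> S powr 1" using a S1 by (intro powr_mono) auto
  finally show ?thesis using S1 by (simp add: S_def)
qed

text \<open>|q(s)|^(-a) is compared with |q(\<omega>)|^(-a): their quotient is a product over the
  roots, which \<open>prod_powr_le\<close> turns into a sum. The constant depends on the polynomial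
  only through the degree bound, since \<open>half_plane_integral_3\<close> is uniform in the root.
  If \<open>q\<close> vanishes at \<open>\<omega>\<close>, the right side is infinite.\<close>

lemma poly_weight_integral:
  fixes q :: "complex poly"
  assumes b: "0 < b" "b < 1" and \<omega>: "Im \<omega> > 0" and d: "degree q \<le> d" and a: "a \<ge> 0" "2 * a * real d \<le> 1"
  shows "(\<integral>\<^sup>+s. kap b \<omega> s * wt a (poly q s) \<partial>lborel)
    \<le> ennreal (10 * (1 / (1 - b) + 1 / b) * (1 + 2 * real d)) * ennreal (Im \<omega> powr (-b)) * wt a (poly q \<omega>)"
proof (cases "poly q \<omega> = 0")
  case True
  define K where "K = 10 * (1 / (1 - b) + 1 / b) * (1 + 2 * real d)"
  have "K > 0" unfolding K_def using b by (intro mult_pos_pos add_pos_nonneg add_pos_pos) auto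
  then have "ennreal K * ennreal (Im \<omega> powr (-b)) \<noteq> 0" using \<omega> by simp
  then show ?thesis unfolding K_def[symmetric] True wt_zero by (simp add: ennreal_mult_top)
next
  case False
  then have "q \<noteq> 0" by auto
  then obtain c rs where c: "c \<noteq> 0" "length rs = degree q" "\<And>z. poly q z = c * (\<Prod>r\<leftarrow>rs. z - r)"
    using complex_poly_factor by blast
  define m where "m = degree q"
  define r where "r i = rs ! i" for i
  have qz: "poly q z = c * (\<Prod>i<m. z - r i)" for z
    unfolding c(3) by (simp add: prod.list_conv_set_nth c(2) m_def r_def atLeast0LessThan)
  have md: "m \<le> d" using d by (simp add: m_def)
  have am: "2 * a * real m \<le> 1"
    using a md mult_left_mono[of "real m" "real d" "2 * a"] by simp
  have \<omega>r: "\<omega> \<noteq> r i" if "i < m" for i using False that by (auto simp: qz)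
  define C where "C = 10 * (1 / (1 - b) + 1 / b)"
  have C0: "C \<ge> 0" using b by (simp add: C_def)
  define Q where "Q = cmod (poly q \<omega>) powr (-a)"
  define h where "h i s = indicator {0<..} (Im s) * (Im s powr (-b) * (cmod (s - cnj \<omega>) powr (-3/2) * cmod (s - r i) powr (-1/2)))" for i s
  define k0 where "k0 s = indicator {0<..} (Im s) * (Im s powr (-b) * cmod (s - cnj \<omega>) powr (-2))" for s
  \<comment> \<open>Off the finitely many roots \<open>wt\<close> is an ordinary negative
    power.\<close>
  have ae: "AE s in lborel. \<forall>i\<in>{..<m}. s \<noteq> r i"
    by (subst AE_ball_countable) (auto intro: AE_lborel_singleton)
  have "(\<integral>\<^sup>+s. kap b \<omega> s * wt a (poly q s) \<partial>lborel) \<le> (\<integral>\<^sup>+s. ennreal Q * (ennreal (1 + real m) * ennreal (k0 s) + (\<Sum>i<m. ennreal (h i s))) \<partial>lborel)"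
  proof (rule nn_integral_mono_AE)
    from ae show "AE s in lborel. kap b \<omega> s * wt a (poly q s) \<le> ennreal Q * (ennreal (1 + real m) * ennreal (k0 s) + (\<Sum>i<m. ennreal (h i s)))"
    proof eventually_elim
      fix s assume s: "\<forall>i\<in>{..<m}. s \<noteq> r i"
      show "kap b \<omega> s * wt a (poly q s) \<le> ennreal Q * (ennreal (1 + real m) * ennreal (k0 s) + (\<Sum>i<m. ennreal (h i s)))"
      proof (cases "Im s > 0")
        case im: True
        have qs: "poly q s \<noteq> 0" using s c(1) by (auto simp: qz)
        define \<rho> where "\<rho> i = cmod (\<omega> - r i) / cmod (s - r i)" for i
        define D where "D = cmod (s - cnj \<omega>)"
        have D: "D > 0" "cmod (s - \<omega>) \<le> D" using cnj_dist_pos[OF im \<omega>] cmod_half_plane_ge(2)[OF im \<omega>] by (auto simp: D_def)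
        have Dpow: "D powr (-2) * sqrt D = D powr (-3/2)"
          using powr_add[of D "-2" "1/2"] D(1) by (simp add: powr_half_sqrt)
        have ratio: "cmod (poly q \<omega>) = cmod (poly q s) * (\<Prod>i<m. \<rho> i)"
          using s c(1) by (simp add: qz norm_mult prod_norm[symmetric] \<rho>_def prod_dividef)
        have "cmod (poly q s) powr (-a) = Q * (\<Prod>i<m. \<rho> i) powr a"
        proof -
          have "Q = cmod (poly q s) powr (-a) * (\<Prod>i<m. \<rho> i) powr (-a)"
            unfolding Q_def ratio by (rule powr_mult)
          moreover have "(\<Prod>i<m. \<rho> i) > 0" using s \<omega>r by (intro prod_pos) (auto simp: \<rho>_def)
          moreover have "(\<Prod>i<m. \<rho> i) powr a \<noteq> 0" using calculation(2) by (metis less_irrefl powr_eq_0_iff)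
          ultimately show ?thesis by (simp only: powr_minus) (simp add: field_simps del: prod_pos prod_zero_iff powr_eq_0_iff)
        qed
        also have "\<dots> \<le> Q * (1 + (\<Sum>i<m. sqrt (\<rho> i)))"
          by (intro mult_left_mono prod_powr_le a am) (auto simp: \<rho>_def Q_def)
        \<comment> \<open>From \<open>cmod (\<omega> - r i) \<le> cmod (s - r i) + D\<close> and
          subadditivity of the square root. The factor \<open>sqrt D\<close> is paid for by the
          kernel, whose exponent changes from -2 to -3/2.\<close>
        also have "\<dots> \<le> Q * (1 + (\<Sum>i<m. 1 + sqrt D * cmod (s - r i) powr (-1/2)))"
        proof (intro mult_left_mono add_left_mono sum_mono)
          fix i assume i: "i \<in> {..<m}"
          have n: "cmod (s - r i) > 0" using s i by auto
          have "cmod (\<omega> - r i) \<le> cmod (s - r i) + D"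
            using norm_triangle_ineq[of "s - r i" "\<omega> - s"] D(2) by (simp add: norm_minus_commute)
          then have "sqrt (cmod (\<omega> - r i)) \<le> sqrt (cmod (s - r i) + D)" by simp
          also have "\<dots> \<le> sqrt (cmod (s - r i)) + sqrt D" using D by (intro sqrt_add_le_add_sqrt) auto
          finally have "sqrt (\<rho> i) \<le> (sqrt (cmod (s - r i)) + sqrt D) / sqrt (cmod (s - r i))"
            unfolding \<rho>_def real_sqrt_divide by (intro divide_right_mono) auto
          also have "\<dots> = 1 + sqrt D * cmod (s - r i) powr (-1/2)"
            using n by (simp add: add_divide_distrib powr_minus_divide powr_half_sqrt)
          finally show "sqrt (\<rho> i) \<le> 1 + sqrt D * cmod (s - r i) powr (-1/2)" .
        qed (simp add: Q_def)
        finally have wle: "cmod (poly q s) powr (-a) \<le> Q * ((1 + real m) + (\<Sum>i<m. sqrt D * cmod (s - r i) powr (-1/2)))"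
          by (simp add: sum.distrib add.assoc)
        have k0n: "k0 s \<ge> 0" by (simp add: k0_def)
        have hi: "k0 s * (sqrt D * cmod (s - r i) powr (-1/2)) = h i s" for i
          using im Dpow[symmetric] by (simp add: k0_def h_def D_def mult_ac)
        have "k0 s * cmod (poly q s) powr (-a) \<le> k0 s * (Q * ((1 + real m) + (\<Sum>i<m. sqrt D * cmod (s - r i) powr (-1/2))))"
          by (rule mult_left_mono[OF wle k0n])
        also have "\<dots> = Q * ((1 + real m) * k0 s + (\<Sum>i<m. k0 s * (sqrt D * cmod (s - r i) powr (-1/2))))"
          by (simp add: algebra_simps sum_distrib_left)
        also have "\<dots> = Q * ((1 + real m) * k0 s + (\<Sum>i<m. h i s))" by (simp only: hi)
        finally have "ennreal (k0 s * cmod (poly q s) powr (-a)) \<le> ennreal (Q * ((1 + real m) * k0 s + (\<Sum>i<m. h i s)))"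
          by (rule ennreal_leI)
        moreover have "kap b \<omega> s * wt a (poly q s) = ennreal (k0 s * cmod (poly q s) powr (-a))"
          unfolding wt_nonzero[OF qs] kap_def k0_def[symmetric] by (rule ennreal_mult[symmetric]) (use k0n in auto)
        moreover have "ennreal (Q * ((1 + real m) * k0 s + (\<Sum>i<m. h i s))) = ennreal Q * (ennreal (1 + real m) * ennreal (k0 s) + (\<Sum>i<m. ennreal (h i s)))"
        proof -
          have h0: "h i s \<ge> 0" for i by (simp add: h_def)
          have "ennreal Q * (ennreal (1 + real m) * ennreal (k0 s) + (\<Sum>i<m. ennreal (h i s))) = ennreal Q * (ennreal ((1 + real m) * k0 s) + ennreal (\<Sum>i<m. h i s))"
            using h0 k0n by (simp add: ennreal_mult)
          also have "\<dots> = ennreal (Q * ((1 + real m) * k0 s + (\<Sum>i<m. h i s)))"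
            using h0 k0n by (subst ennreal_plus[symmetric]) (auto simp: ennreal_mult sum_nonneg Q_def)
          finally show ?thesis by simp
        qed
        ultimately show ?thesis by simp
      qed (simp add: kap_def)
    qed
  qed
  also have "\<dots> = ennreal Q * (ennreal (1 + real m) * (\<integral>\<^sup>+s. ennreal (k0 s) \<partial>lborel) + (\<Sum>i<m. (\<integral>\<^sup>+s. ennreal (h i s) \<partial>lborel)))"
  proof -
    have [measurable]: "k0 \<in> borel_measurable borel" "h i \<in> borel_measurable borel" for i
      unfolding k0_def h_def by measurable
    show ?thesis by (simp add: nn_integral_cmult nn_integral_add nn_integral_sum)
  qed
  also have "\<dots> \<le> ennreal Q * (ennreal (1 + real m) * ennreal (C * Im \<omega> powr (-b)) + (\<Sum>i<m. ennreal (C * Im \<omega> powr (-b))))"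
    unfolding C_def k0_def h_def
    by (intro mult_left_mono add_mono sum_mono half_plane_integral_2[OF b \<omega>] half_plane_integral_3[OF b \<omega>]) auto
  also have "\<dots> = ennreal (Q * ((1 + 2 * real m) * (C * Im \<omega> powr (-b))))"
  proof -
    have "(\<Sum>i<m. ennreal (C * Im \<omega> powr (-b))) = ennreal (real m * (C * Im \<omega> powr (-b)))"
      using C0 by (simp add: ennreal_mult ennreal_of_nat_eq_real_of_nat)
    note sum_eq = this
    have "ennreal Q * (ennreal (1 + real m) * ennreal (C * Im \<omega> powr (-b)) + (\<Sum>i<m. ennreal (C * Im \<omega> powr (-b))))
      = ennreal Q * ennreal ((1 + real m) * (C * Im \<omega> powr (-b)) + real m * (C * Im \<omega> powr (-b)))"
    proof -
      have "ennreal (1 + real m) * ennreal (C * Im \<omega> powr (-b)) = ennreal ((1 + real m) * (C * Im \<omega> powr (-b)))"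
        using C0 by (intro ennreal_mult[symmetric]) auto
      moreover have "ennreal ((1 + real m) * (C * Im \<omega> powr (-b))) + ennreal (real m * (C * Im \<omega> powr (-b))) = ennreal ((1 + real m) * (C * Im \<omega> powr (-b)) + real m * (C * Im \<omega> powr (-b)))"
        using C0 by (intro ennreal_plus[symmetric]) auto
      ultimately show ?thesis by (simp only: sum_eq)
    qed
    also have "\<dots> = ennreal (Q * ((1 + 2 * real m) * (C * Im \<omega> powr (-b))))"
      by (subst ennreal_mult'[symmetric]) (auto simp: Q_def algebra_simps)
    finally show ?thesis .
  qed
  also have "\<dots> \<le> ennreal (C * (1 + 2 * real d) * Im \<omega> powr (-b) * Q)"
  proof (rule ennreal_leI)
    have "(1 + 2 * real m) * (Q * (C * Im \<omega> powr (-b))) \<le> (1 + 2 * real d) * (Q * (C * Im \<omega> powr (-b)))"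
      using md C0 by (intro mult_right_mono) (auto simp: Q_def)
    then show "Q * ((1 + 2 * real m) * (C * Im \<omega> powr (-b))) \<le> C * (1 + 2 * real d) * Im \<omega> powr (-b) * Q"
      by (simp add: mult_ac)
  qed
  also have "\<dots> = ennreal (C * (1 + 2 * real d)) * ennreal (Im \<omega> powr (-b)) * wt a (poly q \<omega>)"
    unfolding wt_nonzero[OF False] Q_def[symmetric] using C0 by (simp add: ennreal_mult Q_def)
  finally show ?thesis unfolding C_def .
qed

lemma poly_fun_slice:
  fixes G :: "complex ^ 'n \<Rightarrow> complex"
  assumes "G \<in> poly_fun"
  shows "\<exists>d. \<forall>x i. \<exists>q. degree q \<le> d \<and> (\<forall>s. G (\<chi> j. if j = i then s else x j) = poly q s)"
  using assms
proof (induction G rule: poly_fun.induct)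
  case (const c)
  show ?case by (intro exI[of _ "0::nat"] allI exI[of _ "[:c:]"]) simp
next
  case (coord k)
  show ?case
  proof (intro exI[of _ "1::nat"] allI)
    fix x :: "'n \<Rightarrow> complex" and i
    show "\<exists>q. degree q \<le> 1 \<and> (\<forall>s. (\<chi> j. if j = i then s else x j) $ k = poly q s)"
      by (rule exI[of _ "if k = i then [:0, 1:] else [:x k:]"]) simp
  qed
next
  case (add f g)
  then obtain d e where d: "\<And>x i. \<exists>q. degree q \<le> d \<and> (\<forall>s. f (\<chi> j. if j = i then s else x j) = poly q s)"
    and e: "\<And>x i. \<exists>q. degree q \<le> e \<and> (\<forall>s. g (\<chi> j. if j = i then s else x j) = poly q s)" by blast
  show ?case
  proof (intro exI[of _ "max d e"] allI)
    fix x :: "'n \<Rightarrow> complex" and i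
    obtain p q where "degree p \<le> d" "\<forall>s. f (\<chi> j. if j = i then s else x j) = poly p s"
      "degree q \<le> e" "\<forall>s. g (\<chi> j. if j = i then s else x j) = poly q s" using d e by blast
    then show "\<exists>q. degree q \<le> max d e \<and> (\<forall>s. f (\<chi> j. if j = i then s else x j) + g (\<chi> j. if j = i then s else x j) = poly q s)"
      by (intro exI[of _ "p + q"]) (auto intro: degree_add_le)
  qed
next
  case (mult f g)
  then obtain d e where d: "\<And>x i. \<exists>q. degree q \<le> d \<and> (\<forall>s. f (\<chi> j. if j = i then s else x j) = poly q s)"
    and e: "\<And>x i. \<exists>q. degree q \<le> e \<and> (\<forall>s. g (\<chi> j. if j = i then s else x j) = poly q s)" by blast
  show ?case
  proof (intro exI[of _ "d + e"] allI)
    fix x :: "'n \<Rightarrow> complex" and i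
    obtain p q where "degree p \<le> d" "\<forall>s. f (\<chi> j. if j = i then s else x j) = poly p s"
      "degree q \<le> e" "\<forall>s. g (\<chi> j. if j = i then s else x j) = poly q s" using d e by blast
    then show "\<exists>q. degree q \<le> d + e \<and> (\<forall>s. f (\<chi> j. if j = i then s else x j) * g (\<chi> j. if j = i then s else x j) = poly q s)"
      by (intro exI[of _ "p * q"]) (auto intro: order_trans[OF degree_mult_le])
  qed
qed

lemma vec_override_measurable:
  fixes \<omega> :: "'n::finite \<Rightarrow> complex"
  shows "(\<lambda>x. \<chi> j. if j \<in> I then x j else \<omega> j) \<in> measurable (Pi\<^sub>M I (\<lambda>_. lborel)) borel"
proof (rule borel_measurable_euclidean_space[THEN iffD2], rule ballI)
  fix b :: "complex ^ 'n" assume "b \<in> Basis"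
  then obtain i c where b: "b = axis i c" unfolding Basis_vec_complex by auto
  have "(\<lambda>x. (if i \<in> I then x i else \<omega> i) \<bullet> c) \<in> borel_measurable (Pi\<^sub>M I (\<lambda>_. lborel))"
  proof (cases "i \<in> I")
    case True
    then have [measurable]: "(\<lambda>x. x i) \<in> measurable (Pi\<^sub>M I (\<lambda>_. lborel)) (lborel :: complex measure)"
      by (rule measurable_component_singleton)
    show ?thesis using True by simp
  qed simp
  then show "(\<lambda>x. (\<chi> j. if j \<in> I then x j else \<omega> j) \<bullet> b) \<in> borel_measurable (Pi\<^sub>M I (\<lambda>_. lborel))"
    by (simp add: b inner_axis)
qed

lemma poly_fun_measurable: "G \<in> poly_fun \<Longrightarrow> G \<in> borel_measurable borel"
  by (intro borel_measurable_continuous_onI rat_on_continuous[OF rat_on_poly open_UNIV])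

text \<open>Tonelli, one coordinate at a time: in each variable the polynomial has degree at most \<open>d\<close>, so the one-variable
  constant does not depend on the frozen coordinates.\<close>
lemma iterated_weight_integral:
  fixes G :: "complex ^ 'n \<Rightarrow> complex" and \<omega> :: "'n \<Rightarrow> complex"
  assumes G: "G \<in> poly_fun" and b: "0 < b" "b < 1" and a: "a \<ge> 0" "2 * a * real d \<le> 1"
    and d: "\<And>x i. \<exists>q. degree q \<le> d \<and> (\<forall>s. G (\<chi> j. if j = i then s else x j) = poly q s)"
    and \<omega>: "\<And>i. Im (\<omega> i) > 0" and I: "finite I"
  shows "(\<integral>\<^sup>+x. (\<Prod>i\<in>I. kap b (\<omega> i) (x i)) * wt a (G (\<chi> j. if j \<in> I then x j else \<omega> j)) \<partial>Pi\<^sub>M I (\<lambda>_. lborel))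
    \<le> ennreal (10 * (1 / (1 - b) + 1 / b) * (1 + 2 * real d)) ^ card I * (\<Prod>i\<in>I. ennreal (Im (\<omega> i) powr (-b))) * wt a (G (\<chi> j. \<omega> j))"
  using I
proof (induction I rule: finite_induct)
  case empty
  interpret product_sigma_finite "\<lambda>_ :: 'n. lborel :: complex measure" by standard
  show ?case by (simp add: PiM_empty nn_integral_count_space_finite)
next
  case (insert i I)
  interpret product_sigma_finite "\<lambda>_ :: 'n. lborel :: complex measure" by standard
  let ?K = "ennreal (10 * (1 / (1 - b) + 1 / b) * (1 + 2 * real d))"
  let ?f = "\<lambda>I x. (\<Prod>i\<in>I. kap b (\<omega> i) (x i)) * wt a (G (\<chi> j. if j \<in> I then x j else \<omega> j))"
  note Gm[measurable] = poly_fun_measurable[OF G]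
  have fm: "?f I' \<in> borel_measurable (Pi\<^sub>M I' (\<lambda>_. lborel))" if "finite I'" for I'
  proof -
    have [measurable]: "(\<lambda>x. G (\<chi> j. if j \<in> I' then x j else \<omega> j)) \<in> borel_measurable (Pi\<^sub>M I' (\<lambda>_. lborel))"
      by (rule measurable_compose[OF vec_override_measurable Gm])
    have [measurable]: "(\<lambda>x. kap b (\<omega> i) (x i)) \<in> borel_measurable (Pi\<^sub>M I' (\<lambda>_. lborel))" if "i \<in> I'" for i
    proof -
      have "(\<lambda>x. x i) \<in> measurable (Pi\<^sub>M I' (\<lambda>_. lborel)) (lborel :: complex measure)"
        by (rule measurable_component_singleton[OF that])
      then show ?thesis by (intro kap_measurable) simp
    qed
    show ?thesis by measurable
  qed
  have "integral\<^sup>N (Pi\<^sub>M (insert i I) (\<lambda>_. lborel)) (?f (insert i I)) = (\<integral>\<^sup>+x. (\<integral>\<^sup>+y. ?f (insert i I) (x(i := y)) \<partial>lborel) \<partial>Pi\<^sub>M I (\<lambda>_. lborel))"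
    by (rule product_nn_integral_insert[OF insert.hyps fm]) (use insert.hyps in simp)
  also have "\<dots> \<le> (\<integral>\<^sup>+x. (?K * ennreal (Im (\<omega> i) powr (-b))) * ?f I x \<partial>Pi\<^sub>M I (\<lambda>_. lborel))"
  proof (rule nn_integral_mono)
    fix x :: "'n \<Rightarrow> complex"
    define z where "z j = (if j \<in> I then x j else \<omega> j)" for j
    obtain q where q: "degree q \<le> d" "\<And>s. G (\<chi> j. if j = i then s else z j) = poly q s" using d by blast
    have P: "(\<Prod>j\<in>I. kap b (\<omega> j) ((x(i := y)) j)) = (\<Prod>j\<in>I. kap b (\<omega> j) (x j))" for y
      by (intro prod.cong) (use insert.hyps in auto)
    have "?f (insert i I) (x(i := y)) = (\<Prod>j\<in>I. kap b (\<omega> j) (x j)) * (kap b (\<omega> i) y * wt a (poly q y))" for y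
    proof -
      have "(\<chi> j. if j \<in> insert i I then (x(i := y)) j else \<omega> j) = (\<chi> j. if j = i then y else z j)"
        by (auto simp: vec_eq_iff z_def)
      then have e: "G (\<chi> j. if j \<in> insert i I then (x(i := y)) j else \<omega> j) = poly q y" by (simp only: q(2))
      have "(\<Prod>j\<in>insert i I. kap b (\<omega> j) ((x(i := y)) j)) = kap b (\<omega> i) y * (\<Prod>j\<in>I. kap b (\<omega> j) (x j))"
        using insert.hyps by (subst prod.insert) (simp, simp, subst P, simp)
      then show ?thesis unfolding e by (simp only: mult_ac)
    qed
    note f_eq = this
    have [measurable]: "poly q \<in> borel_measurable borel"
      by (intro borel_measurable_continuous_onI continuous_intros)
    have "(\<lambda>y. kap b (\<omega> i) y * wt a (poly q y)) \<in> borel_measurable lborel"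
      by (intro borel_measurable_times_ennreal kap_measurable wt_measurable) simp_all
    with f_eq have "(\<integral>\<^sup>+y. ?f (insert i I) (x(i := y)) \<partial>lborel) = (\<Prod>j\<in>I. kap b (\<omega> j) (x j)) * (\<integral>\<^sup>+y. kap b (\<omega> i) y * wt a (poly q y) \<partial>lborel)"
      by (simp only: nn_integral_cmult)
    also have "\<dots> \<le> (\<Prod>j\<in>I. kap b (\<omega> j) (x j)) * (?K * ennreal (Im (\<omega> i) powr (-b)) * wt a (poly q (\<omega> i)))"
      by (intro mult_left_mono poly_weight_integral b \<omega> q(1) a) simp
    \<comment> \<open>The bound puts coordinate \<open>i\<close> back to \<open>\<omega> i\<close>,
      which reproduces the integrand for the smaller index set.\<close>
    also have "poly q (\<omega> i) = G (\<chi> j. if j \<in> I then x j else \<omega> j)"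
    proof -
      have "(\<chi> j. if j = i then \<omega> i else z j) = (\<chi> j. if j \<in> I then x j else \<omega> j)"
        using insert.hyps by (auto simp: vec_eq_iff z_def)
      then show ?thesis using q(2)[of "\<omega> i"] by simp
    qed
    finally show "(\<integral>\<^sup>+y. ?f (insert i I) (x(i := y)) \<partial>lborel) \<le> (?K * ennreal (Im (\<omega> i) powr (-b))) * ?f I x"
      by (simp add: mult_ac)
  qed
  also have "\<dots> = (?K * ennreal (Im (\<omega> i) powr (-b))) * integral\<^sup>N (Pi\<^sub>M I (\<lambda>_. lborel)) (?f I)"
    by (rule nn_integral_cmult[OF fm]) (use insert.hyps in simp)
  also have "\<dots> \<le> (?K * ennreal (Im (\<omega> i) powr (-b))) * (?K ^ card I * (\<Prod>i\<in>I. ennreal (Im (\<omega> i) powr (-b))) * wt a (G (\<chi> j. \<omega> j)))"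
    by (intro mult_left_mono insert.IH) simp
  also have "\<dots> = ?K ^ card (insert i I) * (\<Prod>i\<in>insert i I. ennreal (Im (\<omega> i) powr (-b))) * wt a (G (\<chi> j. \<omega> j))"
    using insert.hyps by (simp add: mult_ac)
  finally show ?case .
qed

section \<open>The Schur test\<close>

text \<open>The witness \<open>t = (i / B) powr (1 / (p * q))\<close> balances the two terms: apart
  from the weights \<open>1 / q\<close> and \<open>1 / p\<close>, which add up to 1, both equal
  \<open>i powr (1 / p) * B powr (1 / q)\<close>.\<close>

lemma hoelder_optimised:
  fixes p q g B i :: real
  assumes p: "p > 1" and q: "q = p / (p - 1)" and B: "B > 0" and g: "g \<ge> 0" and i: "i > 0"
    and le: "\<And>t. t > 0 \<Longrightarrow> g \<le> t powr q * (B / q) + t powr (-p) * (i / p)"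
  shows "g powr p \<le> B powr (p - 1) * i"
proof -
  have q1: "1 / q = 1 - 1 / p" using p by (simp add: q field_simps)
  have q0: "q > 0" using p by (simp add: q)
  define t where "t = (i / B) powr (1 / (p * q))"
  have t: "t > 0" using i B by (simp add: t_def)
  have tq: "t powr q = i powr (1 / p) * B powr (- (1 / p))"
    unfolding t_def powr_powr using q0 i B by (simp add: powr_divide powr_minus field_simps)
  have tp: "t powr (-p) = i powr (- (1 / q)) * B powr (1 / q)"
    unfolding t_def powr_powr using p i B by (simp add: powr_divide powr_minus field_simps)
  have "B powr (- (1 / p)) * B = B powr (1 / q)"
    using B powr_add[of B "- (1 / p)" 1] by (simp add: q1)
  then have 1: "t powr q * B = i powr (1 / p) * B powr (1 / q)" by (simp add: tq)
  have "i powr (- (1 / q)) * i = i powr (1 / p)"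
    using i powr_add[of i "- (1 / q)" 1] by (simp add: q1)
  then have 2: "t powr (-p) * i = i powr (1 / p) * B powr (1 / q)" by (simp add: tp mult_ac)
  have "g \<le> t powr q * B * (1 / q) + t powr (-p) * i * (1 / p)" using le[OF t] by simp
  also have "\<dots> = i powr (1 / p) * B powr (1 / q)" unfolding 1 2 by (simp add: q1 algebra_simps)
  finally have "g powr p \<le> (i powr (1 / p) * B powr (1 / q)) powr p" using g p by (intro powr_mono2) auto
  also have "\<dots> = i * B powr (p / q)" using p i by (simp add: powr_mult powr_powr)
  also have "p / q = p - 1" using p by (simp add: q)
  finally show ?thesis by (simp add: mult_ac)
qed

text \<open>Hoelder's inequality for the measure with density \<open>\<kappa>\<close>, applied to
  \<open>A\<close> and \<open>H / A\<close>. It comes from Young's inequality with a scale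
  \<open>t\<close> that is optimised only after integration, so that nonnegative extended integrals
  suffice throughout.\<close>

lemma weighted_hoelder:
  fixes \<kappa> :: "'a \<Rightarrow> ennreal" and A H :: "'a \<Rightarrow> real"
  assumes [measurable]: "\<kappa> \<in> borel_measurable M" "A \<in> borel_measurable M" "H \<in> borel_measurable M"
    and p: "p > 1" and q: "q = p / (p - 1)" and B: "B > 0" and g: "g \<ge> 0"
    and A: "\<And>x. \<kappa> x \<noteq> 0 \<Longrightarrow> A x > 0" and H: "\<And>x. H x \<ge> 0"
    and 1: "(\<integral>\<^sup>+x. \<kappa> x * ennreal (A x powr q) \<partial>M) \<le> ennreal B"
    and 2: "ennreal g \<le> (\<integral>\<^sup>+x. \<kappa> x * ennreal (H x) \<partial>M)"
  shows "ennreal (g powr p) \<le> ennreal (B powr (p - 1)) * (\<integral>\<^sup>+x. \<kappa> x * ennreal (H x powr p * A x powr (-p)) \<partial>M)"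
proof (cases "\<integral>\<^sup>+x. \<kappa> x * ennreal (H x powr p * A x powr (-p)) \<partial>M")
  case top
  then show ?thesis using B by (simp add: ennreal_mult_top)
next
  case (real i0)
  have q1: "q > 1" using p by (simp add: q)
  have pq: "1 / q + 1 / p = 1" using p by (simp add: q field_simps)
  have bound: "g \<le> t powr q * (B / q) + t powr (-p) * (i0 / p)" if t: "t > 0" for t
  proof -
    define a where "a = t powr q / q"
    define b where "b = t powr (-p) / p"
    have ab: "a \<ge> 0" "b \<ge> 0" using p q1 by (auto simp: a_def b_def)
    have "ennreal g \<le> (\<integral>\<^sup>+x. \<kappa> x * ennreal (H x) \<partial>M)" by (rule 2)
    also have "\<dots> \<le> (\<integral>\<^sup>+x. ennreal a * (\<kappa> x * ennreal (A x powr q)) + ennreal b * (\<kappa> x * ennreal (H x powr p * A x powr (-p))) \<partial>M)"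
    proof (rule nn_integral_mono)
      fix x
      show "\<kappa> x * ennreal (H x) \<le> ennreal a * (\<kappa> x * ennreal (A x powr q)) + ennreal b * (\<kappa> x * ennreal (H x powr p * A x powr (-p)))"
      proof (cases "\<kappa> x = 0")
        case False
        then have Ax: "A x > 0" by (rule A)
        have "H x = (t * A x) * (H x / (t * A x))" using t Ax by simp
        also have "\<dots> \<le> (t * A x) powr q / q + (H x / (t * A x)) powr p / p"
          using Youngs_inequality[OF q1 p pq, of "t * A x" "H x / (t * A x)"] t Ax H[of x] by simp
        also have "\<dots> = a * A x powr q + b * (H x powr p * A x powr (-p))"
          using t Ax H[of x] by (simp add: a_def b_def powr_mult powr_divide powr_minus field_simps)
        finally have "ennreal (H x) \<le> ennreal (a * A x powr q + b * (H x powr p * A x powr (-p)))" by (rule ennreal_leI)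
        also have "\<dots> = ennreal a * ennreal (A x powr q) + ennreal b * ennreal (H x powr p * A x powr (-p))"
          using ab by (intro ennreal_sum_prod2) auto
        finally have "\<kappa> x * ennreal (H x) \<le> \<kappa> x * (ennreal a * ennreal (A x powr q) + ennreal b * ennreal (H x powr p * A x powr (-p)))"
          by (rule mult_left_mono) simp
        also have "\<dots> = ennreal a * (\<kappa> x * ennreal (A x powr q)) + ennreal b * (\<kappa> x * ennreal (H x powr p * A x powr (-p)))"
          by (simp only: distrib_left mult_ac)
        finally show ?thesis .
      qed simp
    qed
    also have "\<dots> = ennreal a * (\<integral>\<^sup>+x. \<kappa> x * ennreal (A x powr q) \<partial>M) + ennreal b * (\<integral>\<^sup>+x. \<kappa> x * ennreal (H x powr p * A x powr (-p)) \<partial>M)"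
      by (simp add: nn_integral_add nn_integral_cmult)
    also have "\<dots> \<le> ennreal a * ennreal B + ennreal b * ennreal i0"
      unfolding real by (intro add_right_mono mult_left_mono 1) simp
    also have "\<dots> = ennreal (a * B + b * i0)" using ab B real by (intro ennreal_sum_prod2[symmetric]) auto
    finally have "ennreal g \<le> ennreal (a * B + b * i0)" .
    moreover have "a * B + b * i0 \<ge> 0" using ab B real by simp
    ultimately have "g \<le> a * B + b * i0" by (simp only: ennreal_le_iff)
    then show ?thesis by (simp add: a_def b_def)
  qed
  have "g powr p / B powr (p - 1) \<le> i0"
  \<comment> \<open>\<open>i0\<close> may be 0, whereas the optimal \<open>t\<close> needs a
    positive number; hence the detour through all \<open>i > i0\<close>.\<close>
  proof (rule dense_ge)
    fix i assume i: "i0 < i"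
    have "g powr p \<le> B powr (p - 1) * i"
    proof (rule hoelder_optimised[OF p q B g])
      show "i > 0" using i real by simp
      fix t :: real assume t: "t > 0"
      have "g \<le> t powr q * (B / q) + t powr (-p) * (i0 / p)" by (rule bound[OF t])
      also have "\<dots> \<le> t powr q * (B / q) + t powr (-p) * (i / p)"
        using i p by (intro add_left_mono mult_left_mono divide_right_mono) auto
      finally show "g \<le> t powr q * (B / q) + t powr (-p) * (i / p)" .
    qed
    then show "g powr p / B powr (p - 1) \<le> i" using B by (simp add: field_simps)
  qed
  then have "g powr p \<le> B powr (p - 1) * i0" using B by (simp add: field_simps)
  then show ?thesis unfolding real using real B by (simp add: ennreal_mult[symmetric])
qed

text \<open>Hoelder with the test function \<open>A\<close>, then Tonelli. The weight
  \<open>\<sigma>\<close> appears only in the transposed estimate, as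
  \<open>A powr p * \<sigma>\<close>. The function \<open>g\<close> is merely dominated by the
  operator applied to \<open>H\<close>, and \<open>S\<close> is the set where \<open>A\<close> is
  known to be positive.\<close>

lemma schur_test:
  fixes k :: "'a \<Rightarrow> 'a \<Rightarrow> ennreal" and A \<sigma> g H :: "'a \<Rightarrow> real"
  assumes "sigma_finite_measure M"
    and k [measurable]: "(\<lambda>(w, z). k w z) \<in> borel_measurable (M \<Otimes>\<^sub>M M)"
    and [measurable]: "A \<in> borel_measurable M" "\<sigma> \<in> borel_measurable M" "g \<in> borel_measurable M" "H \<in> borel_measurable M" "S \<in> sets M"
    and p: "p > 1" and q: "q = p / (p - 1)" and C: "C1 > 0" "C2 > 0"
    and pos: "\<And>x. x \<in> S \<Longrightarrow> A x > 0" "\<And>x. \<sigma> x \<ge> 0" "\<And>x. g x \<ge> 0" "\<And>x. H x \<ge> 0"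
    and 1: "\<And>w. w \<in> S \<Longrightarrow> (\<integral>\<^sup>+z. k w z * indicator S z * ennreal (A z powr q) \<partial>M) \<le> ennreal (C1 * A w powr q)"
    and 2: "\<And>z. z \<in> S \<Longrightarrow> (\<integral>\<^sup>+w. k w z * indicator S w * ennreal (A w powr p * \<sigma> w) \<partial>M) \<le> ennreal (C2 * (A z powr p * \<sigma> z))"
    and 3: "\<And>w. w \<in> S \<Longrightarrow> ennreal (g w) \<le> (\<integral>\<^sup>+z. k w z * indicator S z * ennreal (H z) \<partial>M)"
  shows "(\<integral>\<^sup>+w. indicator S w * ennreal (g w powr p * \<sigma> w) \<partial>M) \<le> ennreal (C1 powr (p - 1) * C2) * (\<integral>\<^sup>+z. indicator S z * ennreal (H z powr p * \<sigma> z) \<partial>M)"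
proof -
  interpret sigma_finite_measure M by fact
  interpret pair_sigma_finite M M by standard
  have q1: "q * (p - 1) = p" using p by (simp add: q)
  define F where "F w z = indicator S w * (indicator S z * (k w z * (ennreal (A w powr p * \<sigma> w) * ennreal (H z powr p * A z powr (-p)))))" for w z
  have pw: "indicator S w * ennreal (g w powr p * \<sigma> w) \<le> ennreal (C1 powr (p - 1)) * (\<integral>\<^sup>+z. F w z \<partial>M)" if "w \<in> space M" for w
  proof (cases "w \<in> S")
    case w: True
    have [measurable]: "(\<lambda>z. k w z) \<in> borel_measurable M" using measurable_compose_Pair1[OF that k] by simp
    define I where "I = (\<integral>\<^sup>+z. k w z * indicator S z * ennreal (H z powr p * A z powr (-p)) \<partial>M)"
    have "A w \<noteq> 0" using pos(1)[OF w] by simp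
    have "ennreal (g w powr p) \<le> ennreal ((C1 * A w powr q) powr (p - 1)) * I"
      unfolding I_def
      by (rule weighted_hoelder[OF _ _ _ p q _ _ _ _ 1[OF w] 3[OF w]])
        (use w pos C \<open>A w \<noteq> 0\<close> in \<open>auto simp: indicator_def split: if_splits\<close>)
    also have "(C1 * A w powr q) powr (p - 1) = C1 powr (p - 1) * A w powr p"
      by (simp add: powr_mult powr_powr q1)
    finally have "ennreal (g w powr p) * ennreal (\<sigma> w) \<le> ennreal (C1 powr (p - 1) * A w powr p) * I * ennreal (\<sigma> w)"
      by (rule mult_right_mono) simp
    then have "ennreal (g w powr p * \<sigma> w) \<le> ennreal (C1 powr (p - 1)) * (ennreal (A w powr p * \<sigma> w) * I)"
      using pos(2)[of w] by (simp add: ennreal_mult mult_ac)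
    also have "ennreal (A w powr p * \<sigma> w) * I = (\<integral>\<^sup>+z. ennreal (A w powr p * \<sigma> w) * (k w z * indicator S z * ennreal (H z powr p * A z powr (-p))) \<partial>M)"
      unfolding I_def by (rule nn_integral_cmult[symmetric]) measurable
    also have "\<dots> = (\<integral>\<^sup>+z. F w z \<partial>M)" using w by (intro nn_integral_cong) (simp add: F_def mult_ac)
    finally show ?thesis using w by simp
  qed simp
  have Fm [measurable]: "(\<lambda>(w, z). F w z) \<in> borel_measurable (M \<Otimes>\<^sub>M M)"
    using k unfolding F_def by measurable
  have le1: "(\<integral>\<^sup>+w. indicator S w * ennreal (g w powr p * \<sigma> w) \<partial>M) \<le> (\<integral>\<^sup>+w. ennreal (C1 powr (p - 1)) * (\<integral>\<^sup>+z. F w z \<partial>M) \<partial>M)"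
    by (intro nn_integral_mono pw)
  have eq1: "(\<integral>\<^sup>+w. ennreal (C1 powr (p - 1)) * (\<integral>\<^sup>+z. F w z \<partial>M) \<partial>M) = ennreal (C1 powr (p - 1)) * (\<integral>\<^sup>+w. (\<integral>\<^sup>+z. F w z \<partial>M) \<partial>M)"
    by (rule nn_integral_cmult) measurable
  have "(\<integral>\<^sup>+w. (\<integral>\<^sup>+z. F w z \<partial>M) \<partial>M) = (\<integral>\<^sup>+z. (\<integral>\<^sup>+w. F w z \<partial>M) \<partial>M)"
    using Fubini'[OF Fm] by simp
  also have "\<dots> \<le> (\<integral>\<^sup>+z. ennreal C2 * (indicator S z * ennreal (H z powr p * \<sigma> z)) \<partial>M)"
  proof (rule nn_integral_mono)
    fix z assume "z \<in> space M"
    show "(\<integral>\<^sup>+w. F w z \<partial>M) \<le> ennreal C2 * (indicator S z * ennreal (H z powr p * \<sigma> z))"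
    proof (cases "z \<in> S")
      case z: True
      have [measurable]: "(\<lambda>w. k w z) \<in> borel_measurable M" using measurable_compose[OF measurable_Pair2'[OF \<open>z \<in> space M\<close>] k] by simp
      have "(\<integral>\<^sup>+w. F w z \<partial>M) = (\<integral>\<^sup>+w. ennreal (H z powr p * A z powr (-p)) * (k w z * indicator S w * ennreal (A w powr p * \<sigma> w)) \<partial>M)"
        using z by (intro nn_integral_cong) (simp add: F_def mult_ac)
      also have "\<dots> = ennreal (H z powr p * A z powr (-p)) * (\<integral>\<^sup>+w. k w z * indicator S w * ennreal (A w powr p * \<sigma> w) \<partial>M)"
        by (rule nn_integral_cmult) measurable
      also have "\<dots> \<le> ennreal (H z powr p * A z powr (-p)) * ennreal (C2 * (A z powr p * \<sigma> z))"
        by (intro mult_left_mono 2 z) simp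
      also have "\<dots> = ennreal ((H z powr p * A z powr (-p)) * (C2 * (A z powr p * \<sigma> z)))"
        using pos(2)[of z] C by (intro ennreal_mult[symmetric]) auto
      also have "(H z powr p * A z powr (-p)) * (C2 * (A z powr p * \<sigma> z)) = C2 * (H z powr p * \<sigma> z)"
        using pos(1)[OF z] by (simp add: powr_minus)
      finally show ?thesis using z C pos(2)[of z] by (simp add: ennreal_mult)
    qed (simp add: F_def)
  qed
  also have "\<dots> = ennreal C2 * (\<integral>\<^sup>+z. indicator S z * ennreal (H z powr p * \<sigma> z) \<partial>M)"
    by (rule nn_integral_cmult) measurable
  finally have "ennreal (C1 powr (p - 1)) * (\<integral>\<^sup>+w. (\<integral>\<^sup>+z. F w z \<partial>M) \<partial>M) \<le> ennreal (C1 powr (p - 1)) * (ennreal C2 * (\<integral>\<^sup>+z. indicator S z * ennreal (H z powr p * \<sigma> z) \<partial>M))"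
    by (rule mult_left_mono) simp
  also have "\<dots> = ennreal (C1 powr (p - 1) * C2) * (\<integral>\<^sup>+z. indicator S z * ennreal (H z powr p * \<sigma> z) \<partial>M)"
    using C by (simp add: ennreal_mult mult.assoc)
  finally show ?thesis using le1 eq1 by simp
qed

section \<open>Weighted estimates on the product of half planes\<close>

lemma norm_berg: "norm (berg w z) = (\<Prod>i\<in>UNIV. cmod (z $ i - cnj (w $ i)) powr (-2))"
proof -
  have "cmod (1 / x\<^sup>2) = cmod x powr (-2)" for x
    by (simp add: norm_divide norm_power powr_minus_divide powr_two_sq)
  then show ?thesis unfolding berg_def prod_norm[symmetric] by simp
qed

lemma norm_berg_sym: "norm (berg w z) = norm (berg z w)"
proof -
  have "cmod (z $ i - cnj (w $ i)) = cmod (w $ i - cnj (z $ i))" for i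
    using complex_mod_cnj[of "z $ i - cnj (w $ i)"] by (simp add: norm_minus_commute del: complex_mod_cnj)
  then show ?thesis by (simp add: norm_berg)
qed

definition ht :: "real \<Rightarrow> complex ^ 'n \<Rightarrow> real" where "ht b z = (\<Prod>i\<in>UNIV. Im (z $ i) powr (-b))"

lemma ht_pos: "z \<in> UH \<Longrightarrow> ht b z > 0"
  unfolding ht_def UH_def by (intro prod_pos) (metis less_irrefl mem_Collect_eq powr_gt_zero)

lemma ht_powr: "z \<in> UH \<Longrightarrow> ht b z powr q = ht (b * q) z"
  unfolding ht_def by (subst prod_powr_distrib) (auto simp: powr_powr)

lemma vec_nth_measurable [measurable]:
  "f \<in> borel_measurable M \<Longrightarrow> (\<lambda>x. (f x :: complex ^ 'n) $ i) \<in> borel_measurable M"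
  by (rule measurable_compose[where N = borel]) (auto intro!: borel_measurable_continuous_onI continuous_intros)

lemma ht_measurable [measurable]: "ht b \<in> borel_measurable borel"
  unfolding ht_def by measurable

text \<open>The order of quantifiers matters: the threshold for \<open>a\<close> depends on the
  polynomial alone, so it can be fixed before \<open>p\<close> is chosen, while \<open>C\<close> may
  depend on \<open>a\<close> and \<open>b\<close> but not on \<open>w\<close>.\<close>

lemma half_space_weight:
  fixes G :: "complex ^ 'n \<Rightarrow> complex"
  assumes G: "G \<in> poly_fun"
  shows "\<exists>\<epsilon>>0. \<forall>a b. 0 \<le> a \<and> a \<le> \<epsilon> \<and> 0 < b \<and> b < 1 \<longrightarrow> (\<exists>C>0. \<forall>w\<in>UH. G w \<noteq> 0 \<longrightarrow>
    (\<integral>\<^sup>+z. ennreal (indicator UH z * norm (berg w z)) * (ennreal (ht b z) * wt a (G z)) \<partial>lborel)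
      \<le> ennreal (C * (ht b w * norm (G w) powr (-a))))"
proof -
  obtain d where d: "\<And>x i. \<exists>q. degree q \<le> d \<and> (\<forall>s. G (\<chi> j. if j = i then s else x j) = poly q s)"
    using poly_fun_slice[OF G] by blast
  have [measurable]: "G \<in> borel_measurable borel" by (rule poly_fun_measurable[OF G])
  show ?thesis
  \<comment> \<open>The summand 1 covers \<open>d = 0\<close>, and
    \<open>2 * a * real d \<le> 1\<close> still follows.\<close>
  proof (rule exI[of _ "1 / (2 * real d + 1)"], intro conjI allI impI)
    fix a b :: real assume ab: "0 \<le> a \<and> a \<le> 1 / (2 * real d + 1) \<and> 0 < b \<and> b < 1"
    have "a * (2 * real d + 1) \<le> 1" using ab by (simp add: field_simps)
    then have ad: "2 * a * real d \<le> 1" using ab by (simp add: algebra_simps)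
    define K where "K = 10 * (1 / (1 - b) + 1 / b) * (1 + 2 * real d)"
    have K: "K > 0" unfolding K_def using ab by (intro mult_pos_pos add_pos_nonneg) auto
    show "\<exists>C>0. \<forall>w\<in>UH. G w \<noteq> 0 \<longrightarrow>
      (\<integral>\<^sup>+z. ennreal (indicator UH z * norm (berg w z)) * (ennreal (ht b z) * wt a (G z)) \<partial>lborel)
        \<le> ennreal (C * (ht b w * norm (G w) powr (-a)))"
    proof (intro exI[of _ "K ^ CARD('n)"] conjI ballI impI)
      fix w :: "complex ^ 'n" assume w: "w \<in> UH" and Gw: "G w \<noteq> 0"
      then have wi: "\<And>i. Im (w $ i) > 0" by (simp add: UH_def)
      have kp: "(\<Prod>i\<in>UNIV. kap b (w $ i) (z $ i)) = ennreal (indicator UH z * norm (berg w z)) * ennreal (ht b z)" for z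
      proof (cases "z \<in> UH")
        case True
        then have "(\<Prod>i\<in>UNIV. kap b (w $ i) (z $ i)) = (\<Prod>i\<in>UNIV. ennreal (Im (z $ i) powr (-b) * cmod (z $ i - cnj (w $ i)) powr (-2)))"
          by (intro prod.cong) (auto simp: kap_def UH_def)
        also have "\<dots> = ennreal (ht b z * norm (berg w z))"
          by (simp add: prod_ennreal ht_def norm_berg prod.distrib)
        finally show ?thesis using True ht_pos[OF True, of b] by (simp add: ennreal_mult mult_ac)
      next
        case False
        then obtain i where "\<not> 0 < Im (z $ i)" by (auto simp: UH_def)
        then have "kap b (w $ i) (z $ i) = 0" by (simp add: kap_def)
        then have "(\<Prod>i\<in>UNIV. kap b (w $ i) (z $ i)) = 0" by (intro prod_zero) auto
        then show ?thesis using False by simp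
      qed
      have "(\<integral>\<^sup>+z. ennreal (indicator UH z * norm (berg w z)) * (ennreal (ht b z) * wt a (G z)) \<partial>lborel)
        = (\<integral>\<^sup>+z. (\<Prod>i\<in>UNIV. kap b (w $ i) (z $ i)) * wt a (G z) \<partial>lborel)"
        by (simp only: kp mult.assoc)
      also have "\<dots> = (\<integral>\<^sup>+x. (\<Prod>i\<in>UNIV. kap b (w $ i) (x i)) * wt a (G (\<chi> i. x i)) \<partial>Pi\<^sub>M UNIV (\<lambda>_. lborel))"
        by (subst nn_integral_vec) simp_all
      also have "\<dots> \<le> ennreal K ^ CARD('n) * (\<Prod>i\<in>UNIV. ennreal (Im (w $ i) powr (-b))) * wt a (G w)"
        using iterated_weight_integral[OF G _ _ _ ad d, of b "\<lambda>i. w $ i" UNIV] ab wi by (simp add: K_def)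
      also have "\<dots> = ennreal (K ^ CARD('n) * (ht b w * norm (G w) powr (-a)))"
        using K Gw ht_pos[OF w, of b] by (simp add: wt_nonzero prod_ennreal ht_def[symmetric] ennreal_power ennreal_mult mult.assoc)
      finally show "(\<integral>\<^sup>+z. ennreal (indicator UH z * norm (berg w z)) * (ennreal (ht b z) * wt a (G z)) \<partial>lborel)
        \<le> ennreal (K ^ CARD('n) * (ht b w * norm (G w) powr (-a)))" .
    qed (use K in simp)
  qed simp
qed

text \<open>L^p boundedness, with weight |J|^(2 - p), of the positive operator with kernel |berg|.
  It is phrased through functions \<open>g\<close> dominated by the operator, whose own values need
  not be finite. \<open>H\<close> has to vanish at the zeros of \<open>J\<close>, as |J f \<circ>
  \<Phi>| does.\<close>

definition half_space_bound :: "(complex ^ 'n \<Rightarrow> complex) \<Rightarrow> real \<Rightarrow> real \<Rightarrow> bool" where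
  "half_space_bound J p C \<longleftrightarrow> (\<forall>g H.
    g \<in> borel_measurable borel \<and> H \<in> borel_measurable borel \<and> (\<forall>z. g z \<ge> 0 \<and> H z \<ge> 0 \<and> (J z = 0 \<longrightarrow> H z = 0)) \<and>
    (\<forall>w\<in>UH. ennreal (g w) \<le> (\<integral>\<^sup>+z. ennreal (indicator UH z * norm (berg w z) * H z) \<partial>lborel)) \<longrightarrow>
    (\<integral>\<^sup>+w. ennreal (indicator UH w * (g w powr p * norm (J w) powr (2 - p))) \<partial>lborel)
      \<le> ennreal C * (\<integral>\<^sup>+z. ennreal (indicator UH z * (H z powr p * norm (J z) powr (2 - p))) \<partial>lborel))"

text \<open>The test function is \<open>|N D|\<^sup>-\<^sup>c \<Prod> y\<^sub>i\<^sup>-\<^sup>1\<^sup>/\<^sup>4\<close> with \<open>c = |2 - p| / p\<close>: its \<open>p\<close>-th power times \<open>|N / D|\<^sup>2\<^sup>-\<^sup>p\<close> is again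
  a negative power of a polynomial, namely of \<open>N\<close> for \<open>p \<ge> 2\<close> and of \<open>D\<close> for \<open>p \<le> 2\<close>.\<close>
lemma half_space_schur:
  fixes N D :: "complex ^ 'n \<Rightarrow> complex"
  assumes N: "N \<in> poly_fun" and D: "D \<in> poly_fun" "\<And>z. z \<in> UH \<Longrightarrow> D z \<noteq> 0"
  shows "\<exists>r. 1 < r \<and> r < 2 \<and> (\<forall>p. r < p \<and> p < r / (r - 1) \<longrightarrow> p > 1 \<and> (\<exists>C>0. half_space_bound (\<lambda>z. N z / D z) p C))"
proof -
  have ND: "(\<lambda>z. N z * D z) \<in> poly_fun" by (rule poly_fun.mult[OF N D(1)])
  have [measurable]: "N \<in> borel_measurable borel" "D \<in> borel_measurable borel"
    by (rule poly_fun_measurable[OF N] poly_fun_measurable[OF D(1)])+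
  let ?W = "\<lambda>G a b C. \<forall>w\<in>UH. G w \<noteq> 0 \<longrightarrow>
    (\<integral>\<^sup>+z. ennreal (indicator UH z * norm (berg w z)) * (ennreal (ht b z) * wt a (G z)) \<partial>lborel)
      \<le> ennreal (C * (ht b w * norm (G w) powr (-a)))"
  obtain \<epsilon>1 where \<epsilon>1: "\<epsilon>1 > 0" "\<And>a b. 0 \<le> a \<Longrightarrow> a \<le> \<epsilon>1 \<Longrightarrow> 0 < b \<Longrightarrow> b < 1 \<Longrightarrow> \<exists>C>0. ?W (\<lambda>z. N z * D z) a b C"
    using half_space_weight[OF ND] by meson
  obtain \<epsilon>2 where \<epsilon>2: "\<epsilon>2 > 0" "\<And>a b. 0 \<le> a \<Longrightarrow> a \<le> \<epsilon>2 \<Longrightarrow> 0 < b \<Longrightarrow> b < 1 \<Longrightarrow> \<exists>C>0. ?W N a b C"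
    using half_space_weight[OF N] by meson
  obtain \<epsilon>3 where \<epsilon>3: "\<epsilon>3 > 0" "\<And>a b. 0 \<le> a \<Longrightarrow> a \<le> \<epsilon>3 \<Longrightarrow> 0 < b \<Longrightarrow> b < 1 \<Longrightarrow> \<exists>C>0. ?W D a b C"
    using half_space_weight[OF D(1)] by meson
  \<comment> \<open>With |2 - p| at most \<open>2 * \<tau>\<close>, the exponents
    \<open>c * q\<close> and \<open>2 * \<bar>2 - p\<bar>\<close> are at most
    \<open>4 * \<tau>\<close>, hence within all three thresholds. The bound 1/8 confines
    \<open>p\<close> to (15/8, 9/4) and \<open>q\<close> below 4, so that the height exponents
    \<open>1/4 * q\<close> and \<open>1/4 * p\<close> lie in (0, 1).\<close>
  define \<tau> where "\<tau> = min (1/8) (min (\<epsilon>1 / 4) (min (\<epsilon>2 / 4) (\<epsilon>3 / 4)))"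
  have \<tau>: "\<tau> > 0" "\<tau> \<le> 1/8" "4 * \<tau> \<le> \<epsilon>1" "4 * \<tau> \<le> \<epsilon>2" "4 * \<tau> \<le> \<epsilon>3"
    using \<epsilon>1(1) \<epsilon>2(1) \<epsilon>3(1) by (auto simp: \<tau>_def min_def)
  show ?thesis
  proof (rule exI[of _ "2 - \<tau>"], intro conjI allI impI)
    show "1 < 2 - \<tau>" "2 - \<tau> < 2" using \<tau> by auto
    fix p assume p: "2 - \<tau> < p \<and> p < (2 - \<tau>) / (2 - \<tau> - 1)"
    \<comment> \<open>The conjugate exponent of \<open>2 - \<tau>\<close> is
      \<open>2 + \<tau> / (1 - \<tau>)\<close>, and \<tau> is at most 1/2.\<close>
    have "(2 - \<tau>) / (2 - \<tau> - 1) \<le> 2 + 2 * \<tau>"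
    proof -
      have "2 * \<tau> * \<tau> \<le> \<tau>" using mult_right_mono[of "2 * \<tau>" 1 \<tau>] \<tau> by simp
      then have "2 - \<tau> \<le> (2 + 2 * \<tau>) * (1 - \<tau>)" by (simp add: algebra_simps)
      then show ?thesis using \<tau> by (simp add: pos_divide_le_eq)
    qed
    then have p2: "\<bar>2 - p\<bar> \<le> 2 * \<tau>" "15/8 < p" "p < 9/4" using p \<tau> by auto
    then show p1: "p > 1" by simp
    define q where "q = p / (p - 1)"
    define c where "c = \<bar>2 - p\<bar> / p"
    have q: "0 < q" "q < 4" using p2 by (auto simp: q_def pos_divide_less_eq)
    have cq: "c * q = \<bar>2 - p\<bar> / (p - 1)" using p1 by (simp add: c_def q_def)
    have "\<bar>2 - p\<bar> \<le> 4 * \<tau> * (p - 1)"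
      using p2(1) mult_left_mono[of "1/2" "p - 1" "4 * \<tau>"] p2(2) \<tau>(1) by linarith
    then have cqle: "c * q \<le> 4 * \<tau>" unfolding cq using p1 by (simp add: pos_divide_le_eq)
    have cq0: "c \<ge> 0" "c * q \<ge> 0" using p1 q by (auto simp: c_def)
    have cp: "c * p = \<bar>2 - p\<bar>" using p1 by (simp add: c_def)
    obtain C1 where C1: "C1 > 0" "?W (\<lambda>z. N z * D z) (c * q) (1/4 * q) C1"
      using \<epsilon>1(2)[of "c * q" "1/4 * q"] cq0 cqle q \<tau>(3) by auto
    define E where "E = (if p \<ge> 2 then N else D)"
    have E [measurable]: "E \<in> borel_measurable borel" by (simp add: E_def)
    obtain C2 where C2: "C2 > 0" "?W E (2 * \<bar>2 - p\<bar>) (1/4 * p) C2"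
    proof -
      have "2 * \<bar>2 - p\<bar> \<le> \<epsilon>2" "2 * \<bar>2 - p\<bar> \<le> \<epsilon>3" "0 < 1/4 * p" "1/4 * p < 1" using p2 \<tau> by auto
      then have "\<exists>C>0. ?W E (2 * \<bar>2 - p\<bar>) (1/4 * p) C"
        unfolding E_def using \<epsilon>2(2)[of "2 * \<bar>2 - p\<bar>" "1/4 * p"] \<epsilon>3(2)[of "2 * \<bar>2 - p\<bar>" "1/4 * p"] by (cases "p \<ge> 2") auto
      then show ?thesis using that by blast
    qed
    \<comment> \<open>\<open>D\<close> has no zeros on \<open>UH\<close>, so \<open>A\<close> is
      positive off the zeros of \<open>N\<close>; at those zeros the convention
      \<open>0 powr x = 0\<close> would make it 0.\<close>
    define S where "S = UH \<inter> {z. N z \<noteq> 0}"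
    have UHm [measurable]: "UH \<in> sets (borel :: (complex ^ 'n) measure)" by (simp add: open_UH borel_open)
    have Sm [measurable]: "S \<in> sets borel" unfolding S_def by measurable
    define A where "A z = norm (N z * D z) powr (-c) * ht (1/4) z" for z
    define \<sigma> where "\<sigma> z = norm (N z / D z) powr (2 - p)" for z
    have [measurable]: "A \<in> borel_measurable borel" "\<sigma> \<in> borel_measurable borel" unfolding A_def \<sigma>_def by measurable
    have Apos: "A z > 0" if "z \<in> S" for z
      unfolding A_def using that D(2) ht_pos by (intro mult_pos_pos) (auto simp: S_def)
    have Aq: "A z powr q = norm (N z * D z) powr (-(c * q)) * ht (1/4 * q) z" if "z \<in> S" for z
      using that unfolding A_def by (simp add: powr_mult powr_powr ht_powr S_def)
    have Ap: "A z powr p * \<sigma> z = norm (E z) powr (-(2 * \<bar>2 - p\<bar>)) * ht (1/4 * p) z" and Enz: "E z \<noteq> 0" if z: "z \<in> S" for z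
    proof -
      have nz: "norm (N z) > 0" "norm (D z) > 0" using z D(2) by (auto simp: S_def)
      then show "E z \<noteq> 0" by (auto simp: E_def)
      have "A z powr p = norm (N z * D z) powr (-\<bar>2 - p\<bar>) * ht (1/4 * p) z"
        using z unfolding A_def by (simp add: powr_mult powr_powr ht_powr S_def cp)
      then have "A z powr p * \<sigma> z = (norm (N z) powr (-\<bar>2 - p\<bar>) * norm (N z) powr (2 - p)) * (norm (D z) powr (-\<bar>2 - p\<bar>) * norm (D z) powr (p - 2)) * ht (1/4 * p) z"
        using powr_minus_divide[of "norm (D z)" "2 - p"] by (simp add: \<sigma>_def norm_mult norm_divide powr_mult powr_divide mult_ac)
      also have "\<dots> = norm (N z) powr (-\<bar>2 - p\<bar> + (2 - p)) * norm (D z) powr (-\<bar>2 - p\<bar> + (p - 2)) * ht (1/4 * p) z"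
        by (simp only: powr_add)
      also have "\<dots> = norm (E z) powr (-(2 * \<bar>2 - p\<bar>)) * ht (1/4 * p) z"
        using nz by (cases "p \<ge> 2") (auto simp: E_def)
      finally show "A z powr p * \<sigma> z = norm (E z) powr (-(2 * \<bar>2 - p\<bar>)) * ht (1/4 * p) z" .
    qed
    define k where "k w z = ennreal (indicator UH w * indicator UH z * norm (berg w z))" for w z :: "complex ^ 'n"
    have km: "(\<lambda>(w, z). k w z) \<in> borel_measurable (lborel \<Otimes>\<^sub>M lborel)"
      unfolding k_def norm_berg by measurable
    have k1: "k w z * indicator S z \<le> ennreal (indicator UH z * norm (berg w z))" if "w \<in> UH" for w z
      by (auto simp: k_def indicator_def that)
    have k2: "k w z * indicator S w \<le> ennreal (indicator UH w * norm (berg z w))" if "z \<in> UH" for w z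
      by (auto simp: k_def indicator_def that norm_berg_sym[of w z])
    have i1: "(\<integral>\<^sup>+z. k w z * indicator S z * ennreal (A z powr q) \<partial>lborel) \<le> ennreal (C1 * A w powr q)" if w: "w \<in> S" for w
    proof -
      have wU: "w \<in> UH" "N w * D w \<noteq> 0" using w D(2) by (auto simp: S_def)
      have "(\<integral>\<^sup>+z. k w z * indicator S z * ennreal (A z powr q) \<partial>lborel)
        \<le> (\<integral>\<^sup>+z. ennreal (indicator UH z * norm (berg w z)) * (ennreal (ht (1/4 * q) z) * wt (c * q) (N z * D z)) \<partial>lborel)"
      proof (rule nn_integral_mono)
        fix z
        show "k w z * indicator S z * ennreal (A z powr q) \<le> ennreal (indicator UH z * norm (berg w z)) * (ennreal (ht (1/4 * q) z) * wt (c * q) (N z * D z))"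
        proof (cases "z \<in> S")
          case True
          then have nz: "N z * D z \<noteq> 0" and h: "ht (1/4 * q) z > 0" using D(2) ht_pos by (auto simp: S_def)
          have "ennreal (A z powr q) = ennreal (ht (1/4 * q) z) * wt (c * q) (N z * D z)"
            unfolding Aq[OF True] wt_nonzero[OF nz] using h by (simp add: ennreal_mult mult.commute)
          then show ?thesis using k1[OF wU(1), of z] by (simp add: mult_right_mono)
        qed simp
      qed
      also have "\<dots> \<le> ennreal (C1 * (ht (1/4 * q) w * norm (N w * D w) powr (-(c * q))))" using C1(2) wU by blast
      finally show ?thesis unfolding Aq[OF w] by (simp add: mult_ac)
    qed
    have i2: "(\<integral>\<^sup>+w. k w z * indicator S w * ennreal (A w powr p * \<sigma> w) \<partial>lborel) \<le> ennreal (C2 * (A z powr p * \<sigma> z))" if z: "z \<in> S" for z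
    proof -
      have zU: "z \<in> UH" "E z \<noteq> 0" using z Enz by (auto simp: S_def)
      have "(\<integral>\<^sup>+w. k w z * indicator S w * ennreal (A w powr p * \<sigma> w) \<partial>lborel)
        \<le> (\<integral>\<^sup>+w. ennreal (indicator UH w * norm (berg z w)) * (ennreal (ht (1/4 * p) w) * wt (2 * \<bar>2 - p\<bar>) (E w)) \<partial>lborel)"
      proof (rule nn_integral_mono)
        fix w
        show "k w z * indicator S w * ennreal (A w powr p * \<sigma> w) \<le> ennreal (indicator UH w * norm (berg z w)) * (ennreal (ht (1/4 * p) w) * wt (2 * \<bar>2 - p\<bar>) (E w))"
        proof (cases "w \<in> S")
          case True
          then have h: "ht (1/4 * p) w > 0" using ht_pos by (auto simp: S_def)
          have "ennreal (A w powr p * \<sigma> w) = ennreal (ht (1/4 * p) w) * wt (2 * \<bar>2 - p\<bar>) (E w)"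
            unfolding Ap[OF True] wt_nonzero[OF Enz[OF True]] using h by (simp add: ennreal_mult mult.commute)
          then show ?thesis using k2[OF zU(1), of w] by (simp add: mult_right_mono)
        qed simp
      qed
      also have "\<dots> \<le> ennreal (C2 * (ht (1/4 * p) z * norm (E z) powr (-(2 * \<bar>2 - p\<bar>))))" using C2(2) zU by blast
      finally show ?thesis unfolding Ap[OF z] by (simp add: mult_ac)
    qed
    show "\<exists>C>0. half_space_bound (\<lambda>z. N z / D z) p C"
      unfolding half_space_bound_def
    proof (rule exI[of _ "C1 powr (p - 1) * C2"], intro conjI allI impI)
      fix g H :: "complex ^ 'n \<Rightarrow> real"
      assume *: "g \<in> borel_measurable borel \<and> H \<in> borel_measurable borel \<and> (\<forall>z. g z \<ge> 0 \<and> H z \<ge> 0 \<and> (N z / D z = 0 \<longrightarrow> H z = 0)) \<and>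
        (\<forall>w\<in>UH. ennreal (g w) \<le> (\<integral>\<^sup>+z. ennreal (indicator UH z * norm (berg w z) * H z) \<partial>lborel))"
      then have [measurable]: "g \<in> borel_measurable borel" "H \<in> borel_measurable borel" by auto
      have i3: "ennreal (g w) \<le> (\<integral>\<^sup>+z. k w z * indicator S z * ennreal (H z) \<partial>lborel)" if w: "w \<in> S" for w
      proof -
        have wU: "w \<in> UH" using w by (simp add: S_def)
        have eq: "ennreal (indicator UH z * norm (berg w z) * H z) = k w z * indicator S z * ennreal (H z)" for z
          using * wU by (auto simp: k_def S_def indicator_def ennreal_mult)
        have "ennreal (g w) \<le> (\<integral>\<^sup>+z. ennreal (indicator UH z * norm (berg w z) * H z) \<partial>lborel)" using * wU by blast
        then show ?thesis by (simp only: eq)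
      qed
      \<comment> \<open>Zeros of \<open>N\<close> contribute to neither side: by
        \<open>0 powr x = 0\<close> the weight is 0 there, whatever the sign of
        \<open>2 - p\<close>.\<close>
      have SU: "ennreal (indicator UH w * (f w powr p * norm (N w / D w) powr (2 - p))) = indicator S w * ennreal (f w powr p * \<sigma> w)" for f :: "complex ^ 'n \<Rightarrow> real" and w
        by (auto simp: S_def \<sigma>_def indicator_def)
      have "(\<integral>\<^sup>+w. indicator S w * ennreal (g w powr p * \<sigma> w) \<partial>lborel) \<le> ennreal (C1 powr (p - 1) * C2) * (\<integral>\<^sup>+z. indicator S z * ennreal (H z powr p * \<sigma> z) \<partial>lborel)"
        by (rule schur_test[OF sigma_finite_lborel km _ _ _ _ _ p1 q_def C1(1) C2(1) Apos _ _ _ i1 i2 i3])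
          (use * in \<open>auto simp: \<sigma>_def\<close>)
      then show "(\<integral>\<^sup>+w. ennreal (indicator UH w * (g w powr p * norm (N w / D w) powr (2 - p))) \<partial>lborel)
        \<le> ennreal (C1 powr (p - 1) * C2) * (\<integral>\<^sup>+z. ennreal (indicator UH z * (H z powr p * norm (N z / D z) powr (2 - p))) \<partial>lborel)"
        by (simp only: SU)
    qed (use C1 C2 in simp)
  qed
qed

section \<open>The projection estimate\<close>

text \<open>\<open>h\<close> is only Lebesgue measurable, so its composite with \<Phi> need not be
  measurable. A Borel function that agrees with it almost everywhere on \<Omega> leaves unchanged
  both the L^p integrals and the pairings that define the projection.\<close>

lemma borel_representative:
  fixes h :: "complex ^ 'n \<Rightarrow> complex"
  assumes \<Omega>: "open \<Omega>" and h: "h \<in> borel_measurable (lebesgue_on \<Omega>)"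
  obtains h' where "h' \<in> borel_measurable borel"
    "\<And>p. lp_nn \<Omega> p h = (\<integral>\<^sup>+x. indicator \<Omega> x * ennreal (cmod (h' x) powr p) \<partial>lborel)"
    "\<And>a b. (\<lambda>x. indicator \<Omega> x *\<^sub>R a x) \<in> borel_measurable borel \<Longrightarrow> (\<lambda>x. indicator \<Omega> x *\<^sub>R b x) \<in> borel_measurable borel \<Longrightarrow>
      (LINT x:\<Omega>|lebesgue. (h x - a x) * b x) = (\<integral>x. indicator \<Omega> x *\<^sub>R ((h' x - indicator \<Omega> x *\<^sub>R a x) * b x) \<partial>lborel)"
proof -
  have \<Omega>m [measurable]: "\<Omega> \<in> sets borel" using \<Omega> by simp
  have hm [measurable]: "(\<lambda>x. indicator \<Omega> x *\<^sub>R h x) \<in> borel_measurable lebesgue"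
    using h \<Omega>m by (subst (asm) borel_measurable_restrict_space_iff) auto
  have "(\<lambda>x. Re (indicator \<Omega> x *\<^sub>R h x)) \<in> borel_measurable lebesgue" "(\<lambda>x. Im (indicator \<Omega> x *\<^sub>R h x)) \<in> borel_measurable lebesgue"
    by measurable
  then obtain hr hi where hr: "hr \<in> borel_measurable lborel" "AE x in lborel. Re (indicator \<Omega> x *\<^sub>R h x) = hr x"
    and hi: "hi \<in> borel_measurable lborel" "AE x in lborel. Im (indicator \<Omega> x *\<^sub>R h x) = hi x"
    by (blast dest: completion_ex_borel_measurable_real)
  define h' where "h' x = complex_of_real (hr x) + \<i> * complex_of_real (hi x)" for x
  have [measurable]: "hr \<in> borel_measurable borel" "hi \<in> borel_measurable borel" using hr hi by auto
  have h'm [measurable]: "h' \<in> borel_measurable borel" unfolding h'_def by measurable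
  have "AE x in lborel. indicator \<Omega> x *\<^sub>R h x = h' x"
    using hr(2) hi(2) by eventually_elim (simp add: h'_def complex_eq_iff)
  then have ae: "AE x in lebesgue. indicator \<Omega> x *\<^sub>R h x = h' x" by (rule AE_completion)
  show ?thesis
  proof (rule that[OF h'm])
    fix p
    have "lp_nn \<Omega> p h = (\<integral>\<^sup>+x. indicator \<Omega> x * ennreal (cmod (h' x) powr p) \<partial>lebesgue)"
      unfolding lp_nn_def
    proof (rule nn_integral_cong_AE)
      show "AE x in lebesgue. indicator \<Omega> x * ennreal (cmod (h x) powr p) = indicator \<Omega> x * ennreal (cmod (h' x) powr p)"
        using ae by eventually_elim (auto simp: indicator_def split: if_splits)
    qed
    also have "\<dots> = (\<integral>\<^sup>+x. indicator \<Omega> x * ennreal (cmod (h' x) powr p) \<partial>lborel)"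
      by (rule nn_integral_completion) measurable
    finally show "lp_nn \<Omega> p h = (\<integral>\<^sup>+x. indicator \<Omega> x * ennreal (cmod (h' x) powr p) \<partial>lborel)" .
  next
    fix a b :: "complex ^ 'n \<Rightarrow> complex"
    assume am [measurable]: "(\<lambda>x. indicator \<Omega> x *\<^sub>R a x) \<in> borel_measurable borel"
      and bm [measurable]: "(\<lambda>x. indicator \<Omega> x *\<^sub>R b x) \<in> borel_measurable borel"
    have [measurable]: "(\<lambda>x. indicator \<Omega> x *\<^sub>R a x) \<in> borel_measurable lebesgue" "(\<lambda>x. indicator \<Omega> x *\<^sub>R b x) \<in> borel_measurable lebesgue"
      "h' \<in> borel_measurable lebesgue"
      using am bm h'm by (auto intro: measurable_completion)
    have 1: "indicator \<Omega> x *\<^sub>R ((h x - a x) * b x) = (indicator \<Omega> x *\<^sub>R h x - indicator \<Omega> x *\<^sub>R a x) * (indicator \<Omega> x *\<^sub>R b x)" for x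
      by (simp add: indicator_def)
    have 2: "indicator \<Omega> x *\<^sub>R ((h' x - indicator \<Omega> x *\<^sub>R a x) * b x) = (h' x - indicator \<Omega> x *\<^sub>R a x) * (indicator \<Omega> x *\<^sub>R b x)" for x
      by (simp add: indicator_def)
    have "(LINT x:\<Omega>|lebesgue. (h x - a x) * b x) = (\<integral>x. (indicator \<Omega> x *\<^sub>R h x - indicator \<Omega> x *\<^sub>R a x) * (indicator \<Omega> x *\<^sub>R b x) \<partial>lebesgue)"
      unfolding set_lebesgue_integral_def 1 ..
    also have "\<dots> = (\<integral>x. (h' x - indicator \<Omega> x *\<^sub>R a x) * (indicator \<Omega> x *\<^sub>R b x) \<partial>lebesgue)"
    proof (rule integral_cong_AE)
      show "AE x in lebesgue. (indicator \<Omega> x *\<^sub>R h x - indicator \<Omega> x *\<^sub>R a x) * (indicator \<Omega> x *\<^sub>R b x) = (h' x - indicator \<Omega> x *\<^sub>R a x) * (indicator \<Omega> x *\<^sub>R b x)"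
        using ae by eventually_elim simp
    qed measurable
    also have "\<dots> = (\<integral>x. (h' x - indicator \<Omega> x *\<^sub>R a x) * (indicator \<Omega> x *\<^sub>R b x) \<partial>lborel)"
      by (rule integral_completion) measurable
    finally show "(LINT x:\<Omega>|lebesgue. (h x - a x) * b x) = (\<integral>x. indicator \<Omega> x *\<^sub>R ((h' x - indicator \<Omega> x *\<^sub>R a x) * b x) \<partial>lborel)"
      by (simp only: 2)
  qed
qed

context proper_rational
begin

lemma pull_back_measurable [measurable]:
  "f \<in> borel_measurable borel \<Longrightarrow> (\<lambda>x. indicator X x *\<^sub>R (jac \<Phi> x * f (\<Phi> x))) \<in> borel_measurable borel"
proof -
  assume [measurable]: "f \<in> borel_measurable borel"
  have "(\<lambda>x. (indicator X x *\<^sub>R jac \<Phi> x) * f (ext x)) \<in> borel_measurable borel" using jac_rat by measurable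
  also have "(\<lambda>x. (indicator X x *\<^sub>R jac \<Phi> x) * f (ext x)) = (\<lambda>x. indicator X x *\<^sub>R (jac \<Phi> x * f (\<Phi> x)))"
    by (auto simp: fun_eq_iff indicator_def ext_eq)
  finally show ?thesis .
qed

text \<open>The push-forward identity applied to |f|^2, because |J f \<circ> \<Phi>|^2 is
  \<open>jn\<close> times |f|^2 \<circ> \<Phi>. Hence square-integrable functions have
  square-integrable pull-backs.\<close>

lemma pull_back_l2:
  assumes M: "\<And>f. f \<in> borel_measurable borel \<Longrightarrow>
      (\<integral>\<^sup>+x. ennreal (jn x) * f (ext x) \<partial>lborel) = ennreal M * (\<integral>\<^sup>+y. indicator \<Omega> y * f y \<partial>lborel)"
    and [measurable]: "f \<in> borel_measurable borel"
  shows "(\<integral>\<^sup>+x. ennreal ((norm (indicator X x *\<^sub>R (jac \<Phi> x * f (\<Phi> x))))\<^sup>2) \<partial>lborel) = ennreal M * (\<integral>\<^sup>+y. indicator \<Omega> y * ennreal ((norm (f y))\<^sup>2) \<partial>lborel)"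
proof -
  have "ennreal ((norm (indicator X x *\<^sub>R (jac \<Phi> x * f (\<Phi> x))))\<^sup>2) = ennreal (jn x) * ennreal ((norm (f (ext x)))\<^sup>2)" for x
    by (auto simp: indicator_def jn_def ext_eq norm_mult power_mult_distrib ennreal_mult)
  then show ?thesis by (simp only:) (rule M, measurable)
qed

end

text \<open>The kernel at \<open>w\<close> is used twice. It reproduces J g \<circ> \<Phi>, which is
  holomorphic and square integrable on \<open>UH\<close>; and, being rational and square integrable
  itself, it is a legitimate \<open>u\<close> in \<open>pull_back_orthogonal\<close>.\<close>

lemma projection_pointwise:
  fixes \<Phi> :: "complex ^ 'n \<Rightarrow> complex ^ 'n"
  assumes \<Phi>: "proper_rational UH \<Omega> \<Phi>" and bd: "bounded \<Omega>"
    and M: "M > 0" "\<And>f. f \<in> borel_measurable borel \<Longrightarrow>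
      (\<integral>\<^sup>+x. ennreal (proper_rational.jn UH \<Phi> x) * f (proper_rational.ext UH \<Phi> x) \<partial>lborel) = ennreal M * (\<integral>\<^sup>+y. indicator \<Omega> y * f y \<partial>lborel)"
    and f [measurable]: "f \<in> borel_measurable borel" and f2: "(\<integral>\<^sup>+y. indicator \<Omega> y * ennreal ((norm (f y))\<^sup>2) \<partial>lborel) < \<infinity>"
    and g: "g \<in> bergman_space \<Omega>"
    and orth: "\<And>u. u \<in> bergman_space \<Omega> \<Longrightarrow> (\<integral>y. indicator \<Omega> y *\<^sub>R ((f y - indicator \<Omega> y *\<^sub>R g y) * cnj (u y)) \<partial>lborel) = 0"
    and w: "w \<in> UH"
  shows "ennreal ((8/25) ^ CARD('n) * norm (jac \<Phi> w * g (\<Phi> w))) \<le> (\<integral>\<^sup>+z. ennreal (indicator UH z * norm (berg w z) * norm (jac \<Phi> z * f (\<Phi> z))) \<partial>lborel)"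
proof -
  interpret R: proper_rational UH \<Omega> \<Phi> by fact
  have [measurable]: "\<Omega> \<in> sets borel" using R.open_Omega by simp
  have \<Phi>\<Omega>: "\<Phi> z \<in> \<Omega>" if "z \<in> UH" for z using R.maps that by blast
  have hg: "holo_on \<Omega> g" and g2: "(\<integral>\<^sup>+x. indicator \<Omega> x * ennreal ((cmod (g x))\<^sup>2) \<partial>lborel) < \<infinity>"
    using g bergman_space_iff[OF R.open_Omega] by auto
  define g' where "g' y = indicator \<Omega> y *\<^sub>R g y" for y
  have [measurable]: "g' \<in> borel_measurable borel" unfolding g'_def by (rule holo_indicator_measurable[OF hg R.open_Omega])
  have g'2: "(\<integral>\<^sup>+y. indicator \<Omega> y * ennreal ((norm (g' y))\<^sup>2) \<partial>lborel) < \<infinity>"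
  proof -
    have "indicator \<Omega> y * ennreal ((norm (g' y))\<^sup>2) = indicator \<Omega> y * ennreal ((norm (g y))\<^sup>2)" for y
      by (auto simp: g'_def indicator_def)
    then show ?thesis using g2 by simp
  qed
  have pb: "(\<integral>\<^sup>+x. ennreal ((norm (indicator UH x *\<^sub>R (jac \<Phi> x * h (\<Phi> x))))\<^sup>2) \<partial>lborel) < \<infinity>"
    if [measurable]: "h \<in> borel_measurable borel" and "(\<integral>\<^sup>+y. indicator \<Omega> y * ennreal ((norm (h y))\<^sup>2) \<partial>lborel) < \<infinity>" for h
    by (subst R.pull_back_l2[OF M(2) that(1)], assumption) (use that(2) in \<open>simp add: ennreal_mult_less_top\<close>)
  define gt where "gt z = jac \<Phi> z * g (\<Phi> z)" for z
  have gt: "indicator UH z *\<^sub>R gt z = indicator UH z *\<^sub>R (jac \<Phi> z * g' (\<Phi> z))" for z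
    by (cases "z \<in> UH") (simp_all add: gt_def g'_def \<Phi>\<Omega>)
  have hgt: "holo_on UH gt"
    unfolding holo_on_iff_cdiff gt_def
  proof
    fix z :: "complex ^ 'n" assume z: "z \<in> UH"
    have "cdiff (\<lambda>z. g (\<Phi> z)) z"
    proof (rule cdiff_compose)
      show "cdiff (\<lambda>z. \<Phi> z $ i) z" for i by (rule rat_on_cdiff[OF R.rat open_UH z])
      show "cdiff g (\<Phi> z)" using hg \<Phi>\<Omega>[OF z] by (simp add: holo_on_iff_cdiff)
    qed
    then show "cdiff (\<lambda>z. jac \<Phi> z * g (\<Phi> z)) z" by (rule cdiff_mult[OF rat_on_cdiff[OF R.jac_rat open_UH z]])
  qed
  have gt2: "(\<integral>\<^sup>+z. indicator UH z * ennreal ((norm (gt z))\<^sup>2) \<partial>lborel) < \<infinity>"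
  proof -
    have "indicator UH z * ennreal ((norm (gt z))\<^sup>2) = ennreal ((norm (indicator UH z *\<^sub>R gt z))\<^sup>2)" for z
      by (simp add: indicator_def)
    then show ?thesis using pb[OF _ g'2] by (simp add: gt)
  qed
  note rep = reproducing_half_space[OF w hgt gt2]
  have bm [measurable]: "(\<lambda>z. indicator UH z *\<^sub>R berg w z) \<in> borel_measurable borel"
    by (rule R.rat_indicator_measurable[OF berg_rat[OF w]])
  have b2: "(\<integral>\<^sup>+z. ennreal ((norm (cnj (indicator UH z *\<^sub>R berg w z)))\<^sup>2) \<partial>lborel) < \<infinity>"
  proof -
    have "ennreal ((norm (cnj (indicator UH z *\<^sub>R berg w z)))\<^sup>2) = indicator UH z * ennreal ((norm (berg w z))\<^sup>2)" for z
      by (simp add: indicator_def)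
    then show ?thesis using rep(2) by simp
  qed
  have int: "integrable lborel (\<lambda>z. indicator UH z *\<^sub>R (jac \<Phi> z * h (\<Phi> z)) * cnj (indicator UH z *\<^sub>R berg w z))"
    if [measurable]: "h \<in> borel_measurable borel" and "(\<integral>\<^sup>+y. indicator \<Omega> y * ennreal ((norm (h y))\<^sup>2) \<partial>lborel) < \<infinity>" for h
    by (rule integrable_from_sq[OF R.pull_back_measurable[OF that(1)] borel_measurable_cnj'[OF bm] pb[OF that] b2])
  have fg2: "(\<integral>\<^sup>+y. indicator \<Omega> y * ennreal ((norm (f y - g' y))\<^sup>2) \<partial>lborel) < \<infinity>"
  proof -
    have "(norm (a - b))\<^sup>2 \<le> 2 * (norm a)\<^sup>2 + 2 * (norm b)\<^sup>2" for a b :: complex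
    proof -
      have "(norm (a - b))\<^sup>2 \<le> (norm a + norm b)\<^sup>2" by (intro power_mono norm_triangle_ineq4) simp
      also have "\<dots> \<le> 2 * (norm a)\<^sup>2 + 2 * (norm b)\<^sup>2"
        using zero_le_power2[of "norm a - norm b"] by (simp add: power2_sum power2_diff)
      finally show ?thesis .
    qed
    note sq = this
    have le: "ennreal ((norm (f y - g' y))\<^sup>2) \<le> ennreal 2 * ennreal ((norm (f y))\<^sup>2) + ennreal 2 * ennreal ((norm (g' y))\<^sup>2)" for y
    proof -
      have "ennreal ((norm (f y - g' y))\<^sup>2) \<le> ennreal (2 * (norm (f y))\<^sup>2 + 2 * (norm (g' y))\<^sup>2)" by (rule ennreal_leI[OF sq])
      also have "\<dots> = ennreal 2 * ennreal ((norm (f y))\<^sup>2) + ennreal 2 * ennreal ((norm (g' y))\<^sup>2)" by (rule ennreal_sum_prod2) auto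
      finally show ?thesis .
    qed
    have "(\<integral>\<^sup>+y. indicator \<Omega> y * ennreal ((norm (f y - g' y))\<^sup>2) \<partial>lborel)
      \<le> (\<integral>\<^sup>+y. ennreal 2 * (indicator \<Omega> y * ennreal ((norm (f y))\<^sup>2)) + ennreal 2 * (indicator \<Omega> y * ennreal ((norm (g' y))\<^sup>2)) \<partial>lborel)"
    proof (rule nn_integral_mono)
      fix y
      show "indicator \<Omega> y * ennreal ((norm (f y - g' y))\<^sup>2) \<le> ennreal 2 * (indicator \<Omega> y * ennreal ((norm (f y))\<^sup>2)) + ennreal 2 * (indicator \<Omega> y * ennreal ((norm (g' y))\<^sup>2))"
        by (cases "y \<in> \<Omega>") (simp_all only: indicator_simps mult_1 mult_zero_left zero_le le not_False_eq_True)
    qed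
    also have "\<dots> = ennreal 2 * (\<integral>\<^sup>+y. indicator \<Omega> y * ennreal ((norm (f y))\<^sup>2) \<partial>lborel) + ennreal 2 * (\<integral>\<^sup>+y. indicator \<Omega> y * ennreal ((norm (g' y))\<^sup>2) \<partial>lborel)"
        by (subst nn_integral_add) (measurable, subst (1 2) nn_integral_cmult, measurable)
    also have "\<dots> < \<infinity>" using f2 g'2 by (simp add: ennreal_mult_less_top)
    finally show ?thesis .
  qed
  \<comment> \<open>The pull-back of \<open>f - g'\<close> is orthogonal to the kernel, so
    \<open>f\<close> may replace \<open>g'\<close> in the reproducing integral before absolute
    values are taken.\<close>
  have "0 = (\<integral>z. indicator UH z *\<^sub>R (jac \<Phi> z * (f (\<Phi> z) - g' (\<Phi> z)) * cnj (berg w z)) \<partial>lborel)"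
  proof (rule R.pull_back_orthogonal[OF bd M berg_rat[OF w] rep(2) _ fg2, symmetric])
    show "(\<lambda>y. f y - g' y) \<in> borel_measurable borel" by measurable
  qed (use orth in \<open>auto simp: g'_def\<close>)
  also have "\<dots> = (\<integral>z. indicator UH z *\<^sub>R (jac \<Phi> z * f (\<Phi> z)) * cnj (indicator UH z *\<^sub>R berg w z)
      - indicator UH z *\<^sub>R (jac \<Phi> z * g' (\<Phi> z)) * cnj (indicator UH z *\<^sub>R berg w z) \<partial>lborel)"
    by (intro Bochner_Integration.integral_cong) (auto simp: indicator_def algebra_simps)
  also have "\<dots> = (\<integral>z. indicator UH z *\<^sub>R (jac \<Phi> z * f (\<Phi> z)) * cnj (indicator UH z *\<^sub>R berg w z) \<partial>lborel)
      - (\<integral>z. indicator UH z *\<^sub>R (jac \<Phi> z * g' (\<Phi> z)) * cnj (indicator UH z *\<^sub>R berg w z) \<partial>lborel)"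
    by (intro Bochner_Integration.integral_diff int f2 g'2) measurable
  also have "(\<integral>z. indicator UH z *\<^sub>R (jac \<Phi> z * g' (\<Phi> z)) * cnj (indicator UH z *\<^sub>R berg w z) \<partial>lborel) = (\<integral>z. indicator UH z *\<^sub>R (gt z * cnj (berg w z)) \<partial>lborel)"
    unfolding gt[symmetric] by (intro Bochner_Integration.integral_cong) (auto simp: indicator_def)
  finally have eq: "(\<integral>z. indicator UH z *\<^sub>R (gt z * cnj (berg w z)) \<partial>lborel) = (\<integral>z. indicator UH z *\<^sub>R (jac \<Phi> z * f (\<Phi> z)) * cnj (indicator UH z *\<^sub>R berg w z) \<partial>lborel)"
    by simp
  have "ennreal ((8/25) ^ CARD('n) * norm (gt w)) \<le> ennreal (norm (\<integral>z. indicator UH z *\<^sub>R (jac \<Phi> z * f (\<Phi> z)) * cnj (indicator UH z *\<^sub>R berg w z) \<partial>lborel))"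
    using rep(1) unfolding eq by (rule ennreal_leI)
  also have "\<dots> \<le> (\<integral>\<^sup>+z. ennreal (norm (indicator UH z *\<^sub>R (jac \<Phi> z * f (\<Phi> z)) * cnj (indicator UH z *\<^sub>R berg w z))) \<partial>lborel)"
    by (rule integral_norm_bound_ennreal[OF int[OF f f2]])
  also have "\<dots> = (\<integral>\<^sup>+z. ennreal (indicator UH z * norm (berg w z) * norm (jac \<Phi> z * f (\<Phi> z))) \<partial>lborel)"
    by (intro nn_integral_cong) (auto simp: indicator_def norm_mult mult_ac)
  finally show ?thesis by (simp add: gt_def)
qed

text \<open>The estimate for Borel representatives, in terms of p-th powers of norms;
  \<open>C\<close> here corresponds to \<open>C powr p\<close> in
  \<open>bergman_Lp_bounded\<close>.\<close>

definition projection_bound :: "(complex ^ 'n) set \<Rightarrow> real \<Rightarrow> real \<Rightarrow> bool" where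
  "projection_bound \<Omega> p C \<longleftrightarrow> (\<forall>f g.
    f \<in> borel_measurable borel \<and> (\<integral>\<^sup>+y. indicator \<Omega> y * ennreal ((norm (f y))\<^sup>2) \<partial>lborel) < \<infinity> \<and> g \<in> bergman_space \<Omega> \<and>
    (\<forall>u\<in>bergman_space \<Omega>. (\<integral>y. indicator \<Omega> y *\<^sub>R ((f y - indicator \<Omega> y *\<^sub>R g y) * cnj (u y)) \<partial>lborel) = 0) \<longrightarrow>
    (\<integral>\<^sup>+y. indicator \<Omega> y * ennreal (norm (g y) powr p) \<partial>lborel) \<le> ennreal C * (\<integral>\<^sup>+y. indicator \<Omega> y * ennreal (norm (f y) powr p) \<partial>lborel))"

text \<open>The exponent of the weight is dictated by |J h \<circ> \<Phi>|^p |J|^(2 - p) = |J|^2 |h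
  \<circ> \<Phi>|^p: the weighted integral on \<open>UH\<close> is \<open>M\<close> times the
  unweighted one on \<Omega>. As \<open>M\<close> occurs on both sides of the estimate and is
  positive, it cancels.\<close>

lemma projection_estimate:
  fixes \<Phi> :: "complex ^ 'n \<Rightarrow> complex ^ 'n"
  assumes \<Phi>: "proper_rational UH \<Omega> \<Phi>" and bd: "bounded \<Omega>" and con: "connected \<Omega>"
    and im: "\<Phi> ` UH = \<Omega>" and ne: "\<Omega> \<noteq> {}"
  shows "\<exists>r. 1 < r \<and> r < 2 \<and> (\<forall>p. r < p \<and> p < r / (r - 1) \<longrightarrow> p > 1 \<and> (\<exists>C>0. projection_bound \<Omega> p C))"
proof -
  interpret R: proper_rational UH \<Omega> \<Phi> by fact
  have [measurable]: "\<Omega> \<in> sets borel" using R.open_Omega by simp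
  have \<Phi>\<Omega>: "\<Phi> z \<in> \<Omega>" if "z \<in> UH" for z using R.maps that by blast
  obtain M where M0: "M \<ge> 0" and M: "\<And>f. f \<in> borel_measurable borel \<Longrightarrow>
      (\<integral>\<^sup>+x. ennreal (R.jn x) * f (R.ext x) \<partial>lborel) = ennreal M * (\<integral>\<^sup>+y. indicator \<Omega> y * f y \<partial>lborel)"
    by (rule R.jac_push[OF con bd]) (rule that, assumption+)
  have Mp: "M > 0" by (rule R.jac_push_positive[OF im ne M0 M])
  obtain N D where ND: "N \<in> poly_fun" "D \<in> poly_fun" "\<And>z. z \<in> UH \<Longrightarrow> D z \<noteq> 0" "\<And>z. z \<in> UH \<Longrightarrow> jac \<Phi> z = N z / D z"
    by (rule rat_onE[OF R.jac_rat]) (rule that, assumption+)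
  define J where "J z = N z / D z" for z
  obtain r where r: "1 < r" "r < 2" and schur: "\<And>p. r < p \<Longrightarrow> p < r / (r - 1) \<Longrightarrow> p > 1 \<and> (\<exists>C>0. half_space_bound J p C)"
    using half_space_schur[OF ND(1-3)] unfolding J_def[abs_def] by blast
  show ?thesis
  proof (rule exI[of _ r], intro conjI allI impI r)
    fix p assume "r < p \<and> p < r / (r - 1)"
    then have p: "p > 1" and "\<exists>C>0. half_space_bound J p C" using schur by auto
    then obtain C where C: "C > 0" and "half_space_bound J p C" by blast
    then have est: "g \<in> borel_measurable borel \<Longrightarrow> H \<in> borel_measurable borel \<Longrightarrow> (\<And>z. g z \<ge> 0) \<Longrightarrow> (\<And>z. H z \<ge> 0) \<Longrightarrow> (\<And>z. J z = 0 \<Longrightarrow> H z = 0) \<Longrightarrow>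
      (\<And>w. w \<in> UH \<Longrightarrow> ennreal (g w) \<le> (\<integral>\<^sup>+z. ennreal (indicator UH z * norm (berg w z) * H z) \<partial>lborel)) \<Longrightarrow>
      (\<integral>\<^sup>+w. ennreal (indicator UH w * (g w powr p * norm (J w) powr (2 - p))) \<partial>lborel)
        \<le> ennreal C * (\<integral>\<^sup>+z. ennreal (indicator UH z * (H z powr p * norm (J z) powr (2 - p))) \<partial>lborel)" for g H
      unfolding half_space_bound_def by simp
    show "p > 1" by fact
    define \<kappa> :: real where "\<kappa> = (8/25) ^ CARD('n)"
    have \<kappa>: "\<kappa> > 0" by (simp add: \<kappa>_def)
    let ?pb = "\<lambda>h z. indicator UH z *\<^sub>R (jac \<Phi> z * h (\<Phi> z))"
    have pb: "(\<integral>\<^sup>+z. ennreal (indicator UH z * ((c * norm (?pb h z)) powr p * norm (J z) powr (2 - p))) \<partial>lborel)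
      = ennreal (c powr p) * (ennreal M * (\<integral>\<^sup>+y. indicator \<Omega> y * ennreal (norm (h y) powr p) \<partial>lborel))"
      if [measurable]: "h \<in> borel_measurable borel" and c: "c > 0" for h c
    proof -
      have "ennreal (indicator UH z * ((c * norm (?pb h z)) powr p * norm (J z) powr (2 - p))) = ennreal (c powr p) * (ennreal (R.jn z) * ennreal (norm (h (R.ext z)) powr p))" for z
      proof (cases "z \<in> UH")
        case True
        have "norm (jac \<Phi> z) powr p * norm (jac \<Phi> z) powr (2 - p) = (norm (jac \<Phi> z))\<^sup>2"
          by (cases "jac \<Phi> z = 0") (simp_all add: powr_add[symmetric] powr_two_sq)
        then have "(c * norm (?pb h z)) powr p * norm (J z) powr (2 - p) = c powr p * (R.jn z * norm (h (R.ext z)) powr p)"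
          using True by (simp add: J_def ND(4)[symmetric] norm_mult powr_mult R.jn_def R.ext_eq mult_ac)
        then show ?thesis using True R.jn_nonneg[of z] by (simp add: ennreal_mult)
      qed (simp add: R.jn_def)
      then have "(\<integral>\<^sup>+z. ennreal (indicator UH z * ((c * norm (?pb h z)) powr p * norm (J z) powr (2 - p))) \<partial>lborel)
        = ennreal (c powr p) * (\<integral>\<^sup>+z. ennreal (R.jn z) * ennreal (norm (h (R.ext z)) powr p) \<partial>lborel)"
        by (simp add: nn_integral_cmult)
      also have "(\<integral>\<^sup>+z. ennreal (R.jn z) * ennreal (norm (h (R.ext z)) powr p) \<partial>lborel) = ennreal M * (\<integral>\<^sup>+y. indicator \<Omega> y * ennreal (norm (h y) powr p) \<partial>lborel)"
        by (rule M) measurable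
      finally show ?thesis .
    qed
    show "\<exists>C>0. projection_bound \<Omega> p C"
      unfolding projection_bound_def
    \<comment> \<open>The reproducing formula controls only \<kappa> |J g \<circ> \<Phi>|, and the
      p-th power of \<kappa> is moved to the other side.\<close>
    proof (rule exI[of _ "\<kappa> powr (-p) * C"], intro conjI allI impI)
      fix f g
      assume *: "f \<in> borel_measurable borel \<and> (\<integral>\<^sup>+y. indicator \<Omega> y * ennreal ((norm (f y))\<^sup>2) \<partial>lborel) < \<infinity> \<and> g \<in> bergman_space \<Omega> \<and>
        (\<forall>u\<in>bergman_space \<Omega>. (\<integral>y. indicator \<Omega> y *\<^sub>R ((f y - indicator \<Omega> y *\<^sub>R g y) * cnj (u y)) \<partial>lborel) = 0)"
      then have fm [measurable]: "f \<in> borel_measurable borel" and f2: "(\<integral>\<^sup>+y. indicator \<Omega> y * ennreal ((norm (f y))\<^sup>2) \<partial>lborel) < \<infinity>"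
        and g: "g \<in> bergman_space \<Omega>" and orth: "\<And>u. u \<in> bergman_space \<Omega> \<Longrightarrow> (\<integral>y. indicator \<Omega> y *\<^sub>R ((f y - indicator \<Omega> y *\<^sub>R g y) * cnj (u y)) \<partial>lborel) = 0"
        by auto
      define g' where "g' y = indicator \<Omega> y *\<^sub>R g y" for y
      have hg: "holo_on \<Omega> g" using g bergman_space_iff[OF R.open_Omega] by auto
      have g'm [measurable]: "g' \<in> borel_measurable borel" unfolding g'_def by (rule holo_indicator_measurable[OF hg R.open_Omega])
      let ?F = "\<integral>\<^sup>+y. indicator \<Omega> y * ennreal (norm (f y) powr p) \<partial>lborel"
      let ?G = "\<integral>\<^sup>+y. indicator \<Omega> y * ennreal (norm (g' y) powr p) \<partial>lborel"
      have "(\<integral>\<^sup>+w. ennreal (indicator UH w * ((\<kappa> * norm (?pb g' w)) powr p * norm (J w) powr (2 - p))) \<partial>lborel)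
        \<le> ennreal C * (\<integral>\<^sup>+z. ennreal (indicator UH z * ((1 * norm (?pb f z)) powr p * norm (J z) powr (2 - p))) \<partial>lborel)"
      proof (rule est)
        have [measurable]: "?pb g' \<in> borel_measurable borel" "?pb f \<in> borel_measurable borel"
          by (rule R.pull_back_measurable, measurable)+
        show "(\<lambda>w. \<kappa> * norm (?pb g' w)) \<in> borel_measurable borel" "(\<lambda>w. 1 * norm (?pb f w)) \<in> borel_measurable borel" by measurable
        show "0 \<le> \<kappa> * norm (?pb g' z)" "0 \<le> 1 * norm (?pb f z)" for z using \<kappa> by auto
        show "1 * norm (?pb f z) = 0" if "J z = 0" for z using that ND(4)[of z] by (auto simp: indicator_def J_def)
        fix w :: "complex ^ 'n" assume w: "w \<in> UH"
        have "ennreal (\<kappa> * norm (?pb g' w)) = ennreal ((8/25) ^ CARD('n) * norm (jac \<Phi> w * g (\<Phi> w)))"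
          using w \<Phi>\<Omega>[OF w] by (simp add: \<kappa>_def g'_def)
        also have "\<dots> \<le> (\<integral>\<^sup>+z. ennreal (indicator UH z * norm (berg w z) * norm (jac \<Phi> z * f (\<Phi> z))) \<partial>lborel)"
          by (rule projection_pointwise[OF \<Phi> bd Mp M fm f2 g orth w])
        also have "\<dots> = (\<integral>\<^sup>+z. ennreal (indicator UH z * norm (berg w z) * (1 * norm (?pb f z))) \<partial>lborel)"
          by (intro nn_integral_cong) (auto simp: indicator_def)
        finally show "ennreal (\<kappa> * norm (?pb g' w)) \<le> (\<integral>\<^sup>+z. ennreal (indicator UH z * norm (berg w z) * (1 * norm (?pb f z))) \<partial>lborel)" .
      qed
      then have "ennreal (\<kappa> powr p) * (ennreal M * ?G) \<le> ennreal C * (ennreal (1 powr p) * (ennreal M * ?F))"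
        unfolding pb[OF g'm \<kappa>] pb[OF fm zero_less_one] .
      then have "ennreal M * (ennreal (\<kappa> powr p) * ?G) \<le> ennreal M * (ennreal C * ?F)" by (simp add: mult_ac)
      then have "ennreal (\<kappa> powr p) * ?G \<le> ennreal C * ?F"
        by (subst (asm) ennreal_mult_le_mult_iff) (use Mp in auto)
      then have "ennreal (\<kappa> powr (-p)) * (ennreal (\<kappa> powr p) * ?G) \<le> ennreal (\<kappa> powr (-p)) * (ennreal C * ?F)"
        by (rule mult_left_mono) simp
      moreover have "ennreal (\<kappa> powr (-p)) * ennreal (\<kappa> powr p) = 1"
        using \<kappa> by (simp add: ennreal_mult[symmetric] powr_add[symmetric])
      ultimately have "?G \<le> ennreal (\<kappa> powr (-p) * C) * ?F"
        using C by (simp add: mult.assoc[symmetric] ennreal_mult)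
      moreover have "indicator \<Omega> y * ennreal (norm (g' y) powr p) = indicator \<Omega> y * ennreal (norm (g y) powr p)" for y
        by (auto simp: g'_def indicator_def)
      ultimately show "(\<integral>\<^sup>+y. indicator \<Omega> y * ennreal (norm (g y) powr p) \<partial>lborel) \<le> ennreal (\<kappa> powr (-p) * C) * ?F"
        by simp
    qed (use C \<kappa> in simp)
  qed
qed

theorem theorem3p1:
  fixes \<Omega> :: "(complex ^ 'n) set"
    and \<Phi> :: "complex ^ 'n \<Rightarrow> complex ^ 'n"
    and P Q :: "'n \<Rightarrow> complex ^ 'n \<Rightarrow> complex"
  assumes "open \<Omega>" and "connected \<Omega>" and "bounded \<Omega>"
    and surj: "\<Phi> ` polydisc = \<Omega>"
    and holo: "\<And>i. holo_on polydisc (\<lambda>z. \<Phi> z $ i)"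
    and proper: "\<And>K. K \<subseteq> \<Omega> \<Longrightarrow> compact K \<Longrightarrow> compact (polydisc \<inter> \<Phi> -` K)"
    and P: "\<And>i. P i \<in> poly_fun" and Q: "\<And>i. Q i \<in> poly_fun"
    and Qnz: "\<And>i z. z \<in> polydisc \<Longrightarrow> Q i z \<noteq> 0"
    and rat: "\<And>i z. z \<in> polydisc \<Longrightarrow> \<Phi> z $ i = P i z / Q i z"
  shows "\<exists>r. 1 < r \<and> r < 2 \<and>
           (\<forall>p. r < p \<and> p < r / (r - 1) \<longrightarrow> bergman_Lp_bounded \<Omega> p)"
proof -
  have \<Phi>: "proper_rational polydisc \<Omega> \<Phi>"
  proof
    show "(\<lambda>z. \<Phi> z $ i) \<in> rat_on polydisc" for i by (rule rat_onI[OF P Q Qnz rat])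
  qed (use assms(1) open_polydisc surj proper in auto)
  \<comment> \<open>Any point of \<open>UH\<close> can serve as the centre of this Cayley
    transform.\<close>
  define e :: "complex ^ 'n" where "e = (\<chi> i. \<i>)"
  have e: "e \<in> UH" by (simp add: e_def UH_def)
  have \<Phi>H: "proper_rational UH \<Omega> (\<lambda>z. \<Phi> (cay e z))" by (rule proper_rational_compose_cay[OF e \<Phi>])
  have im: "(\<lambda>z. \<Phi> (cay e z)) ` UH = \<Omega>"
    using cay_image[OF e] surj by (simp add: image_image[symmetric])
  have ne: "\<Omega> \<noteq> {}" using im e by auto
  obtain r where r: "1 < r" "r < 2" and est: "\<And>p. r < p \<Longrightarrow> p < r / (r - 1) \<Longrightarrow> p > 1 \<and> (\<exists>C>0. projection_bound \<Omega> p C)"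
    using projection_estimate[OF \<Phi>H assms(3,2) im ne] by blast
  show ?thesis
  proof (rule exI[of _ r], intro conjI allI impI r)
    fix p assume "r < p \<and> p < r / (r - 1)"
    then have p: "p > 1" and "\<exists>C>0. projection_bound \<Omega> p C" using est by auto
    then obtain C where C: "C > 0" and "projection_bound \<Omega> p C" by blast
    then have bound: "f \<in> borel_measurable borel \<Longrightarrow> (\<integral>\<^sup>+y. indicator \<Omega> y * ennreal ((norm (f y))\<^sup>2) \<partial>lborel) < \<infinity> \<Longrightarrow> g \<in> bergman_space \<Omega> \<Longrightarrow>
      (\<And>u. u \<in> bergman_space \<Omega> \<Longrightarrow> (\<integral>y. indicator \<Omega> y *\<^sub>R ((f y - indicator \<Omega> y *\<^sub>R g y) * cnj (u y)) \<partial>lborel) = 0) \<Longrightarrow>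
      (\<integral>\<^sup>+y. indicator \<Omega> y * ennreal (norm (g y) powr p) \<partial>lborel) \<le> ennreal C * (\<integral>\<^sup>+y. indicator \<Omega> y * ennreal (norm (f y) powr p) \<partial>lborel)" for f g
      unfolding projection_bound_def by blast
    show "bergman_Lp_bounded \<Omega> p"
      unfolding bergman_Lp_bounded_def
    \<comment> \<open>The root compensates for the power \<open>p\<close> to which
      \<open>bergman_Lp_bounded\<close> raises its constant.\<close>
    proof (rule exI[of _ "C powr (1 / p)"], intro conjI allI impI)
      fix h g assume *: "in_Lp \<Omega> 2 h \<and> in_Lp \<Omega> p h \<and> is_bergman_proj \<Omega> h g"
      then have hm: "h \<in> borel_measurable (lebesgue_on \<Omega>)" and h2: "lp_nn \<Omega> 2 h < \<infinity>" and g: "g \<in> bergman_space \<Omega>"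
        and orth: "\<And>u. u \<in> bergman_space \<Omega> \<Longrightarrow> (LINT x:\<Omega>|lebesgue. (h x - g x) * cnj (u x)) = 0"
        unfolding in_Lp_def is_bergman_proj_def by auto
      obtain f where fm: "f \<in> borel_measurable borel"
        and lp: "\<And>p. lp_nn \<Omega> p h = (\<integral>\<^sup>+x. indicator \<Omega> x * ennreal (cmod (f x) powr p) \<partial>lborel)"
        and int: "\<And>a b. (\<lambda>x. indicator \<Omega> x *\<^sub>R a x) \<in> borel_measurable borel \<Longrightarrow> (\<lambda>x. indicator \<Omega> x *\<^sub>R b x) \<in> borel_measurable borel \<Longrightarrow>
          (LINT x:\<Omega>|lebesgue. (h x - a x) * b x) = (\<integral>x. indicator \<Omega> x *\<^sub>R ((f x - indicator \<Omega> x *\<^sub>R a x) * b x) \<partial>lborel)"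
        by (rule borel_representative[OF assms(1) hm]) (rule that, assumption+)
      have meas: "(\<lambda>x. indicator \<Omega> x *\<^sub>R u x) \<in> borel_measurable borel" if "u \<in> bergman_space \<Omega>" for u
        using that bergman_space_iff[OF assms(1)] by (intro holo_indicator_measurable assms(1)) auto
      have cmeas: "(\<lambda>x. indicator \<Omega> x *\<^sub>R cnj (u x)) \<in> borel_measurable borel" if "u \<in> bergman_space \<Omega>" for u
        using borel_measurable_cnj'[OF meas[OF that]] by simp
      have "(\<integral>\<^sup>+y. indicator \<Omega> y * ennreal (norm (g y) powr p) \<partial>lborel) \<le> ennreal C * (\<integral>\<^sup>+y. indicator \<Omega> y * ennreal (norm (f y) powr p) \<partial>lborel)"
      proof (rule bound[OF fm _ g])
        show "(\<integral>\<^sup>+y. indicator \<Omega> y * ennreal ((norm (f y))\<^sup>2) \<partial>lborel) < \<infinity>"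
          using h2 unfolding lp by (simp add: powr_two_sq)
        show "(\<integral>y. indicator \<Omega> y *\<^sub>R ((f y - indicator \<Omega> y *\<^sub>R g y) * cnj (u y)) \<partial>lborel) = 0" if "u \<in> bergman_space \<Omega>" for u
          using int[OF meas[OF g] cmeas[OF that]] orth[OF that] by simp
      qed
      moreover have "(C powr (1 / p)) powr p = C" using p C by (simp add: powr_powr)
      ultimately show "lp_nn \<Omega> p g \<le> ennreal ((C powr (1 / p)) powr p) * lp_nn \<Omega> p h"
        unfolding lp lp_nn_lborel[OF meas[OF g]] by simp
    qed (use C in simp)
  qed
qed

end
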